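(* (1) For $(\chi,s,\eta,t)\in\mathcal S_+$ we have $$\widetilde K_{s,t}^{\chi,\eta}=(1-q_{\mathbb F}^{-1})\cdot L_t^\eta.$$ (2) For $(\chi,s,\eta,t)\in\mathcal S_-$ we have $$\widetilde K_{s,t}^{\chi,\eta}=c_{\mathbb F}(1-q_{\mathbb F}^{-1})\chi_0(-\alpha)^{-2}|\alpha^2|_{\mathbb F}^{-t+\frac12}\,\Gamma\big((\chi^2|_{\mathcal O_{\mathbb F}^\times})_{2t}\big)\,\Gamma\big((\chi^{-2})_{-t+\frac12}\big)\,L(\tfrac12,\chi_s|_{\mathbb F^\times}\cdot\eta_t)^{-1}\cdot\delta,$$ where $\delta$ is the Dirac distribution at $0\in\mathbb E$.
   Context: Fields. $\mathbb E/\mathbb F$ is a quadratic extension of non-archimedean local fields, $\mathbb E=\mathbb F(\alpha)$ with $\alpha\in\mathbb E\setminus\mathbb F$, $\alpha^2\in\mathbb F^\times\setminus\mathbb F^{\times2}$. For $k\in\{\mathbb E,\mathbb F\}$: $\mathcal O_k$ is the ring of integers, $\mathcal O_k^\times$ its units, $\varpi_k$ a chosen uniformizer, $q_k$ the residue cardinality, $\nu_k$ the valuation, $|\cdot|_k$ the absolute value with $d(ax)=|a|_k\,dx$ for Haar measure $dx$ on $k$ (so $|\varpi_k|_k=q_k^{-1}$). After possibly multiplying $\alpha$ by a power of $\varpi_{\mathbb F}$, either $\alpha^2\in\mathcal O_{\mathbb F}^\times$ (the case where $\mathbb E/\mathbb F$ is unramified, $q_{\mathbb E}=q_{\mathbb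 F}^2$) or $\alpha^2\in\varpi_{\mathbb F}\mathcal O_{\mathbb F}^\times$ (the case where $\mathbb E/\mathbb F$ is ramified, $q_{\mathbb E}=q_{\mathbb F}$). Elements of $\mathbb E$ are written $x=x_1+x_2\alpha$ with $x_1,x_2\in\mathbb F$. Haar measures are normalized so that $\mathcal O_k$ has measure $1$, and $dx=dx_1\,dx_2$. Characters. $\widehat{\mathcal O_k^\times}$ is the set of (continuous) characters of $\mathcal O_k^\times$; for $\chi\in\widehat{\mathcal O_k^\times}$, $s\in\mathbb C$, $\chi_s(x)=\chi(\varpi_k^{-\nu_k(x)}x)|x|_k^s$ ($x\in k^\times$). Distributions and kernels. $\mathcal D'(\mathbb E)$ is the space of all linear functionals on $C_c^\infty(\mathbb E)$ (locally constant compactly supported functions); locally integrable functions are viewed as distributions via $dx$. For $\chi\in\widehat{\mathcal O_{\mathbb E}^\times}$, $\eta\in\widehat{\mathcal O_{\mathbb F}^\times}$ and $x\in\mathbb E\setminus\mathbb F$ put $K_{s,t}^{\chi,\eta}(x)=\chi_{s-\frac12}(x^2)\,(\chi_{s-\frac12}\eta_{t+\frac12})\big(\frac{x_2}{x_1^2-x_2^2\alpha^2}\big)$. This is locally integrable on $\mathbb E$ for $\operatorname{Re}(2s\pm t+\frac12)>0$ and extends to a meromorphic family of distributions in $(s,t)\in\mathbb C^2$. Put $\widetilde K_{s,t}^{\chi,\eta}=\lambda_+\lambda_-K_{s,t}^{\chi,\eta}$, where $\lambda_\pm=L(\frac12,\chi_s|_{\mathbb F^\times}\cdot\eta_t^{\pm1})^{-1}$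 is the inverse local $L$-factor, i.e. $\lambda_\pm=1-q_{\mathbb F}^{-(2s\pm t+\frac12)}$ if $\chi|_{\mathcal O_{\mathbb F}^\times}\cdot\eta^{\pm1}=1$ and $\lambda_\pm=1$ otherwise; this family is holomorphic on $\mathbb C^2$. Parameter sets. $\mathcal S_\pm$ is the set of $(\chi,s,\eta,t)\in\widehat{\mathcal O_{\mathbb E}^\times}\times\mathbb C\times\widehat{\mathcal O_{\mathbb F}^\times}\times\mathbb C$ with $\chi|_{\mathcal O_{\mathbb F}^\times}\cdot\eta^{\pm1}=1$ and $2s\pm t+\frac12\in\frac{2\pi i}{\ln q_{\mathbb F}}\mathbb Z$. (For parameters in $\mathcal S_+\cap\mathcal S_-$ the expressions in (1) and (2) agree.) The family $L_t^\eta$. For $\xi\in\widehat{\mathcal O_{\mathbb F}^\times}$, $\widetilde\xi_a\in\mathcal D'(\mathbb F)$ ($a\in\mathbb C$) is the holomorphic continuation in $a$ of the distribution $\xi_a$ (if $\xi\ne1$), respectively $(1-q_{\mathbb F}^{-a-1})\xi_a$ (if $\xi=1$), from $\operatorname{Re}a>-1$. Put $L_t^\eta(x_1+x_2\alpha)=\widetilde{(\eta^{-2})}_{-2t-1}(x_1)\,\delta(x_2)$, so $L_t^\eta=\eta_{t+\frac12}(x_1^2)^{-1}\delta(x_2)$ if $\eta^2\ne1$; $(1-q_{\mathbb F}^{2t})\eta_{t+\frac12}(x_1^2)^{-1}\delta(x_2)$ if $\eta^2=1$, $2t\notin\frac{2\pi i}{\ln q_{\mathbb F}}\mathbb Z$;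 and $(1-q_{\mathbb F}^{-1})\delta(x_1)\delta(x_2)$ if $\eta^2=1$, $2t\in\frac{2\pi i}{\ln q_{\mathbb F}}\mathbb Z$. Constants. Fix a non-trivial additive character $\psi$ of $\mathbb F$, extended to $\mathbb E$ by $\psi(x_1+x_2\alpha)=\psi(x_1)$. $c_{\mathbb F}>0$ is the constant in Fourier inversion on $\mathbb F$: $f(x)=c_{\mathbb F}\int_{\mathbb F}\psi(-xy)\widehat f(y)\,dy$ with $\widehat f(y)=\int_{\mathbb F}\psi(yz)f(z)\,dz$. For a character $\omega$ of $k^\times$ the gamma factor is $\Gamma(\omega)=\lim_{n\to\infty}\int_{q_k^{-n}\le|x|_k\le q_k^n}\psi(x)\omega(x)|x|_k^{-1}\,dx$; $\Gamma(\xi_a)$ is a meromorphic function of $a\in\mathbb C$, holomorphic and nowhere vanishing if $\xi\neq1$, and with simple poles exactly at $a\in\frac{2\pi i}{\ln q_k}\mathbb Z$ and simple zeros exactly at $a\in1+\frac{2\pi i}{\ln q_k}\mathbb Z$ if $\xi=1$. The product of the meromorphic factors in (2) is read as a meromorphic function of $t$ along $\mathcal S_-$, zeros and poles cancelling. *)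

theory Defs
  imports "HOL-Complex_Analysis.Complex_Analysis"
begin

section \<open>Non-archimedean local fields\<close>

class ultrametric_field = field + complete_space +
  assumes dist_translation: "dist (x + z) (y + z) = dist x y"
    and dist_zero_mult: "dist (x * y) 0 = dist x 0 * dist y 0"
    and dist_ultrametric: "dist (x + y) 0 \<le> max (dist x 0) (dist y 0)"

definition (in ultrametric_field) ring_of_integers :: "'a set" where
  "ring_of_integers = {x. dist x 0 \<le> 1}"

definition (in ultrametric_field) residue_field :: "'a set set" where
  "residue_field = ring_of_integers //
     {(x, y). x \<in> ring_of_integers \<and> y \<in> ring_of_integers \<and> dist x y < 1}"

definition (in ultrametric_field) residue_card :: "'a itself \<Rightarrow> nat" where
  "residue_card _ = card residue_field"

text \<open>
  A field that is complete with respect to a discrete valuation with finite residue field.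
  The metric is required to be the one of the normalised absolute value: \<open>dist x y = |x - y|\<close>,
  where \<open>|x| = q powi (- \<nu> x)\<close> and \<open>q\<close> is the cardinality of the residue field. This is the
  factor by which multiplication by \<open>x\<close> scales Haar measure.
\<close>

class nonarch_local_field = ultrametric_field +
  assumes finite_residue_field: "finite residue_field"
    and value_group: "(\<lambda>x. dist x 0) ` (- {0}) = range (\<lambda>n::int. real (residue_card TYPE('a)) powi n)"

definition absv :: "'k::nonarch_local_field \<Rightarrow> real" where
  "absv x = dist x 0"

definition valuation :: "'k::nonarch_local_field \<Rightarrow> int" where
  "valuation x = (THE n. absv x = real (residue_card TYPE('k)) powi (- n))"

definition integer_units :: "'k::nonarch_local_field set" where
  "integer_units = {x. absv x = 1}"

definition uniformizer :: "'k::nonarch_local_field \<Rightarrow> bool" where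
  "uniformizer \<pi> \<longleftrightarrow> \<pi> \<noteq> 0 \<and> valuation \<pi> = 1"

definition normalized_haar :: "'k::nonarch_local_field measure \<Rightarrow> bool" where
  "normalized_haar M \<longleftrightarrow> sets M = sets borel \<and>
     (\<forall>a. \<forall>B\<in>sets borel. emeasure M ((+) a ` B) = emeasure M B) \<and>
     emeasure M ring_of_integers = 1"

text \<open>The space of locally constant, compactly supported functions.\<close>

definition test_functions :: "('k::nonarch_local_field \<Rightarrow> complex) set" where
  "test_functions = {f. (\<forall>x. \<forall>\<^sub>F y in nhds x. f y = f x) \<and> compact (closure {x. f x \<noteq> 0})}"


section \<open>Characters, local factors\<close>

text \<open>A character of the unit group is a function on the whole field whose values
  outside the unit group are irrelevant.\<close>

definition unit_characters :: "('k::nonarch_local_field \<Rightarrow> complex) set" where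
  "unit_characters = {chi. continuous_on integer_units chi \<and>
     (\<forall>u\<in>integer_units. chi u \<noteq> 0) \<and>
     (\<forall>u\<in>integer_units. \<forall>v\<in>integer_units. chi (u * v) = chi u * chi v)}"

definition trivial_on_units :: "('k::nonarch_local_field \<Rightarrow> complex) \<Rightarrow> bool" where
  "trivial_on_units chi \<longleftrightarrow> (\<forall>u\<in>integer_units. chi u = 1)"

text \<open>\<open>qchar \<pi> \<chi> s\<close> is the quasi-character \<open>\<chi>\<^sub>s\<close> of the multiplicative group,
  extended by \<open>0\<close> to the zero of the field.\<close>

definition qchar :: "'k::nonarch_local_field \<Rightarrow> ('k \<Rightarrow> complex) \<Rightarrow> complex \<Rightarrow> 'k \<Rightarrow> complex" where
  "qchar \<pi> chi s x =
     (if x = 0 then 0 else chi (\<pi> powi (- valuation x) * x) * complex_of_real (absv x) powr s)"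

text \<open>The inverse \<open>L(z, \<omega>)\<^sup>-\<^sup>1\<close> of the local L-factor of a quasi-character \<open>\<omega>\<close>.\<close>

definition inverse_L :: "'k::nonarch_local_field \<Rightarrow> complex \<Rightarrow> ('k \<Rightarrow> complex) \<Rightarrow> complex" where
  "inverse_L \<pi> z \<omega> =
     (if trivial_on_units \<omega> then 1 - \<omega> \<pi> * of_nat (residue_card TYPE('k)) powr (- z) else 1)"

definition additive_character :: "('k::nonarch_local_field \<Rightarrow> complex) \<Rightarrow> bool" where
  "additive_character \<psi> \<longleftrightarrow> continuous_on UNIV \<psi> \<and> (\<forall>x. norm (\<psi> x) = 1) \<and>
     (\<forall>x y. \<psi> (x + y) = \<psi> x * \<psi> y)"

definition gamma_integral ::
  "'k::nonarch_local_field measure \<Rightarrow> ('k \<Rightarrow> complex) \<Rightarrow> ('k \<Rightarrow> complex) \<Rightarrow> nat \<Rightarrow> complex" where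
  "gamma_integral M \<psi> \<omega> n =
     (LINT x : {x. real (residue_card TYPE('k)) powi (- int n) \<le> absv x \<and>
                   absv x \<le> real (residue_card TYPE('k)) powi (int n)} | M.
        \<psi> x * \<omega> x / complex_of_real (absv x))"

text \<open>
  \<open>gamma_factor M \<psi> \<pi> \<xi>\<close> is the meromorphic function \<open>a \<mapsto> \<Gamma>(\<xi>\<^sub>a)\<close>. For trivial \<open>\<xi>\<close> the defining
  limit exists only for \<open>Re a > 0\<close>, elsewhere it is continued; at poles the value is \<open>0\<close>.
\<close>

definition gamma_factor ::
  "'k::nonarch_local_field measure \<Rightarrow> ('k \<Rightarrow> complex) \<Rightarrow> 'k \<Rightarrow> ('k \<Rightarrow> complex) \<Rightarrow> complex \<Rightarrow> complex" where
  "gamma_factor M \<psi> \<pi> \<xi> = (THE G. G nicely_meromorphic_on UNIV \<and>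
     (\<forall>a. Re a > 0 \<longrightarrow> gamma_integral M \<psi> (qchar \<pi> \<xi> a) \<longlonglongrightarrow> G a))"

definition fourier :: "'k::nonarch_local_field measure \<Rightarrow> ('k \<Rightarrow> complex) \<Rightarrow> ('k \<Rightarrow> complex) \<Rightarrow> 'k \<Rightarrow> complex" where
  "fourier M \<psi> f y = (LINT z|M. \<psi> (y * z) * f z)"

definition inversion_constant :: "'k::nonarch_local_field measure \<Rightarrow> ('k \<Rightarrow> complex) \<Rightarrow> real" where
  "inversion_constant M \<psi> = (THE c. c > 0 \<and>
     (\<forall>f\<in>test_functions. \<forall>x.
        f x = complex_of_real c * (LINT y|M. \<psi> (- (x * y)) * fourier M \<psi> f y)))"

text \<open>The distribution \<open>\<xi>\<^sub>a\<close> with its pole cancelled, evaluated at the test function \<open>\<phi>\<close>.\<close>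

definition qchar_distr ::
  "'k::nonarch_local_field measure \<Rightarrow> 'k \<Rightarrow> ('k \<Rightarrow> complex) \<Rightarrow> complex \<Rightarrow> ('k \<Rightarrow> complex) \<Rightarrow> complex" where
  "qchar_distr M \<pi> \<xi> a \<phi> = (THE g. g holomorphic_on UNIV \<and>
     (\<forall>b. Re b > -1 \<longrightarrow> g b =
        (if trivial_on_units \<xi> then 1 - of_nat (residue_card TYPE('k)) powr (- b - 1) else 1) *
        (LINT x|M. qchar \<pi> \<xi> b x * \<phi> x))) a"


section \<open>The quadratic extension\<close>

text \<open>
  The data of the quadratic extension \<open>E = F(\<alpha>)\<close>: the inclusion of \<open>F\<close> into \<open>E\<close>, the generator
  \<open>\<alpha>\<close>, the element \<open>\<alpha>\<^sup>2\<close> of \<open>F\<close>, uniformizers, Haar measures and the additive character of \<open>F\<close>.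
\<close>

record ('f, 'e) quadratic_data =
  emb :: "'f \<Rightarrow> 'e"
  gen :: 'e
  gen_sq :: 'f
  unifF :: 'f
  unifE :: 'e
  haarF :: "'f measure"
  haarE :: "'e measure"
  psi :: "'f \<Rightarrow> complex"

text \<open>
  \<open>unif_compatible\<close> is what makes \<open>L(1/2, \<chi>\<^sub>s|F \<eta>\<^sub>t)\<^sup>-\<^sup>1\<close> equal to \<open>1 - q powr -(2s + t + 1/2)\<close>
  for all \<open>\<chi>\<close> and \<open>\<eta>\<close> with \<open>\<chi>|F \<eta> = 1\<close>: the left-hand side involves \<open>\<chi>\<^sub>s\<close>, which is
  defined by the uniformizer of \<open>E\<close>, at the uniformizer of \<open>F\<close>. The exponent is the
  ramification index.
\<close>

locale quadratic_setting =
  fixes X :: "('f::nonarch_local_field, 'e::nonarch_local_field) quadratic_data"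
  assumes emb_add: "emb X (a + b) = emb X a + emb X b"
    and emb_mult: "emb X (a * b) = emb X a * emb X b"
    and emb_one: "emb X 1 = 1"
    and emb_continuous: "continuous_on UNIV (emb X)"
    and gen_notin: "gen X \<notin> range (emb X)"
    and gen_generates: "\<exists>a b. x = emb X a + emb X b * gen X"
    and gen_squared: "(gen X)\<^sup>2 = emb X (gen_sq X)"
    and gen_sq_nonsquare: "gen_sq X \<noteq> 0" "gen_sq X \<noteq> c\<^sup>2"
    and gen_normalized:
      "(valuation (gen_sq X) = 0 \<and> residue_card TYPE('e) = (residue_card TYPE('f))\<^sup>2) \<or>
       (valuation (gen_sq X) = 1 \<and> residue_card TYPE('e) = residue_card TYPE('f))"
    and unif: "uniformizer (unifF X)" "uniformizer (unifE X)"
    and unif_compatible: "\<exists>e::nat. emb X (unifF X) = unifE X ^ e"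
    and haar: "normalized_haar (haarF X)" "normalized_haar (haarE X)"
    and haar_product:
      "haarE X = distr (haarF X \<Otimes>\<^sub>M haarF X) borel (\<lambda>(x1, x2). emb X x1 + emb X x2 * gen X)"
    and psi: "additive_character (psi X)" "\<exists>x. psi X x \<noteq> 1"

definition coord :: "('f::nonarch_local_field, 'e::nonarch_local_field) quadratic_data \<Rightarrow> 'e \<Rightarrow> 'f \<times> 'f" where
  "coord X x = (THE (x1, x2). x = emb X x1 + emb X x2 * gen X)"

definition psiE :: "('f::nonarch_local_field, 'e::nonarch_local_field) quadratic_data \<Rightarrow> 'e \<Rightarrow> complex" where
  "psiE X x = psi X (fst (coord X x))"

text \<open>The kernel; its value on \<open>F\<close> (a null set) comes out as \<open>0\<close>.\<close>

definition kernel :: "('f::nonarch_local_field, 'e::nonarch_local_field) quadratic_data \<Rightarrow>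
    ('e \<Rightarrow> complex) \<Rightarrow> complex \<Rightarrow> ('f \<Rightarrow> complex) \<Rightarrow> complex \<Rightarrow> 'e \<Rightarrow> complex" where
  "kernel X chi s \<eta> t x =
     (let (x1, x2) = coord X x; z = x2 / (x1\<^sup>2 - x2\<^sup>2 * gen_sq X)
      in qchar (unifE X) chi (s - 1/2) (x\<^sup>2) *
         (qchar (unifE X) chi (s - 1/2) (emb X z) * qchar (unifF X) \<eta> (t + 1/2) z))"

definition lambda_plus :: "('f::nonarch_local_field, 'e::nonarch_local_field) quadratic_data \<Rightarrow>
    ('e \<Rightarrow> complex) \<Rightarrow> complex \<Rightarrow> ('f \<Rightarrow> complex) \<Rightarrow> complex \<Rightarrow> complex" where
  "lambda_plus X chi s \<eta> t =
     inverse_L (unifF X) (1/2) (\<lambda>a. qchar (unifE X) chi s (emb X a) * qchar (unifF X) \<eta> t a)"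

definition lambda_minus :: "('f::nonarch_local_field, 'e::nonarch_local_field) quadratic_data \<Rightarrow>
    ('e \<Rightarrow> complex) \<Rightarrow> complex \<Rightarrow> ('f \<Rightarrow> complex) \<Rightarrow> complex \<Rightarrow> complex" where
  "lambda_minus X chi s \<eta> t =
     inverse_L (unifF X) (1/2) (\<lambda>a. qchar (unifE X) chi s (emb X a) * inverse (qchar (unifF X) \<eta> t a))"

definition holomorphic2 :: "(complex \<times> complex \<Rightarrow> complex) \<Rightarrow> bool" where
  "holomorphic2 g \<longleftrightarrow> (\<forall>p. \<exists>A B. (g has_derivative (\<lambda>(h, k). A * h + B * k)) (at p))"

text \<open>
  The holomorphic family \<open>\<lambda>\<^sub>+ \<lambda>\<^sub>- K\<close> of distributions at the test function \<open>f\<close>: the holomorphic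
  continuation to all \<open>(s, t)\<close> from the region in which \<open>K\<close> is locally integrable.
\<close>

definition normalized_kernel :: "('f::nonarch_local_field, 'e::nonarch_local_field) quadratic_data \<Rightarrow>
    ('e \<Rightarrow> complex) \<Rightarrow> complex \<Rightarrow> ('f \<Rightarrow> complex) \<Rightarrow> complex \<Rightarrow> ('e \<Rightarrow> complex) \<Rightarrow> complex" where
  "normalized_kernel X chi s \<eta> t f = (THE g. holomorphic2 g \<and>
     (\<forall>s t. Re (2 * s + t + 1/2) > 0 \<and> Re (2 * s - t + 1/2) > 0 \<longrightarrow>
        g (s, t) = lambda_plus X chi s \<eta> t * lambda_minus X chi s \<eta> t *
                   (LINT x|haarE X. kernel X chi s \<eta> t x * f x))) (s, t)"

definition L_family :: "('f::nonarch_local_field, 'e::nonarch_local_field) quadratic_data \<Rightarrow>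
    ('f \<Rightarrow> complex) \<Rightarrow> complex \<Rightarrow> ('e \<Rightarrow> complex) \<Rightarrow> complex" where
  "L_family X \<eta> t f =
     qchar_distr (haarF X) (unifF X) (\<lambda>u. inverse ((\<eta> u)\<^sup>2)) (- 2 * t - 1) (\<lambda>x1. f (emb X x1))"

definition S_plus :: "('f::nonarch_local_field, 'e::nonarch_local_field) quadratic_data \<Rightarrow>
    (('e \<Rightarrow> complex) \<times> complex \<times> ('f \<Rightarrow> complex) \<times> complex) set" where
  "S_plus X = {(chi, s, \<eta>, t). chi \<in> unit_characters \<and> \<eta> \<in> unit_characters \<and>
     trivial_on_units (\<lambda>u. chi (emb X u) * \<eta> u) \<and>
     (\<exists>k::int. 2 * s + t + 1/2 = 2 * of_real pi * \<i> / of_real (ln (real (residue_card TYPE('f)))) * of_int k)}"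

definition S_minus :: "('f::nonarch_local_field, 'e::nonarch_local_field) quadratic_data \<Rightarrow>
    (('e \<Rightarrow> complex) \<times> complex \<times> ('f \<Rightarrow> complex) \<times> complex) set" where
  "S_minus X = {(chi, s, \<eta>, t). chi \<in> unit_characters \<and> \<eta> \<in> unit_characters \<and>
     trivial_on_units (\<lambda>u. chi (emb X u) * inverse (\<eta> u)) \<and>
     (\<exists>k::int. 2 * s - t + 1/2 = 2 * of_real pi * \<i> / of_real (ln (real (residue_card TYPE('f)))) * of_int k)}"

text \<open>
  The product of the two gamma factors and the inverse L-factor along \<open>S_minus\<close>, as a function of
  \<open>t'\<close>. For fixed \<open>\<chi>\<close>, \<open>\<eta>\<close> the set \<open>S_minus\<close> is a union of complex lines; the one through \<open>(s, t)\<close> is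
  \<open>t' \<mapsto> (s + (t' - t) / 2, t')\<close>.
\<close>

definition gamma_product_along :: "('f::nonarch_local_field, 'e::nonarch_local_field) quadratic_data \<Rightarrow>
    ('e \<Rightarrow> complex) \<Rightarrow> complex \<Rightarrow> ('f \<Rightarrow> complex) \<Rightarrow> complex \<Rightarrow> complex \<Rightarrow> complex" where
  "gamma_product_along X chi s \<eta> t t' =
     gamma_factor (haarF X) (psi X) (unifF X) (\<lambda>u. (chi (emb X u))\<^sup>2) (2 * t') *
     gamma_factor (haarE X) (psiE X) (unifE X) (\<lambda>u. inverse ((chi u)\<^sup>2)) (- t' + 1/2) *
     lambda_plus X chi (s + (t' - t) / 2) \<eta> t'"

end

theory Submission
  imports Defs
begin

text \<open>Cut \<open>\<E>\<close> into the cells on which both \<open>|x|\<close> and \<open>|x\<^sub>2|\<close> are constant. On a cell the kernel is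
  a monomial in \<open>q\<^sup>s\<close> and \<open>q\<^sup>t\<close> times a function of absolute value 1, so pairing it with a test function
  gives a double series of cell integrals. Far out in either direction this series is geometric:
  for \<open>|x\<^sub>2|\<close> small compared with \<open>|x|\<close> the ratio is the one in \<open>\<lambda>\<^sub>+\<close>, and for \<open>x\<close> close to 0 it is the one in
  \<open>\<lambda>\<^sub>-\<close>. Hence the normalized pairing is a finite sum of entire functions, which is the
  continuation.

  On \<open>S\<^sub>+\<close> the factor \<open>\<lambda>\<^sub>+\<close> vanishes and only the geometric tail along the subfield survives; it is the
  shell expansion of \<open>L\<close>. On \<open>S\<^sub>-\<close> the factor \<open>\<lambda>\<^sub>-\<close> vanishes and only the tail at 0 survives, so the
  distribution is a multiple of \<open>\<delta>\<close>. To identify the coefficient, let \<open>0 < Re t < 1/2\<close>, where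
  both gamma factors are absolutely convergent sums over shells. Their product, grouped by the
  shell of \<open>x / y\<close>, is a sum of integrals of \<open>\<psi> (y (1 + x\<^sub>1)) \<chi>\<^sup>-\<^sup>2 (x)\<close>; integrating over \<open>y\<close> concentrates
  \<open>x\<^sub>1\<close> near \<open>- 1\<close>, and the result is again a cell integral of the kernel with the two
  coordinates exchanged by multiplication with \<open>\<alpha>\<close>. Both sides are meromorphic along the line, so
  the identity extends to all \<open>t\<close>.\<close>

section \<open>Non-archimedean local fields\<close>

subsection \<open>The absolute value\<close>

text \<open>On S_- the real part of 2 s - t + 1/2 is 0 and the kernel is not absolutely integrable
  at 0, so the coefficient of \<delta> cannot be computed as an integral. What the continuation
  leaves there is the part of the double series over one block of \<open>ram\<close> consecutive
  shells, a fundamental domain for multiplication by the uniformizer of F. The gamma product yields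
  another subseries: |x_2| is fixed and |x| is arbitrary. On S_- the terms are invariant under this
  multiplication and each subseries meets every orbit exactly once; hence the two agree.

  Two motions produce every geometric series: multiplication of x by elements of F, and stretching
  of x_2 alone near F. Uniformizers give the ratios; units make the leading integral vanish when the
  relevant character is nontrivial, which is exactly when the local factor is 1.

  The relation |\<iota> a| = |a|^2 is not an axiom of the setting. It is obtained by comparing Haar
  measure on E with the product measure.\<close>

lemma absv_nonneg [simp]: "0 \<le> absv x"
  by (simp add: absv_def)

lemma absv_eq_0_iff [simp]: "absv x = 0 \<longleftrightarrow> x = 0"
  by (simp add: absv_def)

lemma absv_pos_iff [simp]: "0 < absv x \<longleftrightarrow> x \<noteq> 0"
  by (simp add: absv_def)

lemma absv_le_0_iff [simp]: "absv x \<le> 0 \<longleftrightarrow> x = 0"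
  by (simp add: absv_def)

lemma absv_0 [simp]: "absv 0 = 0"
  by simp

lemma absv_mult: "absv (x * y) = absv x * absv y"
  by (simp add: absv_def dist_zero_mult)

lemma absv_1 [simp]: "absv (1 :: 'k::nonarch_local_field) = 1"
proof -
  have "absv (1::'k) * absv (1::'k) = absv (1::'k) * 1"
    by (metis absv_mult mult.right_neutral)
  then show ?thesis by (simp only: mult_cancel_left) simp
qed

lemma absv_power: "absv (x ^ n) = absv x ^ n"
  by (induction n) (simp_all add: absv_mult)

lemma absv_inverse: "absv (inverse x) = inverse (absv x)"
proof (cases "x = 0")
  case False
  then have "absv x * absv (inverse x) = 1" by (simp flip: absv_mult)
  then show ?thesis by (simp add: inverse_unique)
qed simp

lemma absv_divide: "absv (x / y) = absv x / absv y"
  by (simp add: divide_inverse absv_mult absv_inverse)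

lemma absv_power_int: "absv (x powi n) = absv x powi n"
  by (simp add: power_int_def absv_power absv_inverse)

lemma absv_minus [simp]: "absv (- x) = absv (x :: 'k::nonarch_local_field)"
proof -
  have "absv (-1 :: 'k) ^ 2 = 1" by (simp flip: absv_power)
  then have "absv (-1 :: 'k) = 1" using power2_eq_1_iff[of "absv (-1::'k)"]
    by (smt (verit) absv_nonneg)
  then have "absv (-1 * x) = absv x" by (simp only: absv_mult)
  then show ?thesis by simp
qed

lemma dist_eq_absv: "dist x y = absv (x - y)"
  using dist_translation[of x "- y" y] by (simp add: absv_def)

lemma absv_diff_commute: "absv (x - y) = absv (y - x)"
  by (metis absv_minus minus_diff_eq)

lemma absv_add_le: "absv (x + y) \<le> max (absv x) (absv y)"
  by (simp add: absv_def dist_ultrametric)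

lemma absv_diff_le: "absv (x - y) \<le> max (absv x) (absv y)"
  using absv_add_le[of x "- y"] by simp

lemma absv_add_bound: "absv x \<le> r \<Longrightarrow> absv y \<le> r \<Longrightarrow> absv (x + y) \<le> r"
  using absv_add_le[of x y] by simp

lemma absv_diff_bound: "absv x \<le> r \<Longrightarrow> absv y \<le> r \<Longrightarrow> absv (x - y) \<le> r"
  using absv_diff_le[of x y] by simp

lemma absv_add_eq: "absv y < absv x \<Longrightarrow> absv (x + y) = absv x"
  using absv_add_le[of x y] absv_diff_le[of "x + y" y] by auto

lemma absv_add_eq': "absv y < absv x \<Longrightarrow> absv (y + x) = absv x"
  using absv_add_eq[of y x] by (simp add: add.commute)

lemma absv_close_eq: "absv (x - y) < absv y \<Longrightarrow> absv x = absv y"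
  using absv_add_eq[of "x - y" y] by simp


subsection \<open>The value group\<close>

abbreviation rcard :: "'k::nonarch_local_field itself \<Rightarrow> real" where
  "rcard k \<equiv> real (residue_card k)"

lemma ball_relation_equiv:
  "equiv (ring_of_integers :: 'k::nonarch_local_field set)
     {(x, y). x \<in> ring_of_integers \<and> y \<in> ring_of_integers \<and> dist x y < 1}"
proof (rule equivI)
  show "trans {(x::'k, y). x \<in> ring_of_integers \<and> y \<in> ring_of_integers \<and> dist x y < 1}"
  proof (rule transI, clarsimp)
    fix x y z :: 'k assume "dist x y < 1" "dist y z < 1"
    then show "dist x z < 1" using absv_add_le[of "x - y" "y - z"] by (simp add: dist_eq_absv)
  qed
qed (auto simp: refl_on_def sym_def dist_commute)

text \<open>|1 - 0| = 1 puts 0 and 1 in different residue classes. Finiteness of the residue field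
  enters because \<open>card\<close> of an infinite set is 0.\<close>

lemma rcard_gt_1: "rcard TYPE('k::nonarch_local_field) > 1"
proof -
  let ?R = "{(x::'k, y). x \<in> ring_of_integers \<and> y \<in> ring_of_integers \<and> dist x y < 1}"
  have fin: "finite (residue_field :: 'k set set)" by (rule finite_residue_field)
  have i: "(0::'k) \<in> ring_of_integers" "(1::'k) \<in> ring_of_integers"
    using absv_1[where 'k = 'k] by (auto simp: ring_of_integers_def absv_def simp del: absv_1)
  have "?R `` {0} \<in> residue_field" "?R `` {1} \<in> residue_field"
    unfolding residue_field_def by (rule quotientI[OF i(1)], rule quotientI[OF i(2)])
  moreover have "?R `` {0} \<noteq> ?R `` {1}"
  proof -
    have "(1::'k) \<in> ?R `` {1}" using i by auto
    moreover have "(1::'k) \<notin> ?R `` {0}" using absv_1[where 'k = 'k] by (auto simp: dist_eq_absv)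
    ultimately show ?thesis by blast
  qed
  ultimately have "card {?R `` {0}, ?R `` {1}} \<le> card (residue_field :: 'k set set)"
    using fin by (intro card_mono) auto
  with \<open>?R `` {0} \<noteq> ?R `` {1}\<close> show ?thesis by (simp add: residue_card_def)
qed

lemma rcard_pos [simp]: "rcard TYPE('k::nonarch_local_field) > 0"
  using rcard_gt_1[where 'k = 'k] by linarith

lemma residue_card_pos [simp]: "residue_card TYPE('k::nonarch_local_field) > 0"
  using rcard_gt_1[where 'k = 'k] by linarith

lemma residue_card_nonzero [simp]: "residue_card TYPE('k::nonarch_local_field) \<noteq> 0"
  using residue_card_pos[where 'k = 'k] by linarith

lemma powi_less_iff:
  "rcard TYPE('k::nonarch_local_field) powi m < rcard TYPE('k) powi n \<longleftrightarrow> m < n"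
  using power_int_strict_increasing[OF _ rcard_gt_1[where 'k = 'k]]
  by (metis less_asym linorder_neqE)

lemma powi_le_iff:
  "rcard TYPE('k::nonarch_local_field) powi m \<le> rcard TYPE('k) powi n \<longleftrightarrow> m \<le> n"
  by (simp add: powi_less_iff flip: not_less)

lemma powi_inject_iff:
  "rcard TYPE('k::nonarch_local_field) powi m = rcard TYPE('k) powi n \<longleftrightarrow> m = n"
  by (metis powi_le_iff order_antisym order_refl)

lemma ex_absv_eq: "\<exists>x::'k::nonarch_local_field. absv x = rcard TYPE('k) powi n"
proof -
  have "rcard TYPE('k) powi n \<in> (\<lambda>x. dist x (0::'k)) ` (- {0})" unfolding value_group by blast
  then show ?thesis by (auto simp: absv_def)
qed

lemma ex_absv_powi: "x \<noteq> 0 \<Longrightarrow> \<exists>n. absv (x::'k::nonarch_local_field) = rcard TYPE('k) powi n"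
proof -
  assume "x \<noteq> 0"
  then have "dist x 0 \<in> range (\<lambda>n::int. rcard TYPE('k) powi n)" unfolding value_group[symmetric] by blast
  then show ?thesis by (auto simp: absv_def)
qed

lemma valuation_eqI: "absv (x::'k::nonarch_local_field) = rcard TYPE('k) powi (- n) \<Longrightarrow> valuation x = n"
  unfolding valuation_def by (rule the_equality) (auto simp: powi_inject_iff)

lemma absv_eq_valuation:
  assumes "(x::'k::nonarch_local_field) \<noteq> 0"
  shows "absv x = rcard TYPE('k) powi (- valuation x)"
proof -
  obtain n where "absv x = rcard TYPE('k) powi (- (- n))" using ex_absv_powi[OF assms] by auto
  with valuation_eqI[OF this] show ?thesis by simp
qed

lemma absv_eq_powi_iff:
  "absv (x::'k::nonarch_local_field) = rcard TYPE('k) powi n \<longleftrightarrow> x \<noteq> 0 \<and> valuation x = - n"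
  using valuation_eqI[of x "- n"] absv_eq_valuation[of x]
  by (metis absv_eq_0_iff add.inverse_inverse power_int_eq_0_iff rcard_pos less_irrefl)

lemma absv_le_powi_iff:
  "x \<noteq> 0 \<Longrightarrow> absv (x::'k::nonarch_local_field) \<le> rcard TYPE('k) powi n \<longleftrightarrow> - valuation x \<le> n"
  by (simp add: absv_eq_valuation powi_le_iff)

lemma valuation_mult:
  "x \<noteq> 0 \<Longrightarrow> y \<noteq> 0 \<Longrightarrow> valuation (x * y) = valuation x + valuation (y::'k::nonarch_local_field)"
proof (rule valuation_eqI)
  assume "x \<noteq> 0" "y \<noteq> 0"
  then have "absv (x * y) = rcard TYPE('k) powi (- valuation x) * rcard TYPE('k) powi (- valuation y)"
    using absv_mult[of x y] absv_eq_valuation[of x] absv_eq_valuation[of y] by simp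
  then show "absv (x * y) = rcard TYPE('k) powi (- (valuation x + valuation y))"
    by (simp add: power_int_add power_int_diff power_int_minus divide_inverse)
qed

text \<open>Discreteness of the value group: consecutive radii differ by the factor q, so a strict
  bound is a weak bound one step lower. Hence open balls are closed balls, with the index shifted by
  1.\<close>

lemma absv_less_powi_iff:
  "absv (x::'k::nonarch_local_field) < rcard TYPE('k) powi n \<longleftrightarrow> absv x \<le> rcard TYPE('k) powi (n - 1)"
proof (cases "x = 0")
  case False
  then show ?thesis by (auto simp: absv_eq_valuation powi_le_iff powi_less_iff)
qed (auto intro: less_imp_le)

lemma absv_uniformizer: "uniformizer (\<pi>::'k::nonarch_local_field) \<Longrightarrow> absv \<pi> = rcard TYPE('k) powi (-1)"
  by (simp add: uniformizer_def absv_eq_valuation)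

lemma uniformizer_nonzero: "uniformizer \<pi> \<Longrightarrow> \<pi> \<noteq> 0"
  by (simp add: uniformizer_def)

lemma powi_small:
  assumes "(r::real) > 0"
  obtains n where "rcard TYPE('k::nonarch_local_field) powi (- int n) \<le> r"
proof -
  obtain n where "inverse r < rcard TYPE('k) ^ n"
    using real_arch_pow[OF rcard_gt_1[where 'k = 'k]] by blast
  then have "rcard TYPE('k) powi (- int n) \<le> r"
    using assms by (simp add: power_int_minus field_simps)
  then show thesis by (rule that)
qed

lemma powi_large:
  obtains n where "(r::real) \<le> rcard TYPE('k::nonarch_local_field) powi (int n)"
proof -
  obtain n where "r < rcard TYPE('k) ^ n"
    using real_arch_pow[OF rcard_gt_1[where 'k = 'k]] by blast
  then show thesis by (intro that[of n]) simp
qed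


subsection \<open>Topology\<close>

lemma tendsto_absv_iff: "(f \<longlongrightarrow> l) F \<longleftrightarrow> ((\<lambda>x. absv (f x - l)) \<longlongrightarrow> 0) F"
  by (subst tendsto_dist_iff) (simp add: dist_eq_absv)

instance nonarch_local_field \<subseteq> topological_ab_group_add
proof
  fix a b :: 'a
  have tf: "(fst \<longlongrightarrow> a) (nhds (a, b))" "(snd \<longlongrightarrow> b) (nhds (a, b))"
    using tendsto_fst[OF filterlim_ident, of "(a, b)"] tendsto_snd[OF filterlim_ident, of "(a, b)"] by simp_all
  show "LIM x (nhds a \<times>\<^sub>F nhds b). fst x + snd x :> nhds (a + b)"
  proof (subst tendsto_absv_iff, rule tendsto_sandwich[of "\<lambda>_. 0"])
    show "\<forall>\<^sub>F x in nhds a \<times>\<^sub>F nhds b. absv (fst x + snd x - (a + b)) \<le> max (dist (fst x) a) (dist (snd x) b)"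
      by (rule always_eventually, rule allI)
         (metis absv_add_le dist_eq_absv add_diff_add)
    have "((\<lambda>x. max (dist (fst x) a) (dist (snd x) b)) \<longlongrightarrow> max (dist a a) (dist b b)) (nhds (a, b))"
      by (intro tendsto_intros tf) 
    then show "((\<lambda>x. max (dist (fst x) a) (dist (snd x) b)) \<longlongrightarrow> 0) (nhds a \<times>\<^sub>F nhds b)"
      by (simp add: nhds_prod)
  qed simp_all
  show "(uminus \<longlongrightarrow> - a) (nhds a)"
  proof (subst tendsto_absv_iff)
    have "((\<lambda>x. dist x a) \<longlongrightarrow> dist a a) (nhds a)" by (intro tendsto_intros) (simp add: filterlim_ident)
    then show "((\<lambda>x. absv (- x - - a)) \<longlongrightarrow> 0) (nhds a)"
      by (simp add: dist_eq_absv absv_diff_commute)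
  qed
qed

instance nonarch_local_field \<subseteq> topological_comm_monoid_mult
proof
  fix a b :: 'a
  have tf: "(fst \<longlongrightarrow> a) (nhds (a, b))" "(snd \<longlongrightarrow> b) (nhds (a, b))"
    using tendsto_fst[OF filterlim_ident, of "(a, b)"] tendsto_snd[OF filterlim_ident, of "(a, b)"] by simp_all
  show "LIM x (nhds a \<times>\<^sub>F nhds b). fst x * snd x :> nhds (a * b)"
  proof (subst tendsto_absv_iff, rule tendsto_sandwich[of "\<lambda>_. 0"])
    have eq: "x * y - a * b = (x - a) * (y - b) + ((x - a) * b + a * (y - b))" for x y :: 'a
      by (simp add: algebra_simps)
    have *: "absv (x * y - a * b) \<le> max (dist x a * dist y b) (max (dist x a * absv b) (absv a * dist y b))"
      for x y
      unfolding eq dist_eq_absv absv_mult[symmetric]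
      by (rule order.trans[OF absv_add_le], rule max.mono[OF order_refl], rule absv_add_le)
    show "\<forall>\<^sub>F x in nhds a \<times>\<^sub>F nhds b. absv (fst x * snd x - a * b) \<le>
        max (dist (fst x) a * dist (snd x) b) (max (dist (fst x) a * absv b) (absv a * dist (snd x) b))"
      by (rule always_eventually, rule allI) (rule *)
    have "((\<lambda>x. max (dist (fst x) a * dist (snd x) b) (max (dist (fst x) a * absv b) (absv a * dist (snd x) b)))
       \<longlongrightarrow> max (dist a a * dist b b) (max (dist a a * absv b) (absv a * dist b b))) (nhds (a, b))"
      by (intro tendsto_intros tf) 
    then show "((\<lambda>x. max (dist (fst x) a * dist (snd x) b) (max (dist (fst x) a * absv b) (absv a * dist (snd x) b)))
       \<longlongrightarrow> 0) (nhds a \<times>\<^sub>F nhds b)"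
      by (simp add: nhds_prod)
  qed simp_all
qed

text \<open>One representative is chosen per residue class. Two of them at distance below 1 would
  share a class, and integers are at distance at most 1; hence the exact distance 1.\<close>

lemma ball_1_finite_cover:
  "\<exists>D::'k::nonarch_local_field set. finite D \<and> card D = residue_card TYPE('k) \<and> D \<subseteq> {x. absv x \<le> 1} \<and>
     (\<forall>x. absv x \<le> 1 \<longrightarrow> (\<exists>d\<in>D. absv (x - d) < 1)) \<and>
     (\<forall>d\<in>D. \<forall>d'\<in>D. d \<noteq> d' \<longrightarrow> absv (d - d') = 1)"
proof -
  let ?O = "ring_of_integers :: 'k set"
  let ?R = "{(x::'k, y). x \<in> ?O \<and> y \<in> ?O \<and> dist x y < 1}"
  have eqv: "equiv ?O ?R" by (rule ball_relation_equiv)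
  have O: "?O = {x. absv x \<le> 1}" by (auto simp: ring_of_integers_def absv_def)
  have rf: "(residue_field :: 'k set set) = ?O // ?R" by (simp add: residue_field_def)
  have ne: "C \<in> ?O // ?R \<Longrightarrow> (SOME x. x \<in> C) \<in> C" for C
  proof -
    assume "C \<in> ?O // ?R"
    then have "C \<noteq> {}" by (rule in_quotient_imp_non_empty[OF eqv])
    then show ?thesis by (simp add: some_in_eq)
  qed
  define D where "D = (\<lambda>C. SOME x. x \<in> C) ` (?O // ?R)"
  have sub: "C \<in> ?O // ?R \<Longrightarrow> C \<subseteq> ?O" for C using in_quotient_imp_subset[OF eqv] .
  have inj: "inj_on (\<lambda>C. SOME x. x \<in> C) (?O // ?R)"
  proof (rule inj_onI)
    fix C C' assume C: "C \<in> ?O // ?R" "C' \<in> ?O // ?R" "(SOME x. x \<in> C) = (SOME x. x \<in> C')"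
    have "(SOME x. x \<in> C) \<in> C \<inter> C'" using ne[OF C(1)] ne[OF C(2)] C(3) by simp
    then have "C \<inter> C' \<noteq> {}" by (rule ex_in_conv[THEN iffD1, OF exI])
    then show "C = C'" using quotient_disj[OF eqv C(1,2)] by simp
  qed
  have "finite (?O // ?R)" using finite_residue_field[where 'a='k] rf by simp
  then have "finite D" unfolding D_def by simp
  moreover have "card D = residue_card TYPE('k)"
    unfolding D_def by (simp add: card_image[OF inj] residue_card_def rf)
  moreover have "D \<subseteq> {x. absv x \<le> 1}" using ne sub unfolding D_def O by blast
  moreover have "\<exists>d\<in>D. absv (x - d) < 1" if "absv x \<le> 1" for x
  proof -
    have x: "x \<in> ?O" using that unfolding O by (rule CollectI)
    then have C: "?R `` {x} \<in> ?O // ?R" by (rule quotientI)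
    have "(SOME y. y \<in> ?R `` {x}) \<in> ?R `` {x}" by (rule ne[OF C])
    moreover have "y \<in> ?R `` {x} \<Longrightarrow> absv (x - y) < 1" for y by (auto simp: dist_eq_absv)
    ultimately have "absv (x - (SOME y. y \<in> ?R `` {x})) < 1" by blast
    then show ?thesis using imageI[OF C, of "\<lambda>C. SOME x. x \<in> C"] unfolding D_def by (rule bexI)
  qed
  moreover have "absv (d - d') = 1" if "d \<in> D" "d' \<in> D" "d \<noteq> d'" for d d'
  proof (rule ccontr)
    assume n1: "absv (d - d') \<noteq> 1"
    obtain C where C1: "C \<in> ?O // ?R" "d = (SOME x. x \<in> C)"
      using \<open>d \<in> D\<close> unfolding D_def by (rule imageE)
    obtain C' where C2: "C' \<in> ?O // ?R" "d' = (SOME x. x \<in> C')"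
      using \<open>d' \<in> D\<close> unfolding D_def by (rule imageE)
    note C = C1(1) C2(1) C1(2) C2(2)
    have dd: "d \<in> C" "d' \<in> C'" using ne C by auto
    then have "d \<in> ?O" "d' \<in> ?O" using sub C by auto
    then have "absv (d - d') \<le> 1" using O by (auto intro: absv_diff_bound)
    then have "absv (d - d') < 1" using n1 by simp
    then have "(d, d') \<in> ?R" using \<open>d \<in> ?O\<close> \<open>d' \<in> ?O\<close> by (simp add: dist_eq_absv)
    then have "C = C'" using quotient_eq_iff[OF eqv C(1,2) dd] by simp
    with C that show False by simp
  qed
  ultimately show ?thesis by (intro exI[of _ D]) blast
qed

text \<open>The residue representatives are rescaled by an element of absolute value
  \<open>rcard TYPE('k) powi n\<close>. The lower bound on mutual distances later makes the smaller
  balls disjoint, which determines their Haar measure.\<close>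

lemma ball_finite_cover_step:
  "\<exists>D::'k::nonarch_local_field set. finite D \<and> card D = residue_card TYPE('k) \<and>
     D \<subseteq> {x. absv x \<le> rcard TYPE('k) powi n} \<and>
     (\<forall>x. absv x \<le> rcard TYPE('k) powi n \<longrightarrow> (\<exists>d\<in>D. absv (x - d) \<le> rcard TYPE('k) powi (n - 1))) \<and>
     (\<forall>d\<in>D. \<forall>d'\<in>D. d \<noteq> d' \<longrightarrow> absv (d - d') > rcard TYPE('k) powi (n - 1))"
proof -
  obtain D :: "'k set" where D: "finite D" "card D = residue_card TYPE('k)" "D \<subseteq> {x. absv x \<le> 1}"
    "\<And>x. absv x \<le> 1 \<Longrightarrow> \<exists>d\<in>D. absv (x - d) < 1" "\<And>d d'. d \<in> D \<Longrightarrow> d' \<in> D \<Longrightarrow> d \<noteq> d' \<Longrightarrow> absv (d - d') = 1"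
    using ball_1_finite_cover[where 'k = 'k] by auto
  obtain p :: 'k where p: "absv p = rcard TYPE('k) powi n" using ex_absv_eq by blast
  then have p0: "p \<noteq> 0" by (auto simp: absv_eq_powi_iff)
  have pp: "absv p > 0" using p0 by simp
  have lt: "absv x < absv p \<longleftrightarrow> absv x \<le> rcard TYPE('k) powi (n - 1)" for x :: 'k
    unfolding p by (rule absv_less_powi_iff)
  have a: "absv (p * x - p * y) = absv p * absv (x - y)" for x y by (simp flip: absv_mult right_diff_distrib)
  show ?thesis
  proof (intro exI[of _ "(*) p ` D"] conjI allI impI ballI)
    show "card ((*) p ` D) = residue_card TYPE('k)"
      using p0 D(2) by (subst card_image) (auto simp: inj_on_def)
    show "(*) p ` D \<subseteq> {x. absv x \<le> rcard TYPE('k) powi n}"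
      using D(3) pp by (auto simp: absv_mult simp flip: p)
    fix x :: 'k assume "absv x \<le> rcard TYPE('k) powi n"
    then have "absv (x / p) \<le> 1" using pp by (simp add: absv_divide p)
    then obtain d where d: "d \<in> D" "absv (x / p - d) < 1" using D(4) by blast
    have "absv (x - p * d) = absv p * absv (x / p - d)" using p0 by (simp add: algebra_simps flip: absv_mult)
    then have "absv (x - p * d) < absv p" using d(2) pp by simp
    then show "\<exists>d\<in>(*) p ` D. absv (x - d) \<le> rcard TYPE('k) powi (n - 1)" using d(1) lt by blast
  next
    fix d d' assume "d \<in> (*) p ` D" "d' \<in> (*) p ` D" "d \<noteq> d'"
    then have "absv (d - d') = absv p" using D(5) by (auto simp: a)
    then show "rcard TYPE('k) powi (n - 1) < absv (d - d')" using lt[of "d - d'"] by simp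
  qed (use D in auto)
qed

lemma ball_finite_cover:
  "\<exists>D::'k::nonarch_local_field set. finite D \<and>
     {x. absv x \<le> rcard TYPE('k) powi n} \<subseteq> (\<Union>d\<in>D. {x. absv (x - d) \<le> rcard TYPE('k) powi (n - int m)})"
proof (induction m)
  case 0
  show ?case by (intro exI[of _ "{0}"]) auto
next
  case (Suc m)
  then obtain D :: "'k set" where D: "finite D"
    "{x. absv x \<le> rcard TYPE('k) powi n} \<subseteq> (\<Union>d\<in>D. {x. absv (x - d) \<le> rcard TYPE('k) powi (n - int m)})"
    by blast
  obtain C :: "'k set" where C: "finite C"
    "\<And>x. absv x \<le> rcard TYPE('k) powi (n - int m) \<Longrightarrow> \<exists>d\<in>C. absv (x - d) \<le> rcard TYPE('k) powi (n - int m - 1)"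
    using ball_finite_cover_step[where 'k = 'k, of "n - int m"] by auto
  have e: "n - int (Suc m) = n - int m - 1" by simp
  show ?case
  proof (intro exI[of _ "(\<lambda>(d, c). d + c) ` (D \<times> C)"] conjI subsetI)
    fix x :: 'k assume "x \<in> {x. absv x \<le> rcard TYPE('k) powi n}"
    then obtain d where d: "d \<in> D" "absv (x - d) \<le> rcard TYPE('k) powi (n - int m)" using D(2) by blast
    then obtain c where c: "c \<in> C" "absv (x - d - c) \<le> rcard TYPE('k) powi (n - int m - 1)" using C(2) by blast
    then show "x \<in> (\<Union>d\<in>(\<lambda>(d, c). d + c) ` (D \<times> C). {x. absv (x - d) \<le> rcard TYPE('k) powi (n - int (Suc m))})"
      using d unfolding e by (force simp: diff_diff_eq)
  qed (use D C in auto)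
qed

lemma ball_totally_bounded:
  assumes "r > 0"
  shows "\<exists>D::'k::nonarch_local_field set. finite D \<and> {x. absv x \<le> R} \<subseteq> (\<Union>d\<in>D. {x. absv (x - d) \<le> r})"
proof -
  obtain n where n: "R \<le> rcard TYPE('k) powi (int n)" by (rule powi_large)
  obtain m where m: "rcard TYPE('k) powi (- int m) \<le> r" using powi_small[OF assms] .
  obtain D :: "'k set" where D: "finite D"
    "{x. absv x \<le> rcard TYPE('k) powi (int n)} \<subseteq> (\<Union>d\<in>D. {x. absv (x - d) \<le> rcard TYPE('k) powi (int n - int (n + m))})"
    using ball_finite_cover[where 'k = 'k, of "int n" "n + m"] by auto
  have "{x::'k. absv x \<le> R} \<subseteq> (\<Union>d\<in>D. {x. absv (x - d) \<le> r})"
  proof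
    fix x :: 'k assume "x \<in> {x. absv x \<le> R}"
    then have "x \<in> {x. absv x \<le> rcard TYPE('k) powi (int n)}" using n by auto
    then obtain d where "d \<in> D" "absv (x - d) \<le> rcard TYPE('k) powi (int n - int (n + m))" using D(2) by blast
    moreover have "int n - int (n + m) = - int m" by simp
    ultimately show "x \<in> (\<Union>d\<in>D. {x. absv (x - d) \<le> r})" using m by fastforce
  qed
  then show ?thesis using D(1) by blast
qed

lemma compact_absv_ball: "compact {x::'k::nonarch_local_field. absv x \<le> R}"
proof -
  have "{x::'k. absv x \<le> R} = cball 0 R" by (auto simp: dist_eq_absv)
  then have "complete {x::'k. absv x \<le> R}" by (simp add: complete_eq_closed)
  moreover have "\<exists>k. finite k \<and> {x::'k. absv x \<le> R} \<subseteq> (\<Union>x\<in>k. ball x \<epsilon>)" if \<epsilon>: "\<epsilon> > 0" for \<epsilon>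
  proof -
    obtain D :: "'k set" where D: "finite D" "{x. absv x \<le> R} \<subseteq> (\<Union>d\<in>D. {x. absv (x - d) \<le> \<epsilon> / 2})"
      using ball_totally_bounded[of "\<epsilon> / 2" R, where 'k = 'k] half_gt_zero[OF \<epsilon>] by blast
    have "{x. absv (x - d) \<le> \<epsilon> / 2} \<subseteq> ball d \<epsilon>" for d :: 'k
    proof
      fix x assume "x \<in> {x. absv (x - d) \<le> \<epsilon> / 2}"
      then have "absv (x - d) < \<epsilon>" using half_gt_zero[OF \<epsilon>] by simp
      then show "x \<in> ball d \<epsilon>" unfolding mem_ball dist_eq_absv absv_diff_commute[of d x] .
    qed
    then have "(\<Union>d\<in>D. {x. absv (x - d) \<le> \<epsilon> / 2}) \<subseteq> (\<Union>x\<in>D. ball x \<epsilon>)" by (rule UN_mono[OF order_refl])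
    then show ?thesis using D(1) order.trans[OF D(2)] by (intro exI[of _ D] conjI)
  qed
  ultimately show ?thesis by (simp add: compact_eq_totally_bounded)
qed

lemma countable_dense_balls:
  "\<exists>D::'k::nonarch_local_field set. countable D \<and> (\<forall>x. \<forall>r>0. \<exists>d\<in>D. absv (x - d) \<le> r)"
proof -
  have "\<exists>D::'k set. finite D \<and> {x. absv x \<le> real n} \<subseteq> (\<Union>d\<in>D. {x. absv (x - d) \<le> 1 / (real m + 1)})" for n m
    by (rule ball_totally_bounded) simp
  then obtain D :: "nat \<Rightarrow> nat \<Rightarrow> 'k set" where D: "\<And>n m. finite (D n m)"
    "\<And>n m. {x. absv x \<le> real n} \<subseteq> (\<Union>d\<in>D n m. {x. absv (x - d) \<le> 1 / (real m + 1)})" by metis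
  have "\<exists>d\<in>(\<Union>n. \<Union>m. D n m). absv (x - d) \<le> r" if r: "r > 0" for x r
  proof -
    obtain n where n: "absv x \<le> real n" using real_arch_simple by blast
    obtain m where m: "1 / (real m + 1) < r" using nat_approx_posE[OF r] by (auto simp: add.commute)
    have "x \<in> (\<Union>d\<in>D n m. {x. absv (x - d) \<le> 1 / (real m + 1)})" using D(2) n by blast
    then obtain d where "d \<in> D n m" "absv (x - d) \<le> 1 / (real m + 1)" by auto
    then show ?thesis using m by (intro bexI[of _ d]) auto
  qed
  then show ?thesis by (intro exI[of _ "\<Union>n. \<Union>m. D n m"]) (auto intro: countable_finite D)
qed

text \<open>Second countability identifies the Borel sets of a product with the product
  \<sigma>-algebra, so continuous operations on pairs become jointly measurable.\<close>

instance nonarch_local_field \<subseteq> second_countable_topology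
proof
  obtain D :: "'a set" where D: "countable D" "\<And>x r. r > 0 \<Longrightarrow> \<exists>d\<in>D. absv (x - d) \<le> r"
    using countable_dense_balls[where 'k='a] by auto
  define B where "B = (\<lambda>(d, n::nat). ball d (1 / (real n + 1))) ` (D \<times> (UNIV :: nat set))"
  have "topological_basis B"
  proof (rule topological_basisI)
    fix U :: "'a set" and x assume U: "open U" "x \<in> U"
    then obtain r where r: "r > 0" "ball x r \<subseteq> U" by (meson open_contains_ball)
    obtain n where n: "1 / (real n + 1) < r" using nat_approx_posE[OF r(1)] by (auto simp: add.commute)
    define \<delta> where "\<delta> = 1 / (real n + 1)"
    have pos: "\<delta> > 0" by (simp add: \<delta>_def)
    obtain d where d: "d \<in> D" "absv (x - d) \<le> \<delta> / 2" using D(2)[OF half_gt_zero[OF pos], of x] by blast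
    show "\<exists>b\<in>B. x \<in> b \<and> b \<subseteq> U"
    proof (intro bexI[of _ "ball d (1 / (real n + 1))"] conjI)
      show "ball d (1 / (real n + 1)) \<in> B" using d unfolding B_def by auto
      have lt: "absv (x - d) < 1 / (real n + 1)" using d(2) pos unfolding \<delta>_def[symmetric] by linarith
      then show "x \<in> ball d (1 / (real n + 1))" unfolding mem_ball dist_eq_absv absv_diff_commute[of d x] .
      have "y \<in> ball x r" if "y \<in> ball d (1 / (real n + 1))" for y
      proof -
        have "absv (x - y) \<le> max (absv (x - d)) (absv (d - y))" using absv_add_le[of "x - d" "d - y"] by simp
        then show ?thesis using that lt n by (simp add: dist_eq_absv)
      qed
      then show "ball d (1 / (real n + 1)) \<subseteq> U" using r(2) by blast
    qed
  qed (auto simp: B_def)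
  then show "\<exists>B::'a set set. countable B \<and> open = generate_topology B"
    using D(1) by (intro exI[of _ B]) (auto simp: B_def intro: topological_basis_imp_subbasis)
qed

lemma continuous_on_absv [continuous_intros]:
  "continuous_on A f \<Longrightarrow> continuous_on A (\<lambda>x. absv (f x :: 'k::nonarch_local_field))"
  unfolding absv_def by (intro continuous_intros)

lemma measurable_absv [measurable]: "absv \<in> borel_measurable (borel :: 'k::nonarch_local_field measure)"
  by (intro borel_measurable_continuous_onI continuous_intros)

lemma compact_integer_units: "compact (integer_units :: 'k::nonarch_local_field set)"
proof -
  have eq: "integer_units = {x::'k. absv x \<le> 1} \<inter> {x. absv x = 1}" by (auto simp: integer_units_def)
  show ?thesis unfolding eq
    by (intro compact_Int_closed compact_absv_ball closed_Collect_eq continuous_intros)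
qed

text \<open>The radii are discrete, so the closed ball of index \<open>n\<close> is the open ball of
  index \<open>n + 1\<close>.\<close>

lemma open_absv_ball: "open {x::'k::nonarch_local_field. absv (x - a) \<le> rcard TYPE('k) powi n}"
proof -
  have "{x::'k. absv (x - a) \<le> rcard TYPE('k) powi n} = ball a (rcard TYPE('k) powi (n + 1))"
  proof (rule set_eqI)
    fix x :: 'k
    show "x \<in> {x. absv (x - a) \<le> rcard TYPE('k) powi n} \<longleftrightarrow> x \<in> ball a (rcard TYPE('k) powi (n + 1))"
      using absv_less_powi_iff[of "x - a" "n + 1"] absv_diff_commute[of x a] by (simp add: dist_eq_absv)
  qed
  then show ?thesis by simp
qed

subsection \<open>Test functions\<close>

text \<open>The level sets are open and cover the compact support; a Lebesgue number of this cover
  is a radius of constancy valid everywhere. A single \<open>n\<close> serves both as fineness and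
  as bound of the support.\<close>

lemma test_function_uniform:
  assumes "f \<in> test_functions"
  obtains n :: nat where
    "\<And>x y. absv (x - y) \<le> rcard TYPE('k) powi (- int n) \<Longrightarrow> f x = f (y::'k::nonarch_local_field)"
    "\<And>x. f x \<noteq> 0 \<Longrightarrow> absv x \<le> rcard TYPE('k) powi (int n)"
proof -
  let ?K = "closure {x. f x \<noteq> 0}"
  have loc: "\<And>x. \<forall>\<^sub>F y in nhds x. f y = f x" and cpt: "compact ?K"
    using assms by (auto simp: test_functions_def)
  have "open (f -` {c})" for c
  proof (subst open_subopen, intro ballI)
    fix x assume "x \<in> f -` {c}"
    then have "\<forall>\<^sub>F y in nhds x. f y = c" using loc[of x] by simp
    then obtain S where "open S" "x \<in> S" "\<forall>y\<in>S. f y = c" by (auto simp: eventually_nhds)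
    then show "\<exists>T. open T \<and> x \<in> T \<and> T \<subseteq> f -` {c}" by blast
  qed
  then have op: "\<And>G. G \<in> range (\<lambda>c. f -` {c}) \<Longrightarrow> open G" by auto
  have sub: "?K \<subseteq> \<Union> (range (\<lambda>c. f -` {c}))" by auto
  obtain e where e: "e > 0" "\<And>x. x \<in> ?K \<Longrightarrow> \<exists>G\<in>range (\<lambda>c. f -` {c}). ball x e \<subseteq> G"
    by (rule Heine_Borel_lemma[OF cpt sub op]) auto
  have near: "f x = f y" if xy: "absv (x - y) < e" "x \<in> ?K" for x y
  proof -
    obtain c where c: "ball x e \<subseteq> f -` {c}" using e(2)[OF xy(2)] by blast
    have "x \<in> ball x e" "y \<in> ball x e" using e(1) xy(1) by (auto simp: dist_eq_absv)
    then show ?thesis using c by blast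
  qed
  \<comment> \<open>The Lebesgue number speaks only about points of the closed support. If neither
    point lies there, both values are 0.\<close>
  have near': "f x = f y" if "absv (x - y) < e" for x y
  proof (cases "x \<in> ?K \<or> y \<in> ?K")
    case True
    then show ?thesis using near[of x y] near[of y x] that absv_diff_commute[of x y] by auto
  next
    case False
    then have "f x = 0" "f y = 0" using closure_subset[of "{x. f x \<noteq> 0}"] by auto
    then show ?thesis by simp
  qed
  have "bounded ?K" by (rule compact_imp_bounded[OF cpt])
  then obtain R where R: "\<And>x. x \<in> ?K \<Longrightarrow> dist 0 x \<le> R" using bounded_any_center[of ?K 0] by blast
  obtain n1 where n1: "R \<le> rcard TYPE('k) powi (int n1)" by (rule powi_large)
  obtain n2 where n2: "rcard TYPE('k) powi (- int n2) \<le> e / 2" using powi_small[of "e / 2"] e(1) by auto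
  show thesis
  proof (rule that[of "max n1 n2"])
    fix x y :: 'k assume "absv (x - y) \<le> rcard TYPE('k) powi (- int (max n1 n2))"
    also have "\<dots> \<le> rcard TYPE('k) powi (- int n2)" by (simp add: powi_le_iff)
    also have "\<dots> < e" using n2 e(1) by linarith
    finally show "f x = f y" by (rule near')
  next
    fix x :: 'k assume "f x \<noteq> 0"
    then have "absv x \<le> R" using R[of x] closure_subset[of "{x. f x \<noteq> 0}"]
      by (auto simp: dist_eq_absv)
    also note n1
    also have "rcard TYPE('k) powi (int n1) \<le> rcard TYPE('k) powi (int (max n1 n2))" unfolding powi_le_iff by simp
    finally show "absv x \<le> rcard TYPE('k) powi (int (max n1 n2))" .
  qed
qed

lemma continuous_on_test_function: "f \<in> test_functions \<Longrightarrow> continuous_on A f"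
proof -
  assume "f \<in> test_functions"
  then have "\<forall>\<^sub>F y in nhds x. f y = f x" for x by (simp add: test_functions_def)
  then have "(f \<longlongrightarrow> f x) (nhds x)" for x by (rule tendsto_eventually)
  then show ?thesis
    by (auto simp: continuous_on_def at_within_def intro: tendsto_mono[OF inf_le1])
qed

lemma test_function_bounded:
  assumes "f \<in> test_functions"
  obtains B where "\<And>x. norm (f x) \<le> B" "B > 0"
proof -
  have "compact (f ` closure {x. f x \<noteq> 0})"
    using assms by (intro compact_continuous_image continuous_on_test_function) (auto simp: test_functions_def)
  then have "bounded (f ` closure {x. f x \<noteq> 0})" by (rule compact_imp_bounded)
  then obtain B where B: "\<And>y. y \<in> f ` closure {x. f x \<noteq> 0} \<Longrightarrow> norm y \<le> B" "B > 0" by (auto simp: bounded_pos)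
  have "norm (f x) \<le> B" for x
  proof (cases "f x = 0")
    case False
    then show ?thesis using B(1) closure_subset[of "{x. f x \<noteq> 0}"] by blast
  qed (use B in auto)
  then show thesis using B(2) that by blast
qed


subsection \<open>Characters are locally constant\<close>

text \<open>Near 1 squaring multiplies the distance to 1 by |w + 1|, which is at least 3/2. Repeated
  squares of some w different from 1 would therefore leave the disc of radius 1/2.\<close>

lemma no_small_subgroup:
  fixes S :: "complex set"
  assumes sq: "\<And>w. w \<in> S \<Longrightarrow> w\<^sup>2 \<in> S" and le: "\<And>w. w \<in> S \<Longrightarrow> norm (w - 1) \<le> 1/2" and "w \<in> S"
  shows "w = 1"
proof (rule ccontr)
  assume "w \<noteq> 1"
  have grow: "norm (v\<^sup>2 - 1) \<ge> 3/2 * norm (v - 1)" if "v \<in> S" for v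
  proof -
    have "2 - norm (1 - v) \<le> norm (2 - (1 - v))" using norm_triangle_ineq2[of 2 "1 - v"] by simp
    then have "3/2 \<le> norm (v + 1)" using le[OF that] by (simp add: norm_minus_commute add.commute)
    moreover have "v\<^sup>2 - 1 = (v + 1) * (v - 1)" by (simp add: power2_eq_square algebra_simps)
    ultimately show ?thesis by (simp only: norm_mult mult_right_mono[OF _ norm_ge_zero])
  qed
  have "w ^ (2 ^ n) \<in> S \<and> (3/2) ^ n * norm (w - 1) \<le> norm (w ^ (2 ^ n) - 1)" for n
  proof (induction n)
    case (Suc n)
    then have "w ^ 2 ^ n \<in> S" and IH: "(3/2) ^ n * norm (w - 1) \<le> norm (w ^ 2 ^ n - 1)" by auto
    then have "(w ^ 2 ^ n)\<^sup>2 \<in> S" "norm ((w ^ 2 ^ n)\<^sup>2 - 1) \<ge> 3/2 * norm (w ^ 2 ^ n - 1)"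
      using sq grow by auto
    moreover have "(w ^ 2 ^ n)\<^sup>2 = w ^ 2 ^ Suc n" by (simp add: mult.commute flip: power_mult)
    ultimately show ?case using IH by simp
  qed (use assms in simp)
  then have bd: "(3/2) ^ n * norm (w - 1) \<le> 1/2" for n using le by (meson order.trans)
  obtain n where "1 / norm (w - 1) < (3/2 :: real) ^ n" using real_arch_pow[of "3/2 :: real"] by auto
  then have "1 < (3/2) ^ n * norm (w - 1)" using \<open>w \<noteq> 1\<close> by (simp add: field_simps)
  then show False using bd[of n] by linarith
qed

lemma integer_units_mult: "u \<in> integer_units \<Longrightarrow> v \<in> integer_units \<Longrightarrow> u * v \<in> integer_units"
  by (simp add: integer_units_def absv_mult)

lemma integer_units_1 [simp]: "1 \<in> integer_units"
  by (simp add: integer_units_def)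

lemma integer_units_minus_1 [simp]: "- 1 \<in> integer_units"
  by (simp add: integer_units_def)

lemma integer_units_inverse: "u \<in> integer_units \<Longrightarrow> inverse u \<in> integer_units"
  by (simp add: integer_units_def absv_inverse)

lemma integer_units_nonzero: "u \<in> integer_units \<Longrightarrow> u \<noteq> 0"
  by (auto simp: integer_units_def)

context
  fixes chi :: "'k::nonarch_local_field \<Rightarrow> complex"
  assumes chi: "chi \<in> unit_characters"
begin

lemma chi_mult: "u \<in> integer_units \<Longrightarrow> v \<in> integer_units \<Longrightarrow> chi (u * v) = chi u * chi v"
  using chi by (simp add: unit_characters_def)

lemma chi_nonzero: "u \<in> integer_units \<Longrightarrow> chi u \<noteq> 0"
  using chi by (simp add: unit_characters_def)

lemma chi_1 [simp]: "chi 1 = 1"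
  using chi_mult[of 1 1] chi_nonzero[of 1] by simp

lemma chi_inverse: "u \<in> integer_units \<Longrightarrow> chi (inverse u) = inverse (chi u)"
  using chi_mult[of u "inverse u"] integer_units_nonzero[of u] integer_units_inverse[of u]
  by (simp add: inverse_unique)

lemma chi_power: "u \<in> integer_units \<Longrightarrow> chi (u ^ n) = chi u ^ n \<and> u ^ n \<in> integer_units"
  by (induction n) (auto simp: chi_mult integer_units_mult)

lemma chi_norm: "u \<in> integer_units \<Longrightarrow> norm (chi u) = 1"
proof -
  have "compact (chi ` integer_units)"
    using chi by (intro compact_continuous_image compact_integer_units) (simp add: unit_characters_def)
  then have "bounded (chi ` integer_units)" by (rule compact_imp_bounded)
  then obtain B where B: "\<And>u. u \<in> integer_units \<Longrightarrow> norm (chi u) \<le> B" by (auto simp: bounded_iff)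
  have le: "norm (chi u) \<le> 1" if u: "u \<in> integer_units" for u
  proof (rule ccontr)
    assume "\<not> norm (chi u) \<le> 1"
    then obtain n where "B < norm (chi u) ^ n" using real_arch_pow[of "norm (chi u)" B] by auto
    moreover have "norm (chi (u ^ n)) \<le> B" using B chi_power[OF u] by blast
    ultimately show False using chi_power[OF u, of n] by (simp add: norm_power)
  qed
  assume u: "u \<in> integer_units"
  have "norm (inverse (chi u)) \<le> 1" using le[OF integer_units_inverse[OF u]] chi_inverse[OF u] by simp
  moreover have "norm (chi u) > 0" using chi_nonzero[OF u] by simp
  ultimately have "1 \<le> norm (chi u)" unfolding norm_inverse inverse_le_1_iff by simp
  then show ?thesis using le[OF u] by simp
qed

lemma chi_minus_1_sq: "(chi (-1))\<^sup>2 = 1"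
  using chi_power[of "-1" 2] by simp

text \<open>A small ball around 1 is closed under squaring because u^2 - 1 = (u + 1) (u - 1) with |u
  + 1| at most 1. Its image is then a set to which \<open>no_small_subgroup\<close> applies.\<close>

lemma chi_locally_trivial:
  obtains m :: nat where "m > 0"
    "\<And>u. absv (u - 1) \<le> rcard TYPE('k) powi (- int m) \<Longrightarrow> u \<in> integer_units \<and> chi u = 1"
proof -
  have "continuous_on integer_units chi" using chi by (simp add: unit_characters_def)
  then obtain d where d: "d > 0" "\<And>u. u \<in> integer_units \<Longrightarrow> dist u 1 < d \<Longrightarrow> dist (chi u) (chi 1) < 1/2"
    unfolding continuous_on_iff by (meson half_gt_zero_iff integer_units_1 zero_less_one)
  obtain m where m: "rcard TYPE('k) powi (- int m) \<le> d / 2" using powi_small[of "d / 2"] d(1) by auto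
  \<comment> \<open>The exponent is \<open>Suc m\<close> instead of \<open>m\<close> so that the
    radius is below 1 and the ball consists of units.\<close>
  have lt1: "rcard TYPE('k) powi (- int (Suc m)) < 1"
    using powi_less_iff[where 'k = 'k, of "- int (Suc m)" 0] by simp
  define U where "U = {u. absv (u - (1::'k)) \<le> rcard TYPE('k) powi (- int (Suc m))}"
  have unit: "u \<in> integer_units" if "u \<in> U" for u
    using absv_close_eq[of u 1] that lt1 by (simp add: U_def integer_units_def)
  have "chi u = 1" if "u \<in> U" for u
  proof (rule no_small_subgroup[of "chi ` U"])
    fix w assume "w \<in> chi ` U"
    then obtain u where u: "u \<in> U" "w = chi u" by blast
    have "absv u = 1" using unit[OF u(1)] by (simp add: integer_units_def)
    then have "absv (u + 1) \<le> 1" by (intro absv_add_bound) auto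
    then have "absv (u + 1) * absv (u - 1) \<le> 1 * absv (u - 1)" by (intro mult_right_mono) auto
    moreover have "u\<^sup>2 - 1 = (u + 1) * (u - 1)" by (simp add: power2_eq_square algebra_simps)
    ultimately have "u\<^sup>2 \<in> U" using u(1) by (simp add: U_def absv_mult)
    then show "w\<^sup>2 \<in> chi ` U" using u chi_power[OF unit[OF u(1)], of 2] by (metis image_eqI)
    have "rcard TYPE('k) powi (- int (Suc m)) \<le> rcard TYPE('k) powi (- int m)" by (simp add: powi_le_iff del: of_nat_Suc) 
    then have "absv (u - 1) \<le> d / 2" using u(1) m unfolding U_def by simp
    then have "dist u 1 < d" using d(1) by (simp add: dist_eq_absv)
    then show "norm (w - 1) \<le> 1/2" using d(2)[OF unit[OF u(1)]] u(2) by (simp add: dist_norm)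
  qed (use that in blast)
  then show thesis using unit by (intro that[of "Suc m"]) (auto simp: U_def)
qed

end

text \<open>As for unit characters, with doubling in a ball around 0, which is closed under
  addition, in the place of squaring.\<close>

lemma additive_character_locally_trivial:
  assumes "additive_character (\<psi> :: 'k::nonarch_local_field \<Rightarrow> complex)"
  obtains m :: nat where "\<And>x. absv x \<le> rcard TYPE('k) powi (- int m) \<Longrightarrow> \<psi> x = 1"
proof -
  have add: "\<psi> (x + y) = \<psi> x * \<psi> y" and nrm: "norm (\<psi> x) = 1" for x y
    using assms by (auto simp: additive_character_def)
  have 0: "\<psi> 0 = 1" using add[of 0 0] nrm[of 0] by auto
  have "continuous_on UNIV \<psi>" using assms by (simp add: additive_character_def)
  then obtain d where d: "d > 0" "\<And>u. dist u 0 < d \<Longrightarrow> dist (\<psi> u) (\<psi> 0) < 1/2"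
    unfolding continuous_on_iff by (meson half_gt_zero_iff UNIV_I zero_less_one)
  obtain m where m: "rcard TYPE('k) powi (- int m) \<le> d / 2" using powi_small[of "d / 2"] d(1) by auto
  define U where "U = {u::'k. absv u \<le> rcard TYPE('k) powi (- int m)}"
  have "\<psi> u = 1" if "u \<in> U" for u
  proof (rule no_small_subgroup[of "\<psi> ` U"])
    fix w assume "w \<in> \<psi> ` U"
    then obtain u where u: "u \<in> U" "w = \<psi> u" by blast
    then have "u + u \<in> U" using absv_add_bound[of u _ u] by (simp only: U_def mem_Collect_eq)
    then show "w\<^sup>2 \<in> \<psi> ` U" using u add[of u u] by (metis power2_eq_square image_eqI)
    have "absv u \<le> d / 2" using u(1) m unfolding U_def by simp
    then have "dist u 0 < d" using d(1) by (simp add: dist_eq_absv)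
    then show "norm (w - 1) \<le> 1/2" using d(2)[of u] u(2) by (simp add: dist_norm 0)
  qed (use that in blast)
  then show thesis by (intro that[of m]) (auto simp: U_def)
qed


subsection \<open>Quasi-characters\<close>

lemma complex_powi_powr:
  "complex_of_real (rcard TYPE('k::nonarch_local_field) powi n) powr s =
     exp (of_int n * s * of_real (ln (rcard TYPE('k))))"
proof -
  have "ln (rcard TYPE('k) powi n) = of_int n * ln (rcard TYPE('k))"
    using powr_real_of_int'[of "rcard TYPE('k)" n] ln_powr[of "rcard TYPE('k)" "of_int n"] by simp
  then show ?thesis
    by (simp add: powr_def Ln_of_real mult_ac flip: of_real_power_int)
qed

lemma absv_powr_mult:
  "x \<noteq> 0 \<Longrightarrow> y \<noteq> 0 \<Longrightarrow>
    complex_of_real (absv (x * y)) powr s = complex_of_real (absv x) powr s * complex_of_real (absv y) powr s"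
  by (simp add: absv_mult powr_times_real)

context
  fixes chi :: "'k::nonarch_local_field \<Rightarrow> complex" and \<pi> :: 'k
  assumes chi: "chi \<in> unit_characters" and pi: "uniformizer \<pi>"
begin

lemma unit_part: "x \<noteq> 0 \<Longrightarrow> \<pi> powi (- valuation x) * x \<in> integer_units"
  using absv_eq_valuation[of x]
  by (simp add: integer_units_def absv_mult absv_power_int absv_uniformizer[OF pi] absv_inverse
       power_int_minus power_int_inverse divide_inverse)

lemma qchar_0 [simp]: "qchar \<pi> chi s 0 = 0"
  by (simp add: qchar_def)

lemma qchar_nonzero: "x \<noteq> 0 \<Longrightarrow> qchar \<pi> chi s x \<noteq> 0"
  using chi_nonzero[OF chi unit_part] by (simp add: qchar_def)

lemma qchar_decomp: "qchar \<pi> chi s x = qchar \<pi> chi 0 x * complex_of_real (absv x) powr s"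
  by (simp add: qchar_def)

lemma qchar_mult: "qchar \<pi> chi s (x * y) = qchar \<pi> chi s x * qchar \<pi> chi s y"
proof (cases "x = 0 \<or> y = 0")
  case False
  then have xy: "x \<noteq> 0" "y \<noteq> 0" by auto
  have "\<pi> powi (- valuation (x * y)) * (x * y) = (\<pi> powi (- valuation x) * x) * (\<pi> powi (- valuation y) * y)"
    using uniformizer_nonzero[OF pi] xy
    by (simp add: valuation_mult power_int_add power_int_diff power_int_minus field_simps)
  then have "chi (\<pi> powi (- valuation (x * y)) * (x * y)) =
      chi (\<pi> powi (- valuation x) * x) * chi (\<pi> powi (- valuation y) * y)"
    using chi_mult[OF chi unit_part[OF xy(1)] unit_part[OF xy(2)]] by (simp only:)
  then show ?thesis using xy by (simp add: qchar_def absv_powr_mult del: minus_add_distrib)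
qed auto

lemma qchar_1 [simp]: "qchar \<pi> chi s 1 = 1"
  using qchar_mult[of s 1 1] qchar_nonzero[of 1 s] by simp

lemma qchar_inverse: "qchar \<pi> chi s (inverse x) = inverse (qchar \<pi> chi s x)"
proof (cases "x = 0")
  case False
  then show ?thesis using qchar_mult[of s x "inverse x"] by (simp add: inverse_unique)
qed simp

lemma qchar_divide: "qchar \<pi> chi s (x / y) = qchar \<pi> chi s x / qchar \<pi> chi s y"
  by (simp add: divide_inverse qchar_mult qchar_inverse)

lemma qchar_power: "qchar \<pi> chi s (x ^ n) = qchar \<pi> chi s x ^ n"
  by (induction n) (auto simp: qchar_mult)

lemma qchar_unit: "u \<in> integer_units \<Longrightarrow> qchar \<pi> chi s u = chi u"
proof -
  assume u: "u \<in> integer_units"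
  then have "valuation u = 0" by (intro valuation_eqI) (simp add: integer_units_def)
  then show ?thesis using u integer_units_nonzero[OF u] by (simp add: qchar_def integer_units_def)
qed

lemma qchar_uniformizer_0 [simp]: "qchar \<pi> chi 0 \<pi> = 1"
  using pi chi_1[OF chi] by (simp add: qchar_def uniformizer_def)

lemma qchar_norm: "x \<noteq> 0 \<Longrightarrow> norm (qchar \<pi> chi 0 x) = 1"
  using chi_norm[OF chi unit_part] by (simp add: qchar_def)

lemma qchar_norm_le: "norm (qchar \<pi> chi 0 x) \<le> 1"
  by (cases "x = 0") (simp_all add: qchar_norm)

text \<open>\<chi> (-1) squares to 1. By this the sign coming from conjugation, the centre -1 of the
  concentration of x_1 and the sign in \<chi>_0 (- \<alpha>) all disappear.\<close>

lemma qchar_minus_sq: "(qchar \<pi> chi 0 (- x))\<^sup>2 = (qchar \<pi> chi 0 x)\<^sup>2"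
proof -
  have "qchar \<pi> chi 0 (- x) = qchar \<pi> chi 0 (-1) * qchar \<pi> chi 0 x"
    by (simp flip: qchar_mult)
  then show ?thesis using chi_minus_1_sq[OF chi] by (simp add: qchar_unit power_mult_distrib)
qed

text \<open>Division by x reduces the claim to local triviality at 1. The admissible perturbation is
  thus proportional to |x|, and \<open>m\<close> does not depend on \<open>s\<close> because |x| is
  unchanged as well.\<close>

lemma qchar_locally_constant:
  obtains m :: nat where "m > 0"
    "\<And>x y s. absv y \<le> rcard TYPE('k) powi (- int m) * absv x \<Longrightarrow> qchar \<pi> chi s (x + y) = qchar \<pi> chi s x"
proof -
  obtain m where m: "m > 0"
    "\<And>u. absv (u - 1) \<le> rcard TYPE('k) powi (- int m) \<Longrightarrow> u \<in> integer_units \<and> chi u = 1"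
    using chi_locally_trivial[OF chi] by blast
  have "qchar \<pi> chi s (x + y) = qchar \<pi> chi s x"
    if "absv y \<le> rcard TYPE('k) powi (- int m) * absv x" for x y s
  proof (cases "x = 0")
    case False
    have "absv ((1 + y / x) - 1) \<le> rcard TYPE('k) powi (- int m)"
      using that False by (simp add: absv_divide field_simps)
    then have "1 + y / x \<in> integer_units" "chi (1 + y / x) = 1" using m(2) by auto
    then have "qchar \<pi> chi s (1 + y / x) = 1" by (simp add: qchar_unit)
    moreover have "x + y = x * (1 + y / x)" using False by (simp add: field_simps)
    ultimately show ?thesis by (simp add: qchar_mult)
  qed (use that in auto)
  then show thesis using m(1) that by blast
qed

lemma continuous_on_qchar: "continuous_on (- {0}) (qchar \<pi> chi s)"
proof -
  obtain m where m: "m > 0"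
    "\<And>x y s. absv y \<le> rcard TYPE('k) powi (- int m) * absv x \<Longrightarrow> qchar \<pi> chi s (x + y) = qchar \<pi> chi s x"
    by (rule qchar_locally_constant) blast
  show ?thesis
    unfolding continuous_on_iff
  proof (intro ballI allI impI)
    fix x :: 'k and e :: real assume x: "x \<in> - {0}" and e: "e > 0"
    have "rcard TYPE('k) powi (- int m) * absv x > 0" using x by (simp add: zero_less_power_int)
    moreover have "dist (qchar \<pi> chi s x') (qchar \<pi> chi s x) < e"
      if "dist x' x < rcard TYPE('k) powi (- int m) * absv x" for x'
      using m(2)[of "x' - x" x s] that e by (simp add: dist_eq_absv)
    ultimately show "\<exists>d>0. \<forall>x'\<in>- {0}. dist x' x < d \<longrightarrow> dist (qchar \<pi> chi s x') (qchar \<pi> chi s x) < e"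
      by blast
  qed
qed

lemma measurable_qchar: "qchar \<pi> chi s \<in> borel_measurable borel"
  by (rule borel_measurable_continuous_countable_exceptions[of "{0}"]) (simp_all add: continuous_on_qchar)

end

lemma unit_characters_inverse:
  assumes "chi \<in> unit_characters" shows "(\<lambda>u. inverse (chi u)) \<in> unit_characters"
  using assms by (auto simp: unit_characters_def intro!: continuous_intros)

lemma unit_characters_power:
  assumes "chi \<in> unit_characters" shows "(\<lambda>u. chi u ^ n) \<in> unit_characters"
  using assms by (auto simp: unit_characters_def power_mult_distrib intro!: continuous_intros)

section \<open>Integration\<close>

subsection \<open>Maps that scale a measure\<close>

text \<open>\<open>T\<close> multiplies the measure of sets by \<open>c\<close>. The density carries
  1 / c because \<open>distr\<close> measures preimages.\<close>

definition scales :: "'a measure \<Rightarrow> ('a \<Rightarrow> 'a) \<Rightarrow> real \<Rightarrow> bool" where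
  "scales M T c \<longleftrightarrow> T \<in> M \<rightarrow>\<^sub>M M \<and> 0 < c \<and> distr M M T = density M (\<lambda>_. ennreal (1 / c))"

lemma scales_measurable: "scales M T c \<Longrightarrow> T \<in> M \<rightarrow>\<^sub>M M"
  by (simp add: scales_def)

lemma scales_pos: "scales M T c \<Longrightarrow> 0 < c"
  by (simp add: scales_def)

lemma scales_integral:
  fixes f :: "'a \<Rightarrow> 'b::{banach, second_countable_topology}"
  assumes "scales M T c" "f \<in> borel_measurable M"
  shows "(LINT x|M. f (T x)) = (1 / c) *\<^sub>R (LINT x|M. f x)"
proof -
  have "(LINT x|M. f (T x)) = (LINT x|distr M M T. f x)"
    using assms by (intro integral_distr[symmetric]) (auto simp: scales_def)
  also have "\<dots> = (LINT x|density M (\<lambda>_. ennreal (1 / c)). f x)" using assms(1) by (simp add: scales_def)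
  also have "\<dots> = (LINT x|M. (1 / c) *\<^sub>R f x)"
    using assms by (intro integral_density) (auto simp: scales_def)
  finally show ?thesis by simp
qed

lemma scales_integrable:
  fixes f :: "'a \<Rightarrow> 'b::{banach, second_countable_topology}"
  assumes "scales M T c" "f \<in> borel_measurable M"
  shows "integrable M (\<lambda>x. f (T x)) \<longleftrightarrow> integrable M f"
proof -
  have "integrable M (\<lambda>x. f (T x)) \<longleftrightarrow> integrable (distr M M T) f"
    using assms by (intro integrable_distr_eq[symmetric]) (auto simp: scales_def)
  also have "\<dots> \<longleftrightarrow> integrable (density M (\<lambda>_. ennreal (1 / c))) f" using assms(1) by (simp add: scales_def)
  also have "\<dots> \<longleftrightarrow> integrable M (\<lambda>x. (1 / c) *\<^sub>R f x)"
    using assms by (intro integrable_density) (auto simp: scales_def)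
  also have "\<dots> \<longleftrightarrow> integrable M f"
  proof
    assume "integrable M (\<lambda>x. (1 / c) *\<^sub>R f x)"
    then have "integrable M (\<lambda>x. c *\<^sub>R ((1 / c) *\<^sub>R f x))" by (rule integrable_scaleR_right)
    then show "integrable M f" using scales_pos[OF assms(1)] by simp
  qed simp
  finally show ?thesis .
qed

text \<open>Change of variables for an eigenfunction of \<open>T\<close>. With A = B it forces the
  integral to vanish unless c z = 1; with consecutive sets it gives one step of a geometric
  progression.\<close>

lemma scales_set_integral:
  fixes h :: "'a \<Rightarrow> complex"
  assumes T: "scales M T c" and h: "h \<in> borel_measurable M" and B: "B \<in> sets M"
    and AB: "\<And>x. x \<in> A \<longleftrightarrow> T x \<in> B" and hT: "\<And>x. x \<in> A \<Longrightarrow> h (T x) = z * h x"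
  shows "(LINT x:B|M. h x) = of_real c * z * (LINT x:A|M. h x)"
    and "set_integrable M A h \<Longrightarrow> set_integrable M B h"
proof -
  have c: "c > 0" by (rule scales_pos[OF T])
  have *: "indicator B (T x) *\<^sub>R h (T x) = z * (indicator A x *\<^sub>R h x)" for x
    using AB[of x] hT[of x] by (cases "x \<in> A") auto
  have m: "(\<lambda>x. indicator B x *\<^sub>R h x) \<in> borel_measurable M" using h B by measurable
  have "z * (LINT x:A|M. h x) = (LINT x|M. indicator B (T x) *\<^sub>R h (T x))"
    unfolding * set_lebesgue_integral_def by (rule integral_mult_right_zero[symmetric])
  also have "\<dots> = (1 / c) *\<^sub>R (LINT x:B|M. h x)"
    unfolding set_lebesgue_integral_def by (rule scales_integral[OF T m])
  finally show "(LINT x:B|M. h x) = of_real c * z * (LINT x:A|M. h x)"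
    using c by (simp add: scaleR_conv_of_real field_simps)
  assume "set_integrable M A h"
  then have "integrable M (\<lambda>x. indicator B (T x) *\<^sub>R h (T x))"
    unfolding * set_integrable_def by (intro integrable_mult_right)
  then show "set_integrable M B h"
    unfolding set_integrable_def using scales_integrable[OF T m] by simp
qed

text \<open>At each point at most one term is nonzero, so pointwise summability is automatic and
  only the integrals of the norms have to be summable.\<close>

lemma has_integral_disjoint_UN:
  fixes h :: "'a \<Rightarrow> complex" and A :: "nat \<Rightarrow> 'a set"
  assumes A: "\<And>m. A m \<in> sets M" "disjoint_family A"
    and int: "\<And>m. set_integrable M (A m) h"
    and summ: "summable (\<lambda>m. LINT x:A m|M. norm (h x))"
  shows "set_integrable M (\<Union>m. A m) h"
    and "(\<lambda>m. LINT x:A m|M. h x) sums (LINT x:(\<Union>m. A m)|M. h x)"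
proof -
  let ?f = "\<lambda>m x. indicator (A m) x *\<^sub>R h x"
  have sums: "(\<lambda>m. ?f m x) sums (indicator (\<Union>m. A m) x *\<^sub>R h x)" (is ?s)
    and nsums: "summable (\<lambda>m. norm (?f m x))" (is ?n) for x
  proof -
    have "?s \<and> ?n"
    proof (cases "x \<in> (\<Union>m. A m)")
      case True
      then obtain k where k: "x \<in> A k" by blast
      have z: "?f m x = 0" if "m \<noteq> k" for m
        using disjoint_family_onD[OF A(2), of m k] that k by (auto simp: indicator_def)
      have "(\<lambda>m. ?f m x) sums (\<Sum>m\<in>{k}. ?f m x)" by (rule sums_finite) (use z in auto)
      moreover have "summable (\<lambda>m. norm (?f m x))" by (rule summable_finite[of "{k}"]) (use z in auto)
      ultimately show ?thesis using True k by simp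
    qed auto
    then show ?s ?n by auto
  qed
  have ni: "(\<integral>x. norm (?f m x) \<partial>M) = (LINT x:A m|M. norm (h x))" for m
    unfolding set_lebesgue_integral_def by (rule Bochner_Integration.integral_cong) (auto simp: indicator_def)
  have si: "(\<Sum>m. ?f m x) = indicator (\<Union>m. A m) x *\<^sub>R h x" for x using sums[of x] by (simp add: sums_iff)
  have 1: "\<And>i. integrable M (?f i)" using int by (simp add: set_integrable_def)
  have 2: "AE x in M. summable (\<lambda>i. norm (?f i x))" using nsums by simp
  have 3: "summable (\<lambda>i. (\<integral>x. norm (?f i x) \<partial>M))" unfolding ni by (rule summ)
  show "set_integrable M (\<Union>m. A m) h"
    using integrable_suminf[OF 1 2 3] unfolding set_integrable_def si .
  show "(\<lambda>m. LINT x:A m|M. h x) sums (LINT x:(\<Union>m. A m)|M. h x)"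
    using sums_integral[OF 1 2 3] unfolding set_lebesgue_integral_def si .
qed

text \<open>Iterating \<open>T\<close> carries \<open>A 0\<close> through all \<open>A m\<close>.
  The integrals are multiplied by z c at each step and those of the norm by |z| c, so the same
  motion gives both the absolute convergence and the value.\<close>

lemma geometric_set_integral:
  fixes h :: "'a \<Rightarrow> complex" and A :: "nat \<Rightarrow> 'a set"
  assumes T: "scales M T c" and h: "h \<in> borel_measurable M"
    and A: "\<And>m. A m \<in> sets M" "disjoint_family A" "\<And>m x. x \<in> A m \<longleftrightarrow> T x \<in> A (Suc m)"
    and hT: "\<And>m x. x \<in> A m \<Longrightarrow> h (T x) = z * h x"
    and int: "set_integrable M (A 0) h" and z: "norm z * c < 1"
  shows "set_integrable M (\<Union>m. A m) h"
    and "(LINT x:(\<Union>m. A m)|M. h x) = (LINT x:A 0|M. h x) / (1 - z * of_real c)"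
proof -
  have c: "c > 0" by (rule scales_pos[OF T])
  have ints: "set_integrable M (A m) h" for m
  proof (induction m)
    case (Suc m)
    show ?case
      by (rule scales_set_integral(2)[where A = "A m" and B = "A (Suc m)", OF T h A(1) A(3)]) (auto intro: hT Suc)
  qed (rule int)
  define I0 J0 where "I0 = (LINT x:A 0|M. h x)" and "J0 = (LINT x:A 0|M. norm (h x))"
  have I: "(LINT x:A m|M. h x) = (z * of_real c) ^ m * I0" for m
  proof (induction m)
    case (Suc m)
    have "(LINT x:A (Suc m)|M. h x) = of_real c * z * (LINT x:A m|M. h x)"
      by (rule scales_set_integral(1)[where A = "A m" and B = "A (Suc m)", OF T h A(1) A(3)]) (rule hT)
    then show ?case using Suc by simp
  qed (simp add: I0_def)
  let ?n = "\<lambda>x. complex_of_real (norm (h x))"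
  have nm: "?n \<in> borel_measurable M" using h by measurable
  have e2: "(LINT x:A m|M. ?n x) = of_real (LINT x:A m|M. norm (h x))" for m
    by (rule set_integral_complex_of_real)
  have "(LINT x:A m|M. norm (h x)) = (norm z * c) ^ m * J0" for m
  proof (induction m)
    case (Suc m)
    have "(LINT x:A (Suc m)|M. ?n x) = of_real c * of_real (norm z) * (LINT x:A m|M. ?n x)"
      by (rule scales_set_integral(1)[where A = "A m" and B = "A (Suc m)", OF T nm A(1) A(3)])
         (auto simp: hT norm_mult)
    then have "(LINT x:A (Suc m)|M. norm (h x)) = c * norm z * (LINT x:A m|M. norm (h x))"
      unfolding e2 of_real_mult[symmetric] of_real_eq_iff .
    then show ?case using Suc by simp
  qed (simp add: J0_def)
  then have "summable (\<lambda>m. LINT x:A m|M. norm (h x))"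
    using c z by (simp only:) (intro summable_mult2 summable_geometric, simp add: abs_mult)
  note D = has_integral_disjoint_UN[OF A(1,2) ints this]
  show "set_integrable M (\<Union>m. A m) h" by (rule D(1))
  have "norm (z * of_real c) < 1" using c z by (simp add: norm_mult)
  then have "(\<lambda>m. LINT x:A m|M. h x) sums (1 / (1 - z * of_real c) * I0)"
    unfolding I by (intro sums_mult2 geometric_sums)
  with D(2) have "(LINT x:(\<Union>m. A m)|M. h x) = 1 / (1 - z * of_real c) * I0"
    by (rule sums_unique2)
  then show "(LINT x:(\<Union>m. A m)|M. h x) = (LINT x:A 0|M. h x) / (1 - z * of_real c)"
    by (simp add: I0_def)
qed


subsection \<open>Haar measure\<close>

text \<open>Two ultrametric balls are nested or disjoint; the empty set is adjoined for the second
  case.\<close>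

lemma Int_stable_absv_balls:
  "Int_stable (insert {} (range (\<lambda>(a::'k::nonarch_local_field, n). {x. absv (x - a) \<le> rcard TYPE('k) powi n})))"
proof (rule Int_stableI)
  let ?B = "\<lambda>(a::'k, n). {x. absv (x - a) \<le> rcard TYPE('k) powi n}"
  have sub: "?B (a, n) \<subseteq> ?B (b, m)" if "y \<in> ?B (a, n)" "y \<in> ?B (b, m)" "n \<le> m" for a b n m y
  proof
    fix x assume x: "x \<in> ?B (a, n)"
    have "absv (x - a) \<le> rcard TYPE('k) powi m" "absv (y - a) \<le> rcard TYPE('k) powi m"
      using x that powi_le_iff[where 'k = 'k, of n m] by (auto intro: order.trans)
    then have "absv ((x - a) - (y - a)) \<le> rcard TYPE('k) powi m" by (rule absv_diff_bound)
    then have "absv (x - y) \<le> rcard TYPE('k) powi m" by simp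
    moreover have "absv (y - b) \<le> rcard TYPE('k) powi m" using that by simp
    ultimately have "absv ((x - y) + (y - b)) \<le> rcard TYPE('k) powi m" by (rule absv_add_bound)
    then show "x \<in> ?B (b, m)" by simp
  qed
  define B where "B = ?B"
  have "B p \<inter> B p' = {} \<or> B p \<inter> B p' = B p \<or> B p \<inter> B p' = B p'" for p p'
  proof (cases "B p \<inter> B p' = {}")
    case False
    then obtain y where y: "y \<in> B p" "y \<in> B p'" by blast
    show ?thesis
    proof (cases "snd p \<le> snd p'")
      case True
      then have "B p \<subseteq> B p'"
        using sub[of y "fst p" "snd p" "fst p'" "snd p'"] y unfolding B_def prod.collapse by blast
      then show ?thesis by blast
    next
      case False
      then have "B p' \<subseteq> B p"
        using sub[of y "fst p'" "snd p'" "fst p" "snd p"] y unfolding B_def prod.collapse by simp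
      then show ?thesis by blast
    qed
  qed simp
  then have key: "B p \<inter> B p' \<in> insert {} (range B)" for p p' by (metis insert_iff rangeI)
  fix U V assume "U \<in> insert {} (range ?B)" "V \<in> insert {} (range ?B)"
  then have "U \<in> insert {} (range B)" "V \<in> insert {} (range B)" unfolding B_def by simp_all
  then have "U \<inter> V \<in> insert {} (range B)"
    by (elim insertE imageE) (simp_all only: key Int_empty_left Int_empty_right insertI1)
  then show "U \<inter> V \<in> insert {} (range ?B)" unfolding B_def .
qed

lemma sets_borel_absv_balls:
  "sets (borel :: 'k::nonarch_local_field measure) =
    sigma_sets UNIV (insert {} (range (\<lambda>(a::'k, n). {x. absv (x - a) \<le> rcard TYPE('k) powi n})))"
proof -
  let ?B = "\<lambda>(a::'k, n). {x. absv (x - a) \<le> rcard TYPE('k) powi n}"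
  obtain D :: "'k set" where D: "countable D" "\<And>x r. r > 0 \<Longrightarrow> \<exists>d\<in>D. absv (x - d) \<le> r"
    using countable_dense_balls[where 'k='k] by auto
  have "sigma_sets UNIV {S :: 'k set. open S} = sigma_sets UNIV (insert {} (range ?B))"
  proof (rule sigma_sets_eqI)
    fix U :: "'k set" assume "U \<in> {S. open S}"
    then have U: "open U" by simp
    let ?C = "{p \<in> D \<times> (UNIV :: int set). ?B p \<subseteq> U}"
    have "U = (\<Union>p\<in>?C. ?B p)"
    proof (intro equalityI subsetI)
      fix x assume "x \<in> U"
      then obtain r where r: "r > 0" "ball x r \<subseteq> U" using U by (meson open_contains_ball)
      obtain n where n: "rcard TYPE('k) powi (- int n) \<le> r / 2" using powi_small[of "r / 2"] r(1) by auto
      have p: "rcard TYPE('k) powi (- int n) > 0" by (simp add: zero_less_power_int)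
      obtain d where d: "d \<in> D" "absv (x - d) \<le> rcard TYPE('k) powi (- int n)" using D(2)[OF p] by blast
      have "?B (d, - int n) \<subseteq> ball x r"
      proof
        fix y assume "y \<in> ?B (d, - int n)"
        then have "absv (y - d) \<le> rcard TYPE('k) powi (- int n)" by simp
        with d(2) have "absv ((x - d) - (y - d)) \<le> rcard TYPE('k) powi (- int n)" by (rule absv_diff_bound)
        then show "y \<in> ball x r" using n r(1) by (simp add: dist_eq_absv)
      qed
      then have "(d, - int n) \<in> ?C" using r d by auto
      then show "x \<in> (\<Union>p\<in>?C. ?B p)" using d by (intro UN_I[of "(d, - int n)"]) auto
    qed auto
    moreover have "countable ?C" using D(1) by (intro countable_subset[of ?C "D \<times> UNIV"]) auto
    then have "\<Union> (?B ` ?C) \<in> sigma_sets UNIV (insert {} (range ?B))"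
      by (intro sigma_sets_UNION countable_image) (auto intro!: sigma_sets.Basic)
    ultimately show "U \<in> sigma_sets UNIV (insert {} (range ?B))" by (simp only:)
  next
    fix U :: "'k set" assume "U \<in> insert {} (range ?B)"
    then have "open U" using open_absv_ball by auto
    then show "U \<in> sigma_sets UNIV {S. open S}" by (intro sigma_sets.Basic) simp
  qed
  then show ?thesis by (simp add: borel_def)
qed

lemma measure_eqI_absv_balls:
  fixes M N :: "'k::nonarch_local_field measure"
  assumes "sets M = sets borel" "sets N = sets borel"
    and eq: "\<And>a n. emeasure M {x. absv (x - a) \<le> rcard TYPE('k) powi n} =
                    emeasure N {x. absv (x - a) \<le> rcard TYPE('k) powi n}"
    and fin: "\<And>a n. emeasure M {x. absv (x - a) \<le> rcard TYPE('k) powi n} \<noteq> \<infinity>"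
  shows "M = N"
proof (rule measure_eqI_generator_eq_countable[OF Int_stable_absv_balls])
  let ?B = "\<lambda>(a::'k, n). {x. absv (x - a) \<le> rcard TYPE('k) powi n}"
  let ?A = "range (\<lambda>n. ?B (0, int n))"
  show "?A \<subseteq> insert {} (range ?B)" by (intro image_subsetI insertI2 rangeI)
  show "\<Union> ?A = UNIV"
  proof (intro equalityI subsetI UNIV_I)
    fix x :: 'k
    obtain n where "absv x \<le> rcard TYPE('k) powi (int n)" by (rule powi_large)
    then show "x \<in> \<Union> ?A" by auto
  qed
  show "countable ?A" by simp
  fix a assume "a \<in> ?A"
  then obtain n where "a = {x. absv (x - 0) \<le> rcard TYPE('k) powi int n}" by auto
  then show "emeasure M a \<noteq> \<infinity>" using fin by blast
qed (use assms(1,2) eq in \<open>auto simp: sets_borel_absv_balls simp del: power_int_of_nat\<close>)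

locale haar =
  fixes M :: "'k::nonarch_local_field measure"
  assumes haar: "normalized_haar M"
begin

lemma sets_M [simp, measurable_cong]: "sets M = sets borel"
  using haar by (simp add: normalized_haar_def)

lemma space_M [simp]: "space M = UNIV"
  using sets_eq_imp_space_eq[OF sets_M] by simp

lemma sets_absv [measurable]: "{x. absv (x - a) \<le> r} \<in> sets borel" for a :: 'k
proof -
  have "{x. absv (x - a) \<le> r} = cball a r" by (auto simp: dist_eq_absv absv_diff_commute[of a])
  then show ?thesis by simp
qed

text \<open>A ball is the disjoint union of q translates of the next smaller one, so one step of the
  radius multiplies the measure by q. The normalization fixes index 0, and the induction runs in
  both directions from there.\<close>

lemma emeasure_absv_ball: "emeasure M {x. absv (x - a) \<le> rcard TYPE('k) powi n} = ennreal (rcard TYPE('k) powi n)"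
proof -
  define b where "b n = emeasure M {x::'k. absv x \<le> rcard TYPE('k) powi n}" for n
  have tr: "emeasure M ((+) a ` B) = emeasure M B" if "B \<in> sets borel" for a B
    using haar that by (simp add: normalized_haar_def)
  have s0: "{x::'k. absv x \<le> r} \<in> sets borel" for r using sets_absv[of 0 r] by simp
  have shift: "emeasure M {x. absv (x - a) \<le> rcard TYPE('k) powi n} = b n" for a n
  proof -
    have "{x. absv (x - a) \<le> rcard TYPE('k) powi n} = (+) a ` {x. absv x \<le> rcard TYPE('k) powi n}"
      by (auto simp: image_iff intro!: exI[of _ "_ - a"])
    then show ?thesis unfolding b_def using tr[OF s0] by simp
  qed
  have step: "b n = of_nat (residue_card TYPE('k)) * b (n - 1)" for n
  proof -
    obtain D :: "'k set" where D: "finite D" "card D = residue_card TYPE('k)"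
      "D \<subseteq> {x. absv x \<le> rcard TYPE('k) powi n}"
      "\<And>x. absv x \<le> rcard TYPE('k) powi n \<Longrightarrow> \<exists>d\<in>D. absv (x - d) \<le> rcard TYPE('k) powi (n - 1)"
      "\<And>d d'. d \<in> D \<Longrightarrow> d' \<in> D \<Longrightarrow> d \<noteq> d' \<Longrightarrow> absv (d - d') > rcard TYPE('k) powi (n - 1)"
      using ball_finite_cover_step[where 'k = 'k, of n] by auto
    let ?C = "\<lambda>d. {x. absv (x - d) \<le> rcard TYPE('k) powi (n - 1)}"
    have "{x. absv x \<le> rcard TYPE('k) powi n} = (\<Union>d\<in>D. ?C d)"
    proof (intro equalityI subsetI)
      fix x assume "x \<in> (\<Union>d\<in>D. ?C d)"
      then obtain d where d: "d \<in> D" "absv (x - d) \<le> rcard TYPE('k) powi (n - 1)" by blast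
      have "absv (x - d) \<le> rcard TYPE('k) powi n"
        using d(2) powi_le_iff[where 'k = 'k, of "n - 1" n] by linarith
      moreover have "absv d \<le> rcard TYPE('k) powi n" using D(3) d(1) by auto
      ultimately have "absv ((x - d) + d) \<le> rcard TYPE('k) powi n" by (rule absv_add_bound)
      then show "x \<in> {x. absv x \<le> rcard TYPE('k) powi n}" by simp
    qed (use D(4) in auto)
    moreover have "disjoint_family_on ?C D"
      unfolding disjoint_family_on_def
    proof (intro ballI impI, rule ccontr)
      fix d d' assume d: "d \<in> D" "d' \<in> D" "d \<noteq> d'" "?C d \<inter> ?C d' \<noteq> {}"
      then obtain x where "absv (x - d) \<le> rcard TYPE('k) powi (n - 1)" "absv (x - d') \<le> rcard TYPE('k) powi (n - 1)"
        by blast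
      then have "absv ((x - d') - (x - d)) \<le> rcard TYPE('k) powi (n - 1)" by (rule absv_diff_bound[rotated])
      then show False using D(5)[OF d(1-3)] by simp
    qed
    ultimately have "b n = (\<Sum>d\<in>D. emeasure M (?C d))"
      unfolding b_def using D(1) by (subst sum_emeasure) auto
    then show ?thesis using D(2) by (simp add: shift)
  qed
  have eq: "rcard TYPE('k) powi n = rcard TYPE('k) * rcard TYPE('k) powi (n - 1)" for n
    by (simp add: power_int_diff)
  have "b n = ennreal (rcard TYPE('k) powi n)" for n
  proof (induction n rule: int_induct[where k = 0])
    case base
    have "ring_of_integers = {x::'k. absv x \<le> 1}" by (auto simp: ring_of_integers_def absv_def)
    then show ?case using haar by (simp add: b_def normalized_haar_def)
  next
    case (step1 i)
    then show ?case using step[of "i + 1"] eq[of "i + 1"]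
      by (simp add: ennreal_of_nat_eq_real_of_nat flip: ennreal_mult)
  next
    case (step2 i)
    have "b (i - 1) = ennreal (1 / rcard TYPE('k)) * b i"
      unfolding step[of i] by (simp add: ennreal_of_nat_eq_real_of_nat mult.assoc[symmetric] flip: ennreal_mult)
    then show ?case using step2 eq[of i] by (simp flip: ennreal_mult)
  qed
  then show ?thesis using shift by simp
qed

text \<open>This is where \<open>absv\<close> is recognized as the module of Haar measure: the
  preimage of a ball under multiplication by a is a ball whose radius is divided by |a|, and balls
  determine the measure.\<close>

lemma scales_mult: "a \<noteq> 0 \<Longrightarrow> scales M ((*) a) (absv a)"
proof -
  assume a: "a \<noteq> 0"
  then obtain k where k: "absv a = rcard TYPE('k) powi k" using ex_absv_powi by blast
  have m: "(*) a \<in> borel \<rightarrow>\<^sub>M borel"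
    by (intro borel_measurable_continuous_onI) (auto simp: continuous_on_def intro!: tendsto_mult tendsto_const)
  have "distr M M ((*) a) = density M (\<lambda>_. ennreal (1 / absv a))"
  proof (rule measure_eqI_absv_balls)
    fix c :: 'k and n
    have "(*) a -` {x. absv (x - c) \<le> rcard TYPE('k) powi n} = {x. absv (x - c / a) \<le> rcard TYPE('k) powi (n - k)}"
    proof (rule set_eqI)
      fix x
      have "absv (a * x - c) = absv a * absv (x - c / a)" using a by (simp add: algebra_simps flip: absv_mult)
      then show "x \<in> (*) a -` {x. absv (x - c) \<le> rcard TYPE('k) powi n} \<longleftrightarrow>
            x \<in> {x. absv (x - c / a) \<le> rcard TYPE('k) powi (n - k)}"
        by (simp add: k power_int_diff pos_le_divide_eq zero_less_power_int mult.commute)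
    qed
    then have "emeasure (distr M M ((*) a)) {x. absv (x - c) \<le> rcard TYPE('k) powi n} = ennreal (rcard TYPE('k) powi (n - k))"
      using m emeasure_absv_ball by (subst emeasure_distr) (auto cong: measurable_cong_sets)
    moreover have "emeasure (density M (\<lambda>_. ennreal (1 / absv a))) {x. absv (x - c) \<le> rcard TYPE('k) powi n} =
        ennreal (rcard TYPE('k) powi (n - k))"
      by (simp add: emeasure_density_const emeasure_absv_ball k power_int_diff flip: ennreal_mult)
    ultimately show "emeasure (distr M M ((*) a)) {x. absv (x - c) \<le> rcard TYPE('k) powi n} =
        emeasure (density M (\<lambda>_. ennreal (1 / absv a))) {x. absv (x - c) \<le> rcard TYPE('k) powi n}"
      "emeasure (distr M M ((*) a)) {x. absv (x - c) \<le> rcard TYPE('k) powi n} \<noteq> \<infinity>" by simp_all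
  qed simp_all
  then show ?thesis using a m unfolding scales_def by (auto cong: measurable_cong_sets)
qed

lemma scales_shift: "scales M ((+) a) 1"
proof -
  have m: "(+) a \<in> borel \<rightarrow>\<^sub>M borel"
    by (intro borel_measurable_continuous_onI continuous_on_add continuous_on_const continuous_on_id)
  have "distr M M ((+) a) = density M (\<lambda>_. ennreal (1 / 1))"
  proof (rule measure_eqI_absv_balls)
    fix c :: 'k and n
    have "(+) a -` {x. absv (x - c) \<le> rcard TYPE('k) powi n} = {x. absv (x - (c - a)) \<le> rcard TYPE('k) powi n}"
      by (auto simp: algebra_simps)
    then have "emeasure (distr M M ((+) a)) {x. absv (x - c) \<le> rcard TYPE('k) powi n} = ennreal (rcard TYPE('k) powi n)"
      using m emeasure_absv_ball by (subst emeasure_distr) (auto cong: measurable_cong_sets)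
    then show "emeasure (distr M M ((+) a)) {x. absv (x - c) \<le> rcard TYPE('k) powi n} =
        emeasure (density M (\<lambda>_. ennreal (1 / 1))) {x. absv (x - c) \<le> rcard TYPE('k) powi n}"
      "emeasure (distr M M ((+) a)) {x. absv (x - c) \<le> rcard TYPE('k) powi n} \<noteq> \<infinity>"
      by (simp_all add: emeasure_density_const emeasure_absv_ball)
  qed simp_all
  then show ?thesis using m unfolding scales_def by (auto cong: measurable_cong_sets)
qed

sublocale sigma_finite_measure M
proof
  let ?A = "range (\<lambda>n. {x::'k. absv (x - 0) \<le> rcard TYPE('k) powi (int n)})"
  have "\<Union> ?A = UNIV"
  proof (intro equalityI subsetI UNIV_I)
    fix x :: 'k
    obtain n where "absv x \<le> rcard TYPE('k) powi (int n)" by (rule powi_large)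
    then show "x \<in> \<Union> ?A" by auto
  qed
  moreover have "\<forall>a\<in>?A. emeasure M a \<noteq> \<infinity>"
    by (rule ballI, erule imageE) (simp only: emeasure_absv_ball ennreal_neq_top infinity_ennreal_def not_False_eq_True)
  moreover have "?A \<subseteq> sets M" using sets_absv by (simp add: image_subset_iff)
  ultimately show "\<exists>A. countable A \<and> A \<subseteq> sets M \<and> \<Union> A = space M \<and> (\<forall>a\<in>A. emeasure M a \<noteq> \<infinity>)"
    by (intro exI[of _ ?A] conjI) (simp_all only: countable_image countableI_type space_M)
qed

end

subsection \<open>Identity of meromorphic functions\<close>

text \<open>After removal of its singularities the difference vanishes on an open set, hence
  everywhere by the identity theorem. Only punctured neighbourhoods are compared because the values
  at singular points are arbitrary.\<close>

lemma meromorphic_eq_eventually: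
  fixes f g :: "complex \<Rightarrow> complex"
  assumes f: "f meromorphic_on UNIV" and g: "g meromorphic_on UNIV"
    and U: "open U" "U \<noteq> {}" "\<And>z. z \<in> U \<Longrightarrow> f z = g z"
  shows "\<forall>\<^sub>F w in at z. f w = g w"
proof -
  define d where "d = (\<lambda>w. f w - g w)"
  have d: "d meromorphic_on UNIV" unfolding d_def using f g by (intro meromorphic_intros)
  have z0: "remove_sings d w = 0" if "w \<in> U" for w
  proof (rule remove_sings_eqI)
    have "\<forall>\<^sub>F v in at w. v \<in> U" by (rule eventually_at_in_open'[OF U(1) that])
    then have "\<forall>\<^sub>F v in at w. d v = 0" by eventually_elim (simp add: d_def U(3))
    then show "d \<midarrow>w\<rightarrow> 0" by (rule tendsto_eventually)
  qed
  obtain u where u: "u \<in> U" using U(2) by blast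
  have "\<forall>\<^sub>F v in at u. v \<in> U" by (rule eventually_at_in_open'[OF U(1) u])
  then have "\<forall>\<^sub>F v in at u. remove_sings d v = 0" by eventually_elim (rule z0)
  then have "\<exists>\<^sub>F v in at u. remove_sings d v = 0" by (rule eventually_frequently[rotated]) simp
  from frequently_eq_meromorphic_imp_constant[OF this remove_sings_nicely_meromorphic[OF d]]
  have all: "remove_sings d w = 0" for w by (simp add: connected_UNIV)
  have "isolated_singularity_at d z" using d by (meson meromorphic_on_isolated_singularity meromorphic_on_subset subset_UNIV)
  moreover have "not_essential d z" using d by (meson meromorphic_on_not_essential meromorphic_on_subset subset_UNIV)
  ultimately have "\<forall>\<^sub>F w in at z. remove_sings d w = d w" by (intro eventually_remove_sings_eq_at)
  then have "\<forall>\<^sub>F w in at z. 0 = d w" unfolding all .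
  then show ?thesis by eventually_elim (simp add: d_def)
qed

text \<open>A nicely meromorphic function is determined at each point by its values nearby, either
  as a limit or as the default value 0 at a pole. This gives the uniqueness behind the description
  of \<open>gamma_factor\<close>.\<close>

lemma nicely_meromorphic_eqI:
  fixes f g :: "complex \<Rightarrow> complex"
  assumes f: "f nicely_meromorphic_on UNIV" and g: "g nicely_meromorphic_on UNIV"
    and U: "open U" "U \<noteq> {}" "\<And>z. z \<in> U \<Longrightarrow> f z = g z"
  shows "f = g"
proof
  fix z
  have ev: "\<forall>\<^sub>F w in at z. f w = g w"
    using f g U by (intro meromorphic_eq_eventually) (auto simp: nicely_meromorphic_on_def)
  have "is_pole f z \<longleftrightarrow> is_pole g z" using ev by (rule is_pole_cong) simp
  moreover have "is_pole f z \<and> f z = 0 \<or> f \<midarrow>z\<rightarrow> f z" "is_pole g z \<and> g z = 0 \<or> g \<midarrow>z\<rightarrow> g z"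
    using f g by (auto simp: nicely_meromorphic_on_def)
  moreover have "f z = g z" if "f \<midarrow>z\<rightarrow> f z" "g \<midarrow>z\<rightarrow> g z"
    using that tendsto_cong[OF ev] LIM_unique by blast
  moreover have "\<not> is_pole f z" if "f \<midarrow>z\<rightarrow> f z"
    using that not_tendsto_and_filterlim_at_infinity[of "at z"] by (auto simp: is_pole_def)
  moreover have "\<not> is_pole g z" if "g \<midarrow>z\<rightarrow> g z"
    using that not_tendsto_and_filterlim_at_infinity[of "at z"] by (auto simp: is_pole_def)
  ultimately show "f z = g z" by auto
qed


subsection \<open>Shells\<close>

text \<open>The index is the valuation, so large indices are close to 0, and 0 itself lies in no
  shell.\<close>

definition shell :: "int \<Rightarrow> 'k::nonarch_local_field set" where
  "shell k = {x. absv x = rcard TYPE('k) powi (- k)}"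

lemma shell_iff: "x \<in> shell k \<longleftrightarrow> x \<noteq> 0 \<and> valuation x = k"
  by (simp add: shell_def absv_eq_powi_iff)

lemma shell_nonzero: "x \<in> shell k \<Longrightarrow> x \<noteq> 0"
  by (simp add: shell_iff)

lemma shell_0: "shell 0 = integer_units"
  by (simp add: shell_def integer_units_def)

lemma shell_mult_iff: "a \<in> shell j \<Longrightarrow> a * x \<in> shell (j + k) \<longleftrightarrow> x \<in> shell k"
  by (auto simp: shell_iff valuation_mult)

lemma shell_add: "x \<in> shell k \<Longrightarrow> absv h < rcard TYPE('k) powi (- k) \<Longrightarrow>
    h + x \<in> shell k" for x h :: "'k::nonarch_local_field"
  using absv_add_eq'[of h x] by (simp add: shell_def)

lemma shell_add_iff: "absv h < rcard TYPE('k) powi (- k) \<Longrightarrow> x \<in> shell k \<longleftrightarrow> h + x \<in> shell k"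
  for x h :: "'k::nonarch_local_field"
  using shell_add[of x k h] shell_add[of "h + x" k "- h"] by auto

lemma uniformizer_powi_shell:
  "uniformizer (\<pi>::'k::nonarch_local_field) \<Longrightarrow> \<pi> powi k \<in> shell k"
  by (simp add: shell_def absv_power_int absv_uniformizer power_int_minus power_int_inverse)

lemma uniformizer_shell: "uniformizer \<pi> \<Longrightarrow> \<pi> \<in> shell 1"
  by (simp add: shell_iff uniformizer_def)

lemma powr_shell:
  "x \<in> shell k \<Longrightarrow> complex_of_real (absv (x::'k::nonarch_local_field)) powr s =
     exp (- (of_int k * s * of_real (ln (rcard TYPE('k)))))"
  using complex_powi_powr[where 'k = 'k, of "- k" s] by (simp add: shell_def)

lemma ln_rcard_pos [simp]: "ln (rcard TYPE('k::nonarch_local_field)) > 0"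
  using rcard_gt_1[where 'k = 'k] by simp

lemma disjoint_shells: "j \<noteq> k \<Longrightarrow> shell j \<inter> shell k = {}"
  by (auto simp: shell_iff)

context haar
begin

lemma sets_shell [measurable]: "(shell k :: 'k set) \<in> sets borel"
proof -
  have "shell k = (absv :: 'k \<Rightarrow> real) -` {rcard TYPE('k) powi (- k)} \<inter> space borel" by (auto simp: shell_def)
  also have "\<dots> \<in> sets borel" by (rule measurable_sets[OF measurable_absv]) simp
  finally show ?thesis .
qed

lemma measure_absv_ball: "measure M {x. absv (x - a) \<le> rcard TYPE('k) powi n} = rcard TYPE('k) powi n"
  by (simp add: measure_def emeasure_absv_ball)

lemma measure_absv_ball0: "measure M {x. absv x \<le> rcard TYPE('k) powi n} = rcard TYPE('k) powi n"
  using measure_absv_ball[of 0 n] by simp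

lemma emeasure_absv_ball0: "emeasure M {x. absv x \<le> rcard TYPE('k) powi n} = ennreal (rcard TYPE('k) powi n)"
  using emeasure_absv_ball[of 0 n] by simp

lemma emeasure_shell_finite: "emeasure M (shell k) < \<infinity>"
proof -
  have "emeasure M (shell k) \<le> emeasure M {x. absv x \<le> rcard TYPE('k) powi (- k)}"
    by (intro emeasure_mono) (auto simp: shell_def)
  then show ?thesis unfolding emeasure_absv_ball0 by (auto simp: less_top[symmetric] top_unique)
qed

lemma measure_shell: "measure M (shell k) = rcard TYPE('k) powi (- k) * (1 - 1 / rcard TYPE('k))"
proof -
  have eq: "shell k = {x::'k. absv x \<le> rcard TYPE('k) powi (- k)} - {x. absv x \<le> rcard TYPE('k) powi (- k - 1)}"
  proof (rule set_eqI)
    fix x :: 'k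
    show "x \<in> shell k \<longleftrightarrow> x \<in> {x::'k. absv x \<le> rcard TYPE('k) powi (- k)} - {x. absv x \<le> rcard TYPE('k) powi (- k - 1)}"
      using absv_less_powi_iff[of x "- k"] by (simp only: shell_def mem_Collect_eq Diff_iff) linarith
  qed
  have "rcard TYPE('k) powi (- k - 1) \<le> rcard TYPE('k) powi (- k)" unfolding powi_le_iff by simp
  then have sub: "{x::'k. absv x \<le> rcard TYPE('k) powi (- k - 1)} \<subseteq> {x. absv x \<le> rcard TYPE('k) powi (- k)}"
    by (auto intro: order.trans)
  have "measure M (shell k) = measure M {x::'k. absv x \<le> rcard TYPE('k) powi (- k)} -
      measure M {x::'k. absv x \<le> rcard TYPE('k) powi (- k - 1)}"
    unfolding eq by (rule measure_Diff[OF _ _ _ sub]) (simp_all add: emeasure_absv_ball0)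
  moreover have "rcard TYPE('k) powi (- k - 1) = rcard TYPE('k) powi (- k) / rcard TYPE('k)"
    by (simp add: power_int_diff)
  ultimately show ?thesis unfolding measure_absv_ball0 by (simp add: right_diff_distrib)
qed

lemma set_integrable_bounded:
  fixes h :: "'k \<Rightarrow> complex"
  assumes "h \<in> borel_measurable borel" "A \<in> sets borel" "emeasure M A < \<infinity>" "\<And>x. x \<in> A \<Longrightarrow> norm (h x) \<le> B"
  shows "set_integrable M A h"
  unfolding set_integrable_def
  using assms by (intro integrableI_bounded_set_indicator[where B = B]) (auto cong: measurable_cong_sets)

lemma set_integral_eq_const:
  fixes c :: complex
  assumes "A \<in> sets borel" "emeasure M A < \<infinity>" "\<And>x. x \<in> A \<Longrightarrow> h x = c"
  shows "(LINT x:A|M. h x) = of_real (measure M A) * c"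
proof -
  have "(LINT x:A|M. h x) = (LINT x:A|M. c)"
    unfolding set_lebesgue_integral_def
    using assms(3) by (intro Bochner_Integration.integral_cong refl) (auto simp: indicator_def)
  also have "\<dots> = measure M A *\<^sub>R c"
    unfolding set_lebesgue_integral_def using assms(1,2) by (subst integral_scaleR_left) auto
  finally show ?thesis by (simp add: scaleR_conv_of_real)
qed

end


section \<open>Additive characters\<close>

text \<open>\<open>d\<close> records the conductor: the ball of index - d is the largest one on
  which \<psi> is trivial. The witness just outside it drives all the vanishing arguments by
  translation.\<close>

locale haar_psi = haar M for M :: "'k::nonarch_local_field measure" +
  fixes \<psi> :: "'k \<Rightarrow> complex" and d :: int
  assumes psi: "additive_character \<psi>"
    and psi_triv: "\<And>x. absv x \<le> rcard TYPE('k) powi (- d) \<Longrightarrow> \<psi> x = 1"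
    and psi_nontriv: "\<exists>x. absv x \<le> rcard TYPE('k) powi (1 - d) \<and> \<psi> x \<noteq> 1"

text \<open>\<psi> is trivial on some small ball and nontrivial on some large one; the conductor
  sits at the first radius where triviality is lost.\<close>

lemma ex_conductor:
  fixes \<psi> :: "'k::nonarch_local_field \<Rightarrow> complex"
  assumes "normalized_haar M" "additive_character \<psi>" "\<exists>x. \<psi> x \<noteq> 1"
  shows "\<exists>d. haar_psi M \<psi> d"
proof -
  obtain m where m: "\<And>x. absv x \<le> rcard TYPE('k) powi (- int m) \<Longrightarrow> \<psi> x = 1"
    using additive_character_locally_trivial[OF assms(2)] by blast
  obtain x0 where x0: "\<psi> x0 \<noteq> 1" using assms(3) by blast
  obtain n where n: "absv x0 \<le> rcard TYPE('k) powi (int n)" by (rule powi_large)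
  define P where "P = (\<lambda>k::nat. \<exists>x. absv x \<le> rcard TYPE('k) powi (int k - int m) \<and> \<psi> x \<noteq> 1)"
  have "absv x0 \<le> rcard TYPE('k) powi (int (n + m) - int m)" using n by simp
  then have "P (n + m)" using x0 unfolding P_def by blast
  moreover have "\<not> P 0" using m by (auto simp: P_def)
  ultimately obtain k where k: "\<not> P k" "P (Suc k)"
    using ex_least_nat_less[of P "n + m"] by auto
  have "haar_psi M \<psi> (int m - int k)"
  proof
    show "\<exists>x. absv x \<le> rcard TYPE('k) powi (1 - (int m - int k)) \<and> \<psi> x \<noteq> 1"
      using k(2) unfolding P_def by (simp add: algebra_simps)
    show "\<psi> x = 1" if "absv x \<le> rcard TYPE('k) powi (- (int m - int k))" for x
      using k(1) that unfolding P_def by auto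
  qed (use assms in auto)
  then show ?thesis by blast
qed

context haar_psi
begin

lemma measurable_mult_right_const: "(\<lambda>y. y * z) \<in> borel \<rightarrow>\<^sub>M borel" for z :: 'k
proof (rule borel_measurable_continuous_onI, unfold continuous_on_def, rule ballI)
  fix x :: 'k
  show "((\<lambda>y. y * z) \<longlongrightarrow> x * z) (at x)" by (rule tendsto_mult[OF tendsto_ident_at tendsto_const])
qed

lemma psi_add: "\<psi> (x + y) = \<psi> x * \<psi> y"
  using psi by (simp add: additive_character_def)

lemma psi_norm [simp]: "norm (\<psi> x) = 1"
  using psi by (simp add: additive_character_def)

lemma psi_measurable [measurable]: "\<psi> \<in> borel_measurable borel"
  using psi by (intro borel_measurable_continuous_onI) (simp add: additive_character_def)

lemma shift_integral_eq_0:
  fixes h :: "'k \<Rightarrow> complex"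
  assumes h: "h \<in> borel_measurable borel" and A: "A \<in> sets borel" "\<And>x. x \<in> A \<longleftrightarrow> y + x \<in> A"
    and "\<And>x. x \<in> A \<Longrightarrow> h (y + x) = c * h x" and c: "c \<noteq> 1"
  shows "(LINT x:A|M. h x) = 0"
proof -
  have "(LINT x:A|M. h x) = of_real 1 * c * (LINT x:A|M. h x)"
    by (rule scales_set_integral(1)[OF scales_shift]) (use assms in \<open>auto cong: measurable_cong_sets\<close>)
  then show ?thesis using c by (metis mult_1 mult_cancel_right2 of_real_1)
qed

text \<open>Orthogonality: y \<mapsto> \<psi> (y z) is a character of the additive group formed by
  the ball, so its integral is the full measure if it is trivial there and 0 otherwise.\<close>

lemma psi_ball_integral:
  "(LINT y:{y. absv y \<le> rcard TYPE('k) powi n}|M. \<psi> (y * z)) =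
     (if absv z \<le> rcard TYPE('k) powi (- d - n) then of_real (rcard TYPE('k) powi n) else 0)"
proof (cases "absv z \<le> rcard TYPE('k) powi (- d - n)")
  case True
  have "\<psi> (y * z) = 1" if "absv y \<le> rcard TYPE('k) powi n" for y
  proof (rule psi_triv)
    have "absv (y * z) \<le> rcard TYPE('k) powi n * rcard TYPE('k) powi (- d - n)"
      unfolding absv_mult using that True by (intro mult_mono) auto
    then show "absv (y * z) \<le> rcard TYPE('k) powi (- d)" by (simp flip: power_int_add)
  qed
  then have "(LINT y:{y. absv y \<le> rcard TYPE('k) powi n}|M. \<psi> (y * z)) =
      of_real (measure M {y. absv y \<le> rcard TYPE('k) powi n}) * 1"
    by (intro set_integral_eq_const) (auto simp: emeasure_absv_ball0)
  then show ?thesis using True by (simp add: measure_absv_ball0)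
next
  case False
  then have z: "z \<noteq> 0" by auto
  obtain w where w: "absv w \<le> rcard TYPE('k) powi (1 - d)" "\<psi> w \<noteq> 1" using psi_nontriv by blast
  \<comment> \<open>This translation multiplies the integrand by \<psi> w, which is not 1. Since |z|
    is at least one step above the threshold, the translation stays in the ball.\<close>
  define y where "y = w / z"
  have "rcard TYPE('k) powi (- d - n + 1) \<le> absv z"
    using False absv_less_powi_iff[of z "- d - n + 1"] by simp
  then have "absv y \<le> rcard TYPE('k) powi (1 - d) / rcard TYPE('k) powi (- d - n + 1)"
    unfolding y_def absv_divide using w(1) z by (intro frac_le) auto
  also have "\<dots> = rcard TYPE('k) powi n" by (simp add: power_int_diff[symmetric])
  finally have y: "absv y \<le> rcard TYPE('k) powi n" .
  have inv: "x \<in> {y. absv y \<le> rcard TYPE('k) powi n} \<longleftrightarrow> y + x \<in> {y. absv y \<le> rcard TYPE('k) powi n}" for x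
    using absv_add_bound[OF y, of x] absv_diff_bound[OF _ y, of "y + x"] by auto
  have "(\<lambda>y. \<psi> (y * z)) \<in> borel_measurable borel"
    by (rule measurable_compose[OF measurable_mult_right_const psi_measurable])
  then have "(LINT y:{y. absv y \<le> rcard TYPE('k) powi n}|M. \<psi> (y * z)) = 0"
    by (rule shift_integral_eq_0[where y = y and c = "\<psi> w"])
       (use inv w z in \<open>auto simp: distrib_right psi_add y_def\<close>)
  then show ?thesis using False by simp
qed

end


section \<open>Gamma factors\<close>

lemma has_sum_int_geometric:
  fixes f :: "int \<Rightarrow> complex"
  assumes 0: "\<And>k. k < n0 \<Longrightarrow> f k = 0" and tail: "\<And>k. n1 \<le> k \<Longrightarrow> f k = c * r powi k"
    and n: "n0 \<le> n1" and r: "norm r < 1" "r \<noteq> 0"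
  shows "(f has_sum ((\<Sum>k\<in>{n0..<n1}. f k) + c * r powi n1 / (1 - r))) UNIV"
proof -
  have "(f has_sum (c * r powi n1 / (1 - r))) {n1..}"
  proof -
    have "((\<lambda>m. c * r powi n1 * r ^ m) has_sum (c * r powi n1 * (1 / (1 - r)))) UNIV"
      by (intro norm_summable_imp_has_sum sums_mult geometric_sums r)
         (use r in \<open>simp add: norm_mult norm_power\<close>)
    moreover have "((\<lambda>m. c * r powi n1 * r ^ m) has_sum S) UNIV \<longleftrightarrow> (f has_sum S) {n1..}" for S
    proof (rule has_sum_reindex_bij_witness[of _ "\<lambda>k. nat (k - n1)" "\<lambda>m. n1 + int m"])
      fix m :: nat
      show "f (n1 + int m) = c * r powi n1 * r ^ m" using r(2) by (simp add: tail power_int_add)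
    qed simp_all
    ultimately show ?thesis by simp
  qed
  moreover have "(f has_sum (\<Sum>k\<in>{n0..<n1}. f k)) {n0..<n1}" by simp
  ultimately have "(f has_sum ((\<Sum>k\<in>{n0..<n1}. f k) + c * r powi n1 / (1 - r))) ({n0..<n1} \<union> {n1..})"
    by (intro has_sum_Un_disjoint) auto
  moreover have "(f has_sum ((\<Sum>k\<in>{n0..<n1}. f k) + c * r powi n1 / (1 - r))) UNIV \<longleftrightarrow>
      (f has_sum ((\<Sum>k\<in>{n0..<n1}. f k) + c * r powi n1 / (1 - r))) ({n0..<n1} \<union> {n1..})"
    by (rule has_sum_cong_neutral) (use 0 n in auto)
  ultimately show ?thesis by simp
qed

text \<open>Links unconditional sums over all shells with the symmetric truncation used in
  \<open>gamma_integral\<close>.\<close>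

lemma has_sum_int_imp_LIMSEQ:
  fixes f :: "int \<Rightarrow> complex"
  assumes "(f has_sum S) UNIV"
  shows "(\<lambda>n. \<Sum>k\<in>{- int n..int n}. f k) \<longlonglongrightarrow> S"
proof -
  have "filterlim (\<lambda>n. {- int n..int n}) (finite_subsets_at_top UNIV) sequentially"
    unfolding filterlim_finite_subsets_at_top
  proof (intro allI impI)
    fix X :: "int set" assume X: "finite X \<and> X \<subseteq> UNIV"
    define m where "m = (\<Sum>k\<in>X. nat \<bar>k\<bar>)"
    have "nat \<bar>k\<bar> \<le> m" if "k \<in> X" for k unfolding m_def using X that by (intro member_le_sum) auto
    then have "X \<subseteq> {- int n..int n}" if "n \<ge> m" for n using that by force
    then show "\<forall>\<^sub>F n in sequentially. finite {- int n..int n} \<and> X \<subseteq> {- int n..int n} \<and> {- int n..int n} \<subseteq> UNIV"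
      by (auto simp: eventually_sequentially)
  qed
  with assms show ?thesis unfolding has_sum_def by (rule filterlim_compose)
qed

context haar_psi
begin

text \<open>A Gauss sum over one shell. On the shell |x| is constant, so the gamma factor is a
  series in powers of q^(-a) with these coefficients, up to powers of q.\<close>

definition gcoeff :: "'k \<Rightarrow> ('k \<Rightarrow> complex) \<Rightarrow> int \<Rightarrow> complex" where
  "gcoeff \<pi> \<xi> k = (LINT x:shell k|M. \<psi> x * qchar \<pi> \<xi> 0 x)"

context
  fixes \<pi> :: 'k and \<xi> :: "'k \<Rightarrow> complex"
  assumes pi: "uniformizer \<pi>" and xi: "\<xi> \<in> unit_characters"
begin

lemma qchar_measurable [measurable]: "qchar \<pi> \<xi> s \<in> borel_measurable borel"
  by (rule measurable_qchar[OF xi pi])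

text \<open>On a large shell \<xi> is invariant under translations as small as \<open>m\<close>
  steps below the radius, while \<psi> acquires a factor other than 1 under some translation of size
  at most q^(1-d). Once k < d - m, one translation does both.\<close>

lemma gcoeff_eq_0:
  obtains n0 where "\<And>k. k < n0 \<Longrightarrow> gcoeff \<pi> \<xi> k = 0" "n0 \<le> d"
proof -
  obtain m where m: "m > 0"
    "\<And>x y s. absv y \<le> rcard TYPE('k) powi (- int m) * absv x \<Longrightarrow> qchar \<pi> \<xi> s (x + y) = qchar \<pi> \<xi> s x"
    using qchar_locally_constant[OF xi pi] by blast
  obtain y where y: "absv y \<le> rcard TYPE('k) powi (1 - d)" "\<psi> y \<noteq> 1" using psi_nontriv by blast
  have "gcoeff \<pi> \<xi> k = 0" if k: "k < d - int m" for k
    unfolding gcoeff_def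
  proof (rule shift_integral_eq_0[where y = y and c = "\<psi> y"])
    have "absv y \<le> rcard TYPE('k) powi (- k - int m)"
      using y(1) powi_le_iff[where 'k = 'k, of "1 - d" "- k - int m"] k by simp
    moreover have "rcard TYPE('k) powi (- k - int m) < rcard TYPE('k) powi (- k)"
      unfolding powi_less_iff using m(1) by simp
    ultimately have lt: "absv y < rcard TYPE('k) powi (- k)" by linarith
    show "x \<in> shell k \<longleftrightarrow> y + x \<in> shell k" for x by (rule shell_add_iff[OF lt])
    fix x :: 'k assume "x \<in> shell k"
    then have "absv y \<le> rcard TYPE('k) powi (- int m) * absv x"
      using \<open>absv y \<le> rcard TYPE('k) powi (- k - int m)\<close>
      by (simp add: shell_def power_int_diff power_int_minus divide_inverse mult.commute)
    then have "qchar \<pi> \<xi> 0 (y + x) = qchar \<pi> \<xi> 0 x" using m(2)[of y x 0] by (simp add: add.commute)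
    then show "\<psi> (y + x) * qchar \<pi> \<xi> 0 (y + x) = \<psi> y * (\<psi> x * qchar \<pi> \<xi> 0 x)"
      by (simp add: psi_add)
  qed (use y in simp_all)
  then show thesis by (rule that[of "d - int m"]) auto
qed

text \<open>From index \<open>d\<close> on, \<psi> is 1 on the shell. Scaling by \<pi>^k then moves
  the integral to the units without a phase, since the character is normalized to 1 at
  \<pi>.\<close>

lemma gcoeff_tail:
  assumes "d \<le> k"
  shows "gcoeff \<pi> \<xi> k = of_real (rcard TYPE('k) powi (- k)) * (LINT x:shell 0|M. qchar \<pi> \<xi> 0 x)"
proof -
  have "gcoeff \<pi> \<xi> k = (LINT x:shell k|M. qchar \<pi> \<xi> 0 x)"
    unfolding gcoeff_def set_lebesgue_integral_def
  proof (rule Bochner_Integration.integral_cong[OF refl])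
    fix x
    have "\<psi> x = 1" if "x \<in> shell k"
      using that assms powi_le_iff[where 'k = 'k, of "- k" "- d"] by (intro psi_triv) (auto simp: shell_def)
    then show "indicator (shell k) x *\<^sub>R (\<psi> x * qchar \<pi> \<xi> 0 x) = indicator (shell k) x *\<^sub>R qchar \<pi> \<xi> 0 x"
      by (auto simp: indicator_def)
  qed
  also have "\<dots> = of_real (absv (\<pi> powi k)) * 1 * (LINT x:shell 0|M. qchar \<pi> \<xi> 0 x)"
  proof (rule scales_set_integral(1)[OF scales_mult])
    have sk: "\<pi> powi k \<in> shell k" by (rule uniformizer_powi_shell[OF pi])
    then show "\<pi> powi k \<noteq> 0" by (rule shell_nonzero)
    show "x \<in> shell 0 \<longleftrightarrow> \<pi> powi k * x \<in> shell k" for x using shell_mult_iff[OF sk, of x 0] by simp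
    have "qchar \<pi> \<xi> 0 (\<pi> powi k) = 1"
      using qchar_power[OF xi pi] qchar_inverse[OF xi pi] qchar_uniformizer_0[OF xi pi]
      by (simp add: power_int_def)
    then show "qchar \<pi> \<xi> 0 (\<pi> powi k * x) = 1 * qchar \<pi> \<xi> 0 x" for x by (simp add: qchar_mult[OF xi pi])
  qed (simp_all cong: measurable_cong_sets)
  finally show ?thesis
    using uniformizer_powi_shell[OF pi, of k] by (simp add: shell_def)
qed

definition gamma_term :: "complex \<Rightarrow> int \<Rightarrow> complex" where
  "gamma_term a k = gcoeff \<pi> \<xi> k * exp (- (of_int k * (a - 1) * of_real (ln (rcard TYPE('k)))))"

lemma exp_ln_rcard: "exp (of_real (ln (rcard TYPE('k)))) = complex_of_real (rcard TYPE('k))"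
  unfolding exp_of_real exp_ln[OF rcard_pos] ..

lemma gamma_term_eq:
  "gamma_term a k = (LINT x:shell k|M. \<psi> x * qchar \<pi> \<xi> a x / of_real (absv x))"
proof -
  have "(LINT x:shell k|M. \<psi> x * qchar \<pi> \<xi> a x / of_real (absv x)) =
      (LINT x:shell k|M. \<psi> x * qchar \<pi> \<xi> 0 x * exp (- (of_int k * (a - 1) * of_real (ln (rcard TYPE('k))))))"
    unfolding set_lebesgue_integral_def
  proof (rule Bochner_Integration.integral_cong[OF refl])
    fix x :: 'k
    have e: "qchar \<pi> \<xi> a x / of_real (absv x) = qchar \<pi> \<xi> 0 x * exp (- (of_int k * (a - 1) * of_real (ln (rcard TYPE('k)))))"
      if x: "x \<in> shell k"
    proof -
      have "complex_of_real (absv x) = complex_of_real (absv x) powr 1" by simp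
      also have "\<dots> = exp (- (of_int k * 1 * of_real (ln (rcard TYPE('k)))))" by (rule powr_shell[OF x])
      finally have a1: "complex_of_real (absv x) = exp (- (of_int k * 1 * of_real (ln (rcard TYPE('k)))))" .
      have "qchar \<pi> \<xi> a x / of_real (absv x) = qchar \<pi> \<xi> 0 x * (complex_of_real (absv x) powr a / of_real (absv x))"
        by (subst qchar_decomp[OF xi pi]) simp
      also have "complex_of_real (absv x) powr a / of_real (absv x) =
          exp (- (of_int k * (a - 1) * of_real (ln (rcard TYPE('k)))))"
        by (subst powr_shell[OF x], subst a1) (simp add: algebra_simps flip: exp_diff)
      finally show ?thesis .
    qed
    show "indicator (shell k) x *\<^sub>R (\<psi> x * qchar \<pi> \<xi> a x / of_real (absv x)) =
       indicator (shell k) x *\<^sub>R (\<psi> x * qchar \<pi> \<xi> 0 x * exp (- (of_int k * (a - 1) * of_real (ln (rcard TYPE('k))))))"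
    proof (cases "x \<in> shell k")
      case True
      show ?thesis unfolding times_divide_eq_right[symmetric] e[OF True] by (simp only: mult.assoc)
    qed simp
  qed
  then show ?thesis by (simp add: gamma_term_def gcoeff_def set_lebesgue_integral_def mult.assoc[symmetric]
      flip: integral_mult_left_zero scaleR_scaleR mult_scaleR_left)
qed

lemma gamma_integral_eq: "gamma_integral M \<psi> (qchar \<pi> \<xi> a) n = (\<Sum>k\<in>{- int n..int n}. gamma_term a k)"
proof -
  let ?h = "\<lambda>x. \<psi> x * qchar \<pi> \<xi> a x / complex_of_real (absv x)"
  have eq: "{x::'k. rcard TYPE('k) powi (- int n) \<le> absv x \<and> absv x \<le> rcard TYPE('k) powi (int n)} =
      (\<Union>k\<in>{- int n..int n}. shell k)"
  proof (rule set_eqI)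
    fix x :: 'k
    have pos: "rcard TYPE('k) powi (- int n) > 0" by (simp add: zero_less_power_int)
    show "x \<in> {x. rcard TYPE('k) powi (- int n) \<le> absv x \<and> absv x \<le> rcard TYPE('k) powi (int n)} \<longleftrightarrow>
        x \<in> (\<Union>k\<in>{- int n..int n}. shell k)"
      by (cases "x = 0")
         (auto simp: shell_iff absv_eq_valuation powi_le_iff not_le[THEN iffD2, OF pos] simp del: power_int_of_nat)
  qed
  have hm: "?h \<in> borel_measurable borel" by measurable
  have int: "set_integrable M (shell k) ?h" for k
  proof (rule set_integrable_bounded[OF hm _ emeasure_shell_finite])
    fix x :: 'k assume x: "x \<in> shell k"
    then have "x \<noteq> 0" by (rule shell_nonzero)
    have "norm (?h x) = norm (exp (- (of_int k * a * of_real (ln (rcard TYPE('k)))))) / rcard TYPE('k) powi (- k)"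
      unfolding qchar_decomp[OF xi pi, of a] powr_shell[OF x] using x qchar_norm[OF xi pi \<open>x \<noteq> 0\<close>]
      by (simp add: norm_mult norm_divide norm_power_int shell_def)
    then show "norm (?h x) \<le> norm (exp (- (of_int k * a * of_real (ln (rcard TYPE('k)))))) / rcard TYPE('k) powi (- k)"
      by simp
  qed simp
  have "gamma_integral M \<psi> (qchar \<pi> \<xi> a) n = (LINT x:(\<Union>k\<in>{- int n..int n}. shell k)|M. ?h x)"
    unfolding gamma_integral_def eq ..
  also have "\<dots> = (\<Sum>k\<in>{- int n..int n}. (LINT x:shell k|M. ?h x))"
    by (rule set_integral_finite_Union) (auto simp: disjoint_family_on_def shell_iff int)
  finally show ?thesis by (simp add: gamma_term_eq)
qed

text \<open>The coefficients vanish far to the left and are geometric to the right, so for Re a > 0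
  the sum is an explicit function of q^(-a) that is meromorphic in the whole plane. Half-plane
  values determine it.\<close>

lemma gamma_factor_spec:
  "gamma_factor M \<psi> \<pi> \<xi> nicely_meromorphic_on UNIV"
  "Re a > 0 \<Longrightarrow> (gamma_term a has_sum gamma_factor M \<psi> \<pi> \<xi> a) UNIV"
proof -
  obtain n0 where n0: "\<And>k. k < n0 \<Longrightarrow> gcoeff \<pi> \<xi> k = 0" "n0 \<le> d" using gcoeff_eq_0 by blast
  define \<tau> where "\<tau> = (LINT x:shell 0|M. qchar \<pi> \<xi> 0 x)"
  define L where "L = complex_of_real (ln (rcard TYPE('k)))"
  \<comment> \<open>The tail has ratio q^(-a): the coefficients contribute q^(-k) and the powers
    q^(-k (a-1)). The fraction is the sum of this tail from k = d.\<close>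
  define G where "G = (\<lambda>a. (\<Sum>k\<in>{n0..<d}. gcoeff \<pi> \<xi> k * exp (- (of_int k * (a - 1) * L))) +
      \<tau> * exp (- (of_int d * a * L)) / (1 - exp (- (a * L))))"
  have L: "L = of_real (ln (rcard TYPE('k)))" by (simp add: L_def)
  have eL: "exp L = of_real (rcard TYPE('k))" unfolding L by (rule exp_ln_rcard)
  have powL: "of_real (rcard TYPE('k) powi k) = exp (of_int k * L)" for k
    unfolding of_real_power_int eL[symmetric] by (rule exp_power_int)
  have expi: "exp (- (a * L)) powi k = exp (- (of_int k * a * L))" for a k
    by (simp add: exp_power_int mult.assoc)
  have hs: "(gamma_term a has_sum G a) UNIV" if "Re a > 0" for a
  proof -
    have tail: "gamma_term a k = \<tau> * exp (- (a * L)) powi k" if "d \<le> k" for k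
      unfolding gamma_term_def gcoeff_tail[OF that] L[symmetric] \<tau>_def[symmetric] powL expi
      by (simp add: algebra_simps flip: exp_add)
    have nr: "norm (exp (- (a * L))) < 1" using that ln_rcard_pos[where 'k = 'k] by (simp add: L)
    have "(gamma_term a has_sum ((\<Sum>k\<in>{n0..<d}. gamma_term a k) + \<tau> * exp (- (a * L)) powi d / (1 - exp (- (a * L))))) UNIV"
      by (rule has_sum_int_geometric[OF _ tail n0(2) nr]) (simp_all add: gamma_term_def n0(1))
    then show ?thesis by (simp only: G_def gamma_term_def expi L[symmetric])
  qed
  have Gm: "G meromorphic_on UNIV"
    unfolding G_def by (intro meromorphic_intros analytic_on_imp_meromorphic_on analytic_intros)
  have Gan: "remove_sings G a = G a" if "Re a > 0" for a
  proof (rule remove_sings_at_analytic)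
    have "norm (exp (- (a * L))) < 1" using that ln_rcard_pos[where 'k = 'k] by (simp add: L)
    then have ne: "1 - exp (- (a * L)) \<noteq> 0" by (metis eq_iff_diff_eq_0 less_irrefl norm_one)
    show "G analytic_on {a}" unfolding G_def by (intro analytic_intros) (use ne in blast)
  qed
  have "gamma_factor M \<psi> \<pi> \<xi> = remove_sings G"
    unfolding gamma_factor_def
  proof (rule the_equality)
    have lim: "gamma_integral M \<psi> (qchar \<pi> \<xi> a) \<longlonglongrightarrow> G a" if "Re a > 0" for a
      using has_sum_int_imp_LIMSEQ[OF hs[OF that]] by (simp add: gamma_integral_eq[abs_def])
    show "remove_sings G nicely_meromorphic_on UNIV \<and>
        (\<forall>a. Re a > 0 \<longrightarrow> gamma_integral M \<psi> (qchar \<pi> \<xi> a) \<longlonglongrightarrow> remove_sings G a)"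
      using remove_sings_nicely_meromorphic[OF Gm] lim Gan by simp
    fix H assume H: "H nicely_meromorphic_on UNIV \<and>
        (\<forall>a. Re a > 0 \<longrightarrow> gamma_integral M \<psi> (qchar \<pi> \<xi> a) \<longlonglongrightarrow> H a)"
    show "H = remove_sings G"
    proof (rule nicely_meromorphic_eqI)
      show "open {a. Re a > 0}" by (rule open_halfspace_Re_gt)
      have "(1::complex) \<in> {a. Re a > 0}" by simp
      then show "{a. Re a > 0} \<noteq> {}" by blast
      fix a assume "a \<in> {a. Re a > 0}"
      then have "Re a > 0" by simp
      then show "H a = remove_sings G a" using H lim[of a] Gan[of a] LIMSEQ_unique by metis
    qed (use H remove_sings_nicely_meromorphic[OF Gm] in auto)
  qed
  then show "gamma_factor M \<psi> \<pi> \<xi> nicely_meromorphic_on UNIV"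
    "Re a > 0 \<Longrightarrow> (gamma_term a has_sum gamma_factor M \<psi> \<pi> \<xi> a) UNIV"
    using remove_sings_nicely_meromorphic[OF Gm] hs Gan by simp_all
qed

end

end

subsection \<open>Measurability of the field operations\<close>

lemma borel_measurable_field_mult [measurable (raw)]:
  fixes f g :: "'a \<Rightarrow> 'k::nonarch_local_field"
  assumes "f \<in> borel_measurable M" "g \<in> borel_measurable M"
  shows "(\<lambda>x. f x * g x) \<in> borel_measurable M"
proof (rule borel_measurable_continuous_Pair[OF assms])
  show "continuous_on UNIV (\<lambda>x. fst x * snd x :: 'k)"
    by (simp add: continuous_on_def tendsto_mult tendsto_fst tendsto_snd)
qed

lemma borel_measurable_field_diff [measurable (raw)]:
  fixes f g :: "'a \<Rightarrow> 'k::nonarch_local_field"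
  assumes "f \<in> borel_measurable M" "g \<in> borel_measurable M"
  shows "(\<lambda>x. f x - g x) \<in> borel_measurable M"
proof (rule borel_measurable_continuous_Pair[OF assms])
  show "continuous_on UNIV (\<lambda>x. fst x - snd x :: 'k)"
    by (simp add: continuous_on_def tendsto_diff tendsto_fst tendsto_snd)
qed

subsection \<open>Fourier inversion\<close>

text \<open>A test function with a nonzero value at 0; inversion applied to it leaves only one
  possible inversion constant.\<close>

lemma indicator_absv_ball_test_function:
  "(\<lambda>x::'k::nonarch_local_field. if absv x \<le> 1 then 1 else 0) \<in> test_functions"
proof -
  have s: "{x::'k. (if absv x \<le> 1 then 1 else 0 :: complex) \<noteq> 0} = {x. absv x \<le> 1}" by auto
  have "compact (closure {x::'k. absv x \<le> 1})"
    using compact_absv_ball[of 1, where 'k = 'k] by (simp add: compact_imp_closed closure_closed)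
  moreover have "\<forall>\<^sub>F y in nhds x. (if absv y \<le> 1 then 1 else 0 :: complex) = (if absv x \<le> 1 then 1 else 0)" for x :: 'k
  proof -
    have "\<forall>\<^sub>F y in nhds x. dist y x < 1" by (simp add: eventually_nhds_metric exI[of _ 1])
    then show ?thesis
    proof eventually_elim
      case (elim y)
      have "absv (y - x) \<le> 1" using elim by (simp add: dist_eq_absv)
      then show ?case using absv_add_bound[of "y - x" 1 x] absv_diff_bound[of y 1 "y - x"] by auto
    qed
  qed
  ultimately show ?thesis unfolding test_functions_def s mem_Collect_eq by blast
qed

context haar_psi
begin

text \<open>A function invariant under translations of size q^(-n) has a Fourier transform supported
  in a ball, because for larger y such a translation changes \<psi> (y z) by a factor other than
  1.\<close>

lemma fourier_eq_0:
  fixes f :: "'k \<Rightarrow> complex"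
  assumes f: "f \<in> borel_measurable borel"
    and n: "\<And>x y. absv (x - y) \<le> rcard TYPE('k) powi (- n) \<Longrightarrow> f x = f y"
    and y: "\<not> absv y \<le> rcard TYPE('k) powi (n - d)"
  shows "fourier M \<psi> f y = 0"
proof -
  have y0: "y \<noteq> 0" using y by auto
  obtain w where w: "absv w \<le> rcard TYPE('k) powi (1 - d)" "\<psi> w \<noteq> 1" using psi_nontriv by blast
  have "rcard TYPE('k) powi (n - d + 1) \<le> absv y"
    using y absv_less_powi_iff[of y "n - d + 1"] by simp
  then have "absv (w / y) \<le> rcard TYPE('k) powi (1 - d) / rcard TYPE('k) powi (n - d + 1)"
    unfolding absv_divide using w(1) y0 by (intro frac_le) auto
  also have "\<dots> = rcard TYPE('k) powi (- n)" by (simp add: power_int_diff[symmetric])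
  finally have h: "absv (w / y) \<le> rcard TYPE('k) powi (- n)" .
  have "(LINT z:UNIV|M. \<psi> (y * z) * f z) = 0"
  proof (rule shift_integral_eq_0[where y = "w / y" and c = "\<psi> w"])
    show "(\<lambda>z. \<psi> (y * z) * f z) \<in> borel_measurable borel" using f by measurable
    fix z
    have "f (w / y + z) = f z" by (rule n) (use h in simp)
    then show "\<psi> (y * (w / y + z)) * f (w / y + z) = \<psi> w * (\<psi> (y * z) * f z)"
      using y0 by (simp add: distrib_left psi_add)
  qed (use w in simp_all)
  then show ?thesis by (simp add: fourier_def set_lebesgue_integral_def)
qed

text \<open>The transform lives on a ball, so Fubini applies on a set of finite measure. The inner
  integral over y then concentrates z in a ball around x on which f is constant; the product of the
  volumes of the two balls is q^(-d).\<close>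

lemma fourier_inversion:
  assumes f: "f \<in> test_functions"
  shows "f x = of_real (rcard TYPE('k) powi d) * (LINT y|M. \<psi> (- (x * y)) * fourier M \<psi> f y)"
proof -
  obtain n :: nat where n: "\<And>x y. absv (x - y) \<le> rcard TYPE('k) powi (- int n) \<Longrightarrow> f x = f y"
    "\<And>x. f x \<noteq> 0 \<Longrightarrow> absv x \<le> rcard TYPE('k) powi (int n)"
    using test_function_uniform[OF f] by blast
  obtain B where B: "\<And>x. norm (f x) \<le> B" "B > 0" using test_function_bounded[OF f] by blast
  have fm [measurable]: "f \<in> borel_measurable borel"
    by (intro borel_measurable_continuous_onI continuous_on_test_function f)
  \<comment> \<open>The radius beyond which the transform vanishes; its dual ball, of index - d - N
    = - n, is exactly the scale at which f is constant.\<close>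
  define N where "N = int n - d"
  define A where "A = {y::'k. absv y \<le> rcard TYPE('k) powi N}"
  have Am [measurable]: "A \<in> sets borel" unfolding A_def by simp
  interpret P: pair_sigma_finite M M ..
  define h where "h = (\<lambda>y z. indicator A y *\<^sub>R (\<psi> (y * (z - x)) * f z))"
  have pairsets: "sets (M \<Otimes>\<^sub>M M) = sets (borel \<Otimes>\<^sub>M borel)" by (rule sets_pair_measure_cong) simp_all
  have hint: "integrable (M \<Otimes>\<^sub>M M) (\<lambda>(y, z). h y z)"
  proof (rule integrableI_bounded_set[where A = "A \<times> {z. absv z \<le> rcard TYPE('k) powi (int n)}" and B = B])
    show "A \<times> {z. absv z \<le> rcard TYPE('k) powi (int n)} \<in> sets (M \<Otimes>\<^sub>M M)" by (intro pair_measureI) simp_all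
    show "(\<lambda>(y, z). h y z) \<in> borel_measurable (M \<Otimes>\<^sub>M M)" unfolding h_def by measurable
    have "emeasure (M \<Otimes>\<^sub>M M) (A \<times> {z. absv z \<le> rcard TYPE('k) powi (int n)}) =
        emeasure M A * emeasure M {z. absv z \<le> rcard TYPE('k) powi (int n)}"
      by (rule emeasure_pair_measure_Times) simp_all
    then show "emeasure (M \<Otimes>\<^sub>M M) (A \<times> {z. absv z \<le> rcard TYPE('k) powi (int n)}) < \<infinity>"
      unfolding A_def emeasure_absv_ball0 by (simp add: ennreal_mult_less_top)
    show "AE p in M \<Otimes>\<^sub>M M. p \<in> A \<times> {z. absv z \<le> rcard TYPE('k) powi (int n)} \<longrightarrow> norm (case p of (y, z) \<Rightarrow> h y z) \<le> B"
      using B by (intro AE_I2) (auto simp: h_def norm_mult indicator_def)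
    show "AE p in M \<Otimes>\<^sub>M M. p \<notin> A \<times> {z. absv z \<le> rcard TYPE('k) powi (int n)} \<longrightarrow> (case p of (y, z) \<Rightarrow> h y z) = 0"
      using n(2) by (intro AE_I2) (auto simp: h_def indicator_def)
  qed
  have "(LINT y|M. \<psi> (- (x * y)) * fourier M \<psi> f y) = (LINT y|M. LINT z|M. h y z)"
  proof (rule Bochner_Integration.integral_cong[OF refl])
    fix y
    show "\<psi> (- (x * y)) * fourier M \<psi> f y = (LINT z|M. h y z)"
    proof (cases "y \<in> A")
      case True
      have "\<psi> (- (x * y)) * (\<psi> (y * z) * f z) = h y z" for z
        using True psi_add[of "- (x * y)" "y * z"] by (simp add: h_def algebra_simps)
      then show ?thesis
        unfolding fourier_def integral_mult_right_zero[symmetric] by simp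
    next
      case False
      have "fourier M \<psi> f y = 0"
        by (rule fourier_eq_0[OF fm, of "int n"]) (use n(1) False in \<open>auto simp: A_def N_def\<close>)
      then show ?thesis using False by (simp add: h_def)
    qed
  qed
  also have "\<dots> = (LINT z|M. LINT y|M. h y z)"
    using P.Fubini_integral[OF hint] by simp
  also have "\<dots> = (LINT z:{z. absv (z - x) \<le> rcard TYPE('k) powi (- int n)}|M. f z * of_real (rcard TYPE('k) powi N))"
    unfolding set_lebesgue_integral_def
  proof (rule Bochner_Integration.integral_cong[OF refl])
    fix z
    have "(LINT y|M. h y z) = (LINT y:A|M. \<psi> (y * (z - x))) * f z"
      by (simp add: h_def set_lebesgue_integral_def flip: integral_mult_left_zero)
    also have "(LINT y:A|M. \<psi> (y * (z - x))) =
        (if absv (z - x) \<le> rcard TYPE('k) powi (- int n) then of_real (rcard TYPE('k) powi N) else 0)"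
      unfolding A_def psi_ball_integral by (simp add: N_def)
    finally show "(LINT y|M. h y z) =
        indicator {z. absv (z - x) \<le> rcard TYPE('k) powi (- int n)} z *\<^sub>R (f z * of_real (rcard TYPE('k) powi N))"
      by (simp add: indicator_def)
  qed
  also have "\<dots> = of_real (rcard TYPE('k) powi (- int n)) * (f x * of_real (rcard TYPE('k) powi N))"
    by (subst set_integral_eq_const[where c = "f x * of_real (rcard TYPE('k) powi N)"])
       (use n(1) in \<open>simp_all add: measure_absv_ball emeasure_absv_ball\<close>)
  finally have *: "(LINT y|M. \<psi> (- (x * y)) * fourier M \<psi> f y) =
      of_real (rcard TYPE('k) powi (- int n)) * (f x * of_real (rcard TYPE('k) powi N))" .
  have "rcard TYPE('k) powi d * (rcard TYPE('k) powi (- int n) * rcard TYPE('k) powi N) = 1"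
    unfolding N_def by (simp add: power_int_diff power_int_minus)
  then have "complex_of_real (rcard TYPE('k) powi d) * (of_real (rcard TYPE('k) powi (- int n)) * of_real (rcard TYPE('k) powi N)) = 1"
    by (simp only: of_real_mult[symmetric] of_real_1)
  then show ?thesis unfolding * by (simp add: mult_ac)
qed

lemma inversion_constant_eq: "inversion_constant M \<psi> = rcard TYPE('k) powi d"
  unfolding inversion_constant_def
proof (rule the_equality)
  show "rcard TYPE('k) powi d > 0 \<and> (\<forall>f\<in>test_functions. \<forall>x. f x = of_real (rcard TYPE('k) powi d) *
      (LINT y|M. \<psi> (- (x * y)) * fourier M \<psi> f y))"
    using fourier_inversion by (simp add: zero_less_power_int)
  fix c assume c: "c > 0 \<and> (\<forall>f\<in>test_functions. \<forall>x. f x = complex_of_real c * (LINT y|M. \<psi> (- (x * y)) * fourier M \<psi> f y))"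
  let ?f = "\<lambda>x::'k. if absv x \<le> 1 then 1 else 0 :: complex"
  let ?I = "LINT y|M. \<psi> (- (0 * y)) * fourier M \<psi> ?f y"
  have "?f 0 = of_real c * ?I" 
    by (rule c[THEN conjunct2, THEN bspec, OF indicator_absv_ball_test_function, THEN spec])
  moreover have "?f 0 = of_real (rcard TYPE('k) powi d) * ?I" by (rule fourier_inversion[OF indicator_absv_ball_test_function])
  ultimately have e: "of_real c * ?I = of_real (rcard TYPE('k) powi d) * ?I" and "?f 0 = of_real c * ?I"
    by (simp_all only:)
  then have "?I \<noteq> 0" by (intro notI) (simp only: mult_zero_right, simp)
  with e have "complex_of_real c = of_real (rcard TYPE('k) powi d)" using mult_right_cancel[of ?I] by blast
  then show "c = rcard TYPE('k) powi d" by (simp only: of_real_eq_iff)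
qed

end


section \<open>The quadratic extension\<close>

lemma scales_pair:
  assumes "sigma_finite_measure M" "sigma_finite_measure N" "scales M T c" "scales N S c'"
  shows "scales (M \<Otimes>\<^sub>M N) (\<lambda>(x, y). (T x, S y)) (c * c')"
proof -
  have T: "T \<in> M \<rightarrow>\<^sub>M M" "0 < c" "distr M M T = density M (\<lambda>_. ennreal (1 / c))"
    and S: "S \<in> N \<rightarrow>\<^sub>M N" "0 < c'" "distr N N S = density N (\<lambda>_. ennreal (1 / c'))"
    using assms(3,4) by (auto simp: scales_def)
  have sf: "sigma_finite_measure (density N (\<lambda>_. ennreal (1 / c')))"
    using sigma_finite_measure.sigma_finite_iff_density_finite[OF assms(2), of "\<lambda>_. ennreal (1 / c')"] by simp
  have "distr (M \<Otimes>\<^sub>M N) (M \<Otimes>\<^sub>M N) (\<lambda>(x, y). (T x, S y)) = distr M M T \<Otimes>\<^sub>M distr N N S"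
    using T(1) S(1) sf unfolding S(3)[symmetric] by (intro pair_measure_distr[symmetric])
  also have "\<dots> = density (M \<Otimes>\<^sub>M N) (\<lambda>(x, y). ennreal (1 / c) * ennreal (1 / c'))"
    unfolding T(3) S(3) by (rule pair_measure_density) (use assms(2) sf in auto)
  also have "(\<lambda>(x, y). ennreal (1 / c) * ennreal (1 / c')) = (\<lambda>_. ennreal (1 / (c * c')))"
    using T(2) S(2) by (simp add: fun_eq_iff flip: ennreal_mult)
  finally show ?thesis using T(1,2) S(1,2) by (auto simp: scales_def)
qed

text \<open>A map has only one module, so two computations of it may be equated.\<close>

lemma scales_unique:
  assumes "scales M T c" "scales M T c'" "B \<in> sets M" "emeasure M B = 1"
  shows "c = c'"
proof -
  have "density M (\<lambda>_. ennreal (1 / c)) = density M (\<lambda>_. ennreal (1 / c'))" "c > 0" "c' > 0"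
    using assms by (auto simp: scales_def)
  then have "ennreal (1 / c) * emeasure M B = ennreal (1 / c') * emeasure M B"
    using emeasure_density_const[OF assms(3)] by metis
  then show ?thesis using assms(4) \<open>c > 0\<close> \<open>c' > 0\<close> by simp
qed

lemma scales_transfer:
  assumes J: "J \<in> M \<rightarrow>\<^sub>M N" "N = distr M N J" and S: "scales M S c" and T: "T \<in> N \<rightarrow>\<^sub>M N"
    and comm: "\<And>x. x \<in> space M \<Longrightarrow> T (J x) = J (S x)"
  shows "scales N T c"
proof -
  have Sm: "S \<in> M \<rightarrow>\<^sub>M M" by (rule scales_measurable[OF S])
  have "distr N N T = density N (\<lambda>_. ennreal (1 / c))"
  proof (rule measure_eqI)
    fix B assume "B \<in> sets (distr N N T)"
    then have B: "B \<in> sets N" by simp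
    have TB: "T -` B \<inter> space N \<in> sets N" using T B by measurable
    have JB: "J -` B \<inter> space M \<in> sets M" using J(1) B by measurable
    have eq: "J -` (T -` B \<inter> space N) \<inter> space M = S -` (J -` B \<inter> space M) \<inter> space M"
      using comm measurable_space[OF J(1)] measurable_space[OF Sm] by auto
    have "emeasure (distr N N T) B = emeasure N (T -` B \<inter> space N)" by (rule emeasure_distr[OF T B])
    also have "\<dots> = emeasure (distr M N J) (T -` B \<inter> space N)" using J(2) by simp
    also have "\<dots> = emeasure M (S -` (J -` B \<inter> space M) \<inter> space M)"
      unfolding emeasure_distr[OF J(1) TB] eq ..
    also have "\<dots> = emeasure (distr M M S) (J -` B \<inter> space M)" by (rule emeasure_distr[OF Sm JB, symmetric])
    also have "\<dots> = ennreal (1 / c) * emeasure M (J -` B \<inter> space M)"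
      using S emeasure_density_const[OF JB] by (simp add: scales_def)
    also have "emeasure M (J -` B \<inter> space M) = emeasure (distr M N J) B" by (rule emeasure_distr[OF J(1) B, symmetric])
    also have "\<dots> = emeasure N B" using J(2) by simp
    finally show "emeasure (distr N N T) B = emeasure (density N (\<lambda>_. ennreal (1 / c))) B"
      using emeasure_density_const[OF B] by simp
  qed simp
  then show ?thesis using T scales_pos[OF S] by (simp add: scales_def)
qed

section \<open>Coordinates, conjugation and norm\<close>

context quadratic_setting
begin

abbreviation "\<iota> \<equiv> emb X"
abbreviation "\<alpha> \<equiv> gen X"
abbreviation "\<beta> \<equiv> gen_sq X"

sublocale F: haar "haarF X" by standard (rule haar)
sublocale E: haar "haarE X" by standard (rule haar)

lemma emb_0 [simp]: "\<iota> 0 = 0"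
  using emb_add[of 0 0] by (simp only: add_0_right add_cancel_right_right)

lemma emb_minus: "\<iota> (- a) = - \<iota> a"
  using emb_add[of a "- a"] by (simp add: eq_neg_iff_add_eq_0 add.commute)

lemma emb_diff: "\<iota> (a - b) = \<iota> a - \<iota> b"
  using emb_add[of a "- b"] by (simp add: emb_minus)

lemma emb_power: "\<iota> (a ^ n) = \<iota> a ^ n"
  by (induction n) (simp_all add: emb_one emb_mult)

lemma emb_eq_0_iff [simp]: "\<iota> a = 0 \<longleftrightarrow> a = 0"
proof
  assume "\<iota> a = 0"
  then show "a = 0"
    using emb_mult[of a "inverse a"] emb_one by (cases "a = 0") auto
qed simp

lemma emb_eq_iff [simp]: "\<iota> a = \<iota> b \<longleftrightarrow> a = b"
  using emb_eq_0_iff[of "a - b"] by (simp add: emb_diff)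

lemma emb_inverse: "\<iota> (inverse a) = inverse (\<iota> a)"
proof (cases "a = 0")
  case False
  then have "\<iota> a * \<iota> (inverse a) = 1" by (simp add: emb_one flip: emb_mult)
  then show ?thesis by (simp add: inverse_unique)
qed simp

lemma emb_divide: "\<iota> (a / b) = \<iota> a / \<iota> b"
  by (simp add: divide_inverse emb_mult emb_inverse)

lemma emb_power_int: "\<iota> (a powi n) = \<iota> a powi n"
  by (simp add: power_int_def emb_power emb_inverse)

lemma gen_nonzero [simp]: "\<alpha> \<noteq> 0"
  using gen_notin emb_0 by (metis rangeI)

lemma coord_unique:
  assumes "\<iota> a + \<iota> b * \<alpha> = \<iota> a' + \<iota> b' * \<alpha>"
  shows "a = a' \<and> b = b'"
proof -
  have eq: "\<iota> (a - a') = \<iota> (b' - b) * \<alpha>" using assms by (simp add: emb_diff algebra_simps)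
  have "b = b'"
  proof (rule ccontr)
    assume "b \<noteq> b'"
    then have "\<alpha> = \<iota> ((a - a') / (b' - b))" using eq by (simp add: emb_divide emb_diff)
    then show False using gen_notin by blast
  qed
  then show ?thesis using assms by simp
qed

definition re :: "'e \<Rightarrow> 'f" where "re x = fst (coord X x)"
definition im :: "'e \<Rightarrow> 'f" where "im x = snd (coord X x)"

lemma coord_emb: "coord X (\<iota> a + \<iota> b * \<alpha>) = (a, b)"
proof -
  have "(THE p. case p of (x1, x2) \<Rightarrow> \<iota> a + \<iota> b * \<alpha> = \<iota> x1 + \<iota> x2 * \<alpha>) = (a, b)"
    by (rule the_equality) (auto dest: coord_unique)
  then show ?thesis by (simp add: coord_def)
qed

lemma re_im_emb [simp]: "re (\<iota> a + \<iota> b * \<alpha>) = a" "im (\<iota> a + \<iota> b * \<alpha>) = b"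
  by (simp_all add: re_def im_def coord_emb)

lemma re_im_gen [simp]: "re \<alpha> = 0" "im \<alpha> = 1"
  using re_im_emb[of 0 1] by (simp_all add: emb_one)

lemma decomp: "x = \<iota> (re x) + \<iota> (im x) * \<alpha>"
  using gen_generates[of x] by auto

lemma coord_eq: "coord X x = (re x, im x)"
  by (simp add: re_def im_def)

lemma re_im_eqI: "x = \<iota> a + \<iota> b * \<alpha> \<Longrightarrow> re x = a \<and> im x = b"
  by simp

lemma re_im_simps [simp]:
  "re (\<iota> a) = a" "im (\<iota> a) = 0" "re (\<iota> a * x) = a * re x" "im (\<iota> a * x) = a * im x"
  "re (x + y) = re x + re y" "im (x + y) = im x + im y"
  "re (x - y) = re x - re y" "im (x - y) = im x - im y"
  "re (\<alpha> * x) = \<beta> * im x" "im (\<alpha> * x) = re x"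
proof -
  show "re (\<iota> a) = a" "im (\<iota> a) = 0" using re_im_emb[of a 0] by simp_all
  have "\<iota> a * x = \<iota> (a * re x) + \<iota> (a * im x) * \<alpha>"
    by (subst decomp[of x]) (simp add: emb_mult algebra_simps)
  from re_im_eqI[OF this] show "re (\<iota> a * x) = a * re x" "im (\<iota> a * x) = a * im x" by auto
  have "x + y = \<iota> (re x + re y) + \<iota> (im x + im y) * \<alpha>"
    by (subst decomp[of x], subst decomp[of y]) (simp add: emb_add algebra_simps)
  from re_im_eqI[OF this] show "re (x + y) = re x + re y" "im (x + y) = im x + im y" by auto
  have "x - y = \<iota> (re x - re y) + \<iota> (im x - im y) * \<alpha>"
    by (subst decomp[of x], subst decomp[of y]) (simp add: emb_diff algebra_simps)
  from re_im_eqI[OF this] show "re (x - y) = re x - re y" "im (x - y) = im x - im y" by auto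
  have "\<alpha> * \<alpha> = \<iota> \<beta>" using gen_squared by (simp add: power2_eq_square)
  then have "\<alpha> * x = \<iota> (\<beta> * im x) + \<iota> (re x) * \<alpha>"
    by (subst decomp[of x]) (simp add: emb_mult algebra_simps)
  from re_im_eqI[OF this] show "re (\<alpha> * x) = \<beta> * im x" "im (\<alpha> * x) = re x" by auto
qed

definition conjug :: "'e \<Rightarrow> 'e" where "conjug x = \<iota> (re x) - \<iota> (im x) * \<alpha>"

lemma re_im_conjug [simp]: "re (conjug x) = re x" "im (conjug x) = - im x"
  using re_im_eqI[of "conjug x" "re x" "- im x"] by (simp_all add: conjug_def emb_minus)

lemma conjug_conjug [simp]: "conjug (conjug x) = x"
  using decomp[of x] by (simp add: conjug_def[of "conjug x"] emb_minus)

lemma conjug_mult: "conjug (x * y) = conjug x * conjug y"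
proof -
  have aa: "\<alpha> * \<alpha> = \<iota> \<beta>" using gen_squared by (simp add: power2_eq_square)
  have "x * y = (\<iota> (re x) + \<iota> (im x) * \<alpha>) * (\<iota> (re y) + \<iota> (im y) * \<alpha>)"
    by (simp flip: decomp)
  also have "\<dots> = \<iota> (re x) * \<iota> (re y) + (\<alpha> * \<alpha>) * (\<iota> (im x) * \<iota> (im y)) +
       (\<iota> (re x) * \<iota> (im y) + \<iota> (im x) * \<iota> (re y)) * \<alpha>"
    by (simp add: algebra_simps)
  also have "\<dots> = \<iota> (re x * re y + \<beta> * (im x * im y)) + \<iota> (re x * im y + im x * re y) * \<alpha>"
    unfolding aa by (simp add: emb_mult emb_add)
  finally have "re (x * y) = re x * re y + \<beta> * (im x * im y) \<and> im (x * y) = re x * im y + im x * re y"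
    by (rule re_im_eqI)
  then have "conjug (x * y) = \<iota> (re x) * \<iota> (re y) + \<iota> \<beta> * (\<iota> (im x) * \<iota> (im y)) - (\<iota> (re x) * \<iota> (im y) + \<iota> (im x) * \<iota> (re y)) * \<alpha>"
    by (simp add: conjug_def emb_mult emb_add)
  also have "\<dots> = (\<iota> (re x) - \<iota> (im x) * \<alpha>) * (\<iota> (re y) - \<iota> (im y) * \<alpha>)"
    unfolding aa[symmetric] by (simp add: algebra_simps)
  finally show ?thesis by (simp add: conjug_def)
qed

lemma conjug_1 [simp]: "conjug 1 = 1"
  using re_im_simps(1,2)[of 1] by (simp add: conjug_def emb_one)

lemma conjug_power: "conjug (x ^ n) = conjug x ^ n"
  by (induction n) (simp_all add: conjug_mult)

lemma conjug_eq_0_iff [simp]: "conjug x = 0 \<longleftrightarrow> x = 0"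
proof -
  have "conjug 0 = 0" using re_im_simps(1,2)[of 0] by (simp add: conjug_def)
  then show ?thesis using conjug_conjug[of x] by metis
qed

lemma norm_eq: "\<iota> ((re x)\<^sup>2 - (im x)\<^sup>2 * \<beta>) = x * conjug x"
proof -
  have "\<iota> ((re x)\<^sup>2 - (im x)\<^sup>2 * \<beta>) = \<iota> (re x) * \<iota> (re x) - \<iota> (im x) * \<iota> (im x) * (\<alpha> * \<alpha>)"
    using gen_squared by (simp add: emb_diff emb_mult power2_eq_square)
  also have "\<dots> = (\<iota> (re x) + \<iota> (im x) * \<alpha>) * (\<iota> (re x) - \<iota> (im x) * \<alpha>)"
    by (simp add: algebra_simps)
  finally show ?thesis using decomp[of x] by (simp add: conjug_def)
qed


subsection \<open>Absolute values and Haar measures in the extension\<close>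

lemma continuous_on_emb: "continuous_on A \<iota>"
  by (rule continuous_on_subset[OF emb_continuous subset_UNIV])

lemma measurable_emb [measurable]: "\<iota> \<in> borel_measurable borel"
  by (intro borel_measurable_continuous_onI continuous_on_emb)

lemma measurable_combine: "(\<lambda>(x1, x2). \<iota> x1 + \<iota> x2 * \<alpha>) \<in> (haarF X \<Otimes>\<^sub>M haarF X) \<rightarrow>\<^sub>M borel"
  by measurable

lemma ex_emb_small: "\<exists>n. \<forall>a. absv a \<le> rcard TYPE('f) powi (- int n) \<longrightarrow> absv (\<iota> a) < 1"
proof -
  have "\<exists>\<delta>>0. \<forall>a. dist a 0 < \<delta> \<longrightarrow> dist (\<iota> a) (\<iota> 0) < 1"
    using emb_continuous[unfolded continuous_on_iff, THEN bspec[of _ _ 0], THEN spec[of _ 1]] by simp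
  then obtain \<delta> where d: "\<delta> > 0" and d': "\<forall>a. dist a 0 < \<delta> \<longrightarrow> dist (\<iota> a) (\<iota> 0) < 1" by blast
  have d2: "absv a < \<delta> \<Longrightarrow> absv (\<iota> a) < 1" for a using d' unfolding emb_0 absv_def by blast
  obtain n where "rcard TYPE('f) powi (- int n) \<le> \<delta> / 2" using powi_small[of "\<delta> / 2"] d by auto
  then have "rcard TYPE('f) powi (- int n) < \<delta>" using d by linarith
  then have "\<forall>a. absv a \<le> rcard TYPE('f) powi (- int n) \<longrightarrow> absv (\<iota> a) < 1"
    using d2 by (meson order.strict_trans1)
  then show ?thesis by blast
qed

text \<open>Only continuity of the embedding is used. The elements p u^k all lie in one small ball
  of F, whose image is bounded, while their images would grow if |\<iota> u| > 1; the inverse unit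
  excludes |\<iota> u| < 1.\<close>

lemma absv_emb_unit: "u \<in> integer_units \<Longrightarrow> absv (\<iota> u) = 1"
proof -
  obtain n where n: "\<And>a. absv a \<le> rcard TYPE('f) powi (- int n) \<Longrightarrow> absv (\<iota> a) < 1" using ex_emb_small by blast
  have le: "absv (\<iota> u) \<le> 1" if u: "u \<in> integer_units" for u
  proof (rule ccontr)
    assume "\<not> absv (\<iota> u) \<le> 1"
    define p where "p = unifF X ^ n"
    have "absv (p * u ^ k) = rcard TYPE('f) powi (- int n)" for k
      using u by (simp add: p_def absv_mult absv_power integer_units_def absv_uniformizer[OF unif(1)]
          power_int_minus power_inverse)
    then have lt: "absv (\<iota> p) * absv (\<iota> u) ^ k < 1" for k
      using n[of "p * u ^ k"] by (simp add: emb_mult emb_power absv_mult absv_power)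
    have p0: "absv (\<iota> p) > 0" using uniformizer_nonzero[OF unif(1)] by (simp add: p_def)
    obtain k where "1 / absv (\<iota> p) < absv (\<iota> u) ^ k"
      using real_arch_pow[of "absv (\<iota> u)"] \<open>\<not> absv (\<iota> u) \<le> 1\<close> by auto
    then show False using lt[of k] p0 by (simp add: field_simps)
  qed
  assume u: "u \<in> integer_units"
  have "absv (\<iota> (inverse u)) \<le> 1" by (rule le[OF integer_units_inverse[OF u]])
  then have "inverse (absv (\<iota> u)) \<le> 1" by (simp add: emb_inverse absv_inverse)
  then have "1 \<le> absv (\<iota> u)"
    using integer_units_nonzero[OF u] by (auto simp: inverse_le_1_iff)
  then show ?thesis using le[OF u] by simp
qed

definition ram :: nat where "ram = (SOME e. \<iota> (unifF X) = unifE X ^ e)"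

lemma emb_unif: "\<iota> (unifF X) = unifE X ^ ram"
  unfolding ram_def by (rule someI_ex) (rule unif_compatible)

lemma absv_emb_ram:
  assumes "a \<in> shell k"
  shows "\<iota> a \<in> shell (int ram * k)"
proof -
  define u where "u = unifF X powi (- k) * a"
  have "absv u = 1"
    using uniformizer_powi_shell[OF unif(1), of "- k"] assms by (simp add: u_def absv_mult shell_def power_int_minus)
  then have "absv (\<iota> u) = 1" by (intro absv_emb_unit) (simp add: integer_units_def)
  moreover have "a = unifF X powi k * u"
    using uniformizer_nonzero[OF unif(1)] by (simp add: u_def power_int_minus)
  then have "\<iota> a = \<iota> (unifF X) powi k * \<iota> u" by (simp add: emb_mult emb_power_int)
  ultimately have "absv (\<iota> a) = (absv (unifE X) ^ ram) powi k"
    by (simp add: absv_mult absv_power_int emb_unif absv_power)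
  also have "\<dots> = rcard TYPE('e) powi (- (int ram * k))"
    unfolding absv_uniformizer[OF unif(2)] by (simp add: power_int_minus power_int_inverse flip: power_int_mult power_int_of_nat)
  finally show ?thesis by (simp add: shell_def)
qed

text \<open>The second alternative postpones the measurability of the combined map, which is easier
  to check once the map has been rewritten in closed form.\<close>

lemma scales_coord:
  assumes "scales (haarF X) T c" "scales (haarF X) S c'"
  shows "scales (haarE X) (\<lambda>x. \<iota> (T (re x)) + \<iota> (S (im x)) * \<alpha>) (c * c')
     \<or> (\<lambda>x. \<iota> (T (re x)) + \<iota> (S (im x)) * \<alpha>) \<notin> borel_measurable borel"
proof (cases "(\<lambda>x. \<iota> (T (re x)) + \<iota> (S (im x)) * \<alpha>) \<in> borel_measurable borel")
  case True
  have "scales (haarE X) (\<lambda>x. \<iota> (T (re x)) + \<iota> (S (im x)) * \<alpha>) (c * c')"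
  proof (rule scales_transfer)
    show "(\<lambda>(x1, x2). \<iota> x1 + \<iota> x2 * \<alpha>) \<in> (haarF X \<Otimes>\<^sub>M haarF X) \<rightarrow>\<^sub>M haarE X"
      using measurable_combine by (simp cong: measurable_cong_sets)
    show "haarE X = distr (haarF X \<Otimes>\<^sub>M haarF X) (haarE X) (\<lambda>(x1, x2). \<iota> x1 + \<iota> x2 * \<alpha>)"
      by (subst haar_product, rule distr_cong) simp_all
    show "scales (haarF X \<Otimes>\<^sub>M haarF X) (\<lambda>(x, y). (T x, S y)) (c * c')"
      by (rule scales_pair) (use assms F.sigma_finite_measure_axioms in auto)
    show "(\<lambda>x. \<iota> (T (re x)) + \<iota> (S (im x)) * \<alpha>) \<in> haarE X \<rightarrow>\<^sub>M haarE X"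
      using True by (simp cong: measurable_cong_sets)
  qed auto
  then show ?thesis by blast
qed blast

lemma measurable_mult_left_const: "(*) (c :: 'e) \<in> borel_measurable borel"
  by measurable

lemma scales_emb: "a \<noteq> 0 \<Longrightarrow> scales (haarE X) ((*) (\<iota> a)) ((absv a)\<^sup>2)"
proof -
  assume a: "a \<noteq> 0"
  have eq: "(\<lambda>x. \<iota> (a * re x) + \<iota> (a * im x) * \<alpha>) = (*) (\<iota> a)"
  proof
    fix x show "\<iota> (a * re x) + \<iota> (a * im x) * \<alpha> = \<iota> a * x"
      by (subst (3) decomp) (simp add: emb_mult algebra_simps)
  qed
  show ?thesis using scales_coord[OF F.scales_mult[OF a] F.scales_mult[OF a]] measurable_mult_left_const
    unfolding eq by (simp add: power2_eq_square)
qed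

text \<open>Multiplication by \<iota> a has module |\<iota> a| for the Haar measure of E and |a|^2
  for the product of two copies of the Haar measure of F. The measures coincide.\<close>

lemma absv_emb: "absv (\<iota> a) = (absv a)\<^sup>2"
proof (cases "a = 0")
  case False
  have "{x::'e. absv x \<le> rcard TYPE('e) powi 0} \<in> sets (haarE X)" by (simp del: power_int_0_right)
  moreover have "emeasure (haarE X) {x. absv x \<le> rcard TYPE('e) powi 0} = 1"
    unfolding E.emeasure_absv_ball0 by simp
  ultimately show ?thesis
    using False by (intro scales_unique[OF E.scales_mult scales_emb]) auto
qed simp

lemma rcard_ram: "rcard TYPE('e) ^ ram = (rcard TYPE('f))\<^sup>2"
proof -
  have "\<iota> (unifF X) \<in> shell (int ram * 1)" by (rule absv_emb_ram[OF uniformizer_shell[OF unif(1)]])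
  then have "rcard TYPE('e) powi (- int ram) = (rcard TYPE('f) powi (-1))\<^sup>2"
    using absv_emb[of "unifF X"] absv_uniformizer[OF unif(1)] by (simp add: shell_def)
  then have "inverse (rcard TYPE('e) ^ ram) = inverse ((rcard TYPE('f))\<^sup>2)" by (simp add: power_int_minus power_inverse)
  then show ?thesis by (metis inverse_inverse_eq)
qed

lemma ram_pos: "ram > 0"
proof (rule ccontr)
  assume "\<not> ram > 0"
  then have "(rcard TYPE('f))\<^sup>2 = 1" using rcard_ram by simp
  then show False using rcard_gt_1[where 'k = 'f] power2_eq_1_iff[of "rcard TYPE('f)"] by auto
qed

lemma ln_rcard_ram: "real ram * ln (rcard TYPE('e)) = 2 * ln (rcard TYPE('f))"
proof -
  have "ln (rcard TYPE('e) ^ ram) = ln (rcard TYPE('f) ^ 2)" using rcard_ram by simp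
  then show ?thesis by (simp add: ln_realpow)
qed

text \<open>The left side is the absolute value of E, the right side that of F. Squaring the left
  side gives |\<iota> \<beta>|, and this is |\<beta>|^2.\<close>

lemma absv_gen: "absv \<alpha> = absv \<beta>"
proof -
  have "(absv \<alpha>)\<^sup>2 = absv (\<iota> \<beta>)" using gen_squared by (simp add: absv_power[symmetric])
  then have "(absv \<alpha>)\<^sup>2 = (absv \<beta>)\<^sup>2" by (simp add: absv_emb)
  then show ?thesis by simp
qed

text \<open>F is complete, hence closed in E, and \<alpha> lies outside it.\<close>

lemma ex_gen_distance: "\<exists>\<delta>>0. \<forall>a. \<delta> \<le> absv (\<iota> a + \<alpha>)"
proof (rule ccontr)
  assume neg: "\<not> ?thesis"
  \<comment> \<open>The tolerance is a square because distances in F are square roots of the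
    corresponding distances in E.\<close>
  have "\<exists>a. absv (\<iota> a + \<alpha>) < (1 / (real n + 1))\<^sup>2" for n
  proof -
    have "(1 / (real n + 1))\<^sup>2 > 0" by simp
    then show ?thesis using neg not_le by blast
  qed
  then obtain a where a: "\<And>n. absv (\<iota> (a n) + \<alpha>) < (1 / (real n + 1))\<^sup>2" by metis
  have mono: "(1 / (real n + 1))\<^sup>2 \<le> (1 / (real m + 1))\<^sup>2" if "m \<le> n" for m n
    using that by (intro power_mono divide_left_mono) auto
  have aa: "absv (a m - a n) < 1 / (real k + 1)" if "k \<le> m" "k \<le> n" for m n k
  proof -
    have "(absv (a m - a n))\<^sup>2 = absv ((\<iota> (a m) + \<alpha>) - (\<iota> (a n) + \<alpha>))"
      by (simp add: emb_diff flip: absv_emb)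
    also have "\<dots> \<le> max (absv (\<iota> (a m) + \<alpha>)) (absv (\<iota> (a n) + \<alpha>))" by (rule absv_diff_le)
    also have "\<dots> < (1 / (real k + 1))\<^sup>2"
      using a[of m] a[of n] mono[OF that(1)] mono[OF that(2)] by (simp only: max_less_iff_conj) linarith
    finally show ?thesis by (rule power_less_imp_less_base) simp
  qed
  have "Cauchy a"
  proof (rule metric_CauchyI)
    fix e :: real assume "e > 0"
    then obtain k where k: "1 / (real k + 1) < e" using nat_approx_posE by (metis of_nat_Suc add.commute)
    have "dist (a m) (a n) < e" if "k \<le> m" "k \<le> n" for m n
      using aa[OF that] k by (simp add: dist_eq_absv)
    then show "\<exists>M. \<forall>m\<ge>M. \<forall>n\<ge>M. dist (a m) (a n) < e" by blast
  qed
  then obtain b where b: "a \<longlonglongrightarrow> b" using Cauchy_convergent convergentD by blast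
  have "(\<lambda>n. \<iota> (a n)) \<longlonglongrightarrow> \<iota> b"
    using continuous_on_tendsto_compose[OF emb_continuous b] by simp
  moreover have "(\<lambda>n. \<iota> (a n)) \<longlonglongrightarrow> - \<alpha>"
  proof (subst tendsto_absv_iff, rule tendsto_sandwich[of "\<lambda>_. 0"])
    have "(\<lambda>n. (1 / (real n + 1))\<^sup>2) \<longlonglongrightarrow> 0\<^sup>2"
      by (intro tendsto_power) (use LIMSEQ_inverse_real_of_nat in \<open>simp add: inverse_eq_divide add.commute\<close>)
    then show "(\<lambda>n. (1 / (real n + 1))\<^sup>2) \<longlonglongrightarrow> 0" by simp
    show "\<forall>\<^sub>F n in sequentially. absv (\<iota> (a n) - - \<alpha>) \<le> (1 / (real n + 1))\<^sup>2"
      using a by (intro always_eventually) (auto intro: less_imp_le)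
  qed simp_all
  ultimately have "\<iota> b = - \<alpha>" by (rule LIMSEQ_unique)
  then have "\<alpha> = \<iota> (- b)" by (simp add: emb_minus)
  then show False using gen_notin by blast
qed

text \<open>Pulling x_2 out of x leaves an element of the coset \<alpha> + F, whose absolute value
  is bounded below. The square reflects |\<iota> a| = |a|^2. The bound makes the coordinates
  continuous and limits the cells inside a shell.\<close>

lemma im_bound: obtains C where "C > 0" "\<And>x. (absv (im x))\<^sup>2 \<le> C * absv x"
proof -
  obtain \<delta> where d: "\<delta> > 0" "\<And>a. \<delta> \<le> absv (\<iota> a + \<alpha>)" using ex_gen_distance by blast
  have "(absv (im x))\<^sup>2 \<le> 1 / \<delta> * absv x" for x
  proof (cases "im x = 0")
    case False
    have "x = \<iota> (im x) * (\<iota> (re x / im x) + \<alpha>)"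
      using False by (subst (1) decomp) (simp add: emb_divide algebra_simps)
    then have "absv x = (absv (im x))\<^sup>2 * absv (\<iota> (re x / im x) + \<alpha>)" by (metis absv_mult absv_emb)
    also have "\<dots> \<ge> (absv (im x))\<^sup>2 * \<delta>" by (intro mult_left_mono d) simp
    finally show ?thesis using d(1) by (simp add: field_simps)
  qed (use d in simp)
  then show thesis using d(1) that[of "1 / \<delta>"] by simp
qed

text \<open>Multiplication by \<alpha> turns x_1 into a second coordinate.\<close>

lemma re_bound: obtains C where "C > 0" "\<And>x. (absv (re x))\<^sup>2 \<le> C * absv x"
proof -
  obtain C where C: "C > 0" "\<And>x. (absv (im x))\<^sup>2 \<le> C * absv x" by (rule im_bound) blast
  have "(absv (re x))\<^sup>2 \<le> (C * absv \<alpha>) * absv x" for x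
    using C(2)[of "\<alpha> * x"] by (simp add: absv_mult mult.assoc)
  then show thesis using C(1) that[of "C * absv \<alpha>"] by simp
qed

lemma continuous_on_re: "continuous_on A re" and continuous_on_im: "continuous_on A im"
proof -
  have *: "continuous_on A g" if C: "C > 0" "\<And>x. (absv (g x))\<^sup>2 \<le> C * absv x" and d: "\<And>x y. g (x - y) = g x - g y"
    for g :: "'e \<Rightarrow> 'f" and C
    unfolding continuous_on_iff
  proof (intro ballI allI impI)
    fix x e assume e: "e > (0::real)"
    have "dist (g x') (g x) < e" if "dist x' x < e\<^sup>2 / C" for x'
    proof -
      have "(absv (g x' - g x))\<^sup>2 \<le> C * absv (x' - x)" using C(2)[of "x' - x"] by (simp add: d)
      also have "\<dots> < C * (e\<^sup>2 / C)" using that C(1) by (intro mult_strict_left_mono) (simp_all add: dist_eq_absv)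
      finally have "(absv (g x' - g x))\<^sup>2 < e\<^sup>2" using C(1) by simp
      then show ?thesis using e power_less_imp_less_base[of _ 2 e] by (simp add: dist_eq_absv)
    qed
    then show "\<exists>d>0. \<forall>x'\<in>A. dist x' x < d \<longrightarrow> dist (g x') (g x) < e"
      using e C(1) by (intro exI[of _ "e\<^sup>2 / C"]) auto
  qed
  obtain C where C: "C > 0" "\<And>x. (absv (re x))\<^sup>2 \<le> C * absv x" by (rule re_bound) blast
  show "continuous_on A re" by (rule *[OF C]) simp_all
  obtain C where C: "C > 0" "\<And>x. (absv (im x))\<^sup>2 \<le> C * absv x" by (rule im_bound) blast
  show "continuous_on A im" by (rule *[OF C]) simp_all
qed

lemma measurable_re [measurable]: "re \<in> borel_measurable borel"
  and measurable_im [measurable]: "im \<in> borel_measurable borel"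
  by (intro borel_measurable_continuous_onI continuous_on_re continuous_on_im)+

lemma measurable_conjug [measurable]: "conjug \<in> borel_measurable borel"
  unfolding conjug_def by measurable

text \<open>A bound |conjug x| \<le> C |x| follows from the coordinate bounds. Both sides are
  multiplicative, so applying it to powers of x improves the constant to 1.\<close>

lemma absv_conjug [simp]: "absv (conjug x) = absv x"
proof -
  obtain C1 where C1: "C1 > 0" "\<And>x. (absv (re x))\<^sup>2 \<le> C1 * absv x" by (rule re_bound) blast
  obtain C2 where C2: "C2 > 0" "\<And>x. (absv (im x))\<^sup>2 \<le> C2 * absv x" by (rule im_bound) blast
  define C where "C = C1 + C2 * absv \<alpha>"
  have C: "absv (conjug x) \<le> C * absv x" for x
  proof -
    have "absv (conjug x) \<le> max ((absv (re x))\<^sup>2) ((absv (im x))\<^sup>2 * absv \<alpha>)"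
      unfolding conjug_def absv_emb[symmetric] absv_mult[symmetric] by (rule absv_diff_le)
    also have "\<dots> \<le> (absv (re x))\<^sup>2 + (absv (im x))\<^sup>2 * absv \<alpha>" by simp
    also have "\<dots> \<le> C1 * absv x + (C2 * absv x) * absv \<alpha>"
      by (intro add_mono mult_right_mono C1 C2) simp
    also have "\<dots> = C * absv x" by (simp add: C_def algebra_simps)
    finally show ?thesis .
  qed
  have le: "absv (conjug x) \<le> absv x" for x
  proof (cases "x = 0")
    case False
    show ?thesis
    proof (rule ccontr)
      assume "\<not> absv (conjug x) \<le> absv x"
      then have "1 < absv (conjug x) / absv x" using False by simp
      then obtain n where "C < (absv (conjug x) / absv x) ^ n" using real_arch_pow by blast
      then have "C * absv (x ^ n) < absv (conjug (x ^ n))"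
        using False by (simp add: conjug_power absv_power power_divide field_simps)
      then show False using C[of "x ^ n"] by simp
    qed
  qed simp
  show ?thesis using le[of x] le[of "conjug x"] by simp
qed

lemma absv_norm: "absv ((re x)\<^sup>2 - (im x)\<^sup>2 * \<beta>) = absv x"
proof -
  have "(absv ((re x)\<^sup>2 - (im x)\<^sup>2 * \<beta>))\<^sup>2 = (absv x)\<^sup>2"
    unfolding absv_emb[symmetric] norm_eq by (simp add: absv_mult power2_eq_square)
  then show ?thesis by simp
qed

lemma scales_conjug: "scales (haarE X) conjug 1"
proof -
  have id: "scales (haarF X) ((*) 1) 1" using F.scales_mult[of 1] by simp
  have neg: "scales (haarF X) ((*) (-1)) 1" using F.scales_mult[of "-1"] by simp
  have "(\<lambda>x. \<iota> (1 * re x) + \<iota> ((-1) * im x) * \<alpha>) = conjug"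
    by (simp add: fun_eq_iff conjug_def emb_minus)
  then show ?thesis using scales_coord[OF id neg] measurable_conjug by simp
qed

text \<open>Stretches only the direction transversal to F. Near F this keeps |x| fixed and moves one
  cell to the next, which makes the tail along the subfield geometric.\<close>

definition imscale :: "'f \<Rightarrow> 'e \<Rightarrow> 'e" where "imscale a x = \<iota> (re x) + \<iota> (a * im x) * \<alpha>"

lemma re_im_imscale [simp]: "re (imscale a x) = re x" "im (imscale a x) = a * im x"
  by (simp_all add: imscale_def)

lemma scales_imscale: "a \<noteq> 0 \<Longrightarrow> scales (haarE X) (imscale a) (absv a)"
proof -
  assume a: "a \<noteq> 0"
  have id: "scales (haarF X) ((*) 1) 1" using F.scales_mult[of 1] by simp
  have eq: "(\<lambda>x. \<iota> (1 * re x) + \<iota> (a * im x) * \<alpha>) = imscale a" by (simp add: imscale_def fun_eq_iff)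
  have "imscale a \<in> borel_measurable borel" unfolding imscale_def by measurable
  then show ?thesis using scales_coord[OF id F.scales_mult[OF a], unfolded eq] by simp
qed

end

section \<open>The kernel\<close>

lemma absv_powr_ln:
  "x \<noteq> 0 \<Longrightarrow> complex_of_real (absv x) powr s = exp (s * of_real (ln (absv x)))"
  by (simp add: powr_def Ln_of_real)

lemma ln_absv_shell: "x \<in> shell k \<Longrightarrow> ln (absv (x::'k::nonarch_local_field)) = - (of_int k * ln (rcard TYPE('k)))"
  using powr_real_of_int'[of "rcard TYPE('k)" "- k"] ln_powr[of "rcard TYPE('k)" "of_int (- k)"]
  by (simp add: shell_def)

lemma ln_absv_divide: "x \<noteq> 0 \<Longrightarrow> y \<noteq> 0 \<Longrightarrow> ln (absv (x / y)) = ln (absv x) - ln (absv y)"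
  by (simp add: absv_divide ln_div)

section \<open>Unitary part of the kernel and its integrals over cells\<close>

locale quadratic_chars = quadratic_setting X
  for X :: "('f::nonarch_local_field, 'e::nonarch_local_field) quadratic_data" +
  fixes chi :: "'e \<Rightarrow> complex" and eta :: "'f \<Rightarrow> complex"
  assumes chi: "chi \<in> unit_characters" and eta: "eta \<in> unit_characters"
begin

definition c0 :: "'e \<Rightarrow> complex" where "c0 = qchar (unifE X) chi 0"
definition e0 :: "'f \<Rightarrow> complex" where "e0 = qchar (unifF X) eta 0"

lemma c0_simps: "c0 0 = 0" "c0 1 = 1" "c0 (x * y) = c0 x * c0 y" "c0 (x / y) = c0 x / c0 y"
  "c0 (inverse x) = inverse (c0 x)" "c0 (x ^ n) = c0 x ^ n"
  unfolding c0_def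
  by (simp_all add: qchar_0[OF chi unif(2)] qchar_1[OF chi unif(2)] qchar_mult[OF chi unif(2)]
      qchar_divide[OF chi unif(2)] qchar_inverse[OF chi unif(2)] qchar_power[OF chi unif(2)])

lemma e0_simps: "e0 0 = 0" "e0 1 = 1" "e0 (x * y) = e0 x * e0 y" "e0 (x / y) = e0 x / e0 y"
  "e0 (inverse x) = inverse (e0 x)" "e0 (x ^ n) = e0 x ^ n"
  unfolding e0_def
  by (simp_all add: qchar_0[OF eta unif(1)] qchar_1[OF eta unif(1)] qchar_mult[OF eta unif(1)]
      qchar_divide[OF eta unif(1)] qchar_inverse[OF eta unif(1)] qchar_power[OF eta unif(1)])

lemma c0_nonzero: "x \<noteq> 0 \<Longrightarrow> c0 x \<noteq> 0"
  unfolding c0_def by (rule qchar_nonzero[OF chi unif(2)])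

lemma e0_nonzero: "x \<noteq> 0 \<Longrightarrow> e0 x \<noteq> 0"
  unfolding e0_def by (rule qchar_nonzero[OF eta unif(1)])

lemma c0_unit: "u \<in> integer_units \<Longrightarrow> c0 u = chi u"
  unfolding c0_def by (rule qchar_unit[OF chi unif(2)])

lemma e0_unit: "u \<in> integer_units \<Longrightarrow> e0 u = eta u"
  unfolding e0_def by (rule qchar_unit[OF eta unif(1)])

lemma emb_unit: "u \<in> integer_units \<Longrightarrow> \<iota> u \<in> integer_units"
  by (simp add: absv_emb integer_units_def)

text \<open>The uniformizers are compatible, so \<chi>_0 is 1 at both of them. This keeps the ratios
  of the geometric series free of a phase.\<close>

lemma c0_unif [simp]: "c0 (\<iota> (unifF X)) = 1"
  using qchar_uniformizer_0[OF chi unif(2)] unfolding emb_unif c0_simps by (simp add: c0_def)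

lemma e0_unif [simp]: "e0 (unifF X) = 1"
  unfolding e0_def by (rule qchar_uniformizer_0[OF eta unif(1)])

lemma measurable_c0 [measurable]: "c0 \<in> borel_measurable borel"
  unfolding c0_def by (rule measurable_qchar[OF chi unif(2)])

lemma measurable_e0 [measurable]: "e0 \<in> borel_measurable borel"
  unfolding e0_def by (rule measurable_qchar[OF eta unif(1)])

definition nrm :: "'e \<Rightarrow> 'f" where "nrm x = (re x)\<^sup>2 - (im x)\<^sup>2 * \<beta>"

lemma absv_nrm: "absv (nrm x) = absv x"
  unfolding nrm_def by (rule absv_norm)

lemma emb_nrm: "\<iota> (nrm x) = x * conjug x"
  unfolding nrm_def by (rule norm_eq)

lemma nrm_eq_0_iff [simp]: "nrm x = 0 \<longleftrightarrow> x = 0"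
  by (metis absv_nrm absv_eq_0_iff)

lemma nrm_emb_mult: "nrm (\<iota> a * x) = a\<^sup>2 * nrm x"
  by (simp add: nrm_def) (simp add: power_mult_distrib algebra_simps)

definition K0 :: "'e \<Rightarrow> complex" where
  "K0 x = c0 (x\<^sup>2) * (c0 (\<iota> (im x / nrm x)) * e0 (im x / nrm x))"

text \<open>The norm is x times its conjugate, so half of the factor c0 (x^2) cancels. The remaining
  quotient c0 x / c0 (conjug x) is 1 close to F, where x and its conjugate nearly agree.\<close>

lemma K0_eq: "K0 x = c0 x / c0 (conjug x) * (c0 (\<iota> (im x)) * e0 (im x) / e0 (nrm x))"
proof (cases "x = 0")
  case False
  then show ?thesis
    using c0_nonzero[OF False] unfolding K0_def emb_divide emb_nrm c0_simps e0_simps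
    by (simp add: power2_eq_square)
qed (simp add: K0_def c0_simps)

lemma K0_im_0: "im x = 0 \<Longrightarrow> K0 x = 0"
  by (simp add: K0_def c0_simps)

lemma measurable_K0 [measurable]: "K0 \<in> borel_measurable borel"
proof -
  have "nrm \<in> borel_measurable borel" unfolding nrm_def power2_eq_square by measurable
  then have "(\<lambda>x. c0 x / c0 (conjug x) * (c0 (\<iota> (im x)) * e0 (im x) / e0 (nrm x))) \<in> borel_measurable borel"
    by measurable
  then show ?thesis by (simp add: K0_eq[abs_def])
qed

lemma norm_K0_le: "norm (K0 x) \<le> 1"
proof -
  have "norm (c0 y) \<le> 1" for y unfolding c0_def by (rule qchar_norm_le[OF chi unif(2)])
  moreover have "norm (e0 y) \<le> 1" for y unfolding e0_def by (rule qchar_norm_le[OF eta unif(1)])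
  ultimately show ?thesis unfolding K0_def norm_mult by (simp add: mult_le_one)
qed

text \<open>x^2 contributes c0 (\<iota> a) twice and the quotient of x_2 by the norm scales by
  a^(-1). The result is the character in \<lambda>_-.\<close>

lemma K0_emb_mult: "a \<noteq> 0 \<Longrightarrow> K0 (\<iota> a * x) = c0 (\<iota> a) / e0 a * K0 x"
proof -
  assume a: "a \<noteq> 0"
  have eq: "im (\<iota> a * x) / nrm (\<iota> a * x) = inverse a * (im x / nrm x)"
    unfolding nrm_emb_mult using a by (simp add: power2_eq_square divide_inverse)
  show ?thesis
    using c0_nonzero[of "\<iota> a"] e0_nonzero[OF a] a unfolding K0_def eq
    by (simp add: emb_mult emb_inverse c0_simps e0_simps power2_eq_square divide_inverse)
qed

text \<open>The modulus part |x|^(-(t + 1/2)) |x_2|^(2 s + t - 1/2) of the kernel, written with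
  exponentials so that it is visibly entire in s and t.\<close>

definition kpow :: "complex \<Rightarrow> complex \<Rightarrow> int \<Rightarrow> int \<Rightarrow> complex" where
  "kpow s t l j = exp (of_int l * (t + 1/2) * of_real (ln (rcard TYPE('e))) - of_int j * (2 * s + t - 1/2) * of_real (ln (rcard TYPE('f))))"

definition cell :: "int \<Rightarrow> int \<Rightarrow> 'e set" where
  "cell l j = {x. x \<in> shell l \<and> im x \<in> shell j}"

lemma kernel_im_0: "im x = 0 \<Longrightarrow> kernel X chi s eta t x = 0"
  by (simp add: kernel_def coord_eq qchar_def)

lemma kernel_cell:
  assumes "x \<in> cell l j"
  shows "kernel X chi s eta t x = kpow s t l j * K0 x"
proof -
  have x: "x \<noteq> 0" and y: "im x \<noteq> 0" and xs: "x \<in> shell l" and ys: "im x \<in> shell j"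
    using assms by (auto simp: cell_def shell_iff)
  define z where "z = im x / nrm x"
  have z: "z \<noteq> 0" using x y by (simp add: z_def)
  have lz: "ln (absv z) = ln (absv (im x)) - ln (absv x)"
    using ln_absv_divide[OF y, of "nrm x"] x by (simp add: z_def absv_nrm)
  have liz: "ln (absv (\<iota> z)) = 2 * ln (absv z)" using z by (simp add: absv_emb ln_realpow)
  have lx2: "ln (absv (x\<^sup>2)) = 2 * ln (absv x)" using x by (simp add: absv_power ln_realpow)
  have "kernel X chi s eta t x = qchar (unifE X) chi (s - 1/2) (x\<^sup>2) *
      (qchar (unifE X) chi (s - 1/2) (\<iota> z) * qchar (unifF X) eta (t + 1/2) z)"
    by (simp add: kernel_def coord_eq z_def nrm_def Let_def)
  also have "\<dots> = (c0 (x\<^sup>2) * (c0 (\<iota> z) * e0 z)) *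
      (complex_of_real (absv (x\<^sup>2)) powr (s - 1/2) * (complex_of_real (absv (\<iota> z)) powr (s - 1/2) *
       complex_of_real (absv z) powr (t + 1/2)))"
    by (subst qchar_decomp[OF chi unif(2)], subst (2) qchar_decomp[OF chi unif(2)],
        subst qchar_decomp[OF eta unif(1)]) (simp add: c0_def e0_def)
  also have "c0 (x\<^sup>2) * (c0 (\<iota> z) * e0 z) = K0 x" by (simp add: K0_def z_def)
  also have "complex_of_real (absv (x\<^sup>2)) powr (s - 1/2) * (complex_of_real (absv (\<iota> z)) powr (s - 1/2) *
       complex_of_real (absv z) powr (t + 1/2)) = kpow s t l j"
  proof -
    have "x\<^sup>2 \<noteq> 0" "\<iota> z \<noteq> 0" using x z by auto
    then show ?thesis
      unfolding absv_powr_ln[OF \<open>x\<^sup>2 \<noteq> 0\<close>] absv_powr_ln[OF \<open>\<iota> z \<noteq> 0\<close>] absv_powr_ln[OF z] exp_add[symmetric]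
        kpow_def liz lx2 lz ln_absv_shell[OF xs] ln_absv_shell[OF ys]
      by (simp add: algebra_simps)
  qed
  finally show ?thesis by (simp add: mult.commute)
qed

lemma sets_cell [measurable]: "cell l j \<in> sets borel"
proof -
  have "im -` shell j \<inter> space borel \<in> sets borel" by (rule measurable_sets[OF measurable_im F.sets_shell])
  then have "shell l \<inter> (im -` shell j \<inter> space borel) \<in> sets borel" by (rule sets.Int[OF E.sets_shell])
  moreover have "cell l j = shell l \<inter> (im -` shell j \<inter> space borel)" by (auto simp: cell_def)
  ultimately show ?thesis by simp
qed

lemma emeasure_cell_finite: "emeasure (haarE X) (cell l j) < \<infinity>"
proof -
  have "emeasure (haarE X) (cell l j) \<le> emeasure (haarE X) (shell l)"
    by (intro emeasure_mono) (auto simp: cell_def)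
  then show ?thesis using E.emeasure_shell_finite[of l] by (rule order.strict_trans1)
qed

lemma cell_disjoint: "(l, j) \<noteq> (l', j') \<Longrightarrow> cell l j \<inter> cell l' j' = {}"
  by (auto simp: cell_def shell_iff)

lemma measurable_kernel [measurable]: "kernel X chi s eta t \<in> borel_measurable borel"
proof -
  have "(\<lambda>x. K0 x * (exp ((2 * s + t - 1/2) * of_real (ln (absv (im x))) - (t + 1/2) * of_real (ln (absv x)))))
      \<in> borel_measurable borel"
    by measurable
  moreover have "kernel X chi s eta t x = K0 x *
      (exp ((2 * s + t - 1/2) * of_real (ln (absv (im x))) - (t + 1/2) * of_real (ln (absv x))))" for x
  proof (cases "im x = 0")
    case False
    then have "x \<noteq> 0" using re_im_simps(2)[of 0] by auto
    then obtain l j where lj: "x \<in> cell l j" using False by (auto simp: cell_def shell_iff)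
    then have xs: "x \<in> shell l" and ys: "im x \<in> shell j" by (auto simp: cell_def)
    show ?thesis unfolding kernel_cell[OF lj] kpow_def ln_absv_shell[OF xs] ln_absv_shell[OF ys]
      by (simp add: algebra_simps)
  qed (simp add: kernel_im_0 K0_im_0)
  then have "kernel X chi s eta t = (\<lambda>x. K0 x *
      (exp ((2 * s + t - 1/2) * of_real (ln (absv (im x))) - (t + 1/2) * of_real (ln (absv x)))))" by (rule ext)
  ultimately show ?thesis by (simp only:)
qed

text \<open>Independent of s and t: the whole dependence of a cell integral on the parameters sits
  in \<open>kpow\<close>.\<close>

definition kap :: "('e \<Rightarrow> complex) \<Rightarrow> int \<Rightarrow> int \<Rightarrow> complex" where
  "kap f l j = (LINT x:cell l j|haarE X. K0 x * f x)"

lemma cell_integral: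
  "(LINT x:cell l j|haarE X. kernel X chi s eta t x * f x) = kpow s t l j * kap f l j"
proof -
  have "(LINT x:cell l j|haarE X. kernel X chi s eta t x * f x) =
      (LINT x:cell l j|haarE X. kpow s t l j * (K0 x * f x))"
    unfolding set_lebesgue_integral_def
    by (intro Bochner_Integration.integral_cong refl) (auto simp: indicator_def kernel_cell)
  then show ?thesis by (simp add: kap_def)
qed

lemma cell_integrable:
  assumes "f \<in> borel_measurable borel" "\<And>x. norm (f x) \<le> B"
  shows "set_integrable (haarE X) (cell l j) (\<lambda>x. kernel X chi s eta t x * f x)"
proof (rule E.set_integrable_bounded[OF _ _ emeasure_cell_finite, where B = "norm (kpow s t l j) * (1 * B)"])
  fix x assume "x \<in> cell l j"
  then show "norm (kernel X chi s eta t x * f x) \<le> norm (kpow s t l j) * (1 * B)"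
    unfolding kernel_cell[OF \<open>x \<in> cell l j\<close>] norm_mult mult.assoc
    by (intro mult_left_mono mult_mono norm_K0_le assms) auto
qed (use assms in measurable)

lemma cell_empty:
  obtains C where "C > 0" "\<And>l j. cell l j \<noteq> {} \<Longrightarrow> (rcard TYPE('f) powi (- j))\<^sup>2 \<le> C * rcard TYPE('e) powi (- l)"
proof -
  obtain C where C: "C > 0" "\<And>x. (absv (im x))\<^sup>2 \<le> C * absv x" by (rule im_bound) blast
  show thesis
  proof (rule that[OF C(1)])
    fix l j assume "cell l j \<noteq> {}"
    then obtain x where "x \<in> cell l j" by blast
    then show "(rcard TYPE('f) powi (- j))\<^sup>2 \<le> C * rcard TYPE('e) powi (- l)"
      using C(2)[of x] by (simp add: cell_def shell_def)
  qed
qed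

lemma ex_cell_empty: "\<exists>j1. \<forall>l\<ge>l0. \<forall>j<j1. cell l j = {}"
proof -
  obtain C where C: "C > 0" "\<And>l j. cell l j \<noteq> {} \<Longrightarrow> (rcard TYPE('f) powi (- j))\<^sup>2 \<le> C * rcard TYPE('e) powi (- l)"
    by (rule cell_empty) blast
  obtain n where n: "max 1 (C * rcard TYPE('e) powi (- l0)) \<le> rcard TYPE('f) powi (int n)" by (rule powi_large)
  have "cell l j = {}" if "l \<ge> l0" "j < - int n" for l j
  proof (rule ccontr)
    assume "cell l j \<noteq> {}"
    then have "(rcard TYPE('f) powi (- j))\<^sup>2 \<le> C * rcard TYPE('e) powi (- l)" by (rule C(2))
    also have "\<dots> \<le> C * rcard TYPE('e) powi (- l0)" using that C(1) by (simp add: powi_le_iff)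
    also have "\<dots> \<le> rcard TYPE('f) powi (int n)" using n by simp
    also have "\<dots> < rcard TYPE('f) powi (- j)" unfolding powi_less_iff using that by simp
    finally have lt: "(rcard TYPE('f) powi (- j))\<^sup>2 < rcard TYPE('f) powi (- j) * 1" by simp
    have "rcard TYPE('f) powi 0 \<le> rcard TYPE('f) powi (- j)" unfolding powi_le_iff using that by simp
    then have "rcard TYPE('f) powi (- j) * 1 \<le> rcard TYPE('f) powi (- j) * rcard TYPE('f) powi (- j)"
      by (intro mult_left_mono) auto
    with lt show False by (simp add: power2_eq_square)
  qed
  then show ?thesis by (intro exI[of _ "- int n"]) blast
qed

lemma kap_scale: "kap (\<lambda>_. 1) (l + int ram) (j + 1) = of_real (1 / (rcard TYPE('f))\<^sup>2) * kap (\<lambda>_. 1) l j"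
proof -
  let ?p = "unifF X"
  have p0: "?p \<noteq> 0" by (rule uniformizer_nonzero[OF unif(1)])
  have ip: "\<iota> ?p \<in> shell (int ram)" using absv_emb_ram[OF uniformizer_shell[OF unif(1)]] by simp
  have "(LINT x:cell (l + int ram) (j + 1)|haarE X. K0 x * 1) =
      of_real ((absv ?p)\<^sup>2) * 1 * (LINT x:cell l j|haarE X. K0 x * 1)"
  proof (rule scales_set_integral(1)[OF scales_emb[OF p0]])
    show "x \<in> cell l j \<longleftrightarrow> \<iota> ?p * x \<in> cell (l + int ram) (j + 1)" for x
      using shell_mult_iff[OF ip, of x l] shell_mult_iff[OF uniformizer_shell[OF unif(1)], of "im x" j]
      by (simp add: cell_def add.commute)
    show "K0 (\<iota> ?p * x) * 1 = 1 * (K0 x * 1)" for x using K0_emb_mult[OF p0, of x] by simp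
  qed measurable
  then show ?thesis
    by (simp add: kap_def absv_uniformizer[OF unif(1)] power_int_minus power_inverse inverse_eq_divide power_divide)
qed

lemma emb_unit_shell: "u \<in> integer_units \<Longrightarrow> \<iota> u \<in> shell 0"
  unfolding shell_0 by (rule emb_unit)

text \<open>A unit u of F maps the cell to itself and multiplies \<open>K0\<close> by the value of
  \<chi> \<eta>^(-1) at u. This is the reason why \<lambda>_- needs no factor for a nontrivial
  character.\<close>

lemma kap_eq_0:
  assumes "\<not> trivial_on_units (\<lambda>u. chi (\<iota> u) * inverse (eta u))"
  shows "kap (\<lambda>_. 1) l j = 0"
proof -
  obtain u where u: "u \<in> integer_units" "chi (\<iota> u) * inverse (eta u) \<noteq> 1"
    using assms by (auto simp: trivial_on_units_def)
  have u0: "u \<noteq> 0" by (rule integer_units_nonzero[OF u(1)])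
  have us: "u \<in> shell 0" using u(1) by (simp add: shell_0)
  have "(LINT x:cell l j|haarE X. K0 x * 1) =
      of_real ((absv u)\<^sup>2) * (chi (\<iota> u) * inverse (eta u)) * (LINT x:cell l j|haarE X. K0 x * 1)"
  proof (rule scales_set_integral(1)[OF scales_emb[OF u0]])
    show "x \<in> cell l j \<longleftrightarrow> \<iota> u * x \<in> cell l j" for x
      using shell_mult_iff[OF emb_unit_shell[OF u(1)], of x l] shell_mult_iff[OF us, of "im x" j]
      by (simp add: cell_def)
    show "K0 (\<iota> u * x) * 1 = chi (\<iota> u) * inverse (eta u) * (K0 x * 1)" for x
      using K0_emb_mult[OF u0, of x] by (simp add: c0_unit[OF emb_unit[OF u(1)]] e0_unit[OF u(1)] divide_inverse)
  qed measurable
  then have "kap (\<lambda>_. 1) l j * (1 - chi (\<iota> u) * inverse (eta u)) = 0"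
    using u(1) by (simp add: kap_def integer_units_def algebra_simps)
  then show ?thesis using u(2) by simp
qed


subsection \<open>Cells close to the subfield\<close>

text \<open>The level \<open>J\<close> is so large that on shells up to index \<open>L\<close> the points at distance at most
  \<open>q\<^sub>F powi - J\<close> from the subfield behave like points of the subfield.\<close>

definition fine_level :: "('e \<Rightarrow> complex) \<Rightarrow> int \<Rightarrow> int \<Rightarrow> bool" where
  "fine_level f L J \<longleftrightarrow>
     (rcard TYPE('f) powi (- J))\<^sup>2 * absv \<alpha> < rcard TYPE('e) powi (- L) \<and>
     (\<forall>x. rcard TYPE('e) powi (- L) \<le> absv x \<and> absv (im x) \<le> rcard TYPE('f) powi (- J) \<longrightarrow>
        K0 x = inverse (e0 (re x) ^ 2) * (c0 (\<iota> (im x)) * e0 (im x)) \<and> f x = f (\<iota> (re x)))"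

lemma re_close:
  assumes "rcard TYPE('e) powi (- L) \<le> absv x" "absv (im x) \<le> rcard TYPE('f) powi (- J)"
    and J: "(rcard TYPE('f) powi (- J))\<^sup>2 * absv \<alpha> < rcard TYPE('e) powi (- L)"
  shows "absv (\<iota> (re x)) = absv x"
proof (rule absv_close_eq)
  have "absv (\<iota> (re x) - x) = (absv (im x))\<^sup>2 * absv \<alpha>"
    by (subst (2) decomp) (simp add: absv_mult absv_emb)
  also have "\<dots> \<le> (rcard TYPE('f) powi (- J))\<^sup>2 * absv \<alpha>"
    using assms by (intro mult_right_mono power_mono) auto
  finally show "absv (\<iota> (re x) - x) < absv x" using J assms(1) by linarith
qed

lemma ex_small_level:
  assumes "(\<epsilon>::real) > 0"
  obtains n :: nat where "\<And>J. J \<ge> int n \<Longrightarrow> (rcard TYPE('f) powi (- J))\<^sup>2 * C \<le> \<epsilon>"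
proof -
  have pos: "\<epsilon> / (\<bar>C\<bar> + 1) > 0" using assms by (simp add: add_nonneg_pos)
  obtain n where n: "rcard TYPE('f) powi (- int n) \<le> \<epsilon> / (\<bar>C\<bar> + 1)" using powi_small[OF pos] .
  have "(rcard TYPE('f) powi (- J))\<^sup>2 * C \<le> \<epsilon>" if "J \<ge> int n" for J
  proof -
    have le: "rcard TYPE('f) powi (- J) \<le> rcard TYPE('f) powi (- int n)" unfolding powi_le_iff using that by simp
    have le1: "rcard TYPE('f) powi (- J) \<le> rcard TYPE('f) powi 0" unfolding powi_le_iff using that by simp
    have "(rcard TYPE('f) powi (- J))\<^sup>2 * C \<le> (rcard TYPE('f) powi (- J))\<^sup>2 * (\<bar>C\<bar> + 1)"
      by (intro mult_left_mono) auto
    also have "\<dots> \<le> (rcard TYPE('f) powi (- int n) * 1) * (\<bar>C\<bar> + 1)"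
      unfolding power2_eq_square using le le1 by (intro mult_right_mono mult_mono) (auto simp del: power_int_of_nat)
    also have "\<dots> \<le> \<epsilon>" using n by (simp add: pos_le_divide_eq)
    finally show ?thesis .
  qed
  then show thesis by (rule that)
qed

text \<open>Every requirement asks that \<iota> (im x) \<alpha> be small compared with a fixed
  radius, because |x| is bounded below on the shells concerned.\<close>

lemma ex_fine_level:
  assumes loc: "\<And>x y. absv (x - y) \<le> rcard TYPE('e) powi (- int n) \<Longrightarrow> f x = f y"
  shows "\<exists>J0. \<forall>J\<ge>J0. fine_level f L J"
proof -
  obtain m where m: "\<And>x y s. absv y \<le> rcard TYPE('e) powi (- int m) * absv x \<Longrightarrow>
      qchar (unifE X) chi s (x + y) = qchar (unifE X) chi s x"
    by (rule qchar_locally_constant[OF chi unif(2)]) blast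
  obtain m' where m': "\<And>x y s. absv y \<le> rcard TYPE('f) powi (- int m') * absv x \<Longrightarrow>
      qchar (unifF X) eta s (x + y) = qchar (unifF X) eta s x"
    by (rule qchar_locally_constant[OF eta unif(1)]) blast
  define r where "r = rcard TYPE('e) powi (- L)"
  \<comment> \<open>In order: strictness of the size condition, constancy of f, constancy of the
    character of E near the conjugate of x, and constancy of the character of F near the square of
    x_1.\<close>
  define \<epsilon> where "\<epsilon> = min (r / 2) (min (rcard TYPE('e) powi (- int n))
      (min (rcard TYPE('e) powi (- int m) * r) (rcard TYPE('f) powi (- int m') * r)))"
  have r0: "r > 0" by (simp add: r_def zero_less_power_int)
  have e0: "\<epsilon> > 0" using r0 by (simp add: \<epsilon>_def zero_less_power_int del: power_int_of_nat)
  obtain k where k: "\<And>J. J \<ge> int k \<Longrightarrow> (rcard TYPE('f) powi (- J))\<^sup>2 * absv \<alpha> \<le> \<epsilon>"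
    by (rule ex_small_level[OF e0]) blast
  have "fine_level f L J" if J: "J \<ge> int k" for J
    unfolding fine_level_def
  proof (intro conjI allI impI)
    have le: "(rcard TYPE('f) powi (- J))\<^sup>2 * absv \<alpha> \<le> \<epsilon>" by (rule k[OF J])
    show lt: "(rcard TYPE('f) powi (- J))\<^sup>2 * absv \<alpha> < rcard TYPE('e) powi (- L)"
      using le r0 unfolding r_def[symmetric] \<epsilon>_def by linarith
    fix x assume x: "rcard TYPE('e) powi (- L) \<le> absv x \<and> absv (im x) \<le> rcard TYPE('f) powi (- J)"
    have rx: "absv (\<iota> (re x)) = absv x" using x lt by (intro re_close) auto
    have "(absv (im x))\<^sup>2 * absv \<alpha> \<le> (rcard TYPE('f) powi (- J))\<^sup>2 * absv \<alpha>"
      using x by (intro mult_right_mono power_mono) auto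
    from order.trans[OF this le] have small: "absv (\<iota> (im x) * \<alpha>) \<le> \<epsilon>" by (simp add: absv_mult absv_emb)
    have rle: "r \<le> absv x" using x by (simp add: r_def)
    have sE: "rcard TYPE('e) powi (- int m) * r \<le> rcard TYPE('e) powi (- int m) * absv x"
      using rle by (intro mult_left_mono) auto
    have sF: "rcard TYPE('f) powi (- int m') * r \<le> rcard TYPE('f) powi (- int m') * absv x"
      using rle by (intro mult_left_mono) auto
    have x0: "x \<noteq> 0" using rle r0 by auto
    have dif: "x - \<iota> (re x) = \<iota> (im x) * \<alpha>" by (subst (1) decomp) simp
    show "f x = f (\<iota> (re x))"
      by (rule loc) (use small in \<open>simp add: dif \<epsilon>_def del: power_int_of_nat\<close>)
    \<comment> \<open>The difference of x and its conjugate is taken as a sum of two equal terms;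
      the ultrametric inequality then bounds it in every residue characteristic.\<close>
    have "absv (\<iota> (im x) * \<alpha> + \<iota> (im x) * \<alpha>) \<le> \<epsilon>" by (rule absv_add_bound[OF small small])
    also have "\<dots> \<le> rcard TYPE('e) powi (- int m) * absv (conjug x)"
      unfolding absv_conjug by (rule order.trans[OF _ sE]) (simp add: \<epsilon>_def del: power_int_of_nat)
    finally have "c0 (conjug x + (\<iota> (im x) * \<alpha> + \<iota> (im x) * \<alpha>)) = c0 (conjug x)"
      unfolding c0_def by (rule m)
    moreover have "conjug x + (\<iota> (im x) * \<alpha> + \<iota> (im x) * \<alpha>) = x"
    proof -
      have "(p - a) + (a + a) = p + a" for p a :: 'e by simp
      then show ?thesis unfolding conjug_def using decomp[of x] by (simp only:)
    qed
    ultimately have cc: "c0 x / c0 (conjug x) = 1" using c0_nonzero[of "conjug x"] x0 by simp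
    have "absv (- ((im x)\<^sup>2 * \<beta>)) = absv (\<iota> (im x) * \<alpha>)"
      by (simp add: absv_mult absv_power absv_emb absv_gen)
    also have "\<dots> \<le> rcard TYPE('f) powi (- int m') * absv ((re x)\<^sup>2)"
    proof -
      have "\<epsilon> \<le> rcard TYPE('f) powi (- int m') * r" by (simp add: \<epsilon>_def del: power_int_of_nat)
      then have "absv (\<iota> (im x) * \<alpha>) \<le> rcard TYPE('f) powi (- int m') * absv x" using small sF by linarith
      then show ?thesis using rx by (simp only: absv_power absv_emb)
    qed
    finally have "e0 ((re x)\<^sup>2 + - ((im x)\<^sup>2 * \<beta>)) = e0 ((re x)\<^sup>2)" unfolding e0_def by (rule m')
    then have "e0 (nrm x) = e0 (re x) ^ 2" by (simp add: nrm_def e0_simps)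
    then show "K0 x = inverse (e0 (re x) ^ 2) * (c0 (\<iota> (im x)) * e0 (im x))"
      unfolding K0_eq cc by (simp add: divide_inverse)
  qed
  then show ?thesis by blast
qed

text \<open>At this level the change of x caused by the stretch is smaller than |x|, so x keeps its
  shell while x_2 changes its own.\<close>

lemma cell_imscale:
  assumes fine: "fine_level f L J" and l: "l \<le> L" and j: "J \<le> j" and a: "absv a \<le> 1" "a \<in> shell k" "absv (1 - a) \<le> 1"
  shows "x \<in> cell l j \<longleftrightarrow> imscale a x \<in> cell l (k + j)"
proof -
  have im: "im x \<in> shell j \<longleftrightarrow> a * im x \<in> shell (k + j)" using shell_mult_iff[OF a(2)] by blast
  have "x \<in> shell l \<longleftrightarrow> imscale a x \<in> shell l" if i: "im x \<in> shell j"
  proof -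
    have d: "imscale a x - x = - (\<iota> ((1 - a) * im x) * \<alpha>)"
      by (subst (2) decomp) (simp add: imscale_def emb_mult emb_diff emb_one algebra_simps)
    have "absv (im x) \<le> rcard TYPE('f) powi (- J)"
      using i j powi_le_iff[where 'k = 'f, of "- j" "- J"] by (simp add: shell_def)
    then have "absv (1 - a) * absv (im x) \<le> 1 * rcard TYPE('f) powi (- J)"
      using a(3) by (intro mult_mono) auto
    then have "(absv (1 - a) * absv (im x))\<^sup>2 * absv \<alpha> \<le> (rcard TYPE('f) powi (- J))\<^sup>2 * absv \<alpha>"
      by (intro mult_right_mono power_mono) auto
    also have "\<dots> < rcard TYPE('e) powi (- L)" using fine by (simp add: fine_level_def)
    also have "\<dots> \<le> rcard TYPE('e) powi (- l)" unfolding powi_le_iff using l by simp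
    finally have "absv (imscale a x - x) < rcard TYPE('e) powi (- l)"
      unfolding d by (simp add: absv_mult absv_emb)
    then show ?thesis using shell_add_iff[of "imscale a x - x" l x] by simp
  qed
  then show ?thesis using im by (auto simp: cell_def)
qed

lemma K0_imscale:
  assumes fine: "fine_level f L J" and l: "l \<le> L" and j: "J \<le> j" and x: "x \<in> cell l j"
    and a: "absv a \<le> 1" "a \<in> shell k" "absv (1 - a) \<le> 1"
  shows "K0 (imscale a x) = c0 (\<iota> a) * e0 a * K0 x" "f (imscale a x) = f x"
proof -
  have y: "imscale a x \<in> cell l (k + j)" using cell_imscale[OF fine l j a] x by simp
  have k: "k \<ge> 0" using a(1,2) powi_le_iff[where 'k = 'f, of "- k" 0] by (simp add: shell_def)
  have 1: "rcard TYPE('e) powi (- L) \<le> absv w \<and> absv (im w) \<le> rcard TYPE('f) powi (- J)" if "w \<in> cell l i" "J \<le> i" for w i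
    using that l powi_le_iff[where 'k = 'e, of "- L" "- l"] powi_le_iff[where 'k = 'f, of "- i" "- J"]
    by (simp add: cell_def shell_def)
  have fx: "K0 w = inverse (e0 (re w) ^ 2) * (c0 (\<iota> (im w)) * e0 (im w)) \<and> f w = f (\<iota> (re w))"
    if "w \<in> cell l i" "J \<le> i" for w i
    using fine 1[OF that] unfolding fine_level_def by blast
  have "J \<le> k + j" using k j by simp
  from fx[OF y this] fx[OF x j] show "K0 (imscale a x) = c0 (\<iota> a) * e0 a * K0 x" "f (imscale a x) = f x"
    by (auto simp: emb_mult c0_simps e0_simps)
qed

lemma absv_one_minus_unit: "absv a \<le> 1 \<Longrightarrow> absv (1 - a :: 'f) \<le> 1"
  by (rule absv_diff_bound) simp_all

text \<open>The counterpart of \<open>kap_eq_0\<close> for \<lambda>_+: stretching x_2 by a unit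
  multiplies the integrand by the value of \<chi> \<eta>, and the cell is preserved.\<close>

lemma kap_tail_eq_0:
  assumes fine: "fine_level f L J" and l: "l \<le> L" and f: "f \<in> borel_measurable borel"
    and nt: "\<not> trivial_on_units (\<lambda>u. chi (\<iota> u) * eta u)"
  shows "kap f l J = 0"
proof -
  obtain u where u: "u \<in> integer_units" "chi (\<iota> u) * eta u \<noteq> 1"
    using nt by (auto simp: trivial_on_units_def)
  have u0: "u \<noteq> 0" by (rule integer_units_nonzero[OF u(1)])
  have u1: "absv u \<le> 1" "u \<in> shell 0" using u(1) by (auto simp: shell_0 integer_units_def)
  note ua = u1 absv_one_minus_unit[OF u1(1)]
  have "(LINT x:cell l J|haarE X. K0 x * f x) =
      of_real (absv u) * (chi (\<iota> u) * eta u) * (LINT x:cell l J|haarE X. K0 x * f x)"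
  proof (rule scales_set_integral(1)[OF scales_imscale[OF u0]])
    show "x \<in> cell l J \<longleftrightarrow> imscale u x \<in> cell l J" for x
      using cell_imscale[OF fine l order_refl ua, of x] by simp
    show "K0 (imscale u x) * f (imscale u x) = chi (\<iota> u) * eta u * (K0 x * f x)" if "x \<in> cell l J" for x
      using K0_imscale[OF fine l order_refl that ua] by (simp add: c0_unit[OF emb_unit[OF u(1)]] e0_unit[OF u(1)])
  qed (use f in measurable)
  then have "kap f l J * (1 - chi (\<iota> u) * eta u) = 0"
    using u(1) by (simp add: kap_def integer_units_def algebra_simps)
  then show ?thesis using u(2) by simp
qed

end

section \<open>Holomorphic continuation of the kernel\<close>

subsection \<open>Holomorphic functions of two variables\<close>

lemma holomorphic2_const: "holomorphic2 (\<lambda>_. c)"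
proof -
  have "((\<lambda>_. c) has_derivative (\<lambda>(h, k). 0 * h + 0 * k)) (at p)" for p :: "complex \<times> complex"
    by (simp add: case_prod_unfold)
  then show ?thesis unfolding holomorphic2_def by blast
qed

lemma holomorphic2_add:
  assumes "holomorphic2 f" "holomorphic2 g" shows "holomorphic2 (\<lambda>p. f p + g p)"
  unfolding holomorphic2_def
proof
  fix p
  obtain A B C D where "(f has_derivative (\<lambda>(h, k). A * h + B * k)) (at p)"
    "(g has_derivative (\<lambda>(h, k). C * h + D * k)) (at p)"
    using assms unfolding holomorphic2_def by blast
  then have "((\<lambda>p. f p + g p) has_derivative (\<lambda>x. (case x of (h, k) \<Rightarrow> A * h + B * k) + (case x of (h, k) \<Rightarrow> C * h + D * k))) (at p)"
    by (rule has_derivative_add)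
  also have "(\<lambda>x. (case x of (h, k) \<Rightarrow> A * h + B * k) + (case x of (h, k) \<Rightarrow> C * h + D * k)) =
      (\<lambda>(h, k). (A + C) * h + (B + D) * k)"
    by (auto simp: fun_eq_iff algebra_simps)
  finally show "\<exists>A B. ((\<lambda>p. f p + g p) has_derivative (\<lambda>(h, k). A * h + B * k)) (at p)" by blast
qed

lemma holomorphic2_mult:
  assumes "holomorphic2 f" "holomorphic2 g" shows "holomorphic2 (\<lambda>p. f p * g p)"
  unfolding holomorphic2_def
proof
  fix p
  obtain A B C D where "(f has_derivative (\<lambda>(h, k). A * h + B * k)) (at p)"
    "(g has_derivative (\<lambda>(h, k). C * h + D * k)) (at p)"
    using assms unfolding holomorphic2_def by blast
  then have "((\<lambda>p. f p * g p) has_derivative (\<lambda>x. f p * (case x of (h, k) \<Rightarrow> C * h + D * k) + (case x of (h, k) \<Rightarrow> A * h + B * k) * g p)) (at p)"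
    by (rule has_derivative_mult)
  also have "(\<lambda>x. f p * (case x of (h, k) \<Rightarrow> C * h + D * k) + (case x of (h, k) \<Rightarrow> A * h + B * k) * g p) =
      (\<lambda>(h, k). (f p * C + A * g p) * h + (f p * D + B * g p) * k)"
    by (auto simp: fun_eq_iff algebra_simps)
  finally show "\<exists>A B. ((\<lambda>p. f p * g p) has_derivative (\<lambda>(h, k). A * h + B * k)) (at p)" by blast
qed

lemma holomorphic2_sum:
  "(\<And>i. i \<in> I \<Longrightarrow> holomorphic2 (f i)) \<Longrightarrow> holomorphic2 (\<lambda>p. \<Sum>i\<in>I. f i p)"
  by (induction I rule: infinite_finite_induct) (simp_all add: holomorphic2_const holomorphic2_add)

lemma holomorphic2_exp: "holomorphic2 (\<lambda>(s, t). exp (a * s + b * t + c))"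
  unfolding holomorphic2_def
proof
  fix p :: "complex \<times> complex"
  have "((\<lambda>p. exp (a * fst p + b * snd p + c)) has_derivative
     (\<lambda>x. exp (a * fst p + b * snd p + c) * (a * fst x + b * snd x))) (at p)"
  proof -
    have "((\<lambda>p. a * fst p + b * snd p + c) has_derivative (\<lambda>x. a * fst x + b * snd x)) (at p)"
      by (auto intro!: derivative_eq_intros)
    moreover have "(exp has_derivative (*) (exp (a * fst p + b * snd p + c))) (at (a * fst p + b * snd p + c))"
      using DERIV_exp unfolding has_field_derivative_def .
    ultimately show ?thesis by (rule has_derivative_compose)
  qed
  also have "(\<lambda>x. exp (a * fst p + b * snd p + c) * (a * fst x + b * snd x)) =
     (\<lambda>(h, k). exp (a * fst p + b * snd p + c) * a * h + exp (a * fst p + b * snd p + c) * b * k)"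
    by (auto simp: fun_eq_iff algebra_simps)
  finally show "\<exists>A B. ((\<lambda>(s, t). exp (a * s + b * t + c)) has_derivative (\<lambda>(h, k). A * h + B * k)) (at p)"
    unfolding case_prod_unfold by blast
qed

lemma holomorphic2_imp_holomorphic: "holomorphic2 g \<Longrightarrow> (\<lambda>z. g (z, t)) holomorphic_on UNIV"
proof -
  assume g: "holomorphic2 g"
  have "\<exists>A. ((\<lambda>z. g (z, t)) has_field_derivative A) (at z)" for z
  proof -
    obtain A B where D: "(g has_derivative (\<lambda>(h, k). A * h + B * k)) (at (z, t))"
      using g unfolding holomorphic2_def by blast
    have "((\<lambda>z. (z, t)) has_derivative (\<lambda>h. (h, 0))) (at z)"
      by (intro has_derivative_Pair has_derivative_ident has_derivative_const)
    from has_derivative_compose[OF this D] have "((\<lambda>z. g (z, t)) has_derivative (\<lambda>h. A * h)) (at z)" by simp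
    then show ?thesis unfolding has_field_derivative_def by blast
  qed
  then show ?thesis by (auto simp: holomorphic_on_def field_differentiable_def)
qed

text \<open>For fixed t the region of convergence contains the half-plane Re s > |Re t|, so
  continuation in s alone suffices.\<close>

lemma holomorphic2_eqI:
  assumes g: "holomorphic2 g" and h: "holomorphic2 h"
    and eq: "\<And>s t. Re (2 * s + t + 1/2) > 0 \<Longrightarrow> Re (2 * s - t + 1/2) > 0 \<Longrightarrow> g (s, t) = h (s, t)"
  shows "g = h"
proof
  fix p :: "complex \<times> complex"
  obtain s t where p: "p = (s, t)" by (cases p)
  let ?U = "{z. Re z > \<bar>Re t\<bar>}"
  have "of_real (\<bar>Re t\<bar> + 1) \<in> ?U" by simp
  then have ne: "?U \<noteq> {}" by blast
  have "g (s, t) = h (s, t)"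
  proof (rule analytic_continuation_open[of ?U UNIV "\<lambda>z. g (z, t)" "\<lambda>z. h (z, t)"])
    show "open ?U" by (rule open_halfspace_Re_gt)
    show "g (z, t) = h (z, t)" if "z \<in> ?U" for z using that by (intro eq) auto
  qed (use ne g h holomorphic2_imp_holomorphic in auto)
  then show "g p = h p" by (simp add: p)
qed


subsection \<open>Integrals over shells\<close>

context quadratic_chars
begin

text \<open>q_F^(-(2 s + t + 1/2)): at once the ratio of the tail along F and the term subtracted in
  \<lambda>_+. \<open>Zc\<close> below plays the same part for the tail at 0 and
  \<lambda>_-.\<close>

definition Wc :: "complex \<Rightarrow> complex \<Rightarrow> complex" where
  "Wc s t = exp (- ((2 * s + t + 1/2) * of_real (ln (rcard TYPE('f)))))"

definition Zc :: "complex \<Rightarrow> complex \<Rightarrow> complex" where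
  "Zc s t = exp (- ((2 * s - t + 1/2) * of_real (ln (rcard TYPE('f)))))"

definition lamP :: "complex \<Rightarrow> complex \<Rightarrow> complex" where
  "lamP s t = (if trivial_on_units (\<lambda>u. chi (\<iota> u) * eta u) then 1 - Wc s t else 1)"

definition lamM :: "complex \<Rightarrow> complex \<Rightarrow> complex" where
  "lamM s t = (if trivial_on_units (\<lambda>u. chi (\<iota> u) * inverse (eta u)) then 1 - Zc s t else 1)"

lemma qchar_at_unif:
  "qchar (unifE X) chi s (\<iota> (unifF X)) = exp (- (2 * s * of_real (ln (rcard TYPE('f)))))"
  "qchar (unifF X) eta t (unifF X) = exp (- (t * of_real (ln (rcard TYPE('f)))))"
proof -
  have p0: "unifF X \<noteq> 0" by (rule uniformizer_nonzero[OF unif(1)])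
  then have ip0: "\<iota> (unifF X) \<noteq> 0" by simp
  have l: "ln (absv (unifF X)) = - ln (rcard TYPE('f))"
    using ln_absv_shell[OF uniformizer_shell[OF unif(1)]] by simp
  have l2: "ln (absv (\<iota> (unifF X))) = - (2 * ln (rcard TYPE('f)))"
    using p0 l by (simp add: absv_emb ln_realpow)
  show "qchar (unifF X) eta t (unifF X) = exp (- (t * of_real (ln (rcard TYPE('f)))))"
    by (subst qchar_decomp[OF eta unif(1)])
       (simp add: absv_powr_ln[OF p0] l qchar_uniformizer_0[OF eta unif(1)])
  show "qchar (unifE X) chi s (\<iota> (unifF X)) = exp (- (2 * s * of_real (ln (rcard TYPE('f)))))"
    using c0_unif unfolding c0_def
    by (subst qchar_decomp[OF chi unif(2)]) (simp add: absv_powr_ln[OF ip0] l2 algebra_simps)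
qed

lemma rcard_powr: "complex_of_nat (residue_card TYPE('f)) powr z = exp (z * of_real (ln (rcard TYPE('f))))"
  using Ln_of_real[of "rcard TYPE('f)"] by (simp add: powr_def)

lemma lambda_plus_eq: "lambda_plus X chi s eta t = lamP s t"
proof -
  have "trivial_on_units (\<lambda>a. qchar (unifE X) chi s (\<iota> a) * qchar (unifF X) eta t a) \<longleftrightarrow>
      trivial_on_units (\<lambda>u. chi (\<iota> u) * eta u)"
    by (auto simp: trivial_on_units_def qchar_unit[OF chi unif(2)] qchar_unit[OF eta unif(1)] emb_unit)
  then show ?thesis
    unfolding lambda_plus_def inverse_L_def lamP_def qchar_at_unif rcard_powr Wc_def exp_add[symmetric]
    by (simp add: algebra_simps)
qed

lemma lambda_minus_eq: "lambda_minus X chi s eta t = lamM s t"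
proof -
  have "trivial_on_units (\<lambda>a. qchar (unifE X) chi s (\<iota> a) * inverse (qchar (unifF X) eta t a)) \<longleftrightarrow>
      trivial_on_units (\<lambda>u. chi (\<iota> u) * inverse (eta u))"
    by (auto simp: trivial_on_units_def qchar_unit[OF chi unif(2)] qchar_unit[OF eta unif(1)] emb_unit)
  then show ?thesis
    unfolding lambda_minus_def inverse_L_def lamM_def qchar_at_unif rcard_powr Zc_def exp_minus[symmetric] exp_add[symmetric]
    by (simp add: algebra_simps)
qed

lemma norm_Wc: "Re (2 * s + t + 1/2) > 0 \<Longrightarrow> norm (Wc s t) < 1"
  using ln_rcard_pos[where 'k = 'f] by (simp add: Wc_def mult_pos_pos)

lemma norm_Zc: "Re (2 * s - t + 1/2) > 0 \<Longrightarrow> norm (Zc s t) < 1"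
  using ln_rcard_pos[where 'k = 'f] by (simp add: Zc_def mult_pos_pos)

text \<open>\<lambda>_+ times the integral over one shell. The last term stands for the whole tail
  from J on: \<lambda>_+ cancels the denominator of the geometric series, and if the character is
  nontrivial the term is 0.\<close>

definition shell_poly :: "('e \<Rightarrow> complex) \<Rightarrow> int \<Rightarrow> int \<Rightarrow> int \<Rightarrow> complex \<Rightarrow> complex \<Rightarrow> complex" where
  "shell_poly f J j1 l s t =
     lamP s t * (\<Sum>j\<in>{j1..<J}. kpow s t l j * kap f l j) + kpow s t l J * kap f l J"

lemma one_minus_unif: "absv (unifF X) \<le> 1" "unifF X \<in> shell 1" "absv (1 - unifF X) \<le> 1"
proof -
  show s: "unifF X \<in> shell 1" by (rule uniformizer_shell[OF unif(1)])
  then show a: "absv (unifF X) \<le> 1"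
    using powi_le_iff[where 'k = 'f, of "-1" 0] by (simp add: shell_def)
  show "absv (1 - unifF X) \<le> 1" by (rule absv_one_minus_unit[OF a])
qed

lemma of_real_absv_unif: "complex_of_real (absv (unifF X)) = exp (- of_real (ln (rcard TYPE('f))))"
  using powr_shell[OF one_minus_unif(2), of 1] by simp

text \<open>Cells below \<open>j1\<close> are empty, those up to \<open>J\<close> are kept, and from
  \<open>J\<close> on the stretch by the uniformizer of F moves each cell to the next.\<close>

lemma shell_integral:
  assumes fine: "fine_level f L J" and l: "l \<le> L" and j1: "j1 \<le> J" "\<And>j. j < j1 \<Longrightarrow> cell l j = {}"
    and f: "f \<in> borel_measurable borel" "\<And>x. norm (f x) \<le> B"
    and st: "Re (2 * s + t + 1/2) > 0"
  shows "set_integrable (haarE X) (shell l) (\<lambda>x. kernel X chi s eta t x * f x)"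
    and "lamP s t * (LINT x:shell l|haarE X. kernel X chi s eta t x * f x) = shell_poly f J j1 l s t"
proof -
  let ?h = "\<lambda>x. kernel X chi s eta t x * f x"
  let ?A = "\<lambda>m::nat. cell l (J + int m)"
  let ?z = "exp (- ((2 * s + t - 1/2) * of_real (ln (rcard TYPE('f)))))"
  have p0: "unifF X \<noteq> 0" by (rule uniformizer_nonzero[OF unif(1)])
  \<comment> \<open>The kernel contributes q_F^(-(2 s + t - 1/2)) and the module of the stretch the
    missing q_F^(-1).\<close>
  have zc: "?z * of_real (absv (unifF X)) = Wc s t"
    unfolding of_real_absv_unif Wc_def exp_add[symmetric]
    by (rule arg_cong[of _ _ exp]) (simp add: field_simps)
  have "norm (?z * of_real (absv (unifF X))) < 1" unfolding zc by (rule norm_Wc[OF st])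
  then have zn: "norm ?z * absv (unifF X) < 1" by (simp add: norm_mult)
  have mem: "x \<in> ?A m \<longleftrightarrow> imscale (unifF X) x \<in> ?A (Suc m)" for m x
    using cell_imscale[OF fine l _ one_minus_unif, of "J + int m" x] by (simp add: add_ac)
  have step: "?h (imscale (unifF X) x) = ?z * ?h x" if "x \<in> ?A m" for m x
  proof -
    have "kpow s t l (J + int (Suc m)) = ?z * kpow s t l (J + int m)"
      unfolding kpow_def exp_add[symmetric] by (simp add: algebra_simps)
    moreover have "imscale (unifF X) x \<in> cell l (J + int (Suc m))" using mem that by blast
    ultimately show ?thesis
      using K0_imscale[OF fine l _ that one_minus_unif] kernel_cell[OF that, of s t]
        kernel_cell[of "imscale (unifF X) x" l "J + int (Suc m)" s t] by simp
  qed
  have hm: "?h \<in> borel_measurable borel" using f(1) by measurable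
  have disj: "disjoint_family ?A"
    unfolding disjoint_family_on_def using cell_disjoint by auto
  note geo = geometric_set_integral[OF scales_imscale[OF p0], of ?h ?A ?z]
  have U: "set_integrable (haarE X) (\<Union>m. ?A m) ?h"
    "(LINT x:(\<Union>m. ?A m)|haarE X. ?h x) = (LINT x:?A 0|haarE X. ?h x) / (1 - ?z * of_real (absv (unifF X)))"
    using geo[OF _ _ disj mem step _ zn] hm cell_integrable[OF f] by (auto cong: measurable_cong_sets)
  let ?V = "\<Union>j\<in>{j1..<J}. cell l j"
  have V: "set_integrable (haarE X) ?V ?h"
    by (rule set_integrable_UN) (auto simp: cell_integrable[OF f])
  have VU: "?V \<inter> (\<Union>m. ?A m) = {}" by (auto simp: cell_def shell_iff)
  \<comment> \<open>The cells miss only the points of F in the shell, where the kernel is 0 by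
    convention.\<close>
  have eq: "indicator (shell l) x *\<^sub>R ?h x = indicator (?V \<union> (\<Union>m. ?A m)) x *\<^sub>R ?h x" for x
  proof (cases "x \<in> shell l \<and> im x \<noteq> 0")
    case True
    define j where "j = valuation (im x)"
    have x: "x \<in> cell l j" using True by (simp add: cell_def shell_iff j_def)
    have "j \<ge> j1" using x j1(2)[of j] by (cases "j < j1") auto
    have "x \<in> ?V \<union> (\<Union>m. ?A m)"
    proof (cases "j < J")
      case False
      then have "x \<in> ?A (nat (j - J))" using x by simp
      then show ?thesis by blast
    qed (use x \<open>j \<ge> j1\<close> in auto)
    then show ?thesis using True by simp
  next
    case False
    then have "x \<notin> shell l \<or> kernel X chi s eta t x = 0" using kernel_im_0 by blast
    then show ?thesis by (auto simp: indicator_def cell_def)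
  qed
  have VUint: "set_integrable (haarE X) (?V \<union> (\<Union>m. ?A m)) ?h"
    by (rule set_integrable_Un[OF V U(1)]) (auto intro!: sets.finite_UN)
  show "set_integrable (haarE X) (shell l) ?h"
    using VUint unfolding set_integrable_def eq .
  have "(LINT x:shell l|haarE X. ?h x) = (LINT x:?V \<union> (\<Union>m. ?A m)|haarE X. ?h x)"
    unfolding set_lebesgue_integral_def eq ..
  also have "\<dots> = (LINT x:?V|haarE X. ?h x) + (LINT x:(\<Union>m. ?A m)|haarE X. ?h x)"
    by (rule set_integral_Un[OF VU V U(1)])
  also have "(LINT x:?V|haarE X. ?h x) = (\<Sum>j\<in>{j1..<J}. (LINT x:cell l j|haarE X. ?h x))"
    using cell_disjoint by (intro set_integral_finite_Union) (auto simp: disjoint_family_on_def cell_integrable[OF f])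
  finally have I: "(LINT x:shell l|haarE X. ?h x) =
      (\<Sum>j\<in>{j1..<J}. kpow s t l j * kap f l j) + kpow s t l J * kap f l J / (1 - Wc s t)"
    unfolding U(2) zc cell_integral by simp
  have W1: "1 - Wc s t \<noteq> 0" using norm_Wc[OF st] by (metis eq_iff_diff_eq_0 less_irrefl norm_one)
  have "lamP s t * (kpow s t l J * kap f l J / (1 - Wc s t)) = kpow s t l J * kap f l J"
    using kap_tail_eq_0[OF fine l f(1)] W1 by (auto simp: lamP_def)
  then show "lamP s t * (LINT x:shell l|haarE X. ?h x) = shell_poly f J j1 l s t"
    unfolding I shell_poly_def distrib_left by simp
qed

definition punctured_ball :: "int \<Rightarrow> 'e set" where
  "punctured_ball M = {x. x \<noteq> 0 \<and> M \<le> valuation x}"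

text \<open>The exponent collects q_F^(2 t + 1) from |x| and q_F^(-(2 s + t - 1/2)) from |x_2|.
  Together with the module q_F^(-2) it becomes \<open>Zc\<close>.\<close>

lemma kernel_scale:
  "kernel X chi s eta t (\<iota> (unifF X) * x) = exp ((t - 2 * s + 3/2) * of_real (ln (rcard TYPE('f)))) * kernel X chi s eta t x"
proof (cases "im x = 0")
  case False
  then have "x \<noteq> 0" using re_im_simps(2)[of 0] by auto
  then obtain l j where lj: "x \<in> cell l j" using False by (auto simp: cell_def shell_iff)
  have ip: "\<iota> (unifF X) \<in> shell (int ram)" using absv_emb_ram[OF one_minus_unif(2)] by simp
  have "\<iota> (unifF X) * x \<in> cell (int ram + l) (1 + j)"
    using lj shell_mult_iff[OF ip, of x l] shell_mult_iff[OF one_minus_unif(2), of "im x" j] by (simp add: cell_def)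
  moreover have "kpow s t (int ram + l) (1 + j) =
      exp ((t - 2 * s + 3/2) * of_real (ln (rcard TYPE('f)))) * kpow s t l j"
  proof -
    have "of_int (int ram) * complex_of_real (ln (rcard TYPE('e))) = complex_of_real (real ram * ln (rcard TYPE('e)))" by simp
    also have "\<dots> = 2 * of_real (ln (rcard TYPE('f)))" unfolding ln_rcard_ram by simp
    finally have r: "of_int (int ram) * complex_of_real (ln (rcard TYPE('e))) = 2 * of_real (ln (rcard TYPE('f)))" .
    have "of_int (int ram + l) * (t + 1/2) * complex_of_real (ln (rcard TYPE('e))) =
        (t + 1/2) * (of_int (int ram) * of_real (ln (rcard TYPE('e)))) + of_int l * (t + 1/2) * of_real (ln (rcard TYPE('e)))"
      by (simp add: algebra_simps)
    then have e: "of_int (int ram + l) * (t + 1/2) * complex_of_real (ln (rcard TYPE('e))) =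
        (t + 1/2) * (2 * of_real (ln (rcard TYPE('f)))) + of_int l * (t + 1/2) * of_real (ln (rcard TYPE('e)))"
      unfolding r .
    show ?thesis unfolding kpow_def exp_add[symmetric] e
      by (rule arg_cong[of _ _ exp]) (simp add: field_simps)
  qed
  ultimately show ?thesis
    using K0_emb_mult[OF uniformizer_nonzero[OF unif(1)], of x] by (simp add: kernel_cell[OF lj] kernel_cell)
qed (simp add: kernel_im_0)

text \<open>Multiplication by the uniformizer of F shifts the shells of E by \<open>ram\<close>, so
  the \<open>ram\<close> shells starting at M are a fundamental domain of the punctured ball, and
  the ball is a geometric series over its translates.\<close>

lemma ball_integral:
  assumes fine: "fine_level (\<lambda>_. 1) (M + int ram - 1) J"
    and j1: "j1 \<le> J" "\<And>l j. M \<le> l \<Longrightarrow> j < j1 \<Longrightarrow> cell l j = {}"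
    and st: "Re (2 * s + t + 1/2) > 0" "Re (2 * s - t + 1/2) > 0"
  shows "set_integrable (haarE X) (punctured_ball M) (kernel X chi s eta t)"
    and "lamP s t * lamM s t * (LINT x:punctured_ball M|haarE X. kernel X chi s eta t x) =
      (\<Sum>l\<in>{M..<M + int ram}. shell_poly (\<lambda>_. 1) J j1 l s t)"
proof -
  let ?h = "kernel X chi s eta t"
  let ?A = "\<lambda>m::nat. \<Union>l\<in>{M + int ram * int m..<M + int ram * int m + int ram}. (shell l :: 'e set)"
  let ?z = "exp ((t - 2 * s + 3/2) * of_real (ln (rcard TYPE('f))))"
  have p0: "unifF X \<noteq> 0" by (rule uniformizer_nonzero[OF unif(1)])
  have ip: "\<iota> (unifF X) \<in> shell (int ram)" using absv_emb_ram[OF one_minus_unif(2)] by simp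
  have zc: "?z * of_real ((absv (unifF X))\<^sup>2) = Zc s t"
  proof -
    have "complex_of_real ((absv (unifF X))\<^sup>2) = complex_of_real (absv (unifF X)) * complex_of_real (absv (unifF X))"
      by (simp add: power2_eq_square)
    then show ?thesis unfolding of_real_absv_unif Zc_def exp_add[symmetric]
      by (simp only: exp_add[symmetric]) (rule arg_cong[of _ _ exp], simp add: field_simps)
  qed
  have "norm (?z * of_real ((absv (unifF X))\<^sup>2)) < 1" unfolding zc by (rule norm_Zc[OF st(2)])
  then have zn: "norm ?z * (absv (unifF X))\<^sup>2 < 1" by (simp add: norm_mult norm_power)
  have ram: "int ram > 0" using ram_pos by simp
  have Aiff: "x \<in> ?A m \<longleftrightarrow> x \<noteq> 0 \<and> M + int ram * int m \<le> valuation x \<and> valuation x < M + int ram * int m + int ram" for x m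
    by (auto simp: shell_iff)
  have mem: "x \<in> ?A m \<longleftrightarrow> \<iota> (unifF X) * x \<in> ?A (Suc m)" for m x
  proof (cases "x = 0")
    case False
    then have "valuation (\<iota> (unifF X) * x) = int ram + valuation x"
      using ip by (subst valuation_mult) (auto simp: shell_iff)
    then show ?thesis unfolding Aiff using False p0 by (simp add: algebra_simps)
  next
    case True
    then show ?thesis unfolding Aiff by simp
  qed
  have disj: "disjoint_family ?A"
    unfolding disjoint_family_on_def
  proof (intro ballI impI, rule ccontr)
    fix m n :: nat assume mn: "m \<noteq> n" "?A m \<inter> ?A n \<noteq> {}"
    from mn(2) have "\<exists>x. x \<in> ?A m \<inter> ?A n" unfolding ex_in_conv .
    then obtain x where "x \<in> ?A m \<inter> ?A n" by (rule exE)
    note x = IntD1[OF this] IntD2[OF this]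
    have *: "m' < n' \<Longrightarrow> M + int ram * int m' + int ram \<le> M + int ram * int n'" for m' n' :: nat
    proof -
      assume "m' < n'"
      then have "int ram * (int m' + 1) \<le> int ram * int n'" using ram by (intro mult_left_mono) auto
      then show ?thesis by (simp add: algebra_simps)
    qed
    show False using x mn(1) *[of m n] *[of n m] unfolding Aiff by (cases "m < n") auto
  qed
  have UA: "(\<Union>m. ?A m) = punctured_ball M"
  proof (intro equalityI subsetI)
    fix x assume "x \<in> (\<Union>m. ?A m)"
    then obtain m where "x \<in> ?A m" by blast
    then show "x \<in> punctured_ball M" unfolding Aiff punctured_ball_def using ram
      by (auto intro: order.trans[rotated])
  next
    fix x assume x: "x \<in> punctured_ball M"
    define k where "k = (valuation x - M) div int ram"
    have k0: "k \<ge> 0" using x ram by (simp add: k_def punctured_ball_def pos_imp_zdiv_nonneg_iff)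
    have "(valuation x - M) mod int ram \<ge> 0" "(valuation x - M) mod int ram < int ram" using ram by auto
    moreover have "valuation x - M = int ram * k + (valuation x - M) mod int ram" by (simp add: k_def)
    ultimately have "x \<in> ?A (nat k)" unfolding Aiff using x k0 by (simp add: punctured_ball_def)
    then show "x \<in> (\<Union>m. ?A m)" by blast
  qed
  have fine1: "set_integrable (haarE X) (shell l) ?h"
    "lamP s t * (LINT x:shell l|haarE X. ?h x) = shell_poly (\<lambda>_. 1) J j1 l s t"
    if "l \<in> {M..<M + int ram}" for l
  proof -
    have "l \<le> M + int ram - 1" "\<And>j. j < j1 \<Longrightarrow> cell l j = {}" using that j1(2)[of l] by auto
    from shell_integral[OF fine this(1) j1(1) this(2), of 1 s t] st(1)
    show "set_integrable (haarE X) (shell l) ?h"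
      "lamP s t * (LINT x:shell l|haarE X. ?h x) = shell_poly (\<lambda>_. 1) J j1 l s t" by auto
  qed
  have A0: "?A 0 = (\<Union>l\<in>{M..<M + int ram}. shell l)" by simp
  have int0: "set_integrable (haarE X) (?A 0) ?h"
    unfolding A0 by (rule set_integrable_UN) (auto simp: fine1)
  have As: "?A m \<in> sets (haarE X)" for m by (rule sets.finite_UN) simp_all
  have geo: "set_integrable (haarE X) (\<Union>m. ?A m) ?h"
    "(LINT x:(\<Union>m. ?A m)|haarE X. ?h x) = (LINT x:?A 0|haarE X. ?h x) / (1 - ?z * of_real ((absv (unifF X))\<^sup>2))"
    using geometric_set_integral[OF scales_emb[OF p0], of ?h ?A ?z, OF _ As disj mem kernel_scale int0 zn]
    by (auto cong: measurable_cong_sets)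
  show "set_integrable (haarE X) (punctured_ball M) ?h" using geo(1) unfolding UA .
  have "(LINT x:?A 0|haarE X. ?h x) = (\<Sum>l\<in>{M..<M + int ram}. (LINT x:shell l|haarE X. ?h x))"
    unfolding A0 using fine1(1) disjoint_shells by (intro set_integral_finite_Union) (auto simp: disjoint_family_on_def)
  then have "lamP s t * (LINT x:?A 0|haarE X. ?h x) = (\<Sum>l\<in>{M..<M + int ram}. shell_poly (\<lambda>_. 1) J j1 l s t)"
    by (simp add: sum_distrib_left fine1(2))
  then have e: "lamP s t * (LINT x:punctured_ball M|haarE X. ?h x) =
      (\<Sum>l\<in>{M..<M + int ram}. shell_poly (\<lambda>_. 1) J j1 l s t) / (1 - Zc s t)"
    using geo(2) unfolding UA zc by simp
  have Z1: "1 - Zc s t \<noteq> 0" using norm_Zc[OF st(2)] by (metis eq_iff_diff_eq_0 less_irrefl norm_one)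
  \<comment> \<open>For a nontrivial character \<lambda>_- does not cancel the denominator, but then
    all coefficients \<open>kap\<close> of the constant function are 0 and both sides
    vanish.\<close>
  have "lamM s t * ((\<Sum>l\<in>{M..<M + int ram}. shell_poly (\<lambda>_. 1) J j1 l s t) / (1 - Zc s t)) =
      (\<Sum>l\<in>{M..<M + int ram}. shell_poly (\<lambda>_. 1) J j1 l s t)"
    using Z1 kap_eq_0 by (auto simp: lamM_def shell_poly_def)
  then show "lamP s t * lamM s t * (LINT x:punctured_ball M|haarE X. ?h x) =
      (\<Sum>l\<in>{M..<M + int ram}. shell_poly (\<lambda>_. 1) J j1 l s t)"
    unfolding e[symmetric] by (simp add: mult_ac)
qed


subsection \<open>The continuation\<close>

text \<open>Fineness is required up to M + ram - 1 to include the fundamental block at 0. It is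
  required for the constant function too, since near 0 the test function is replaced by its value f
  0.\<close>

definition adapted :: "('e \<Rightarrow> complex) \<Rightarrow> int \<Rightarrow> int \<Rightarrow> int \<Rightarrow> bool" where
  "adapted f M J j1 \<longleftrightarrow> fine_level f (M + int ram - 1) J \<and> fine_level (\<lambda>_. 1) (M + int ram - 1) J \<and> j1 \<le> J \<and>
     (\<forall>l j. - M \<le> l \<longrightarrow> j < j1 \<longrightarrow> cell l j = {}) \<and> 0 \<le> M \<and>
     (\<forall>x. x \<noteq> 0 \<and> M \<le> valuation x \<longrightarrow> f x = f 0) \<and> (\<forall>x. x \<noteq> 0 \<and> valuation x < - M \<longrightarrow> f x = 0)"

lemma ex_adapted:
  assumes "f \<in> test_functions"
  obtains n0 where "\<And>M. n0 \<le> M \<Longrightarrow> \<exists>J j1. adapted f M J j1"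
proof -
  obtain n :: nat where n: "\<And>x y. absv (x - y) \<le> rcard TYPE('e) powi (- int n) \<Longrightarrow> f x = f y"
    "\<And>x. f x \<noteq> 0 \<Longrightarrow> absv x \<le> rcard TYPE('e) powi (int n)"
    using test_function_uniform[OF assms] by blast
  have "\<exists>J j1. adapted f M J j1" if M: "int n \<le> M" for M
  proof -
    obtain Ja where Ja: "\<And>J. J \<ge> Ja \<Longrightarrow> fine_level f (M + int ram - 1) J"
      using ex_fine_level[of n f "M + int ram - 1"] n(1) by blast
    obtain Jb where Jb: "\<And>J. J \<ge> Jb \<Longrightarrow> fine_level (\<lambda>_. 1) (M + int ram - 1) J"
      using ex_fine_level[of n "\<lambda>_. 1" "M + int ram - 1"] by blast
    obtain j1 where j1: "\<forall>l\<ge>- M. \<forall>j<j1. cell l j = {}" using ex_cell_empty by blast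
    have c: "f x = f 0" if "x \<noteq> 0" "M \<le> valuation x" for x
      by (rule n(1)) (use that M in \<open>simp add: absv_eq_valuation powi_le_iff\<close>)
    have z: "f x = 0" if x: "x \<noteq> 0" "valuation x < - M" for x
    proof (rule ccontr)
      assume "f x \<noteq> 0"
      then have "absv x \<le> rcard TYPE('e) powi (int n)" by (rule n(2))
      then show False using x M by (simp add: absv_le_powi_iff del: power_int_of_nat)
    qed
    show ?thesis
      by (rule exI[of _ "max (max Ja Jb) j1"], rule exI[of _ j1])
         (use Ja Jb j1 M c z in \<open>auto simp: adapted_def\<close>)
  qed
  then show thesis by (rule that)
qed

text \<open>\<lambda>_+ is absorbed in every \<open>shell_poly\<close>. \<lambda>_- survives only on
  the shells away from 0; at 0 it has cancelled the geometric series over blocks.\<close>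

definition cont :: "('e \<Rightarrow> complex) \<Rightarrow> int \<Rightarrow> int \<Rightarrow> int \<Rightarrow> complex \<times> complex \<Rightarrow> complex" where
  "cont f M J j1 = (\<lambda>(s, t). lamM s t * (\<Sum>l\<in>{- M..<M}. shell_poly f J j1 l s t) +
     f 0 * (\<Sum>l\<in>{M..<M + int ram}. shell_poly (\<lambda>_. 1) J j1 l s t))"

lemma cont_eq_integral:
  assumes f: "f \<in> test_functions" and ad: "adapted f M J j1"
    and st: "Re (2 * s + t + 1/2) > 0" "Re (2 * s - t + 1/2) > 0"
  shows "lamP s t * lamM s t * (LINT x|haarE X. kernel X chi s eta t x * f x) = cont f M J j1 (s, t)"
proof -
  let ?h = "\<lambda>x. kernel X chi s eta t x * f x"
  obtain B where B: "\<And>x. norm (f x) \<le> B" using test_function_bounded[OF f] by blast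
  have fm: "f \<in> borel_measurable borel"
    by (intro borel_measurable_continuous_onI continuous_on_test_function f)
  have a: "fine_level f (M + int ram - 1) J" "fine_level (\<lambda>_. 1) (M + int ram - 1) J" "j1 \<le> J"
    "\<And>l j. - M \<le> l \<Longrightarrow> j < j1 \<Longrightarrow> cell l j = {}" "0 \<le> M"
    "\<And>x. x \<noteq> 0 \<Longrightarrow> M \<le> valuation x \<Longrightarrow> f x = f 0" "\<And>x. x \<noteq> 0 \<Longrightarrow> valuation x < - M \<Longrightarrow> f x = 0"
    using ad by (auto simp: adapted_def)
  have S: "set_integrable (haarE X) (shell l) ?h"
    "lamP s t * (LINT x:shell l|haarE X. ?h x) = shell_poly f J j1 l s t" if l: "l \<in> {- M..<M}" for l
  proof -
    have "l \<le> M + int ram - 1" "\<And>j. j < j1 \<Longrightarrow> cell l j = {}" using l a(4)[of l] by auto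
    from shell_integral[OF a(1) this(1) a(3) this(2) fm B st(1)]
    show "set_integrable (haarE X) (shell l) ?h"
      "lamP s t * (LINT x:shell l|haarE X. ?h x) = shell_poly f J j1 l s t" by auto
  qed
  have P: "set_integrable (haarE X) (punctured_ball M) (kernel X chi s eta t)"
    "lamP s t * lamM s t * (LINT x:punctured_ball M|haarE X. kernel X chi s eta t x) =
      (\<Sum>l\<in>{M..<M + int ram}. shell_poly (\<lambda>_. 1) J j1 l s t)"
    using ball_integral[OF a(2) a(3) a(4) st] a(5) by auto
  have pw: "?h x = (\<Sum>l\<in>{- M..<M}. indicator (shell l) x *\<^sub>R ?h x) +
      f 0 * (indicator (punctured_ball M) x *\<^sub>R kernel X chi s eta t x)" for x
  proof (cases "x = 0")
    case True
    then have "kernel X chi s eta t x = 0" using kernel_im_0 re_im_simps(2)[of 0] by simp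
    then show ?thesis by simp
  next
    case False
    have ind: "indicator (shell l) x *\<^sub>R ?h x = (if valuation x = l then ?h x else 0)" for l
      using False by (auto simp: shell_iff)
    have "(\<Sum>l\<in>{- M..<M}. indicator (shell l) x *\<^sub>R ?h x) = (if valuation x \<in> {- M..<M} then ?h x else 0)"
      unfolding ind by (simp add: sum.delta')
    then show ?thesis using False a(6)[OF False] a(7)[OF False] a(5)
      by (auto simp: punctured_ball_def indicator_def)
  qed
  have "(LINT x|haarE X. ?h x) = (LINT x|haarE X. (\<Sum>l\<in>{- M..<M}. indicator (shell l) x *\<^sub>R ?h x) +
      f 0 * (indicator (punctured_ball M) x *\<^sub>R kernel X chi s eta t x))"
    by (rule Bochner_Integration.integral_cong[OF refl pw])
  also have "\<dots> = (\<Sum>l\<in>{- M..<M}. (LINT x:shell l|haarE X. ?h x)) +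
      f 0 * (LINT x:punctured_ball M|haarE X. kernel X chi s eta t x)"
  proof -
    have i1: "integrable (haarE X) (\<lambda>x. \<Sum>l\<in>{- M..<M}. indicator (shell l) x *\<^sub>R ?h x)"
      by (intro Bochner_Integration.integrable_sum S(1)[unfolded set_integrable_def])
    have i2: "integrable (haarE X) (\<lambda>x. f 0 * (indicator (punctured_ball M) x *\<^sub>R kernel X chi s eta t x))"
      using P(1) unfolding set_integrable_def by (rule integrable_mult_right)
    have e1: "(LINT x|haarE X. (\<Sum>l\<in>{- M..<M}. indicator (shell l) x *\<^sub>R ?h x)) =
        (\<Sum>l\<in>{- M..<M}. (LINT x|haarE X. indicator (shell l) x *\<^sub>R ?h x))"
      by (intro Bochner_Integration.integral_sum S(1)[unfolded set_integrable_def])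
    show ?thesis unfolding Bochner_Integration.integral_add[OF i1 i2] e1 integral_mult_right_zero set_lebesgue_integral_def ..
  qed
  finally have I: "(LINT x|haarE X. ?h x) = (\<Sum>l\<in>{- M..<M}. (LINT x:shell l|haarE X. ?h x)) +
      f 0 * (LINT x:punctured_ball M|haarE X. kernel X chi s eta t x)" .
  have e3: "lamP s t * (\<Sum>l\<in>{- M..<M}. (LINT x:shell l|haarE X. ?h x)) = (\<Sum>l\<in>{- M..<M}. shell_poly f J j1 l s t)"
    unfolding sum_distrib_left by (rule sum.cong[OF refl]) (rule S(2))
  have e4: "x * y * (A + z * C) = y * (x * A) + z * (x * y * C)" for x y z A C :: complex
    by (simp add: algebra_simps)
  show ?thesis unfolding I cont_def prod.case e4 P(2) e3 ..
qed

lemma holomorphic2_kpow: "holomorphic2 (\<lambda>(s, t). kpow s t l j)"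
proof -
  have "(\<lambda>(s, t). kpow s t l j) = (\<lambda>(s, t). exp ((- (2 * of_int j * of_real (ln (rcard TYPE('f))))) * s +
     (of_int l * of_real (ln (rcard TYPE('e))) - of_int j * of_real (ln (rcard TYPE('f)))) * t +
     (of_int l * of_real (ln (rcard TYPE('e))) / 2 + of_int j * of_real (ln (rcard TYPE('f))) / 2)))"
    by (auto simp: kpow_def fun_eq_iff algebra_simps)
  then show ?thesis by (simp only: holomorphic2_exp)
qed

lemma holomorphic2_lamP: "holomorphic2 (\<lambda>(s, t). lamP s t)"
proof -
  have "(\<lambda>(s, t). Wc s t) = (\<lambda>(s, t). exp ((- (2 * of_real (ln (rcard TYPE('f))))) * s +
     (- of_real (ln (rcard TYPE('f)))) * t + (- of_real (ln (rcard TYPE('f))) / 2)))"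
    by (auto simp: Wc_def fun_eq_iff algebra_simps)
  then have "holomorphic2 (\<lambda>(s, t). Wc s t)" by (simp only: holomorphic2_exp)
  then have "holomorphic2 (\<lambda>p. 1 + (- 1) * (case p of (s, t) \<Rightarrow> Wc s t))"
    by (intro holomorphic2_add holomorphic2_mult holomorphic2_const)
  then show ?thesis
    by (cases "trivial_on_units (\<lambda>u. chi (\<iota> u) * eta u)") (simp_all add: lamP_def case_prod_unfold holomorphic2_const)
qed

lemma holomorphic2_lamM: "holomorphic2 (\<lambda>(s, t). lamM s t)"
proof -
  have "(\<lambda>(s, t). Zc s t) = (\<lambda>(s, t). exp ((- (2 * of_real (ln (rcard TYPE('f))))) * s +
     (of_real (ln (rcard TYPE('f)))) * t + (- of_real (ln (rcard TYPE('f))) / 2)))"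
    by (auto simp: Zc_def fun_eq_iff algebra_simps)
  then have "holomorphic2 (\<lambda>(s, t). Zc s t)" by (simp only: holomorphic2_exp)
  then have "holomorphic2 (\<lambda>p. 1 + (- 1) * (case p of (s, t) \<Rightarrow> Zc s t))"
    by (intro holomorphic2_add holomorphic2_mult holomorphic2_const)
  then show ?thesis
    by (cases "trivial_on_units (\<lambda>u. chi (\<iota> u) * inverse (eta u))") (simp_all add: lamM_def case_prod_unfold holomorphic2_const)
qed

lemma holomorphic2_cont: "holomorphic2 (cont f M J j1)"
  using holomorphic2_kpow holomorphic2_lamP holomorphic2_lamM
  unfolding cont_def shell_poly_def case_prod_unfold
  by (intro holomorphic2_add holomorphic2_mult holomorphic2_sum holomorphic2_const) auto

text \<open>The continuation is unique, so the value is the same for all adapted parameters and they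
  may be chosen to suit each application.\<close>

lemma normalized_kernel_eq:
  assumes f: "f \<in> test_functions" and ad: "adapted f M J j1"
  shows "normalized_kernel X chi s eta t f = cont f M J j1 (s, t)"
proof -
  let ?P = "\<lambda>g. holomorphic2 g \<and> (\<forall>s t. Re (2 * s + t + 1/2) > 0 \<and> Re (2 * s - t + 1/2) > 0 \<longrightarrow>
        g (s, t) = lambda_plus X chi s eta t * lambda_minus X chi s eta t *
                   (LINT x|haarE X. kernel X chi s eta t x * f x))"
  have "(THE g. ?P g) = cont f M J j1"
  proof (rule the_equality)
    show P: "?P (cont f M J j1)"
      using holomorphic2_cont cont_eq_integral[OF f ad] by (simp add: lambda_plus_eq lambda_minus_eq)
    fix g assume g: "?P g"
    show "g = cont f M J j1"
      by (rule holomorphic2_eqI) (use g P in auto)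
  qed
  then show ?thesis by (simp add: normalized_kernel_def)
qed

end

section \<open>The distributions of quasi-characters\<close>

context haar
begin

text \<open>The scheme used for the kernel, in one variable: from index N on the test function is
  constant and multiplication by \<pi> gives the ratio q^(-(a + 1)). The normalizing factor cancels
  it, or else the integral over shell N is 0.\<close>

lemma qchar_distr_eq:
  fixes \<phi> :: "'k \<Rightarrow> complex"
  assumes pi: "uniformizer \<pi>" and xi: "\<xi> \<in> unit_characters"
    and phi: "\<phi> \<in> borel_measurable borel" "\<And>x. norm (\<phi> x) \<le> B"
    and N: "\<And>x. x \<noteq> 0 \<Longrightarrow> N \<le> valuation x \<Longrightarrow> \<phi> x = \<phi> 0" "\<And>x. x \<noteq> 0 \<Longrightarrow> valuation x < - N \<Longrightarrow> \<phi> x = 0"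
    and N0: "0 \<le> N"
  shows "qchar_distr M \<pi> \<xi> a \<phi> =
     (if trivial_on_units \<xi> then 1 - exp (- ((a + 1) * of_real (ln (rcard TYPE('k))))) else 1) *
     (\<Sum>k\<in>{- N..<N}. exp (- (of_int k * a * of_real (ln (rcard TYPE('k))))) * (LINT x:shell k|M. qchar \<pi> \<xi> 0 x * \<phi> x)) +
     exp (- (of_int N * a * of_real (ln (rcard TYPE('k))))) * (LINT x:shell N|M. qchar \<pi> \<xi> 0 x * \<phi> x)"
proof -
  define L where "L = complex_of_real (ln (rcard TYPE('k)))"
  define b where "b k = (LINT x:shell k|M. qchar \<pi> \<xi> 0 x * \<phi> x)" for k
  define lam where "lam a = (if trivial_on_units \<xi> then 1 - exp (- ((a + 1) * L)) else 1)" for a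
  define D where "D = (\<lambda>a. lam a * (\<Sum>k\<in>{- N..<N}. exp (- (of_int k * a * L)) * b k) + exp (- (of_int N * a * L)) * b N)"
  note qm = measurable_qchar[OF xi pi]
  have pi0: "\<pi> \<noteq> 0" by (rule uniformizer_nonzero[OF pi])
  have hol: "D holomorphic_on UNIV"
    unfolding D_def lam_def by (cases "trivial_on_units \<xi>") (auto intro!: holomorphic_intros)
  have main: "lam a * (LINT x|M. qchar \<pi> \<xi> a x * \<phi> x) = D a" if a: "Re a > -1" for a
  proof -
    let ?h = "\<lambda>x. qchar \<pi> \<xi> a x * \<phi> x"
    let ?A = "\<lambda>m::nat. shell (N + int m) :: 'k set"
    let ?z = "exp (- (a * L))"
    have hm: "?h \<in> borel_measurable borel" using qm phi(1) by measurable
    have sh: "qchar \<pi> \<xi> a x = exp (- (of_int k * a * L)) * qchar \<pi> \<xi> 0 x" if "x \<in> shell k" for x k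
      by (subst qchar_decomp[OF xi pi]) (simp add: powr_shell[OF that] L_def)
    have int: "set_integrable M (shell k) ?h" for k
    proof (rule set_integrable_bounded[OF hm _ emeasure_shell_finite])
      fix x :: 'k assume "x \<in> shell k"
      then show "norm (?h x) \<le> norm (exp (- (of_int k * a * L))) * (1 * B)"
        unfolding sh[OF \<open>x \<in> shell k\<close>] norm_mult mult.assoc
        by (intro mult_left_mono mult_mono qchar_norm_le[OF xi pi] phi) auto
    qed simp
    have shI: "(LINT x:shell k|M. ?h x) = exp (- (of_int k * a * L)) * b k" for k
    proof -
      have "(LINT x:shell k|M. ?h x) = (LINT x:shell k|M. exp (- (of_int k * a * L)) * (qchar \<pi> \<xi> 0 x * \<phi> x))"
        unfolding set_lebesgue_integral_def
        by (intro Bochner_Integration.integral_cong refl) (auto simp: indicator_def sh)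
      then show ?thesis by (simp add: b_def)
    qed
    have mem: "x \<in> ?A m \<longleftrightarrow> \<pi> * x \<in> ?A (Suc m)" for m x
      using shell_mult_iff[OF uniformizer_shell[OF pi], of x "N + int m"] by (simp add: add_ac)
    have step: "?h (\<pi> * x) = ?z * ?h x" if "x \<in> ?A m" for m x
    proof -
      have "\<pi> * x \<in> ?A (Suc m)" using mem that by blast
      then have "\<phi> (\<pi> * x) = \<phi> x" using N(1)[of x] N(1)[of "\<pi> * x"] that by (simp add: shell_iff)
      moreover have "qchar \<pi> \<xi> a \<pi> = ?z"
        using sh[OF uniformizer_shell[OF pi]] qchar_uniformizer_0[OF xi pi] by simp
      ultimately show ?thesis by (simp add: qchar_mult[OF xi pi])
    qed
    have disj: "disjoint_family ?A" unfolding disjoint_family_on_def by (auto simp: shell_iff)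
    have c: "complex_of_real (absv \<pi>) = exp (- L)"
      using powr_shell[OF uniformizer_shell[OF pi], of 1] by (simp add: L_def)
    have zc: "?z * of_real (absv \<pi>) = exp (- ((a + 1) * L))"
      unfolding c exp_add[symmetric] by (simp add: algebra_simps)
    have nr: "norm (exp (- ((a + 1) * L))) < 1"
      using a ln_rcard_pos[where 'k = 'k] by (simp add: L_def)
    then have "norm (?z * of_real (absv \<pi>)) < 1" unfolding zc .
    then have zn: "norm ?z * absv \<pi> < 1" by (simp add: norm_mult)
    have hM: "?h \<in> borel_measurable M" using hm by (simp cong: measurable_cong_sets)
    have As: "?A m \<in> sets M" for m by simp
    note geo = geometric_set_integral[where h = ?h and A = ?A and z = ?z, OF scales_mult[OF pi0] hM As disj mem step int zn]
    have pw: "?h x = (\<Sum>k\<in>{- N..<N}. indicator (shell k) x *\<^sub>R ?h x) + indicator (\<Union>m. ?A m) x *\<^sub>R ?h x" for x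
    proof (cases "x = 0")
      case False
      have ind: "indicator (shell k) x *\<^sub>R ?h x = (if valuation x = k then ?h x else 0)" for k
        using False by (auto simp: shell_iff)
      have s: "(\<Sum>k\<in>{- N..<N}. indicator (shell k) x *\<^sub>R ?h x) = (if valuation x \<in> {- N..<N} then ?h x else 0)"
        unfolding ind by (simp add: sum.delta')
      have u: "x \<in> (\<Union>m. ?A m) \<longleftrightarrow> N \<le> valuation x"
      proof
        assume "N \<le> valuation x"
        then have "x \<in> ?A (nat (valuation x - N))" using False by (simp add: shell_iff)
        then show "x \<in> (\<Union>m. ?A m)" by blast
      qed (auto simp: shell_iff)
      show ?thesis unfolding s using u N(2)[OF False] N0 by (auto simp: indicator_def)
    qed (simp add: qchar_0[OF xi pi])
    have "(LINT x|M. ?h x) = (LINT x|M. (\<Sum>k\<in>{- N..<N}. indicator (shell k) x *\<^sub>R ?h x) + indicator (\<Union>m. ?A m) x *\<^sub>R ?h x)"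
      by (rule Bochner_Integration.integral_cong[OF refl pw])
    also have "\<dots> = (\<Sum>k\<in>{- N..<N}. (LINT x:shell k|M. ?h x)) + (LINT x:(\<Union>m. ?A m)|M. ?h x)"
    proof -
      have i1: "integrable M (\<lambda>x. \<Sum>k\<in>{- N..<N}. indicator (shell k) x *\<^sub>R ?h x)"
        by (intro Bochner_Integration.integrable_sum int[unfolded set_integrable_def])
      have e1: "(LINT x|M. (\<Sum>k\<in>{- N..<N}. indicator (shell k) x *\<^sub>R ?h x)) =
          (\<Sum>k\<in>{- N..<N}. (LINT x|M. indicator (shell k) x *\<^sub>R ?h x))"
        by (intro Bochner_Integration.integral_sum int[unfolded set_integrable_def])
      have i2: "integrable M (\<lambda>x. indicator (\<Union>m. ?A m) x *\<^sub>R ?h x)"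
        using geo(1) unfolding set_integrable_def .
      show ?thesis
        unfolding Bochner_Integration.integral_add[OF i1 i2] e1 set_lebesgue_integral_def ..
    qed
    finally have I: "(LINT x|M. ?h x) = (\<Sum>k\<in>{- N..<N}. exp (- (of_int k * a * L)) * b k) +
        exp (- (of_int N * a * L)) * b N / (1 - exp (- ((a + 1) * L)))"
    proof -
      have "(LINT x:(\<Union>m. ?A m)|M. ?h x) = (LINT x:?A 0|M. ?h x) / (1 - ?z * of_real (absv \<pi>))"
        by (rule geo(2))
      then show "(LINT x|M. ?h x) = (\<Sum>k\<in>{- N..<N}. (LINT x:shell k|M. ?h x)) + (LINT x:(\<Union>m. ?A m)|M. ?h x) \<Longrightarrow> ?thesis"
        unfolding zc shI by simp
    qed
    have r1: "1 - exp (- ((a + 1) * L)) \<noteq> 0" using nr by (metis eq_iff_diff_eq_0 less_irrefl norm_one)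
    have "lam a * (exp (- (of_int N * a * L)) * b N / (1 - exp (- ((a + 1) * L)))) = exp (- (of_int N * a * L)) * b N"
    proof (cases "trivial_on_units \<xi>")
      case True
      then show ?thesis using r1 by (simp add: lam_def)
    next
      case False
      then obtain u where u: "u \<in> integer_units" "\<xi> u \<noteq> 1" by (auto simp: trivial_on_units_def)
      have u0: "u \<noteq> 0" by (rule integer_units_nonzero[OF u(1)])
      have us: "u \<in> shell 0" using u(1) by (simp add: shell_0)
      have mu: "x \<in> shell N \<longleftrightarrow> u * x \<in> shell N" for x :: 'k using shell_mult_iff[OF us, of x N] by simp
      have "(LINT x:shell N|M. qchar \<pi> \<xi> 0 x * \<phi> x) = of_real (absv u) * \<xi> u * (LINT x:shell N|M. qchar \<pi> \<xi> 0 x * \<phi> x)"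
      proof (rule scales_set_integral(1)[OF scales_mult[OF u0]])
        show "(\<lambda>x. qchar \<pi> \<xi> 0 x * \<phi> x) \<in> borel_measurable M" using qm phi(1) by measurable
        fix x :: 'k assume x: "x \<in> shell N"
        then have "\<phi> (u * x) = \<phi> x" using N(1)[of x] N(1)[of "u * x"] mu[of x] by (simp add: shell_iff)
        then show "qchar \<pi> \<xi> 0 (u * x) * \<phi> (u * x) = \<xi> u * (qchar \<pi> \<xi> 0 x * \<phi> x)"
          by (simp add: qchar_mult[OF xi pi] qchar_unit[OF xi pi u(1)])
      qed (use mu in simp_all)
      then have "b N * (1 - \<xi> u) = 0" using u(1) by (simp add: b_def integer_units_def algebra_simps)
      then have "b N = 0" using u(2) by simp
      then show ?thesis by simp
    qed
    then show ?thesis unfolding I D_def distrib_left by simp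
  qed
  have powr: "of_nat (residue_card TYPE('k)) powr (- b - 1) = exp (- ((b + 1) * L))" for b
  proof -
    have "of_nat (residue_card TYPE('k)) powr (- b - 1) = exp ((- b - 1) * L)"
      using Ln_of_real[of "rcard TYPE('k)"] by (simp add: powr_def L_def)
    also have "\<dots> = exp (- ((b + 1) * L))" by (rule arg_cong[of _ _ exp]) (simp add: algebra_simps)
    finally show ?thesis .
  qed
  have eqlam: "(if trivial_on_units \<xi> then 1 - of_nat (residue_card TYPE('k)) powr (- b - 1) else 1) = lam b" for b
    by (simp add: lam_def powr)
  have "(THE g. g holomorphic_on UNIV \<and> (\<forall>b. Re b > -1 \<longrightarrow> g b =
        (if trivial_on_units \<xi> then 1 - of_nat (residue_card TYPE('k)) powr (- b - 1) else 1) *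
        (LINT x|M. qchar \<pi> \<xi> b x * \<phi> x))) = D"
  proof (rule the_equality)
    show "D holomorphic_on UNIV \<and> (\<forall>b. Re b > -1 \<longrightarrow> D b =
        (if trivial_on_units \<xi> then 1 - of_nat (residue_card TYPE('k)) powr (- b - 1) else 1) *
        (LINT x|M. qchar \<pi> \<xi> b x * \<phi> x))"
      unfolding eqlam using hol main by simp
    fix g assume g: "g holomorphic_on UNIV \<and> (\<forall>b. Re b > -1 \<longrightarrow> g b =
        (if trivial_on_units \<xi> then 1 - of_nat (residue_card TYPE('k)) powr (- b - 1) else 1) *
        (LINT x|M. qchar \<pi> \<xi> b x * \<phi> x))"
    show "g = D"
    proof
      fix b
      have "(0::complex) \<in> {b. Re b > -1}" by simp
      then have ne: "{b. Re b > -1} \<noteq> {}" by blast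
      show "g b = D b"
      proof (rule analytic_continuation_open[of "{b. Re b > -1}" UNIV g D])
        show "open {b. Re b > -1}" by (rule open_halfspace_Re_gt)
        show "g b = D b" if "b \<in> {b. Re b > -1}" for b
          using g main[of b] that unfolding eqlam by simp
      qed (use ne g hol in auto)
    qed
  qed
  then show ?thesis by (simp add: qchar_distr_def D_def lam_def b_def L_def)
qed

end


section \<open>The kernel along the first family of lines\<close>

text \<open>Only shells of E whose index is a multiple of the ramification index contain points of
  F.\<close>

lemma sum_dvd_reindex:
  fixes F :: "int \<Rightarrow> complex"
  assumes "r > 0"
  shows "(\<Sum>l\<in>{r * a..<r * b}. if r dvd l then F (l div r) else 0) = (\<Sum>k\<in>{a..<b}. F k)"
proof -
  have "(\<Sum>l\<in>{r * a..<r * b}. if r dvd l then F (l div r) else 0) = (\<Sum>l\<in>(*) r ` {a..<b}. F (l div r))"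
  proof (rule sum.mono_neutral_cong_right)
    show "(*) r ` {a..<b} \<subseteq> {r * a..<r * b}" using assms by auto
    show "\<forall>l\<in>{r * a..<r * b} - (*) r ` {a..<b}. (if r dvd l then F (l div r) else 0) = 0"
    proof
      fix l assume l: "l \<in> {r * a..<r * b} - (*) r ` {a..<b}"
      have "\<not> r dvd l"
      proof
        assume "r dvd l"
        then obtain k where k: "l = r * k" by blast
        then have "k \<in> {a..<b}" using l assms by auto
        then show False using l k by blast
      qed
      then show "(if r dvd l then F (l div r) else 0) = 0" by simp
    qed
  qed auto
  also have "\<dots> = (\<Sum>k\<in>{a..<b}. F k)"
    using assms by (subst sum.reindex) (auto simp: inj_on_def)
  finally show ?thesis .
qed

context quadratic_chars
begin

lemma integral_haarE:
  fixes g :: "'f \<Rightarrow> complex"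
  assumes g: "g \<in> borel_measurable borel" "A \<in> sets borel" "emeasure (haarF X) A < \<infinity>" "\<And>x. x \<in> A \<Longrightarrow> norm (g x) \<le> B"
    and C: "C \<in> sets borel" "emeasure (haarF X) C < \<infinity>"
  shows "(LINT x:{x. re x \<in> A \<and> im x \<in> C}|haarE X. g (re x)) = of_real (measure (haarF X) C) * (LINT y:A|haarF X. g y)"
proof -
  interpret P: pair_sigma_finite "haarF X" "haarF X" ..
  let ?D = "{x. re x \<in> A \<and> im x \<in> C}"
  have D: "?D \<in> sets borel"
  proof -
    have "(re -` A \<inter> space borel) \<inter> (im -` C \<inter> space borel) \<in> sets borel"
      by (intro sets.Int measurable_sets[OF measurable_re] measurable_sets[OF measurable_im] g C)
    moreover have "?D = (re -` A \<inter> space borel) \<inter> (im -` C \<inter> space borel)" by auto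
    ultimately show ?thesis by simp
  qed
  let ?h = "\<lambda>p. indicator A (fst p) *\<^sub>R (g (fst p)) * of_real (indicator C (snd p))"
  have hm: "?h \<in> borel_measurable (haarF X \<Otimes>\<^sub>M haarF X)" using g(1,2) C(1) by measurable
  have "integrable (haarF X \<Otimes>\<^sub>M haarF X) ?h"
  proof (rule integrableI_bounded_set[where A = "A \<times> C" and B = B])
    show "A \<times> C \<in> sets (haarF X \<Otimes>\<^sub>M haarF X)" using g C by (intro pair_measureI) simp_all
    have "emeasure (haarF X \<Otimes>\<^sub>M haarF X) (A \<times> C) = emeasure (haarF X) A * emeasure (haarF X) C"
      by (rule F.emeasure_pair_measure_Times) (use g C in simp_all)
    then show "emeasure (haarF X \<Otimes>\<^sub>M haarF X) (A \<times> C) < \<infinity>"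
      using g(3) C(2) by (simp add: ennreal_mult_less_top)
  qed (use hm g(4) in \<open>auto simp: indicator_def\<close>)
  note P.integral_fst'[OF this]
  have "(LINT x:?D|haarE X. g (re x)) =
      (LINT p|(haarF X \<Otimes>\<^sub>M haarF X). (\<lambda>x. indicator ?D x *\<^sub>R g (re x)) ((\<lambda>(x1, x2). \<iota> x1 + \<iota> x2 * \<alpha>) p))"
    unfolding set_lebesgue_integral_def
    by (subst haar_product, rule integral_distr[OF measurable_combine]) (use D g(1) in measurable)
  also have "\<dots> = (LINT p|(haarF X \<Otimes>\<^sub>M haarF X). ?h p)"
    by (rule Bochner_Integration.integral_cong[OF refl]) (auto simp: indicator_def split: prod.splits)
  also have "\<dots> = (LINT y|haarF X. LINT z|haarF X. ?h (y, z))"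
    using P.integral_fst'[OF \<open>integrable (haarF X \<Otimes>\<^sub>M haarF X) ?h\<close>] by simp
  also have "\<dots> = (LINT y|haarF X. indicator A y *\<^sub>R g y * of_real (measure (haarF X) C))"
    using C by (intro Bochner_Integration.integral_cong refl) simp
  finally show ?thesis unfolding set_lebesgue_integral_def integral_mult_left_zero by (simp only: mult.commute)
qed

lemma decomp_unif: "(y::'f) \<noteq> 0 \<Longrightarrow> \<exists>k u. y = unifF X powi k * u \<and> u \<in> integer_units"
  using unit_part[OF eta unif(1), of y] uniformizer_nonzero[OF unif(1)]
  by (intro exI[of _ "valuation y"] exI[of _ "unifF X powi (- valuation y) * y"]) (simp add: power_int_minus)

lemma c0_e0_unif_powi: "c0 (\<iota> (unifF X powi k)) = 1" "e0 (unifF X powi k) = 1"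
  by (simp_all add: power_int_def emb_power emb_inverse c0_simps e0_simps)

lemma c0_e0_trivial:
  assumes "trivial_on_units (\<lambda>u. chi (\<iota> u) * eta u)" "y \<noteq> 0"
  shows "c0 (\<iota> y) * e0 y = 1"
proof -
  obtain k u where "y = unifF X powi k * u" "u \<in> integer_units" using decomp_unif[OF assms(2)] by blast
  then show ?thesis
    using assms(1) by (simp add: emb_mult c0_simps e0_simps c0_e0_unif_powi c0_unit[OF emb_unit] e0_unit trivial_on_units_def)
qed

lemma emb_shell_iff: "y \<noteq> 0 \<Longrightarrow> \<iota> y \<in> shell l \<longleftrightarrow> l = int ram * valuation y"
  using absv_emb_ram[of y "valuation y"] by (auto simp: shell_iff)

text \<open>At a fine level the cell is the product of a shell of F in x_1 and a shell in x_2, and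
  the integrand depends on x_1 alone, because \<chi> \<eta> = 1 removes x_2. The integral therefore
  splits.\<close>

lemma kap_fine:
  assumes tr: "trivial_on_units (\<lambda>u. chi (\<iota> u) * eta u)" and fine: "fine_level f L J" and l: "l \<le> L"
    and f: "f \<in> borel_measurable borel" "\<And>x. norm (f x) \<le> B"
  shows "kap f l J = of_real (rcard TYPE('f) powi (- J) * (1 - 1 / rcard TYPE('f))) *
     (if int ram dvd l then (LINT y:shell (l div int ram)|haarF X. inverse (e0 y ^ 2) * f (\<iota> y)) else 0)"
proof -
  let ?A = "{y. \<iota> y \<in> shell l}"
  let ?g = "\<lambda>y. inverse (e0 y ^ 2) * f (\<iota> y)"
  have small: "(rcard TYPE('f) powi (- J))\<^sup>2 * absv \<alpha> < rcard TYPE('e) powi (- L)"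
    using fine by (simp add: fine_level_def)
  have Ll: "rcard TYPE('e) powi (- L) \<le> rcard TYPE('e) powi (- l)" unfolding powi_le_iff using l by simp
  have cell: "cell l J = {x. re x \<in> ?A \<and> im x \<in> shell J}"
  proof -
    have "x \<in> shell l \<longleftrightarrow> \<iota> (re x) \<in> shell l" if "im x \<in> shell J" for x
    proof -
      have "absv (\<iota> (re x) - x) = (absv (im x))\<^sup>2 * absv \<alpha>"
        by (subst (2) decomp) (simp add: absv_mult absv_emb)
      also have "\<dots> < rcard TYPE('e) powi (- l)" using that small Ll by (simp add: shell_def)
      finally show ?thesis using shell_add_iff[of "\<iota> (re x) - x" l x] by simp
    qed
    then show ?thesis by (auto simp: cell_def)
  qed
  have val: "K0 x * f x = ?g (re x)" if "x \<in> cell l J" for x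
  proof -
    have "rcard TYPE('e) powi (- L) \<le> absv x \<and> absv (im x) \<le> rcard TYPE('f) powi (- J)" "im x \<noteq> 0"
      using that Ll by (auto simp: cell_def shell_def shell_nonzero)
    then have "K0 x = inverse (e0 (re x) ^ 2) * (c0 (\<iota> (im x)) * e0 (im x)) \<and> f x = f (\<iota> (re x))"
      using fine by (simp add: fine_level_def)
    then show ?thesis using c0_e0_trivial[OF tr \<open>im x \<noteq> 0\<close>] by simp
  qed
  have A: "?A = (if int ram dvd l then shell (l div int ram) else {})"
  proof (rule set_eqI)
    fix y
    show "y \<in> ?A \<longleftrightarrow> y \<in> (if int ram dvd l then shell (l div int ram) else {})"
      using emb_shell_iff[of y l] ram_pos by (cases "y = 0") (auto simp: shell_iff)
  qed
  have Am: "?A \<in> sets borel" unfolding A by simp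
  have Af: "emeasure (haarF X) ?A < \<infinity>" unfolding A using F.emeasure_shell_finite by simp
  have gB: "norm (?g y) \<le> 1 * B" if "y \<in> ?A" for y
  proof -
    have "y \<noteq> 0" using that by (auto simp: shell_iff)
    then have "norm (e0 y) = 1" unfolding e0_def by (rule qchar_norm[OF eta unif(1)])
    then show ?thesis using f(2)[of "\<iota> y"] by (simp add: norm_mult norm_inverse norm_power)
  qed
  have gm: "?g \<in> borel_measurable borel" using f(1) by measurable
  have "kap f l J = (LINT x:cell l J|haarE X. ?g (re x))"
    unfolding kap_def set_lebesgue_integral_def
    by (intro Bochner_Integration.integral_cong refl) (auto simp: indicator_def val)
  also have "\<dots> = of_real (measure (haarF X) (shell J)) * (LINT y:?A|haarF X. ?g y)"
    unfolding cell by (rule integral_haarE[OF gm Am Af gB F.sets_shell F.emeasure_shell_finite])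
  finally have e: "kap f l J = of_real (measure (haarF X) (shell J)) * (LINT y:?A|haarF X. ?g y)" .
  show ?thesis
  proof (cases "int ram dvd l")
    case True
    show ?thesis unfolding e A F.measure_shell if_P[OF True] ..
  next
    case False
    have "(LINT y:{}|haarF X. ?g y) = 0" by (simp add: set_lebesgue_integral_def)
    then show ?thesis unfolding e A if_not_P[OF False] by (simp only: mult_zero_right)
  qed
qed

lemma normalized_kernel_S_plus:
  assumes S: "(chi, s, eta, t) \<in> S_plus X" and f: "f \<in> test_functions"
  shows "normalized_kernel X chi s eta t f = (1 - 1 / of_nat (residue_card TYPE('f))) * L_family X eta t f"
proof -
  define L where "L = complex_of_real (ln (rcard TYPE('f)))"
  have L0: "L \<noteq> 0" using ln_rcard_pos[where 'k = 'f] unfolding L_def of_real_eq_0_iff by linarith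
  from S obtain k :: int where tr: "trivial_on_units (\<lambda>u. chi (\<iota> u) * eta u)"
    and k: "2 * s + t + 1/2 = 2 * of_real pi * \<i> / L * of_int k" by (auto simp: S_plus_def L_def)
  have kL: "(2 * s + t + 1/2) * L = 2 * of_int k * of_real pi * \<i>" using L0 by (simp add: k)
  have W1: "Wc s t = 1"
    unfolding Wc_def L_def[symmetric] kL exp_minus using exp_integer_2pi[OF Ints_of_int, of k] by (simp add: mult_ac)
  obtain n0 where n0: "\<And>M. n0 \<le> M \<Longrightarrow> \<exists>J j1. adapted f M J j1" using ex_adapted[OF f] by blast
  define N where "N = max n0 0"
  \<comment> \<open>A multiple of \<open>ram\<close>, so that the cutoffs on E match the cutoffs - N
    and N on F.\<close>
  define M where "M = int ram * N"
  have ram: "int ram > 0" using ram_pos by simp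
  have "N * 1 \<le> N * int ram" using ram by (intro mult_left_mono) (auto simp: N_def)
  then have "n0 \<le> M" unfolding M_def N_def by (simp add: mult.commute)
  then obtain J j1 where ad: "adapted f M J j1" using n0 by blast
  have a: "fine_level f (M + int ram - 1) J" "fine_level (\<lambda>_. 1) (M + int ram - 1) J" "0 \<le> M"
    "\<And>x. x \<noteq> 0 \<Longrightarrow> M \<le> valuation x \<Longrightarrow> f x = f 0" "\<And>x. x \<noteq> 0 \<Longrightarrow> valuation x < - M \<Longrightarrow> f x = 0"
    using ad by (auto simp: adapted_def)
  obtain B where B: "\<And>x. norm (f x) \<le> B" using test_function_bounded[OF f] by blast
  have fm [measurable]: "f \<in> borel_measurable borel"
    by (intro borel_measurable_continuous_onI continuous_on_test_function f)
  define b where "b k = (LINT y:shell k|haarF X. inverse (e0 y ^ 2) * f (\<iota> y))" for k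
  define c where "c = complex_of_real (1 - 1 / rcard TYPE('f))"
  have lamP0: "lamP s t = 0" using tr W1 by (simp add: lamP_def)
  have rl: "of_int (int ram) * complex_of_real (ln (rcard TYPE('e))) = 2 * L"
  proof -
    have "of_int (int ram) * complex_of_real (ln (rcard TYPE('e))) = complex_of_real (real ram * ln (rcard TYPE('e)))" by simp
    then show ?thesis unfolding ln_rcard_ram L_def by simp
  qed
  have qJ: "complex_of_real (rcard TYPE('f) powi (- J)) = exp (- (of_int J * L))"
    using complex_powi_powr[where 'k = 'f, of "- J" 1] by (simp add: L_def)
  \<comment> \<open>All dependence on J collects in a power of \<open>Wc\<close>, which is 1 on S_+;
    the choice of J leaves no trace.\<close>
  have kp: "kpow s t (int ram * i) J * complex_of_real (rcard TYPE('f) powi (- J)) = exp (of_int i * (2 * t + 1) * L)" for i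
  proof -
    have "of_int (int ram * i) * (t + 1/2) * complex_of_real (ln (rcard TYPE('e))) =
      of_int i * (t + 1/2) * (of_int (int ram) * of_real (ln (rcard TYPE('e))))" by simp
    also have "\<dots> = of_int i * (2 * t + 1) * L" unfolding rl by (simp add: field_simps)
    finally have e: "of_int (int ram * i) * (t + 1/2) * complex_of_real (ln (rcard TYPE('e))) = of_int i * (2 * t + 1) * L" .
    have "kpow s t (int ram * i) J * exp (- (of_int J * L)) =
        exp (of_int i * (2 * t + 1) * L - of_int J * ((2 * s + t + 1/2) * L))"
      unfolding kpow_def e L_def[symmetric] exp_add[symmetric] by (rule arg_cong[of _ _ exp]) (simp add: field_simps)
    also have "\<dots> = exp (of_int i * (2 * t + 1) * L)"
    proof -
      have "exp (of_int J * ((2 * s + t + 1/2) * L)) = 1"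
        unfolding kL using exp_integer_2pi[OF Ints_of_int, of "J * k"] by (simp add: mult_ac)
      then show ?thesis by (simp add: exp_diff)
    qed
    finally show ?thesis unfolding qJ .
  qed
  have sp: "shell_poly f J j1 l s t = c * (if int ram dvd l then exp (of_int (l div int ram) * (2 * t + 1) * L) * b (l div int ram) else 0)"
    if "l \<le> M + int ram - 1" for l
  proof (cases "int ram dvd l")
    case True
    then obtain i where i: "l = int ram * i" by blast
    then have d: "l div int ram = i" using ram by simp
    have kf: "kap f l J = complex_of_real (rcard TYPE('f) powi (- J)) * (c * b i)"
      using kap_fine[OF tr a(1) that fm B] unfolding d if_P[OF True] b_def c_def of_real_mult mult.assoc .
    have "shell_poly f J j1 l s t = kpow s t l J * kap f l J" by (simp add: shell_poly_def lamP0)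
    also have "\<dots> = (kpow s t (int ram * i) J * complex_of_real (rcard TYPE('f) powi (- J))) * (c * b i)"
      unfolding kf unfolding i by (simp only: mult.assoc)
    finally show ?thesis unfolding kp using True d by simp
  next
    case False
    then show ?thesis using kap_fine[OF tr a(1) that fm B] by (simp add: shell_poly_def lamP0)
  qed
  have sp1: "f 0 * shell_poly (\<lambda>_. 1) J j1 l s t = shell_poly f J j1 l s t" if "l \<in> {M..<M + int ram}" for l
  proof -
    have "kap f l J = (LINT x:cell l J|haarE X. f 0 * (K0 x * 1))"
      unfolding kap_def set_lebesgue_integral_def
    proof (rule Bochner_Integration.integral_cong[OF refl])
      fix x
      have "f x = f 0" if "x \<in> cell l J" using a(4)[of x] that \<open>l \<in> {M..<M + int ram}\<close> by (auto simp: cell_def shell_iff)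
      then show "indicator (cell l J) x *\<^sub>R (K0 x * f x) = indicator (cell l J) x *\<^sub>R (f 0 * (K0 x * 1))"
        by (auto simp: indicator_def)
    qed
    also have "\<dots> = f 0 * kap (\<lambda>_. 1) l J" by (simp add: kap_def)
    finally show ?thesis by (simp add: shell_poly_def lamP0)
  qed
  have "(\<Sum>l\<in>{- M..<M}. shell_poly f J j1 l s t) =
      c * (\<Sum>l\<in>{int ram * (- N)..<int ram * N}. if int ram dvd l then exp (of_int (l div int ram) * (2 * t + 1) * L) * b (l div int ram) else 0)"
    unfolding sum_distrib_left using ram by (intro sum.cong) (auto simp: M_def sp)
  also have "\<dots> = c * (\<Sum>k\<in>{- N..<N}. exp (of_int k * (2 * t + 1) * L) * b k)"
    using sum_dvd_reindex[OF ram, of "\<lambda>k. exp (of_int k * (2 * t + 1) * L) * b k" "- N" N] by simp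
  finally have s1: "(\<Sum>l\<in>{- M..<M}. shell_poly f J j1 l s t) = c * (\<Sum>k\<in>{- N..<N}. exp (of_int k * (2 * t + 1) * L) * b k)" .
  have "f 0 * (\<Sum>l\<in>{M..<M + int ram}. shell_poly (\<lambda>_. 1) J j1 l s t) =
      c * (\<Sum>l\<in>{int ram * N..<int ram * (N + 1)}. if int ram dvd l then exp (of_int (l div int ram) * (2 * t + 1) * L) * b (l div int ram) else 0)"
    unfolding sum_distrib_left using ram by (intro sum.cong) (auto simp: M_def sp1 sp distrib_left)
  also have "\<dots> = c * (\<Sum>k\<in>{N..<N + 1}. exp (of_int k * (2 * t + 1) * L) * b k)"
    using sum_dvd_reindex[OF ram, of "\<lambda>k. exp (of_int k * (2 * t + 1) * L) * b k" N "N + 1"] by simp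
  also have "{N..<N + 1} = {N}" by auto
  finally have s2: "f 0 * (\<Sum>l\<in>{M..<M + int ram}. shell_poly (\<lambda>_. 1) J j1 l s t) = c * (exp (of_int N * (2 * t + 1) * L) * b N)"
    by simp
  define xi where "xi = (\<lambda>u. inverse ((eta u)\<^sup>2))"
  have xi: "xi \<in> unit_characters" unfolding xi_def by (intro unit_characters_inverse unit_characters_power eta)
  have qx: "qchar (unifF X) xi 0 y = inverse (e0 y ^ 2)" for y
    by (simp add: qchar_def e0_def xi_def power_mult_distrib)
  \<comment> \<open>Where \<chi> = \<eta>^(-1) on units, \<chi> \<eta>^(-1) is \<eta>^(-2). Thus
    \<lambda>_- is triggered by the same condition as the normalization of L.\<close>
  have trxi: "trivial_on_units (\<lambda>u. chi (\<iota> u) * inverse (eta u)) \<longleftrightarrow> trivial_on_units xi"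
  proof -
    have "chi (\<iota> u) * inverse (eta u) = xi u" if "u \<in> integer_units" for u
    proof -
      have "chi (\<iota> u) * eta u = 1" using tr that by (simp add: trivial_on_units_def)
      then have "chi (\<iota> u) = inverse (eta u)" by (metis inverse_unique mult.commute)
      then show ?thesis by (simp add: xi_def power2_eq_square)
    qed
    then show ?thesis by (simp add: trivial_on_units_def)
  qed
  \<comment> \<open>With \<open>Wc\<close> equal to 1 the ratio in \<lambda>_- is q_F^(2 t), which
    is the one of L at the exponent - 2 t - 1.\<close>
  have Z: "Zc s t = exp (- ((- 2 * t - 1 + 1) * L))"
  proof -
    have "Zc s t = Wc s t * exp (2 * t * L)"
      unfolding Zc_def Wc_def L_def[symmetric] exp_add[symmetric] by (rule arg_cong[of _ _ exp]) (simp add: field_simps)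
    then show ?thesis unfolding W1 by simp
  qed
  have valF: "valuation (\<iota> y) = int ram * valuation y" if "y \<noteq> 0" for y
    using emb_shell_iff[OF that, of "int ram * valuation y"] by (simp add: shell_iff)
  have Ldist: "L_family X eta t f =
     (if trivial_on_units xi then 1 - exp (- ((- 2 * t - 1 + 1) * L)) else 1) *
     (\<Sum>k\<in>{- N..<N}. exp (- (of_int k * (- 2 * t - 1) * L)) * b k) + exp (- (of_int N * (- 2 * t - 1) * L)) * b N"
    unfolding L_family_def xi_def[symmetric] b_def qx[symmetric] L_def
  proof (rule F.qchar_distr_eq[OF unif(1) xi])
    show "(\<lambda>x1. f (\<iota> x1)) \<in> borel_measurable borel" by measurable
    show "norm (f (\<iota> x)) \<le> B" for x by (rule B)
    show "f (\<iota> x) = f (\<iota> 0)" if "x \<noteq> 0" "N \<le> valuation x" for x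
      using a(4)[of "\<iota> x"] valF[OF that(1)] that ram by (simp add: M_def)
    show "f (\<iota> x) = 0" if "x \<noteq> 0" "valuation x < - N" for x
    proof (rule a(5))
      have "int ram * valuation x < int ram * (- N)" using that ram by (intro mult_strict_left_mono)
      then show "valuation (\<iota> x) < - M" using valF[OF that(1)] by (simp add: M_def)
    qed (use that in simp)
    show "0 \<le> N" by (simp add: N_def)
  qed
  have ee: "exp (- (of_int k * (- 2 * t - 1) * L)) = exp (of_int k * (2 * t + 1) * L)" for k
    by (rule arg_cong[of _ _ exp]) (simp add: algebra_simps)
  have "normalized_kernel X chi s eta t f = cont f M J j1 (s, t)" by (rule normalized_kernel_eq[OF f ad])
  also have "\<dots> = c * L_family X eta t f"
    unfolding cont_def prod.case s1 s2 Ldist ee lamM_def trxi Z by (simp add: algebra_simps)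
  finally show ?thesis by (simp add: c_def)
qed

end

section \<open>The product of the two gamma factors\<close>

lemma has_sum_product_complex:
  fixes a :: "'a \<Rightarrow> complex" and b :: "'b \<Rightarrow> complex"
  assumes a: "(a has_sum S) A" and b: "(b has_sum T) B"
  shows "((\<lambda>(x, y). a x * b y) has_sum (S * T)) (A \<times> B)"
proof (rule has_sum_SigmaI)
  show "((\<lambda>y. case (x, y) of (x, y) \<Rightarrow> a x * b y) has_sum (a x * T)) B" for x
    using has_sum_cmult_right[OF b, of "a x"] by simp
  show "((\<lambda>x. a x * T) has_sum (S * T)) A" by (rule has_sum_cmult_left[OF a])
  have an: "(\<lambda>x. norm (a x)) summable_on A" and bn: "(\<lambda>y. norm (b y)) summable_on B"
    using has_sum_imp_summable[OF a] has_sum_imp_summable[OF b] summable_on_iff_abs_summable_on_complex by blast+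
  have "(\<lambda>p. norm (case p of (x, y) \<Rightarrow> a x * b y)) summable_on A \<times> B"
    unfolding Infinite_Sum.abs_summable_on_Sigma_iff
  proof (intro conjI ballI)
    fix x
    have "(\<lambda>y. norm (a x) * norm (b y)) summable_on B" by (rule summable_on_cmult_right[OF bn])
    then show "(\<lambda>y. norm (case (x, y) of (x, y) \<Rightarrow> a x * b y)) summable_on B" by (simp add: norm_mult)
  next
    have "norm (infsum (\<lambda>y. norm (case (x, y) of (x, y) \<Rightarrow> a x * b y)) B) = norm (a x) * infsum (\<lambda>y. norm (b y)) B" for x
      by (simp add: norm_mult infsum_cmult_right' abs_mult infsum_nonneg)
    moreover have "(\<lambda>x. norm (a x) * infsum (\<lambda>y. norm (b y)) B) summable_on A"
      by (rule summable_on_cmult_left[OF an])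
    ultimately show "(\<lambda>x. norm (infsum (\<lambda>y. norm (case (x, y) of (x, y) \<Rightarrow> a x * b y)) B)) summable_on A"
      by (simp only:)
  qed
  then show "(\<lambda>(x, y). a x * b y) summable_on A \<times> B"
    using summable_on_iff_abs_summable_on_complex by blast
qed

lemma scales_set_integral_eq:
  fixes h :: "'a \<Rightarrow> complex"
  assumes T: "scales M T c" and h: "h \<in> borel_measurable M" and B: "B \<in> sets M"
    and AB: "\<And>x. x \<in> A \<longleftrightarrow> T x \<in> B"
  shows "(LINT x:B|M. h x) = of_real c * (LINT x:A|M. h (T x))"
proof -
  have c: "c > 0" by (rule scales_pos[OF T])
  have m: "(\<lambda>x. indicator B x *\<^sub>R h x) \<in> borel_measurable M" using h B by measurable
  have "(LINT x|M. indicator B (T x) *\<^sub>R h (T x)) = (1 / c) *\<^sub>R (LINT x:B|M. h x)"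
    unfolding set_lebesgue_integral_def by (rule scales_integral[OF T m])
  moreover have "(\<lambda>x. indicator B (T x) *\<^sub>R h (T x)) = (\<lambda>x. indicator A x *\<^sub>R h (T x))"
    using AB by (auto simp: indicator_def)
  ultimately show ?thesis
    using c by (simp add: set_lebesgue_integral_def scaleR_conv_of_real field_simps)
qed

lemma (in pair_sigma_finite) set_Fubini:
  fixes h :: "'a \<Rightarrow> 'b \<Rightarrow> complex"
  assumes h: "(\<lambda>(x, y). h x y) \<in> borel_measurable (M1 \<Otimes>\<^sub>M M2)"
    and A: "A \<in> sets M1" "emeasure M1 A < \<infinity>" and C: "C \<in> sets M2" "emeasure M2 C < \<infinity>"
    and B: "\<And>x y. x \<in> A \<Longrightarrow> y \<in> C \<Longrightarrow> norm (h x y) \<le> B"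
  shows "(LINT x:A|M1. (LINT y:C|M2. h x y)) = (LINT y:C|M2. (LINT x:A|M1. h x y))"
proof -
  let ?H = "\<lambda>x y. indicator A x *\<^sub>R (indicator C y *\<^sub>R h x y)"
  have "integrable (M1 \<Otimes>\<^sub>M M2) (\<lambda>(x, y). ?H x y)"
  proof (rule integrableI_bounded_set[where A = "A \<times> C" and B = B])
    show "A \<times> C \<in> sets (M1 \<Otimes>\<^sub>M M2)" using A C by (intro pair_measureI)
    have "(\<lambda>p. indicator (A \<times> C) p *\<^sub>R (case p of (x, y) \<Rightarrow> h x y)) \<in> borel_measurable (M1 \<Otimes>\<^sub>M M2)"
      using h A C by measurable
    moreover have "(\<lambda>p. indicator (A \<times> C) p *\<^sub>R (case p of (x, y) \<Rightarrow> h x y)) = (\<lambda>(x, y). ?H x y)"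
      by (auto simp: indicator_def fun_eq_iff)
    ultimately show "(\<lambda>(x, y). ?H x y) \<in> borel_measurable (M1 \<Otimes>\<^sub>M M2)" by simp
    have "emeasure (M1 \<Otimes>\<^sub>M M2) (A \<times> C) = emeasure M1 A * emeasure M2 C"
      by (rule M2.emeasure_pair_measure_Times) (use A C in simp_all)
    then show "emeasure (M1 \<Otimes>\<^sub>M M2) (A \<times> C) < \<infinity>"
      using A C by (simp add: ennreal_mult_less_top)
  qed (use B in \<open>auto simp: indicator_def\<close>)
  from Fubini_integral[OF this] have "(LINT y|M2. (LINT x|M1. ?H x y)) = (LINT x|M1. (LINT y|M2. ?H x y))" .
  moreover have "(LINT y|M2. ?H x y) = indicator A x *\<^sub>R (LINT y:C|M2. h x y)" for x
    unfolding set_lebesgue_integral_def by (rule integral_scaleR_right)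
  moreover have "(LINT x|M1. ?H x y) = indicator C y *\<^sub>R (LINT x:A|M1. h x y)" for y
    unfolding set_lebesgue_integral_def scaleR_left_commute[of "indicator A _"] by (rule integral_scaleR_right)
  ultimately show ?thesis unfolding set_lebesgue_integral_def by (simp only:)
qed

section \<open>The characters entering the two gamma factors\<close>

context quadratic_chars
begin

lemma psiE_eq: "psiE X x = psi X (re x)"
  by (simp add: psiE_def re_def)

lemma psiE_character: "additive_character (psiE X)" "\<exists>x. psiE X x \<noteq> 1"
proof -
  have p: "continuous_on UNIV (psi X)" "\<And>x. norm (psi X x) = 1" "\<And>x y. psi X (x + y) = psi X x * psi X y"
    using psi(1) by (auto simp: additive_character_def)
  have "continuous_on UNIV (\<lambda>x. psi X (re x))"
    by (rule continuous_on_compose2[OF p(1) continuous_on_re]) simp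
  then show "additive_character (psiE X)"
    using p(2,3) by (simp add: additive_character_def psiE_eq[abs_def])
  obtain y where "psi X y \<noteq> 1" using psi(2) by blast
  then show "\<exists>x. psiE X x \<noteq> 1" by (intro exI[of _ "\<iota> y"]) (simp add: psiE_eq)
qed

definition xiF :: "'f \<Rightarrow> complex" where "xiF u = (chi (\<iota> u))\<^sup>2"
definition xiE :: "'e \<Rightarrow> complex" where "xiE u = inverse ((chi u)\<^sup>2)"

lemma xiE_char: "xiE \<in> unit_characters"
  unfolding xiE_def by (intro unit_characters_inverse unit_characters_power chi)

lemma xiF_char: "xiF \<in> unit_characters"
proof -
  have "continuous_on integer_units (\<lambda>u. chi (\<iota> u))"
    using chi by (intro continuous_on_compose2[OF _ continuous_on_emb]) (auto simp: unit_characters_def emb_unit)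
  then have "(\<lambda>u. chi (\<iota> u)) \<in> unit_characters"
    using chi emb_unit by (simp add: unit_characters_def emb_mult)
  then show ?thesis unfolding xiF_def by (rule unit_characters_power)
qed

lemma qchar_xiE: "qchar (unifE X) xiE 0 x = inverse (c0 x ^ 2)"
  by (simp add: qchar_def c0_def xiE_def)

lemma qchar_xiF: "qchar (unifF X) xiF 0 y = c0 (\<iota> y) ^ 2"
proof (cases "y = 0")
  case False
  define u where "u = unifF X powi (- valuation y) * y"
  have u: "u \<in> integer_units" unfolding u_def by (rule unit_part[OF eta unif(1) False])
  have "c0 (\<iota> u) = c0 (\<iota> y)" by (simp add: u_def emb_mult c0_simps c0_e0_unif_powi del: power_int_minus)
  then show ?thesis using False c0_unit[OF emb_unit[OF u]] by (simp add: qchar_def xiF_def flip: u_def)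
qed (simp add: qchar_def c0_simps)

end

section \<open>The double series of the gamma product, grouped by the shell of the quotient\<close>

locale quadratic_gamma = quadratic_chars X chi eta
  for X :: "('f::nonarch_local_field, 'e::nonarch_local_field) quadratic_data" and chi eta +
  fixes d dE :: int
  assumes psiF: "haar_psi (haarF X) (psi X) d" and psiE: "haar_psi (haarE X) (psiE X) dE"
begin

sublocale PF: haar_psi "haarF X" "psi X" d by (rule psiF)
sublocale PE: haar_psi "haarE X" "psiE X" dE by (rule psiE)
sublocale FE: pair_sigma_finite "haarF X" "haarE X" ..

definition gF :: "int \<Rightarrow> complex" where "gF k = PF.gcoeff (unifF X) xiF k"
definition gE :: "int \<Rightarrow> complex" where "gE k = PE.gcoeff (unifE X) xiE k"

lemma gF_eq: "gF k = (LINT y:shell k|haarF X. psi X y * c0 (\<iota> y) ^ 2)"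
  by (simp add: gF_def PF.gcoeff_def qchar_xiF)

lemma gE_eq: "gE k = (LINT x:shell k|haarE X. psi X (re x) * inverse (c0 x ^ 2))"
  by (simp add: gE_def PE.gcoeff_def qchar_xiE psiE_eq)

lemma norm_c0: "x \<noteq> 0 \<Longrightarrow> norm (c0 x) = 1"
  unfolding c0_def by (rule qchar_norm[OF chi unif(2)])

text \<open>Substituting \<iota> y x in the integral over E lets \<open>l\<close> index the shell of
  the quotient. The factor \<chi>^2 (y) cancels the reciprocal factor thus created, and \<psi>
  combines to y (1 + x_1).\<close>

lemma coeff_product:
  "gF k * gE (l + int ram * k) = of_real ((rcard TYPE('f) powi (- k)) ^ 2) *
     (LINT x:shell l|haarE X. inverse (c0 x ^ 2) * (LINT y:shell k|haarF X. psi X (y * (1 + re x))))"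
proof -
  let ?q = "complex_of_real ((rcard TYPE('f) powi (- k)) ^ 2)"
  have 1: "gE (l + int ram * k) = ?q * inverse (c0 (\<iota> y) ^ 2) * (LINT x:shell l|haarE X. psi X (y * re x) * inverse (c0 x ^ 2))"
    if y: "y \<in> shell k" for y
  proof -
    have y0: "y \<noteq> 0" by (rule shell_nonzero[OF y])
    have iy: "\<iota> y \<in> shell (int ram * k)" by (rule absv_emb_ram[OF y])
    have "gE (l + int ram * k) = of_real ((absv y)\<^sup>2) * (LINT x:shell l|haarE X. psi X (re (\<iota> y * x)) * inverse (c0 (\<iota> y * x) ^ 2))"
      unfolding gE_eq
    proof (rule scales_set_integral_eq[OF scales_emb[OF y0]])
      show "x \<in> shell l \<longleftrightarrow> \<iota> y * x \<in> shell (l + int ram * k)" for x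
        using shell_mult_iff[OF iy, of x l] by (simp add: add.commute)
      show "(\<lambda>x. psi X (re x) * inverse (c0 x ^ 2)) \<in> borel_measurable (haarE X)"
        using measurable_compose[OF measurable_re PF.psi_measurable] by measurable
    qed simp
    also have "(LINT x:shell l|haarE X. psi X (re (\<iota> y * x)) * inverse (c0 (\<iota> y * x) ^ 2)) =
        (LINT x:shell l|haarE X. inverse (c0 (\<iota> y) ^ 2) * (psi X (y * re x) * inverse (c0 x ^ 2)))"
      unfolding re_im_simps c0_simps power_mult_distrib inverse_mult_distrib by (simp only: mult_ac)
    also have "\<dots> = inverse (c0 (\<iota> y) ^ 2) * (LINT x:shell l|haarE X. psi X (y * re x) * inverse (c0 x ^ 2))"
      by simp
    finally show ?thesis using y by (simp add: shell_def)
  qed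
  have pm: "(\<lambda>(y, x). psi X (y * (1 + re x)) * inverse (c0 x ^ 2)) \<in> borel_measurable (haarF X \<Otimes>\<^sub>M haarE X)"
  proof -
    have "(\<lambda>p. fst p * (1 + re (snd p))) \<in> borel_measurable (haarF X \<Otimes>\<^sub>M haarE X)" by measurable
    from measurable_compose[OF this PF.psi_measurable]
    have [measurable]: "(\<lambda>p. psi X (fst p * (1 + re (snd p)))) \<in> borel_measurable (haarF X \<Otimes>\<^sub>M haarE X)" .
    have "(\<lambda>p. psi X (fst p * (1 + re (snd p))) * inverse (c0 (snd p) ^ 2)) \<in> borel_measurable (haarF X \<Otimes>\<^sub>M haarE X)"
      by measurable
    then show ?thesis by (simp add: case_prod_unfold)
  qed
  have "gF k * gE (l + int ram * k) = (LINT y:shell k|haarF X. psi X y * c0 (\<iota> y) ^ 2 * gE (l + int ram * k))"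
    unfolding gF_eq by (simp add: set_lebesgue_integral_def flip: integral_mult_left_zero)
  also have "\<dots> = (LINT y:shell k|haarF X. ?q * (LINT x:shell l|haarE X. psi X (y * (1 + re x)) * inverse (c0 x ^ 2)))"
    unfolding set_lebesgue_integral_def[of "haarF X"]
  proof (rule Bochner_Integration.integral_cong[OF refl])
    fix y
    show "indicator (shell k) y *\<^sub>R (psi X y * c0 (\<iota> y) ^ 2 * gE (l + int ram * k)) =
      indicator (shell k) y *\<^sub>R (?q * (LINT x:shell l|haarE X. psi X (y * (1 + re x)) * inverse (c0 x ^ 2)))"
    proof (cases "y \<in> shell k")
      case True
      then have "c0 (\<iota> y) \<noteq> 0" using shell_nonzero[OF True] by (intro c0_nonzero) simp
      then have "psi X y * c0 (\<iota> y) ^ 2 * gE (l + int ram * k) =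
          ?q * (psi X y * (LINT x:shell l|haarE X. psi X (y * re x) * inverse (c0 x ^ 2)))"
        unfolding 1[OF True] by (simp add: field_simps)
      also have "psi X y * (LINT x:shell l|haarE X. psi X (y * re x) * inverse (c0 x ^ 2)) =
          (LINT x:shell l|haarE X. psi X y * (psi X (y * re x) * inverse (c0 x ^ 2)))" by simp
      also have "\<dots> = (LINT x:shell l|haarE X. psi X (y * (1 + re x)) * inverse (c0 x ^ 2))"
        by (simp add: distrib_left PF.psi_add mult.assoc)
      finally show ?thesis by simp
    qed simp
  qed
  also have "\<dots> = ?q * (LINT y:shell k|haarF X. (LINT x:shell l|haarE X. psi X (y * (1 + re x)) * inverse (c0 x ^ 2)))"
    by simp
  also have "(LINT y:shell k|haarF X. (LINT x:shell l|haarE X. psi X (y * (1 + re x)) * inverse (c0 x ^ 2))) =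
      (LINT x:shell l|haarE X. (LINT y:shell k|haarF X. psi X (y * (1 + re x)) * inverse (c0 x ^ 2)))"
  proof (rule FE.set_Fubini[OF pm _ F.emeasure_shell_finite _ E.emeasure_shell_finite, where B = 1])
    show "norm (psi X (y * (1 + re x)) * inverse (c0 x ^ 2)) \<le> 1" if "x \<in> shell l" for x y
      using norm_c0[OF shell_nonzero[OF that]] by (simp add: norm_mult norm_inverse norm_power)
  qed simp_all
  finally show ?thesis by (simp add: mult.commute)
qed

text \<open>By \<open>psiball_eq\<close> an approximate identity at 0: total mass q^(-d) for every
  \<open>n\<close>, concentrated on smaller and smaller balls as \<open>n\<close> grows.\<close>

definition psiball :: "int \<Rightarrow> 'f \<Rightarrow> complex" where
  "psiball n z = (LINT y:{y. absv y \<le> rcard TYPE('f) powi n}|haarF X. psi X (y * z))"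

lemma psiball_eq: "psiball n z = (if absv z \<le> rcard TYPE('f) powi (- d - n) then of_real (rcard TYPE('f) powi n) else 0)"
  unfolding psiball_def by (rule PF.psi_ball_integral)

text \<open>A shell is a difference of consecutive balls, so sums over k will telescope.\<close>

lemma shell_psi_integral: "(LINT y:shell k|haarF X. psi X (y * z)) = psiball (- k) z - psiball (- k - 1) z"
proof -
  let ?h = "\<lambda>y. psi X (y * z)"
  have hm: "?h \<in> borel_measurable borel"
    by (rule measurable_compose[OF PF.measurable_mult_right_const PF.psi_measurable])
  have i: "set_integrable (haarF X) {y. absv y \<le> rcard TYPE('f) powi n} ?h" for n
    by (rule F.set_integrable_bounded[OF hm, where B = 1]) (simp_all add: F.emeasure_absv_ball0)
  have ish: "set_integrable (haarF X) (shell k) ?h"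
    by (rule F.set_integrable_bounded[OF hm _ F.emeasure_shell_finite, where B = 1]) simp_all
  have eq: "{y::'f. absv y \<le> rcard TYPE('f) powi (- k)} = shell k \<union> {y. absv y \<le> rcard TYPE('f) powi (- k - 1)}"
  proof (rule set_eqI)
    fix y :: 'f
    have "rcard TYPE('f) powi (- k - 1) < rcard TYPE('f) powi (- k)" unfolding powi_less_iff by simp
    then show "y \<in> {y. absv y \<le> rcard TYPE('f) powi (- k)} \<longleftrightarrow> y \<in> shell k \<union> {y. absv y \<le> rcard TYPE('f) powi (- k - 1)}"
      using absv_less_powi_iff[of y "- k"] unfolding shell_def mem_Collect_eq Un_iff by linarith
  qed
  have disj: "shell k \<inter> {y::'f. absv y \<le> rcard TYPE('f) powi (- k - 1)} = {}"
  proof -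
    have "\<not> rcard TYPE('f) powi (- k) \<le> rcard TYPE('f) powi (- k - 1)" unfolding powi_le_iff by simp
    then show ?thesis by (auto simp: shell_def)
  qed
  have "psiball (- k) z = (LINT y:shell k|haarF X. ?h y) + psiball (- k - 1) z"
    unfolding psiball_def eq by (rule set_integral_Un[OF disj ish i])
  then show ?thesis by simp
qed

text \<open>The power of q removes the factor produced by the substitution in
  \<open>coeff_product\<close>, so that the terms with fixed \<open>l\<close> telescope.\<close>

definition cdiag :: "int \<Rightarrow> int \<Rightarrow> complex" where
  "cdiag l k = of_real ((rcard TYPE('f) powi k) ^ 2) * (gF k * gE (l + int ram * k))"

lemma cdiag_eq: "cdiag l k = (LINT x:shell l|haarE X. inverse (c0 x ^ 2) * (psiball (- k) (1 + re x) - psiball (- k - 1) (1 + re x)))"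
proof -
  have "(rcard TYPE('f) powi k) ^ 2 * (rcard TYPE('f) powi (- k)) ^ 2 = 1"
  proof -
    have "rcard TYPE('f) powi k * rcard TYPE('f) powi (- k) = 1" by (simp add: power_int_minus)
    then show ?thesis unfolding power_mult_distrib[symmetric] by simp
  qed
  then have "complex_of_real ((rcard TYPE('f) powi k) ^ 2) * of_real ((rcard TYPE('f) powi (- k)) ^ 2) = 1"
    by (simp only: of_real_mult[symmetric] of_real_1)
  then show ?thesis
    unfolding cdiag_def coeff_product shell_psi_integral mult.assoc[symmetric] by simp
qed

text \<open>The approximate identity placed at x_1 = - 1 inside one shell of E.\<close>

definition near :: "int \<Rightarrow> int \<Rightarrow> complex" where
  "near l n = (LINT x:shell l|haarE X. inverse (c0 x ^ 2) * psiball n (1 + re x))"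

lemma measurable_psiball: "(\<lambda>x. psiball n (1 + re x)) \<in> borel_measurable borel"
proof -
  have s: "{x. absv (1 + re x) \<le> r} \<in> sets borel" for r
  proof -
    have "(\<lambda>x. absv (1 + re x)) -` {..r} \<inter> space borel \<in> sets borel"
      by (rule measurable_sets[OF measurable_compose[OF _ measurable_absv]]) measurable
    moreover have "(\<lambda>x. absv (1 + re x)) -` {..r} \<inter> space borel = {x. absv (1 + re x) \<le> r}" by auto
    ultimately show ?thesis by simp
  qed
  have "(\<lambda>x. indicator {x. absv (1 + re x) \<le> rcard TYPE('f) powi (- d - n)} x *\<^sub>R complex_of_real (rcard TYPE('f) powi n)) \<in> borel_measurable borel"
    using s by measurable
  moreover have "(\<lambda>x. indicator {x. absv (1 + re x) \<le> rcard TYPE('f) powi (- d - n)} x *\<^sub>R complex_of_real (rcard TYPE('f) powi n)) = (\<lambda>x. psiball n (1 + re x))"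
    by (auto simp: psiball_eq indicator_def fun_eq_iff)
  ultimately show ?thesis by (simp only:)
qed

lemma near_bound_pw: "x \<in> shell l \<Longrightarrow> norm (inverse (c0 x ^ 2) * psiball n (1 + re x)) \<le> rcard TYPE('f) powi n"
  using norm_c0[OF shell_nonzero] by (simp add: norm_mult norm_inverse norm_power psiball_eq norm_power_int)

lemma near_integrable: "set_integrable (haarE X) (shell l) (\<lambda>x. inverse (c0 x ^ 2) * psiball n (1 + re x))"
  by (rule E.set_integrable_bounded[OF _ _ E.emeasure_shell_finite near_bound_pw])
     (use measurable_psiball in measurable)

lemma cdiag_near: "cdiag l k = near l (- k) - near l (- k - 1)"
  unfolding cdiag_eq near_def right_diff_distrib by (rule set_integral_diff(2)[OF near_integrable near_integrable])

lemma cdiag_telescope: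
  assumes "N \<le> n"
  shows "(\<Sum>k\<in>{N..<n}. cdiag l k) = near l (- N) - near l (- n)"
  using assms
proof (induction n rule: int_ge_induct)
  case (step n)
  have "{N..<n + 1} = insert n {N..<n}" using step.hyps by auto
  then show ?case using step by (simp add: cdiag_near)
qed simp

lemma near_bound: "norm (near l n) \<le> rcard TYPE('f) powi n * measure (haarE X) (shell l)"
proof -
  have "norm (near l n) \<le> (LINT x:shell l|haarE X. norm (inverse (c0 x ^ 2) * psiball n (1 + re x)))"
    unfolding near_def by (rule set_integral_norm_bound[OF near_integrable])
  also have "\<dots> \<le> (LINT x:shell l|haarE X. rcard TYPE('f) powi n)"
  proof (rule set_integral_mono)
    show "set_integrable (haarE X) (shell l) (\<lambda>x. norm (inverse (c0 x ^ 2) * psiball n (1 + re x)))"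
      by (rule set_integrable_norm[OF near_integrable])
    show "set_integrable (haarE X) (shell l) (\<lambda>x. rcard TYPE('f) powi n)"
      unfolding set_integrable_def using E.emeasure_shell_finite
      by (intro integrable_scaleR_left integrable_real_indicator) simp_all
  qed (rule near_bound_pw)
  also have "\<dots> = rcard TYPE('f) powi n * measure (haarE X) (shell l)"
  proof -
    have "(LINT x:shell l|haarE X. rcard TYPE('f) powi n) = (LINT x|haarE X. indicator (shell l) x) *\<^sub>R rcard TYPE('f) powi n"
      unfolding set_lebesgue_integral_def using E.emeasure_shell_finite
      by (intro integral_scaleR_left integrable_real_indicator) simp_all
    then show ?thesis by simp
  qed
  finally show ?thesis .
qed

text \<open>In this direction the balls grow, but the shell has finite measure and the height q^n of
  the approximate identity tends to 0.\<close>

lemma near_tendsto_0: "(\<lambda>n. near l (- int n)) \<longlonglongrightarrow> 0"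
proof (rule Lim_null_comparison)
  show "\<forall>\<^sub>F n in sequentially. norm (near l (- int n)) \<le> (1 / rcard TYPE('f)) ^ n * measure (haarE X) (shell l)"
    using near_bound[of l "- int n" for n]
    by (intro always_eventually) (simp add: power_int_minus power_one_over inverse_eq_divide)
  have "(\<lambda>n. (1 / rcard TYPE('f)) ^ n) \<longlonglongrightarrow> 0"
    using rcard_gt_1[where 'k = 'f] by (intro LIMSEQ_power_zero) simp
  from tendsto_mult_left_zero[OF this]
  show "(\<lambda>n. (1 / rcard TYPE('f)) ^ n * measure (haarE X) (shell l)) \<longlonglongrightarrow> 0" .
qed

definition slice :: "int \<Rightarrow> complex" where
  "slice l = (LINT x:{x. x \<in> shell l \<and> re x \<in> shell 0}|haarE X. c0 (\<iota> (re x)) ^ 2 * inverse (c0 x ^ 2))"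

text \<open>Scaling by the units of the small field preserves the shells, so the neighbourhood of \<open>- 1\<close>
  may be replaced by its average over all translates, that is, by the whole unit group.\<close>

lemma near_eq_slice:
  obtains N where "\<And>n l. N \<le> n \<Longrightarrow>
     of_real (1 - 1 / rcard TYPE('f)) * near l n = of_real (rcard TYPE('f) powi (- d)) * slice l"
proof -
  obtain m where m: "m > 0" "\<And>x y s. absv y \<le> rcard TYPE('f) powi (- int m) * absv x \<Longrightarrow>
      qchar (unifF X) xiF s (x + y) = qchar (unifF X) xiF s x"
    by (rule qchar_locally_constant[OF xiF_char unif(1)]) blast
  have "of_real (1 - 1 / rcard TYPE('f)) * near l n = of_real (rcard TYPE('f) powi (- d)) * slice l"
    if n: "int m - d \<le> n" for n l
  proof -
    let ?r = "rcard TYPE('f) powi (- d - n)"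
    let ?H = "\<lambda>u x. inverse (c0 x ^ 2) * (c0 (\<iota> u) ^ 2 * psiball n (u + re x))"
    have rm: "?r \<le> rcard TYPE('f) powi (- int m)" unfolding powi_le_iff using n by simp
    have "rcard TYPE('f) powi (- int m) < rcard TYPE('f) powi 0" unfolding powi_less_iff using m(1) by simp
    then have r1: "?r < 1" using rm by simp
    \<comment> \<open>Replacing x by u^(-1) x moves the centre from - 1 to - u at the price of the
      factor \<chi>^2 (u).\<close>
    have inv: "near l n = (LINT x:shell l|haarE X. ?H u x)" if u: "u \<in> shell 0" for u
    proof -
      have u1: "absv u = 1" and u0: "u \<noteq> 0" using u by (auto simp: shell_def)
      have iu: "inverse u \<noteq> 0" "absv (inverse u) = 1" using u0 u1 by (auto simp: absv_inverse)
      have is0: "\<iota> (inverse u) \<in> shell 0" using iu by (simp add: shell_def absv_emb)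
      have "near l n = of_real ((absv (inverse u))\<^sup>2) *
          (LINT x:shell l|haarE X. inverse (c0 (\<iota> (inverse u) * x) ^ 2) * psiball n (1 + re (\<iota> (inverse u) * x)))"
        unfolding near_def
      proof (rule scales_set_integral_eq[OF scales_emb[OF iu(1)]])
        show "x \<in> shell l \<longleftrightarrow> \<iota> (inverse u) * x \<in> shell l" for x
          using shell_mult_iff[OF is0, of x l] by simp
        show "(\<lambda>x. inverse (c0 x ^ 2) * psiball n (1 + re x)) \<in> borel_measurable (haarE X)"
          using measurable_psiball by measurable
      qed simp
      also have "(LINT x:shell l|haarE X. inverse (c0 (\<iota> (inverse u) * x) ^ 2) * psiball n (1 + re (\<iota> (inverse u) * x))) =
          (LINT x:shell l|haarE X. ?H u x)"
        unfolding set_lebesgue_integral_def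
      proof (rule Bochner_Integration.integral_cong[OF refl])
        fix x
        have "u + re x = u * (1 + inverse u * re x)" using u0 by (simp add: distrib_left)
        then have "absv (u + re x) = absv (1 + inverse u * re x)" using u1 by (simp only: absv_mult mult_1)
        then have "psiball n (1 + re (\<iota> (inverse u) * x)) = psiball n (u + re x)"
          unfolding re_im_simps psiball_eq by simp
        moreover have "inverse (c0 (\<iota> (inverse u) * x) ^ 2) = inverse (c0 x ^ 2) * c0 (\<iota> u) ^ 2"
          by (simp add: emb_inverse c0_simps power_mult_distrib power_inverse mult.commute)
        ultimately show "indicator (shell l) x *\<^sub>R (inverse (c0 (\<iota> (inverse u) * x) ^ 2) * psiball n (1 + re (\<iota> (inverse u) * x))) =
            indicator (shell l) x *\<^sub>R ?H u x" by (simp only: mult.assoc)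
      qed
      finally show ?thesis using iu(2) by simp
    qed
    have Hm: "(\<lambda>(u, x). ?H u x) \<in> borel_measurable (haarF X \<Otimes>\<^sub>M haarE X)"
    proof -
      have s: "{p \<in> space (haarF X \<Otimes>\<^sub>M haarE X). absv (fst p + re (snd p)) \<le> ?r} \<in> sets (haarF X \<Otimes>\<^sub>M haarE X)"
        by measurable
      have "(\<lambda>p. inverse (c0 (snd p) ^ 2) * (c0 (\<iota> (fst p)) ^ 2 *
          (indicator {p \<in> space (haarF X \<Otimes>\<^sub>M haarE X). absv (fst p + re (snd p)) \<le> ?r} p *\<^sub>R complex_of_real (rcard TYPE('f) powi n))))
        \<in> borel_measurable (haarF X \<Otimes>\<^sub>M haarE X)"
        using s by measurable
      moreover have "(\<lambda>p. inverse (c0 (snd p) ^ 2) * (c0 (\<iota> (fst p)) ^ 2 *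
          (indicator {p \<in> space (haarF X \<Otimes>\<^sub>M haarE X). absv (fst p + re (snd p)) \<le> ?r} p *\<^sub>R complex_of_real (rcard TYPE('f) powi n)))) =
          (\<lambda>(u, x). ?H u x)"
        by (auto simp: fun_eq_iff psiball_eq space_pair_measure indicator_def)
      ultimately show ?thesis by (simp only:)
    qed
    have inner: "(LINT u:shell 0|haarF X. ?H u x) =
        (if re x \<in> shell 0 then of_real (rcard TYPE('f) powi (- d)) * (c0 (\<iota> (re x)) ^ 2 * inverse (c0 x ^ 2)) else 0)" for x
    proof -
      have val: "indicator (shell 0) u *\<^sub>R ?H u x =
          (if re x \<in> shell 0 then indicator {u. absv (u - (- re x)) \<le> ?r} u *\<^sub>R
             (of_real (rcard TYPE('f) powi n) * (c0 (\<iota> (re x)) ^ 2 * inverse (c0 x ^ 2))) else 0)" for u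
      proof (cases "absv (u + re x) \<le> ?r")
        case True
        have iff: "u \<in> shell 0 \<longleftrightarrow> re x \<in> shell 0"
        proof -
          have "absv (u + re x) < 1" using True r1 by simp
          then have "- re x \<in> shell 0 \<longleftrightarrow> u \<in> shell 0"
            using shell_add_iff[of "u + re x" 0 "- re x"] by simp
          then show ?thesis by (simp add: shell_def)
        qed
        show ?thesis
        proof (cases "re x \<in> shell 0")
          case re: True
          have "absv (u + re x) \<le> rcard TYPE('f) powi (- int m) * absv (- re x)"
            using True rm re by (simp add: shell_def)
          \<comment> \<open>The bound n \<ge> m - d was chosen for this: on the ball around - x_1
            the square of \<chi> is constant, and squaring hides the sign.\<close>
          then have "qchar (unifF X) xiF 0 (- re x + (u + re x)) = qchar (unifF X) xiF 0 (- re x)" by (rule m(2))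
          then have "c0 (\<iota> u) ^ 2 = c0 (- \<iota> (re x)) ^ 2" by (simp add: qchar_xiF emb_minus)
          also have "\<dots> = c0 (\<iota> (re x)) ^ 2" unfolding c0_def by (rule qchar_minus_sq[OF chi unif(2)])
          finally show ?thesis using True re iff by (simp add: psiball_eq mult_ac)
        qed (use iff True in simp)
      next
        case False
        then show ?thesis by (simp add: psiball_eq)
      qed
      have "(LINT u:shell 0|haarF X. ?H u x) = (if re x \<in> shell 0 then
          (LINT u:{u. absv (u - (- re x)) \<le> ?r}|haarF X. of_real (rcard TYPE('f) powi n) * (c0 (\<iota> (re x)) ^ 2 * inverse (c0 x ^ 2))) else 0)"
        unfolding set_lebesgue_integral_def val by simp
      also have "(LINT u:{u. absv (u - (- re x)) \<le> ?r}|haarF X. of_real (rcard TYPE('f) powi n) * (c0 (\<iota> (re x)) ^ 2 * inverse (c0 x ^ 2))) =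
          of_real ?r * (of_real (rcard TYPE('f) powi n) * (c0 (\<iota> (re x)) ^ 2 * inverse (c0 x ^ 2)))"
        by (subst F.set_integral_eq_const[OF F.sets_absv _ refl])
           (simp_all only: F.emeasure_absv_ball F.measure_absv_ball infinity_ennreal_def ennreal_less_top)
      also have "\<dots> = of_real (rcard TYPE('f) powi (- d)) * (c0 (\<iota> (re x)) ^ 2 * inverse (c0 x ^ 2))"
      proof -
        have "?r * rcard TYPE('f) powi n = rcard TYPE('f) powi (- d)" by (simp flip: power_int_add)
        then show ?thesis unfolding mult.assoc[symmetric] of_real_mult[symmetric] by (simp only:)
      qed
      finally show ?thesis .
    qed
    \<comment> \<open>The factor is the measure of the unit group of F; it is the origin of 1 - 1/q
      in the final formula on S_-.\<close>
    have "of_real (1 - 1 / rcard TYPE('f)) * near l n = (LINT u:shell 0|haarF X. near l n)"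
      using F.set_integral_eq_const[OF F.sets_shell F.emeasure_shell_finite, of 0 "\<lambda>_. near l n" "near l n"]
      by (simp add: F.measure_shell)
    also have "\<dots> = (LINT u:shell 0|haarF X. (LINT x:shell l|haarE X. ?H u x))"
      unfolding set_lebesgue_integral_def[of "haarF X"]
    proof (rule Bochner_Integration.integral_cong[OF refl])
      fix u show "indicator (shell 0) u *\<^sub>R near l n = indicator (shell 0) u *\<^sub>R (LINT x:shell l|haarE X. ?H u x)"
        using inv[of u] by (cases "u \<in> shell 0") simp_all
    qed
    also have "\<dots> = (LINT x:shell l|haarE X. (LINT u:shell 0|haarF X. ?H u x))"
    proof (rule FE.set_Fubini[OF Hm _ F.emeasure_shell_finite _ E.emeasure_shell_finite, where B = "rcard TYPE('f) powi n"])
      fix u x assume "u \<in> (shell 0 :: 'f set)" "x \<in> (shell l :: 'e set)"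
      then have "u \<noteq> 0" "x \<noteq> 0" by (auto simp: shell_nonzero)
      then show "norm (?H u x) \<le> rcard TYPE('f) powi n"
        using norm_c0[of x] norm_c0[of "\<iota> u"]
        by (simp add: norm_mult norm_inverse norm_power psiball_eq norm_power_int)
    qed simp_all
    also have "\<dots> = (LINT x:{x. x \<in> shell l \<and> re x \<in> shell 0}|haarE X.
        of_real (rcard TYPE('f) powi (- d)) * (c0 (\<iota> (re x)) ^ 2 * inverse (c0 x ^ 2)))"
      unfolding inner unfolding set_lebesgue_integral_def
      by (rule Bochner_Integration.integral_cong[OF refl]) (auto simp: indicator_def)
    also have "\<dots> = of_real (rcard TYPE('f) powi (- d)) * slice l" unfolding slice_def by simp
    finally show ?thesis .
  qed
  then show thesis by (rule that[of "int m - d"])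
qed

text \<open>The partial sum telescopes to two values of \<open>near\<close>. The one at a small ball
  no longer changes once n is large, the other tends to 0.\<close>

lemma cdiag_sum_LIMSEQ:
  "(\<lambda>n. of_real (1 - 1 / rcard TYPE('f)) * (\<Sum>k\<in>{- int n..int n}. cdiag l k)) \<longlonglongrightarrow> of_real (rcard TYPE('f) powi (- d)) * slice l"
proof -
  obtain N where N: "\<And>n l. N \<le> n \<Longrightarrow>
     of_real (1 - 1 / rcard TYPE('f)) * near l n = of_real (rcard TYPE('f) powi (- d)) * slice l"
    by (rule near_eq_slice) blast
  let ?c = "complex_of_real (1 - 1 / rcard TYPE('f))"
  have "(\<lambda>n. of_real (rcard TYPE('f) powi (- d)) * slice l - ?c * near l (- int (Suc n)))
      \<longlonglongrightarrow> of_real (rcard TYPE('f) powi (- d)) * slice l - ?c * 0"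
    by (intro tendsto_intros LIMSEQ_Suc[OF near_tendsto_0])
  moreover have "\<forall>\<^sub>F n in sequentially. of_real (rcard TYPE('f) powi (- d)) * slice l - ?c * near l (- int (Suc n)) =
      ?c * (\<Sum>k\<in>{- int n..int n}. cdiag l k)"
    unfolding eventually_sequentially
  proof (intro exI[of _ "nat N"] allI impI)
    fix n assume "nat N \<le> n"
    then have "?c * near l (int n) = of_real (rcard TYPE('f) powi (- d)) * slice l" by (intro N) simp
    moreover have "{- int n..int n} = {- int n..<int n + 1}" by auto
    moreover have "(\<Sum>k\<in>{- int n..<int n + 1}. cdiag l k) = near l (- (- int n)) - near l (- (int n + 1))"
      by (rule cdiag_telescope) simp
    moreover have "- (int n + 1) = - int (Suc n)" by simp
    ultimately show "of_real (rcard TYPE('f) powi (- d)) * slice l - ?c * near l (- int (Suc n)) =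
        ?c * (\<Sum>k\<in>{- int n..int n}. cdiag l k)"
      by (simp only: right_diff_distrib minus_minus)
  qed
  ultimately show ?thesis by (simp add: tendsto_cong)
qed

end

section \<open>The kernel along the second family of lines\<close>

context quadratic_chars
begin

definition summand :: "complex \<Rightarrow> complex \<Rightarrow> int \<Rightarrow> int \<Rightarrow> complex" where
  "summand s t l j = kpow s t l j * kap (\<lambda>_. 1) l j"

lemma exp_LF: "exp (of_int k * complex_of_real (ln (rcard TYPE('f)))) = of_real (rcard TYPE('f) powi k)"
  using complex_powi_powr[where 'k = 'f, of k 1] by simp

lemma ram_LE: "of_int (int ram) * complex_of_real (ln (rcard TYPE('e))) = 2 * of_real (ln (rcard TYPE('f)))"
proof -
  have "of_int (int ram) * complex_of_real (ln (rcard TYPE('e))) = complex_of_real (real ram * ln (rcard TYPE('e)))" by simp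
  then show ?thesis unfolding ln_rcard_ram by simp
qed

lemma summand_shift: "summand s t (l + int ram) (j + 1) = Zc s t * summand s t l j"
proof -
  have "of_int (l + int ram) * (t + 1/2) * complex_of_real (ln (rcard TYPE('e))) =
      of_int l * (t + 1/2) * of_real (ln (rcard TYPE('e))) + (t + 1/2) * (of_int (int ram) * of_real (ln (rcard TYPE('e))))"
    by (simp add: algebra_simps)
  then have e: "of_int (l + int ram) * (t + 1/2) * complex_of_real (ln (rcard TYPE('e))) =
      of_int l * (t + 1/2) * of_real (ln (rcard TYPE('e))) + (t + 1/2) * (2 * of_real (ln (rcard TYPE('f))))"
    unfolding ram_LE .
  have q: "complex_of_real (1 / (rcard TYPE('f))\<^sup>2) = exp (of_int (-2) * of_real (ln (rcard TYPE('f))))"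
    unfolding exp_LF by (simp add: power_int_minus inverse_eq_divide)
  have "kpow s t (l + int ram) (j + 1) * exp (of_int (-2) * of_real (ln (rcard TYPE('f)))) = Zc s t * kpow s t l j"
    unfolding kpow_def Zc_def e exp_add[symmetric] by (rule arg_cong[of _ _ exp]) (simp add: field_simps)
  then show ?thesis unfolding summand_def kap_scale q by (simp add: mult.assoc[symmetric])
qed

lemma summand_shift_int:
  assumes "Zc s t = 1"
  shows "summand s t (l + int ram * m) (j + m) = summand s t l j"
proof (induction m rule: int_induct[where k = 0])
  case (step1 i)
  have "l + int ram * (i + 1) = (l + int ram * i) + int ram" "j + (i + 1) = (j + i) + 1"
    by (simp_all add: algebra_simps)
  then show ?case using step1 summand_shift[of s t "l + int ram * i" "j + i"] assms by (simp only: mult_1)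
next
  case (step2 i)
  have "l + int ram * i = (l + int ram * (i - 1)) + int ram" "j + i = (j + (i - 1)) + 1"
    by (simp_all add: algebra_simps)
  then show ?case using step2 summand_shift[of s t "l + int ram * (i - 1)" "j + (i - 1)"] assms by (simp only: mult_1)
qed simp

lemma summand_tail_step:
  assumes fine: "fine_level (\<lambda>_. 1) L J" and l: "l \<le> L" and j: "J \<le> j"
  shows "summand s t l (j + 1) = Wc s t * summand s t l j"
proof -
  have p0: "unifF X \<noteq> 0" by (rule uniformizer_nonzero[OF unif(1)])
  have "(LINT x:cell l (j + 1)|haarE X. K0 x * 1) = of_real (absv (unifF X)) * 1 * (LINT x:cell l j|haarE X. K0 x * 1)"
  proof (rule scales_set_integral(1)[OF scales_imscale[OF p0]])
    show "x \<in> cell l j \<longleftrightarrow> imscale (unifF X) x \<in> cell l (j + 1)" for x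
      using cell_imscale[OF fine l j one_minus_unif, of x] by (simp add: add.commute)
    show "K0 (imscale (unifF X) x) * 1 = 1 * (K0 x * 1)" if "x \<in> cell l j" for x
      using K0_imscale(1)[OF fine l j that one_minus_unif] by simp
  qed measurable
  then have k: "kap (\<lambda>_. 1) l (j + 1) = exp (- of_real (ln (rcard TYPE('f)))) * kap (\<lambda>_. 1) l j"
    by (simp add: kap_def of_real_absv_unif)
  have "kpow s t l (j + 1) * exp (- of_real (ln (rcard TYPE('f)))) = Wc s t * kpow s t l j"
    unfolding kpow_def Wc_def exp_add[symmetric] by (rule arg_cong[of _ _ exp]) (simp add: field_simps)
  then show ?thesis unfolding summand_def k by (simp add: mult.assoc[symmetric])
qed

text \<open>Sums a single shell of E over all |x_2|. Unlike the integral over a ball around 0, this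
  converges on S_- as soon as Re t > 0.\<close>

lemma summand_has_sum:
  assumes fine: "fine_level (\<lambda>_. 1) L J" and l: "l \<le> L" and j1: "j1 \<le> J" "\<And>j. j < j1 \<Longrightarrow> cell l j = {}"
    and st: "Re (2 * s + t + 1/2) > 0"
  obtains S where "(summand s t l has_sum S) UNIV" "lamP s t * S = shell_poly (\<lambda>_. 1) J j1 l s t"
proof -
  let ?W = "Wc s t"
  have W: "norm ?W < 1" "?W \<noteq> 0" using norm_Wc[OF st] by (simp_all add: Wc_def)
  have tail: "summand s t l j = summand s t l J / ?W powi J * ?W powi j" if "J \<le> j" for j
    using that
  proof (induction j rule: int_ge_induct)
    case (step j)
    then show ?case using summand_tail_step[OF fine l step.hyps, of s t] W(2) by (simp add: power_int_add)
  qed (use W in simp)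
  have z: "summand s t l j = 0" if "j < j1" for j
    using j1(2)[OF that] by (simp add: summand_def kap_def set_lebesgue_integral_def)
  let ?S = "(\<Sum>j\<in>{j1..<J}. summand s t l j) + summand s t l J / ?W powi J * ?W powi J / (1 - ?W)"
  have "(summand s t l has_sum ?S) UNIV"
    by (rule has_sum_int_geometric[OF z tail j1(1) W])
  moreover have "lamP s t * ?S = shell_poly (\<lambda>_. 1) J j1 l s t"
  proof -
    have W1: "1 - ?W \<noteq> 0" using W(1) by (metis eq_iff_diff_eq_0 less_irrefl norm_one)
    have "lamP s t * (summand s t l J / (1 - ?W)) = summand s t l J"
      using kap_tail_eq_0[OF fine l] W1 by (auto simp: lamP_def summand_def)
    then show ?thesis using W(2) by (simp add: shell_poly_def distrib_left summand_def)
  qed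
  ultimately show thesis by (rule that)
qed

text \<open>When \<open>Zc\<close> is 1 the terms are constant along steps of \<open>ram\<close> in
  l and 1 in j. Each such orbit meets the column j = j0 once and the block of \<open>ram\<close>
  rows once, so the column sum equals the sum over the block.\<close>

lemma summand_regroup:
  assumes fine: "fine_level (\<lambda>_. 1) (M + int ram - 1) J" and j1: "j1 \<le> J" "\<And>l j. M \<le> l \<Longrightarrow> j < j1 \<Longrightarrow> cell l j = {}"
    and st: "Re (2 * s + t + 1/2) > 0" and Z: "Zc s t = 1"
    and S: "((\<lambda>l. summand s t l j0) has_sum S) UNIV"
  shows "lamP s t * S = (\<Sum>l\<in>{M..<M + int ram}. shell_poly (\<lambda>_. 1) J j1 l s t)"
proof -
  let ?I = "{M..<M + int ram}"
  have ram: "int ram > 0" using ram_pos by simp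
  have "\<exists>T. (summand s t l has_sum T) UNIV \<and> lamP s t * T = shell_poly (\<lambda>_. 1) J j1 l s t" if "l \<in> ?I" for l
  proof -
    have "l \<le> M + int ram - 1" "\<And>j. j < j1 \<Longrightarrow> cell l j = {}" using that j1(2)[of l] by auto
    from summand_has_sum[OF fine this(1) j1(1) this(2) st] show ?thesis by blast
  qed
  then obtain T where T: "\<And>l. l \<in> ?I \<Longrightarrow> (summand s t l has_sum T l) UNIV"
    "\<And>l. l \<in> ?I \<Longrightarrow> lamP s t * T l = shell_poly (\<lambda>_. 1) J j1 l s t" by metis
  have inner: "((\<lambda>m. summand s t (l + int ram * m) j0) has_sum T l) UNIV" if l: "l \<in> ?I" for l
  proof -
    have "summand s t (l + int ram * m) j0 = summand s t l (j0 - m)" for m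
      using summand_shift_int[OF Z, of l m "j0 - m"] by simp
    moreover have "((\<lambda>m. summand s t l (j0 - m)) has_sum T l) UNIV \<longleftrightarrow> (summand s t l has_sum T l) UNIV"
      by (rule has_sum_reindex_bij_witness[of _ "\<lambda>j. j0 - j" "\<lambda>m. j0 - m"]) simp_all
    ultimately show ?thesis using T(1)[OF l] by simp
  qed
  have "((\<lambda>(l, m). summand s t (l + int ram * m) j0) has_sum S) (?I \<times> UNIV) \<longleftrightarrow> ((\<lambda>l. summand s t l j0) has_sum S) UNIV"
  \<comment> \<open>Division of l - M by \<open>ram\<close>: the remainder selects the row of the
    block, the quotient the position on the orbit.\<close>
  proof (rule has_sum_reindex_bij_witness[of _ "\<lambda>l. (M + (l - M) mod int ram, (l - M) div int ram)" "\<lambda>(l, m). l + int ram * m"])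
    fix a assume "a \<in> ?I \<times> (UNIV :: int set)"
    then obtain l m where a: "a = (l, m)" "M \<le> l" "l < M + int ram" by (cases a) auto
    have e: "l + int ram * m - M = (l - M) + int ram * m" by simp
    have "(l - M) mod int ram = l - M" "(l - M) div int ram = 0" using a by (simp_all add: mod_pos_pos_trivial div_pos_pos_trivial)
    then show "(M + ((case a of (l, m) \<Rightarrow> l + int ram * m) - M) mod int ram, ((case a of (l, m) \<Rightarrow> l + int ram * m) - M) div int ram) = a"
      using ram unfolding a prod.case e by simp
  next
    fix l :: int
    show "(case (M + (l - M) mod int ram, (l - M) div int ram) of (l, m) \<Rightarrow> l + int ram * m) = l" by simp
    show "(M + (l - M) mod int ram, (l - M) div int ram) \<in> ?I \<times> UNIV" using ram by simp
  qed auto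
  then have "((\<lambda>(l, m). summand s t (l + int ram * m) j0) has_sum S) (?I \<times> UNIV)" using S by simp
  from has_sum_SigmaD[OF this, of T] have "(T has_sum S) ?I" using inner by simp
  then have "S = (\<Sum>l\<in>?I. T l)" using has_sum_unique has_sum_finite by blast
  then show ?thesis using T(2) by (simp add: sum_distrib_left)
qed

end

lemma in_shell_valuation: "x \<noteq> 0 \<Longrightarrow> x \<in> shell (valuation x)"
  by (simp add: shell_iff)

section \<open>The gamma product in a strip and its continuation\<close>

context quadratic_gamma
begin

definition vb :: int where "vb = valuation \<beta>"
definition va :: int where "va = valuation \<alpha>"

lemma alpha_shell: "\<alpha> \<in> shell va" and beta_shell: "\<beta> \<in> shell vb"
  using gen_sq_nonsquare(1) by (auto simp: va_def vb_def in_shell_valuation)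

lemma va_LE: "of_int va * complex_of_real (ln (rcard TYPE('e))) = of_int vb * of_real (ln (rcard TYPE('f)))"
proof -
  have "ln (absv \<alpha>) = ln (absv \<beta>)" by (simp add: absv_gen)
  then have "of_int va * ln (rcard TYPE('e)) = of_int vb * ln (rcard TYPE('f))"
    unfolding ln_absv_shell[OF alpha_shell] ln_absv_shell[OF beta_shell] by simp
  then show ?thesis by (metis of_real_mult of_real_of_int_eq)
qed

context
  assumes tr: "trivial_on_units (\<lambda>u. chi (\<iota> u) * inverse (eta u))"
begin

lemma e0_eq: "e0 y = c0 (\<iota> y)"
proof (cases "y = 0")
  case False
  then obtain k u where y: "y = unifF X powi k * u" and u: "u \<in> integer_units" using decomp_unif by blast
  have "chi (\<iota> u) * inverse (eta u) = 1" using tr u by (simp add: trivial_on_units_def)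
  then have "chi (\<iota> u) = eta u" using chi_nonzero[OF eta u] by (simp add: field_simps)
  then show ?thesis
    using u by (simp add: y emb_mult c0_simps e0_simps c0_e0_unif_powi c0_unit[OF emb_unit] e0_unit)
qed (simp add: e0_simps c0_simps)

text \<open>On S_- \<eta> agrees with \<chi> on the units of F, and the norm contributes a second
  conjugate in the denominator while x cancels.\<close>

lemma K0_eq_square: "K0 x = c0 (\<iota> (im x)) ^ 2 * inverse (c0 (conjug x) ^ 2)"
proof (cases "x = 0")
  case False
  then show ?thesis using c0_nonzero[OF False] c0_nonzero[of "conjug x"]
    unfolding K0_eq e0_eq emb_nrm c0_simps by (simp add: field_simps power2_eq_square)
qed (simp add: K0_im_0 re_im_simps(2)[of 0, simplified] c0_simps)

text \<open>Multiplication by \<alpha> makes \<beta> x_2 the first coordinate, so x_1 a unit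
  corresponds to x_2 of valuation - v(\<beta>). Conjugation then replaces x in the denominator by
  its conjugate, as in \<open>K0\<close>.\<close>

lemma slice_eq: "slice (l + va) = of_real (absv \<alpha>) * c0 \<alpha> ^ 2 * kap (\<lambda>_. 1) l (- vb)"
proof -
  have i0: "im x \<in> shell (- vb) \<longleftrightarrow> \<beta> * im x \<in> shell 0" for x
    using shell_mult_iff[OF beta_shell, of "im x" "- vb"] by simp
  have mem: "x \<in> cell l (- vb) \<longleftrightarrow> \<alpha> * x \<in> {x. x \<in> shell (l + va) \<and> re x \<in> shell 0}" for x
    using shell_mult_iff[OF alpha_shell, of x l] i0[of x] by (simp add: cell_def add.commute)
  have sS: "{x. x \<in> shell (l + va) \<and> re x \<in> shell 0} \<in> sets (haarE X)"
  proof -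
    have "shell (l + va) \<inter> (re -` shell 0 \<inter> space borel) \<in> sets borel"
      by (intro sets.Int[OF E.sets_shell] measurable_sets[OF measurable_re F.sets_shell])
    moreover have "shell (l + va) \<inter> (re -` shell 0 \<inter> space borel) = {x. x \<in> shell (l + va) \<and> re x \<in> shell 0}" by auto
    ultimately show ?thesis by simp
  qed
  have bb: "c0 (\<iota> \<beta>) = c0 \<alpha> ^ 2" using gen_squared by (simp add: c0_simps flip: gen_squared)
  have "slice (l + va) = of_real (absv \<alpha>) * (LINT x:cell l (- vb)|haarE X. c0 (\<iota> (re (\<alpha> * x))) ^ 2 * inverse (c0 (\<alpha> * x) ^ 2))"
    unfolding slice_def
    by (rule scales_set_integral_eq[OF E.scales_mult[OF gen_nonzero] _ sS mem]) measurable
  also have "(LINT x:cell l (- vb)|haarE X. c0 (\<iota> (re (\<alpha> * x))) ^ 2 * inverse (c0 (\<alpha> * x) ^ 2)) =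
      (LINT x:cell l (- vb)|haarE X. c0 \<alpha> ^ 2 * (c0 (\<iota> (im x)) ^ 2 * inverse (c0 x ^ 2)))"
    using c0_nonzero[OF gen_nonzero]
    unfolding re_im_simps emb_mult c0_simps bb by (simp add: field_simps power2_eq_square)
  also have "\<dots> = c0 \<alpha> ^ 2 * (LINT x:cell l (- vb)|haarE X. c0 (\<iota> (im x)) ^ 2 * inverse (c0 x ^ 2))" by simp
  also have "(LINT x:cell l (- vb)|haarE X. c0 (\<iota> (im x)) ^ 2 * inverse (c0 x ^ 2)) =
      of_real 1 * (LINT x:cell l (- vb)|haarE X. c0 (\<iota> (im (conjug x))) ^ 2 * inverse (c0 (conjug x) ^ 2))"
  proof (rule scales_set_integral_eq[OF scales_conjug])
    show "x \<in> cell l (- vb) \<longleftrightarrow> conjug x \<in> cell l (- vb)" for x by (simp add: cell_def shell_def)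
  qed measurable
  also have "\<dots> = kap (\<lambda>_. 1) l (- vb)"
  proof -
    have "c0 (\<iota> (im (conjug x))) ^ 2 * inverse (c0 (conjug x) ^ 2) = K0 x * 1" for x
      using qchar_minus_sq[OF chi unif(2), of "\<iota> (im x)"] by (simp add: K0_eq_square emb_minus c0_def)
    then show ?thesis by (simp add: kap_def)
  qed
  finally show ?thesis by (simp add: mult.assoc)
qed

text \<open>In this strip both gamma series converge absolutely, which permits summation along fixed
  quotient shells. This yields a full column of the kernel series, and
  \<open>summand_regroup\<close> turns it into the block left by the continuation.\<close>

lemma gamma_product_eq:
  assumes t: "0 < Re t" "Re t < 1/2" and k: "2 * s - t + 1/2 = 2 * of_real pi * \<i> / of_real (ln (rcard TYPE('f))) * of_int k"
    and fine: "fine_level (\<lambda>_. 1) (M + int ram - 1) J" and j1: "j1 \<le> J" "\<And>l j. M \<le> l \<Longrightarrow> j < j1 \<Longrightarrow> cell l j = {}"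
  shows "of_real (1 - 1 / rcard TYPE('f)) * (gamma_factor (haarF X) (psi X) (unifF X) xiF (2 * t) *
      gamma_factor (haarE X) (psiE X) (unifE X) xiE (- t + 1/2) * lamP s t) =
    of_real (rcard TYPE('f) powi (- d)) * c0 \<alpha> ^ 2 * exp (of_int vb * (1/2 - t) * of_real (ln (rcard TYPE('f)))) *
      (\<Sum>l\<in>{M..<M + int ram}. shell_poly (\<lambda>_. 1) J j1 l s t)"
proof -
  define L where "L = complex_of_real (ln (rcard TYPE('f)))"
  define K where "K = complex_of_real (ln (rcard TYPE('e)))"
  have L0: "L \<noteq> 0" using ln_rcard_pos[where 'k = 'f] unfolding L_def of_real_eq_0_iff by linarith
  have kL: "(2 * s - t + 1/2) * L = 2 * of_int k * of_real pi * \<i>" using L0 by (simp add: k L_def)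
  have Z: "Zc s t = 1"
    unfolding Zc_def L_def[symmetric] kL exp_minus using exp_integer_2pi[OF Ints_of_int, of k] by (simp add: mult_ac)
  define A where "A = gamma_factor (haarF X) (psi X) (unifF X) xiF (2 * t)"
  define B where "B = gamma_factor (haarE X) (psiE X) (unifE X) xiE (- t + 1/2)"
  define a where "a k = gF k * exp (- (of_int k * (2 * t - 1) * L))" for k
  define b where "b m = gE m * exp (of_int m * (t + 1/2) * K)" for m
  have "(PF.gamma_term (unifF X) xiF (2 * t) has_sum A) UNIV"
    unfolding A_def using t by (intro PF.gamma_factor_spec(2)[OF unif(1) xiF_char]) simp
  moreover have "PF.gamma_term (unifF X) xiF (2 * t) = a"
    by (simp add: fun_eq_iff a_def gF_def L_def PF.gamma_term_def[OF unif(1) xiF_char])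
  ultimately have hA: "(a has_sum A) UNIV" by simp
  have "(PE.gamma_term (unifE X) xiE (- t + 1/2) has_sum B) UNIV"
    unfolding B_def using t by (intro PE.gamma_factor_spec(2)[OF unif(2) xiE_char]) simp
  moreover have "PE.gamma_term (unifE X) xiE (- t + 1/2) m = b m" for m
    unfolding PE.gamma_term_def[OF unif(2) xiE_char] b_def gE_def K_def
    by (rule arg_cong2[of _ _ _ _ "(*)", OF refl], rule arg_cong[of _ _ exp]) (simp add: field_simps)
  then have "PE.gamma_term (unifE X) xiE (- t + 1/2) = b" by (rule ext)
  ultimately have hB: "(b has_sum B) UNIV" by simp
  have "((\<lambda>(l, k). a k * b (l + int ram * k)) has_sum A * B) (UNIV \<times> UNIV) \<longleftrightarrow>
      ((\<lambda>(k, m). a k * b m) has_sum A * B) (UNIV \<times> UNIV)"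
    by (rule has_sum_reindex_bij_witness[of _ "\<lambda>(k, m). (m - int ram * k, k)" "\<lambda>(l, k). (k, l + int ram * k)"]) auto
  then have prod: "((\<lambda>(l, k). a k * b (l + int ram * k)) has_sum A * B) (UNIV \<times> UNIV)"
    using has_sum_product_complex[OF hA hB] by simp
  have tm: "a k * b (l + int ram * k) = exp (of_int l * (t + 1/2) * K) * cdiag l k" for l k
  proof -
    have "of_int (l + int ram * k) * (t + 1/2) * K = of_int l * (t + 1/2) * K + of_int k * (t + 1/2) * (of_int (int ram) * K)"
      by (simp add: algebra_simps)
    then have e: "of_int (l + int ram * k) * (t + 1/2) * K = of_int l * (t + 1/2) * K + of_int k * (t + 1/2) * (2 * L)"
      unfolding K_def L_def ram_LE .
    have "complex_of_real ((rcard TYPE('f) powi k) ^ 2) = exp (of_int k * L) * exp (of_int k * L)"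
      unfolding L_def exp_LF by (simp add: power2_eq_square)
    then have "exp (of_int l * (t + 1/2) * K) * complex_of_real ((rcard TYPE('f) powi k) ^ 2) =
        exp (- (of_int k * (2 * t - 1) * L)) * exp (of_int (l + int ram * k) * (t + 1/2) * K)"
      unfolding e by (simp only: exp_add[symmetric]) (rule arg_cong[of _ _ exp], simp add: field_simps)
    then show ?thesis unfolding a_def b_def cdiag_def by (simp add: mult_ac)
  qed
  let ?c = "complex_of_real (1 - 1 / rcard TYPE('f))"
  let ?d = "complex_of_real (rcard TYPE('f) powi (- d))"
  define c where "c l = infsum (\<lambda>k. a k * b (l + int ram * k)) UNIV" for l
  have hc: "((\<lambda>k. a k * b (l + int ram * k)) has_sum c l) UNIV" for l
    unfolding c_def using summable_on_SigmaD1[OF has_sum_imp_summable[OF prod], of l] by (intro has_sum_infsum) simp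
  \<comment> \<open>The inner sum is known to exist by absolute convergence, but its value is
    available only as a limit of symmetric partial sums.\<close>
  have cl: "?c * c l = exp (of_int l * (t + 1/2) * K) * (?d * slice l)" for l
  proof (rule LIMSEQ_unique)
    show "(\<lambda>n. ?c * (\<Sum>k\<in>{- int n..int n}. a k * b (l + int ram * k))) \<longlonglongrightarrow> ?c * c l"
      by (intro tendsto_mult tendsto_const has_sum_int_imp_LIMSEQ hc)
    have "(\<lambda>n. exp (of_int l * (t + 1/2) * K) * (?c * (\<Sum>k\<in>{- int n..int n}. cdiag l k)))
        \<longlonglongrightarrow> exp (of_int l * (t + 1/2) * K) * (?d * slice l)"
      by (intro tendsto_mult tendsto_const cdiag_sum_LIMSEQ)
    moreover have "exp (of_int l * (t + 1/2) * K) * (?c * (\<Sum>k\<in>{- int n..int n}. cdiag l k)) =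
        ?c * (\<Sum>k\<in>{- int n..int n}. a k * b (l + int ram * k))" for n
      unfolding tm by (simp add: sum_distrib_left mult_ac)
    ultimately show "(\<lambda>n. ?c * (\<Sum>k\<in>{- int n..int n}. a k * b (l + int ram * k)))
        \<longlonglongrightarrow> exp (of_int l * (t + 1/2) * K) * (?d * slice l)" by (simp only:)
  qed
  have "(c has_sum A * B) UNIV"
    by (rule has_sum_SigmaD[OF prod]) (use hc in simp)
  then have "((\<lambda>l. ?c * c l) has_sum ?c * (A * B)) UNIV" by (rule has_sum_cmult_right)
  then have "((\<lambda>l. exp (of_int l * (t + 1/2) * K) * (?d * slice l)) has_sum ?c * (A * B)) UNIV" unfolding cl .
  moreover have "((\<lambda>l. exp (of_int (l + va) * (t + 1/2) * K) * (?d * slice (l + va))) has_sum ?c * (A * B)) UNIV \<longleftrightarrow>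
      ((\<lambda>l. exp (of_int l * (t + 1/2) * K) * (?d * slice l)) has_sum ?c * (A * B)) UNIV"
    by (rule has_sum_reindex_bij_witness[of _ "\<lambda>l. l - va" "\<lambda>l. l + va"]) auto
  ultimately have h1: "((\<lambda>l. exp (of_int (l + va) * (t + 1/2) * K) * (?d * slice (l + va))) has_sum ?c * (A * B)) UNIV" by simp
  \<comment> \<open>Three origins: the mass q^(-d) of the approximate identity, \<chi>_0
    (\<alpha>)^2 from exchanging the coordinates, and |\<beta>|^(t - 1/2) from the shift of
    shells.\<close>
  define C where "C = ?d * c0 \<alpha> ^ 2 * exp (of_int vb * (1/2 - t) * L)"
  have "?d \<noteq> 0" unfolding of_real_eq_0_iff by (simp add: power_int_eq_0_iff)
  then have C0: "C \<noteq> 0" using c0_nonzero[OF gen_nonzero] by (simp add: C_def)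
  have "exp (of_int (l + va) * (t + 1/2) * K) * (?d * slice (l + va)) = C * summand s t l (- vb)" for l
  proof -
    have "of_int (l + va) * (t + 1/2) * K = of_int l * (t + 1/2) * K + (t + 1/2) * (of_int va * K)"
      by (simp add: algebra_simps)
    then have e: "of_int (l + va) * (t + 1/2) * K = of_int l * (t + 1/2) * K + (t + 1/2) * (of_int vb * L)"
      unfolding K_def L_def va_LE .
    have al: "complex_of_real (absv \<alpha>) = exp (- (of_int vb * L))"
    proof -
      have "complex_of_real (absv \<alpha>) = complex_of_real (absv \<beta>)" by (simp add: absv_gen)
      then show ?thesis using powr_shell[OF beta_shell, of 1] by (simp add: L_def)
    qed
    \<comment> \<open>The exponents match only up to v(\<beta>) times 2 s - t + 1/2, whose
      exponential is 1 on S_-.\<close>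
    have "exp (of_int (l + va) * (t + 1/2) * K) * complex_of_real (absv \<alpha>) =
        exp (of_int vb * (1/2 - t) * L) * (kpow s t l (- vb) * exp (- (of_int vb * ((2 * s - t + 1/2) * L))))"
      unfolding e al kpow_def K_def[symmetric] L_def[symmetric] exp_add[symmetric]
      by (rule arg_cong[of _ _ exp]) (simp add: field_simps)
    also have "exp (- (of_int vb * ((2 * s - t + 1/2) * L))) = 1"
      unfolding kL exp_minus using exp_integer_2pi[OF Ints_of_int, of "vb * k"] by (simp add: mult_ac)
    finally have "exp (of_int (l + va) * (t + 1/2) * K) * complex_of_real (absv \<alpha>) =
        exp (of_int vb * (1/2 - t) * L) * kpow s t l (- vb)" by simp
    then show ?thesis unfolding slice_eq C_def summand_def by (simp add: mult_ac)
  qed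
  then have "((\<lambda>l. C * summand s t l (- vb)) has_sum ?c * (A * B)) UNIV" using h1 by simp
  then have "((\<lambda>l. inverse C * (C * summand s t l (- vb))) has_sum inverse C * (?c * (A * B))) UNIV"
    by (rule has_sum_cmult_right)
  moreover have "inverse C * (C * summand s t l (- vb)) = summand s t l (- vb)" for l using C0 by simp
  ultimately have hS: "((\<lambda>l. summand s t l (- vb)) has_sum inverse C * (?c * (A * B))) UNIV" by simp
  \<comment> \<open>On S_- this real part equals 2 Re t.\<close>
  have st: "Re (2 * s + t + 1/2) > 0"
  proof -
    have "2 * s + t + 1/2 = (2 * s - t + 1/2) + 2 * t" by simp
    moreover have "Re (2 * s - t + 1/2) = 0"
    proof -
      have "(2 * s - t + 1/2) = 2 * of_int k * of_real pi * \<i> / L" using kL L0 by (simp add: field_simps)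
      also have "\<dots> = of_real (2 * of_int k * pi / ln (rcard TYPE('f))) * \<i>" by (simp add: L_def)
      finally show ?thesis by (simp only: Re_i_times mult.commute[of _ \<i>] Im_complex_of_real minus_zero)
    qed
    ultimately show ?thesis using t(1) by simp
  qed
  have "lamP s t * (inverse C * (?c * (A * B))) = (\<Sum>l\<in>{M..<M + int ram}. shell_poly (\<lambda>_. 1) J j1 l s t)"
    by (rule summand_regroup[OF fine j1 st Z hS])
  then have "C * (lamP s t * (inverse C * (?c * (A * B)))) = C * (\<Sum>l\<in>{M..<M + int ram}. shell_poly (\<lambda>_. 1) J j1 l s t)"
    by (simp only:)
  moreover have "C * (lamP s t * (inverse C * (?c * (A * B)))) = ?c * (A * B * lamP s t)"
    using C0 by (simp add: field_simps)
  ultimately show ?thesis by (simp only: A_def B_def C_def L_def)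
qed

text \<open>The block sum is entire along the line, so the singularities of the gamma product are
  removable there and their removal returns the value of the entire side, also at points where
  single factors have poles.\<close>

lemma remove_sings_gamma_product:
  assumes k: "2 * s - t + 1/2 = 2 * of_real pi * \<i> / of_real (ln (rcard TYPE('f))) * of_int k"
    and fine: "fine_level (\<lambda>_. 1) (M + int ram - 1) J" and j1: "j1 \<le> J" "\<And>l j. M \<le> l \<Longrightarrow> j < j1 \<Longrightarrow> cell l j = {}"
  shows "of_real (1 - 1 / rcard TYPE('f)) * remove_sings (gamma_product_along X chi s eta t) t =
    of_real (rcard TYPE('f) powi (- d)) * c0 \<alpha> ^ 2 * exp (of_int vb * (1/2 - t) * of_real (ln (rcard TYPE('f)))) *
      (\<Sum>l\<in>{M..<M + int ram}. shell_poly (\<lambda>_. 1) J j1 l s t)"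
proof -
  let ?c = "complex_of_real (1 - 1 / rcard TYPE('f))"
  define s' where "s' = (\<lambda>t'. s + (t' - t) / 2)"
  define H where "H = (\<lambda>t'. of_real (rcard TYPE('f) powi (- d)) * c0 \<alpha> ^ 2 * exp (of_int vb * (1/2 - t') * of_real (ln (rcard TYPE('f)))) *
      (\<Sum>l\<in>{M..<M + int ram}. shell_poly (\<lambda>_. 1) J j1 l (s' t') t') / ?c)"
  define G where "G = gamma_product_along X chi s eta t"
  have c0: "?c \<noteq> 0" unfolding of_real_eq_0_iff using rcard_gt_1[where 'k = 'f] by (simp add: field_simps)
  have lam: "lamP (s' t') t' = (if trivial_on_units (\<lambda>u. chi (\<iota> u) * eta u) then 1 - exp (- ((2 * (s + (t' - t) / 2) + t' + 1/2) * of_real (ln (rcard TYPE('f))))) else 1)" for t'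
    by (simp add: lamP_def Wc_def s'_def)
  have lam_hol: "(\<lambda>t'. lamP (s' t') t') holomorphic_on UNIV"
    unfolding lam by (cases "trivial_on_units (\<lambda>u. chi (\<iota> u) * eta u)") (auto intro!: holomorphic_intros)
  have kpow_hol: "(\<lambda>t'. kpow (s' t') t' l j) holomorphic_on UNIV" for l j
    unfolding kpow_def s'_def by (intro holomorphic_intros) auto
  have H_hol: "H holomorphic_on UNIV"
    unfolding H_def shell_poly_def by (intro holomorphic_intros lam_hol kpow_hol c0) auto
  have G_eq: "G = (\<lambda>t'. gamma_factor (haarF X) (psi X) (unifF X) xiF (2 * t') *
      gamma_factor (haarE X) (psiE X) (unifE X) xiE (- t' + 1/2) * lamP (s' t') t')"
    by (simp add: G_def gamma_product_along_def[abs_def] lambda_plus_eq s'_def xiF_def[abs_def] xiE_def[abs_def])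
  have GF: "gamma_factor (haarF X) (psi X) (unifF X) xiF meromorphic_on UNIV"
    using PF.gamma_factor_spec(1)[OF unif(1) xiF_char] by (simp add: nicely_meromorphic_on_def)
  have GE: "gamma_factor (haarE X) (psiE X) (unifE X) xiE meromorphic_on UNIV"
    using PE.gamma_factor_spec(1)[OF unif(2) xiE_char] by (simp add: nicely_meromorphic_on_def)
  have G_mero: "G meromorphic_on UNIV"
    unfolding G_eq
  proof (intro meromorphic_on_mult)
    show "(\<lambda>t'. gamma_factor (haarF X) (psi X) (unifF X) xiF (2 * t')) meromorphic_on UNIV"
      by (rule meromorphic_on_compose[OF GF]) (auto intro!: analytic_intros)
    show "(\<lambda>t'. gamma_factor (haarE X) (psiE X) (unifE X) xiE (- t' + 1/2)) meromorphic_on UNIV"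
      by (rule meromorphic_on_compose[OF GE]) (auto intro!: analytic_intros)
    show "(\<lambda>t'. lamP (s' t') t') meromorphic_on UNIV"
      using lam_hol by (intro analytic_on_imp_meromorphic_on) (simp add: analytic_on_open)
  qed
  have H_mero: "H meromorphic_on UNIV"
    using H_hol by (intro analytic_on_imp_meromorphic_on) (simp add: analytic_on_open)
  let ?U = "{z. 0 < Re z} \<inter> {z. Re z < 1/2}"
  have "\<forall>\<^sub>F w in at t. G w = H w"
  proof (rule meromorphic_eq_eventually[OF G_mero H_mero])
    show "open ?U" by (intro open_Int open_halfspace_Re_gt open_halfspace_Re_lt)
    have "(1/4 :: complex) \<in> ?U" by simp
    then show "?U \<noteq> {}" by blast
    fix t' assume "t' \<in> ?U"
    then have t': "0 < Re t'" "Re t' < 1/2" by auto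
    \<comment> \<open>2 s - t is constant along the line, so every point of it lies on S_- with the
      same integer k.\<close>
    have "2 * s' t' - t' + 1/2 = 2 * of_real pi * \<i> / of_real (ln (rcard TYPE('f))) * of_int k"
      using k by (simp add: s'_def field_simps)
    from gamma_product_eq[OF t' this fine j1] show "G t' = H t'"
      using c0 unfolding G_eq H_def by (simp only: nonzero_eq_divide_eq mult.commute[of _ ?c] not_False_eq_True)
  qed
  moreover have "H \<midarrow>t\<rightarrow> H t"
    using H_hol by (metis holomorphic_on_imp_continuous_on continuous_on_eq_continuous_at open_UNIV UNIV_I isContD)
  ultimately have "G \<midarrow>t\<rightarrow> H t" by (simp add: tendsto_cong)
  then have "remove_sings G t = H t" by (rule remove_sings_eqI)
  moreover have "s' t = s" by (simp add: s'_def)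
  ultimately show ?thesis using c0 unfolding G_def[symmetric] H_def by simp
qed

end

lemma normalized_kernel_S_minus:
  assumes S: "(chi, s, eta, t) \<in> S_minus X" and f: "f \<in> test_functions"
  shows "normalized_kernel X chi s eta t f =
             of_real (inversion_constant (haarF X) (psi X)) *
             (1 - 1 / of_nat (residue_card TYPE('f))) *
             inverse ((qchar (unifE X) chi 0 (- gen X))\<^sup>2) *
             complex_of_real (absv (gen_sq X)) powr (- t + 1/2) *
             remove_sings (gamma_product_along X chi s eta t) t *
             f 0"
proof -
  define L where "L = complex_of_real (ln (rcard TYPE('f)))"
  have L0: "L \<noteq> 0" using ln_rcard_pos[where 'k = 'f] unfolding L_def of_real_eq_0_iff by linarith
  from S obtain k :: int where tr: "trivial_on_units (\<lambda>u. chi (\<iota> u) * inverse (eta u))"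
    and k: "2 * s - t + 1/2 = 2 * of_real pi * \<i> / of_real (ln (rcard TYPE('f))) * of_int k" by (auto simp: S_minus_def)
  have kL: "(2 * s - t + 1/2) * L = 2 * of_int k * of_real pi * \<i>" using L0 by (simp add: k L_def)
  have Z: "Zc s t = 1"
    unfolding Zc_def L_def[symmetric] kL exp_minus using exp_integer_2pi[OF Ints_of_int, of k] by (simp add: mult_ac)
  obtain n0 where n0: "\<And>M. n0 \<le> M \<Longrightarrow> \<exists>J j1. adapted f M J j1" using ex_adapted[OF f] by blast
  then obtain M J j1 where ad: "adapted f M J j1" using order_refl by blast
  have fine: "fine_level (\<lambda>_. 1) (M + int ram - 1) J" "j1 \<le> J" "\<And>l j. M \<le> l \<Longrightarrow> j < j1 \<Longrightarrow> cell l j = {}"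
    using ad by (auto simp: adapted_def)
  define D where "D = (\<Sum>l\<in>{M..<M + int ram}. shell_poly (\<lambda>_. 1) J j1 l s t)"
  define R where "R = remove_sings (gamma_product_along X chi s eta t) t"
  \<comment> \<open>This removes all shells away from 0; only the block at 0 remains, where the test
    function enters through f 0.\<close>
  have "lamM s t = 0" using tr Z by (simp add: lamM_def)
  then have N: "normalized_kernel X chi s eta t f = f 0 * D"
    unfolding normalized_kernel_eq[OF f ad] cont_def D_def by simp
  have R: "complex_of_real (1 - 1 / rcard TYPE('f)) * R =
     of_real (rcard TYPE('f) powi (- d)) * c0 \<alpha> ^ 2 * exp (of_int vb * (1/2 - t) * of_real (ln (rcard TYPE('f)))) * D"
    unfolding R_def D_def by (rule remove_sings_gamma_product[OF tr k fine])
  \<comment> \<open>The next three equations pair each constant of the statement with its reciprocal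
    in the block formula: c_F = q^d with q^(-d), then the power of |\<beta>|, then the value at -
    \<alpha>, whose sign is lost in the square.\<close>
  have q: "complex_of_real (rcard TYPE('f) powi d) * of_real (rcard TYPE('f) powi (- d)) = 1"
    unfolding of_real_mult[symmetric] by (simp add: power_int_minus)
  have b: "complex_of_real (absv \<beta>) powr (- t + 1/2) * exp (of_int vb * (1/2 - t) * of_real (ln (rcard TYPE('f)))) = 1"
    unfolding powr_shell[OF beta_shell] exp_add[symmetric] by simp
  have a: "inverse ((qchar (unifE X) chi 0 (- \<alpha>))\<^sup>2) * c0 \<alpha> ^ 2 = 1"
    using c0_nonzero[OF gen_nonzero] unfolding qchar_minus_sq[OF chi unif(2)] c0_def by simp
  have "of_real (inversion_constant (haarF X) (psi X)) * (1 - 1 / of_nat (residue_card TYPE('f))) *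
      inverse ((qchar (unifE X) chi 0 (- \<alpha>))\<^sup>2) * complex_of_real (absv \<beta>) powr (- t + 1/2) * R * f 0 =
    complex_of_real (rcard TYPE('f) powi d) * inverse ((qchar (unifE X) chi 0 (- \<alpha>))\<^sup>2) *
      complex_of_real (absv \<beta>) powr (- t + 1/2) * (complex_of_real (1 - 1 / rcard TYPE('f)) * R) * f 0"
    unfolding PF.inversion_constant_eq by (simp add: mult_ac)
  also have "\<dots> = (complex_of_real (rcard TYPE('f) powi d) * of_real (rcard TYPE('f) powi (- d))) *
      (inverse ((qchar (unifE X) chi 0 (- \<alpha>))\<^sup>2) * c0 \<alpha> ^ 2) *
      (complex_of_real (absv \<beta>) powr (- t + 1/2) * exp (of_int vb * (1/2 - t) * of_real (ln (rcard TYPE('f))))) * (f 0 * D)"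
    unfolding R by (simp only: mult_ac)
  also have "\<dots> = f 0 * D" unfolding q a b by simp
  finally show ?thesis unfolding N R_def by (rule sym)
qed

end

theorem theorem3p11:
  fixes X :: "('f::nonarch_local_field, 'e::nonarch_local_field) quadratic_data"
  assumes "quadratic_setting X"
  shows "(\<forall>(chi, s, \<eta>, t) \<in> S_plus X. \<forall>f \<in> test_functions.
           normalized_kernel X chi s \<eta> t f =
             (1 - 1 / of_nat (residue_card TYPE('f))) * L_family X \<eta> t f) \<and>
         (\<forall>(chi, s, \<eta>, t) \<in> S_minus X. \<forall>f \<in> test_functions.
           normalized_kernel X chi s \<eta> t f =
             of_real (inversion_constant (haarF X) (psi X)) *
             (1 - 1 / of_nat (residue_card TYPE('f))) *
             inverse ((qchar (unifE X) chi 0 (- gen X))\<^sup>2) *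
             complex_of_real (absv (gen_sq X)) powr (- t + 1/2) *
             remove_sings (gamma_product_along X chi s \<eta> t) t *
             f 0)"
proof -
  interpret quadratic_setting X by (rule assms)
  have chars: "quadratic_chars X chi \<eta>" if "chi \<in> unit_characters" "\<eta> \<in> unit_characters" for chi \<eta>
    by unfold_locales (use that in auto)
  have plus: "normalized_kernel X chi s \<eta> t f = (1 - 1 / of_nat (residue_card TYPE('f))) * L_family X \<eta> t f"
    if S: "(chi, s, \<eta>, t) \<in> S_plus X" and f: "f \<in> test_functions" for chi s \<eta> t f
  proof -
    have "quadratic_chars X chi \<eta>" using S by (intro chars) (auto simp: S_plus_def)
    then show ?thesis using S f by (rule quadratic_chars.normalized_kernel_S_plus)
  qed
  have minus: "normalized_kernel X chi s \<eta> t f =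
             of_real (inversion_constant (haarF X) (psi X)) *
             (1 - 1 / of_nat (residue_card TYPE('f))) *
             inverse ((qchar (unifE X) chi 0 (- gen X))\<^sup>2) *
             complex_of_real (absv (gen_sq X)) powr (- t + 1/2) *
             remove_sings (gamma_product_along X chi s \<eta> t) t *
             f 0"
    if S: "(chi, s, \<eta>, t) \<in> S_minus X" and f: "f \<in> test_functions" for chi s \<eta> t f
  proof -
    have Q: "quadratic_chars X chi \<eta>" using S by (intro chars) (auto simp: S_minus_def)
    obtain d where d: "haar_psi (haarF X) (psi X) d" using ex_conductor[OF haar(1) psi] by blast
    obtain dE where dE: "haar_psi (haarE X) (psiE X) dE"
      using ex_conductor[OF haar(2) quadratic_chars.psiE_character[OF Q]] by blast
    have "quadratic_gamma X chi \<eta> d dE"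
      using Q d dE by (simp add: quadratic_gamma_def quadratic_gamma_axioms_def)
    then show ?thesis using S f by (rule quadratic_gamma.normalized_kernel_S_minus)
  qed
  show ?thesis using plus minus by fast
qed

end
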